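(* Let $\mathcal{B}$ be a rigid braided category, $H\in\mathcal{B}$ a Hopf algebra (with invertible antipode), $\mathcal{C}=H_{\mathcal{B}}\text{-mod}$. Let $\rho$ be a pivot on $\mathcal{B}$ and let $\varsigma$ be the anti-twist on $\mathcal{B}$ corresponding to $\rho$. Then $$HH_{\mathcal{B}_\varsigma}(\mathcal{C})\simeq HH_\rho(\mathcal{C}),$$ compatibly with $\varsigma^H$ on the left hand side and with the restriction to $HH_\rho(\mathcal{C})$ of the automorphism $\varsigma$ of $Id_{HH(\mathcal{C})}$ on the right hand side.
   Context: $k$ is an algebraically closed field of characteristic $0$; categories are $k$-linear; associators and identity factors are suppressed. **Duals, braiding.** $X^*$ is the left dual ($X^*\otimes X\to1$, $1\to X\otimes X^*$), ${}^*X$ the right dual ($ev:X\otimes{}^*X\to1$, $coev:1\to{}^*X\otimes X$), $X^\#=X^{**}$, ${}^\#X={}^*({}^*X)$. $\tau$ is the braiding of $\mathcal{B}$ and $\tau^{-1}_{X,Y}:=(\tau_{Y,X})^{-1}:X\otimes Y\to Y\otimes X$. **Pivots and anti-twists.** A pivot is a monoidal natural isomorphism $\rho_X:X\to X^\#$ on $\mathcal{B}$. The corresponding anti-twist is $\varsigma_M:M\to M\otimes M\otimes M^*\to M\otimes M^\#\otimes M^*\to M$, where the first map is $Id_M\otimes coev$, the second is $\big((Id_M\otimes\rho_M)\tau^{-1}_{M,M}\big)\otimes Id_{M^*}$, the third is $Id_M\otimes ev$; it satisfies $\varsigma_{X\otimes Y}=(\tau_{Y,X}\tau_{X,Y})^{-1}(\varsigma_X\otimes\varsigma_Y)$.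 $\mathcal{B}_\varsigma$ is $\mathcal{B}$ as a left module category over itself with the automorphism $\varsigma$ of $Id_{\mathcal{B}}$ and $E_{X,M}=\varsigma_{X\otimes M}(Id_X\otimes\varsigma_M)^{-1}$. **$HH(\mathcal{C})$ and $HH_\rho(\mathcal{C})$.** $\mathcal{C}$ is monoidal with $H$ acting on $V\otimes W$ by $(\rho_V\otimes\rho_W)(Id_H\otimes\tau_{H,V}\otimes Id_W)(\Delta\otimes Id)$. $HH(\mathcal{C})$: objects $M\in\mathcal{C}$ with natural isomorphisms $\tau^\bullet_{M,X}:M\otimes X\to{}^\#X\otimes M$, $\tau^\bullet_{M,1}=Id$, $\tau^\bullet_{M,X\otimes Y}=(Id\otimes\tau^\bullet_{M,Y})(\tau^\bullet_{M,X}\otimes Id)$; put $\tau^\bullet_{X,M}:=(\tau^\bullet_{M,X^\#})^{-1}:X\otimes M\to M\otimes X^\#$. The automorphism $\varsigma$ of $Id_{HH(\mathcal{C})}$ is $\varsigma_M=(Id_M\otimes ev)(\tau^\bullet_{M,M}\otimes Id_{M^*})(Id_M\otimes coev)$. View $\mathcal{B}\subset\mathcal{C}$ via trivial $H$-actions through the counit $\epsilon$. $HH_\rho(\mathcal{C})$ is the full subcategory of those $M\in HH(\mathcal{C})$ such that $\tau^\bullet_{X,M}=(Id_M\otimes\rho_X)\tau^{-1}_{X,M}$ for all $X\in\mathcal{B}$. **$HH_{\mathcal{B}_\varsigma}(\mathcal{C})$**, identified with $aYD^H_{\mathcal{M}}$ for $\mathcal{M}=\mathcal{B}_\varsigma$: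 ${}^*H$ is an algebra with unit ${}^*\epsilon$ and multiplication the map whose adjoint $H\otimes{}^*H\otimes{}^*H\to1$ is $ev(Id_H\otimes ev\otimes Id_{{}^*H})(\tau^{-1}_{H,H}\Delta\otimes Id)$. For an $H$-module $M$ let $r_0,r_1:H\otimes{}^*H\otimes M\to{}^*H\otimes M$ be the maps whose adjoints $H\otimes H\otimes{}^*H\otimes M\to M$ are: for $r_1$, $ev\circ(m_H\otimes Id)$; for $r_0$, $\rho_{H,M}(Id_H\otimes ev)(Id_H\otimes m_H\otimes Id)(Id_H\otimes S\otimes Id_H\otimes Id)(\Delta\otimes Id_H\otimes Id)(\tau_{H,H}\otimes Id)$. Put $act_M=r_1\circ E_{H,{}^*H\otimes M}\circ(Id_H\otimes r_0)\circ(\Delta\otimes Id)$. Objects of $aYD^H_{\mathcal{M}}$ are $M\in\mathcal{M}$ which are both $H$- and ${}^*H$-modules with $\rho_{H,M}(Id_H\otimes\rho_{{}^*H,M})=\rho_{{}^*H,M}\circ act_M$; morphisms respect both actions. $\varsigma^H_M=\rho_{{}^*H,M}(Id_{{}^*H}\otimes\rho_{H,M})(coev\otimes Id_M)\varsigma_M$. *)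

theory Defs
  imports "HOL-Library.FuncSet" "HOL-Computational_Algebra.Polynomial"
begin

section \<open>Linear categories\<close>

text \<open>
  Hom sets are not required to be disjoint: an arrow does not determine its source and target.
  In this way a morphism of modules (or of half-braided objects) is literally a morphism of the
  underlying objects. Functors are accordingly given on arrows together with source and target.
\<close>

record ('k, 'o, 'a) lincat =
  Obj :: "'o set"
  Hom :: "'o \<Rightarrow> 'o \<Rightarrow> 'a set"
  idm :: "'o \<Rightarrow> 'a"
  comp :: "'a \<Rightarrow> 'a \<Rightarrow> 'a"  (infixr "\<cdot>\<index>" 65)
  zeroa :: "'o \<Rightarrow> 'o \<Rightarrow> 'a"
  adda :: "'a \<Rightarrow> 'a \<Rightarrow> 'a"  (infixl "\<oplus>\<index>" 60)
  scal :: "'k \<Rightarrow> 'a \<Rightarrow> 'a"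

locale linear_category =
  fixes C :: "('k::field, 'o, 'a, 'z) lincat_scheme" (structure)
  assumes idm_hom: "X \<in> Obj C \<Longrightarrow> idm C X \<in> Hom C X X"
    and comp_hom: "\<lbrakk>X \<in> Obj C; Y \<in> Obj C; Z \<in> Obj C; f \<in> Hom C X Y; g \<in> Hom C Y Z\<rbrakk>
      \<Longrightarrow> g \<cdot> f \<in> Hom C X Z"
    and comp_idl: "\<lbrakk>X \<in> Obj C; Y \<in> Obj C; f \<in> Hom C X Y\<rbrakk> \<Longrightarrow> idm C Y \<cdot> f = f"
    and comp_idr: "\<lbrakk>X \<in> Obj C; Y \<in> Obj C; f \<in> Hom C X Y\<rbrakk> \<Longrightarrow> f \<cdot> idm C X = f"
    and comp_assoc: "\<lbrakk>W \<in> Obj C; X \<in> Obj C; Y \<in> Obj C; Z \<in> Obj C;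
        f \<in> Hom C W X; g \<in> Hom C X Y; h \<in> Hom C Y Z\<rbrakk> \<Longrightarrow> (h \<cdot> g) \<cdot> f = h \<cdot> (g \<cdot> f)"
    and zero_hom: "\<lbrakk>X \<in> Obj C; Y \<in> Obj C\<rbrakk> \<Longrightarrow> zeroa C X Y \<in> Hom C X Y"
    and add_hom: "\<lbrakk>X \<in> Obj C; Y \<in> Obj C; f \<in> Hom C X Y; g \<in> Hom C X Y\<rbrakk> \<Longrightarrow> f \<oplus> g \<in> Hom C X Y"
    and scal_hom: "\<lbrakk>X \<in> Obj C; Y \<in> Obj C; f \<in> Hom C X Y\<rbrakk> \<Longrightarrow> scal C c f \<in> Hom C X Y"
    and add_assoc: "\<lbrakk>X \<in> Obj C; Y \<in> Obj C; f \<in> Hom C X Y; g \<in> Hom C X Y; h \<in> Hom C X Y\<rbrakk>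
      \<Longrightarrow> (f \<oplus> g) \<oplus> h = f \<oplus> (g \<oplus> h)"
    and add_commute: "\<lbrakk>X \<in> Obj C; Y \<in> Obj C; f \<in> Hom C X Y; g \<in> Hom C X Y\<rbrakk> \<Longrightarrow> f \<oplus> g = g \<oplus> f"
    and add_zero: "\<lbrakk>X \<in> Obj C; Y \<in> Obj C; f \<in> Hom C X Y\<rbrakk> \<Longrightarrow> zeroa C X Y \<oplus> f = f"
    and add_neg: "\<lbrakk>X \<in> Obj C; Y \<in> Obj C; f \<in> Hom C X Y\<rbrakk> \<Longrightarrow> \<exists>g \<in> Hom C X Y. g \<oplus> f = zeroa C X Y"
    and scal_add: "\<lbrakk>X \<in> Obj C; Y \<in> Obj C; f \<in> Hom C X Y; g \<in> Hom C X Y\<rbrakk>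
      \<Longrightarrow> scal C c (f \<oplus> g) = scal C c f \<oplus> scal C c g"
    and add_scal: "\<lbrakk>X \<in> Obj C; Y \<in> Obj C; f \<in> Hom C X Y\<rbrakk>
      \<Longrightarrow> scal C (c + d) f = scal C c f \<oplus> scal C d f"
    and scal_scal: "\<lbrakk>X \<in> Obj C; Y \<in> Obj C; f \<in> Hom C X Y\<rbrakk>
      \<Longrightarrow> scal C (c * d) f = scal C c (scal C d f)"
    and scal_one: "\<lbrakk>X \<in> Obj C; Y \<in> Obj C; f \<in> Hom C X Y\<rbrakk> \<Longrightarrow> scal C 1 f = f"
    and comp_addl: "\<lbrakk>X \<in> Obj C; Y \<in> Obj C; Z \<in> Obj C; f \<in> Hom C X Y; g \<in> Hom C Y Z; h \<in> Hom C Y Z\<rbrakk>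
      \<Longrightarrow> (g \<oplus> h) \<cdot> f = (g \<cdot> f) \<oplus> (h \<cdot> f)"
    and comp_addr: "\<lbrakk>X \<in> Obj C; Y \<in> Obj C; Z \<in> Obj C; f \<in> Hom C X Y; g \<in> Hom C X Y; h \<in> Hom C Y Z\<rbrakk>
      \<Longrightarrow> h \<cdot> (f \<oplus> g) = (h \<cdot> f) \<oplus> (h \<cdot> g)"
    and comp_scall: "\<lbrakk>X \<in> Obj C; Y \<in> Obj C; Z \<in> Obj C; f \<in> Hom C X Y; g \<in> Hom C Y Z\<rbrakk>
      \<Longrightarrow> scal C c g \<cdot> f = scal C c (g \<cdot> f)"
    and comp_scalr: "\<lbrakk>X \<in> Obj C; Y \<in> Obj C; Z \<in> Obj C; f \<in> Hom C X Y; g \<in> Hom C Y Z\<rbrakk>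
      \<Longrightarrow> g \<cdot> scal C c f = scal C c (g \<cdot> f)"

definition arr_inverse ::
  "('k, 'o, 'a, 'z) lincat_scheme \<Rightarrow> 'o \<Rightarrow> 'o \<Rightarrow> 'a \<Rightarrow> 'a \<Rightarrow> bool" where
  "arr_inverse C X Y f g \<longleftrightarrow>
     g \<in> Hom C Y X \<and> comp C g f = idm C X \<and> comp C f g = idm C Y"

definition is_iso :: "('k, 'o, 'a, 'z) lincat_scheme \<Rightarrow> 'o \<Rightarrow> 'o \<Rightarrow> 'a \<Rightarrow> bool" where
  "is_iso C X Y f \<longleftrightarrow> f \<in> Hom C X Y \<and> (\<exists>g. arr_inverse C X Y f g)"

definition arr_inv :: "('k, 'o, 'a, 'z) lincat_scheme \<Rightarrow> 'o \<Rightarrow> 'o \<Rightarrow> 'a \<Rightarrow> 'a" where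
  "arr_inv C X Y f = (THE g. arr_inverse C X Y f g)"

definition full_subcat ::
  "('k, 'o, 'a, 'z) lincat_scheme \<Rightarrow> ('o \<Rightarrow> bool) \<Rightarrow> ('k, 'o, 'a, 'z) lincat_scheme" where
  "full_subcat C P = C\<lparr>Obj := {X \<in> Obj C. P X}\<rparr>"

definition linear_functor ::
  "('k, 'o, 'a, 'y) lincat_scheme \<Rightarrow> ('k, 'p, 'b, 'z) lincat_scheme
     \<Rightarrow> ('o \<Rightarrow> 'p) \<Rightarrow> ('o \<Rightarrow> 'o \<Rightarrow> 'a \<Rightarrow> 'b) \<Rightarrow> bool" where
  "linear_functor C D Fo Fa \<longleftrightarrow>
     (\<forall>X \<in> Obj C. Fo X \<in> Obj D) \<and>
     (\<forall>X \<in> Obj C. \<forall>Y \<in> Obj C. \<forall>f \<in> Hom C X Y. Fa X Y f \<in> Hom D (Fo X) (Fo Y)) \<and>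
     (\<forall>X \<in> Obj C. Fa X X (idm C X) = idm D (Fo X)) \<and>
     (\<forall>X \<in> Obj C. \<forall>Y \<in> Obj C. \<forall>Z \<in> Obj C. \<forall>f \<in> Hom C X Y. \<forall>g \<in> Hom C Y Z.
        Fa X Z (comp C g f) = comp D (Fa Y Z g) (Fa X Y f)) \<and>
     (\<forall>X \<in> Obj C. \<forall>Y \<in> Obj C. \<forall>f \<in> Hom C X Y. \<forall>g \<in> Hom C X Y.
        Fa X Y (adda C f g) = adda D (Fa X Y f) (Fa X Y g)) \<and>
     (\<forall>X \<in> Obj C. \<forall>Y \<in> Obj C. \<forall>f \<in> Hom C X Y. \<forall>c.
        Fa X Y (scal C c f) = scal D c (Fa X Y f))"

definition natural_iso ::
  "('k, 'o, 'a, 'y) lincat_scheme \<Rightarrow> ('k, 'p, 'b, 'z) lincat_scheme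
     \<Rightarrow> ('o \<Rightarrow> 'p) \<Rightarrow> ('o \<Rightarrow> 'o \<Rightarrow> 'a \<Rightarrow> 'b) \<Rightarrow> ('o \<Rightarrow> 'p) \<Rightarrow> ('o \<Rightarrow> 'o \<Rightarrow> 'a \<Rightarrow> 'b)
     \<Rightarrow> ('o \<Rightarrow> 'b) \<Rightarrow> bool" where
  "natural_iso C D Fo Fa Go Ga \<eta> \<longleftrightarrow>
     (\<forall>X \<in> Obj C. is_iso D (Fo X) (Go X) (\<eta> X)) \<and>
     (\<forall>X \<in> Obj C. \<forall>Y \<in> Obj C. \<forall>f \<in> Hom C X Y.
        comp D (\<eta> Y) (Fa X Y f) = comp D (Ga X Y f) (\<eta> X))"

definition linear_equivalence ::
  "('k, 'o, 'a, 'y) lincat_scheme \<Rightarrow> ('k, 'p, 'b, 'z) lincat_scheme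
     \<Rightarrow> ('o \<Rightarrow> 'p) \<Rightarrow> ('o \<Rightarrow> 'o \<Rightarrow> 'a \<Rightarrow> 'b) \<Rightarrow> bool" where
  "linear_equivalence C D Fo Fa \<longleftrightarrow>
     linear_functor C D Fo Fa \<and>
     (\<exists>Go Ga \<eta> \<theta>. linear_functor D C Go Ga \<and>
        natural_iso C C (\<lambda>X. X) (\<lambda>X Y f. f)
          (\<lambda>X. Go (Fo X)) (\<lambda>X Y f. Ga (Fo X) (Fo Y) (Fa X Y f)) \<eta> \<and>
        natural_iso D D (\<lambda>X. Fo (Go X)) (\<lambda>X Y f. Fa (Go X) (Go Y) (Ga X Y f))
          (\<lambda>X. X) (\<lambda>X Y f. f) \<theta>)"


section \<open>Monoidal categories\<close>

record ('k, 'o, 'a) moncat = "('k, 'o, 'a) lincat" +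
  munit :: "'o"  ("\<I>\<index>")
  tens :: "'o \<Rightarrow> 'o \<Rightarrow> 'o"  (infixr "\<otimes>\<index>" 75)
  tensa :: "'a \<Rightarrow> 'a \<Rightarrow> 'a"  (infixr "\<star>\<index>" 75)
  assoc :: "'o \<Rightarrow> 'o \<Rightarrow> 'o \<Rightarrow> 'a"
  lunit :: "'o \<Rightarrow> 'a"
  runit :: "'o \<Rightarrow> 'a"

locale monoidal_category = linear_category C
  for C :: "('k::field, 'o, 'a, 'z) moncat_scheme" (structure) +
  assumes munit_obj: "\<I> \<in> Obj C"
    and tens_obj: "\<lbrakk>X \<in> Obj C; Y \<in> Obj C\<rbrakk> \<Longrightarrow> X \<otimes> Y \<in> Obj C"
    and tensa_hom: "\<lbrakk>X \<in> Obj C; Y \<in> Obj C; X' \<in> Obj C; Y' \<in> Obj C; f \<in> Hom C X Y; f' \<in> Hom C X' Y'\<rbrakk>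
      \<Longrightarrow> f \<star> f' \<in> Hom C (X \<otimes> X') (Y \<otimes> Y')"
    and tensa_id: "\<lbrakk>X \<in> Obj C; Y \<in> Obj C\<rbrakk> \<Longrightarrow> idm C X \<star> idm C Y = idm C (X \<otimes> Y)"
    and tensa_comp: "\<lbrakk>X \<in> Obj C; Y \<in> Obj C; Z \<in> Obj C; X' \<in> Obj C; Y' \<in> Obj C; Z' \<in> Obj C;
        f \<in> Hom C X Y; g \<in> Hom C Y Z; f' \<in> Hom C X' Y'; g' \<in> Hom C Y' Z'\<rbrakk>
      \<Longrightarrow> (g \<cdot> f) \<star> (g' \<cdot> f') = (g \<star> g') \<cdot> (f \<star> f')"
    and tensa_addl: "\<lbrakk>X \<in> Obj C; Y \<in> Obj C; X' \<in> Obj C; Y' \<in> Obj C;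
        f \<in> Hom C X Y; g \<in> Hom C X Y; f' \<in> Hom C X' Y'\<rbrakk>
      \<Longrightarrow> (f \<oplus> g) \<star> f' = (f \<star> f') \<oplus> (g \<star> f')"
    and tensa_addr: "\<lbrakk>X \<in> Obj C; Y \<in> Obj C; X' \<in> Obj C; Y' \<in> Obj C;
        f \<in> Hom C X Y; f' \<in> Hom C X' Y'; g' \<in> Hom C X' Y'\<rbrakk>
      \<Longrightarrow> f \<star> (f' \<oplus> g') = (f \<star> f') \<oplus> (f \<star> g')"
    and tensa_scall: "\<lbrakk>X \<in> Obj C; Y \<in> Obj C; X' \<in> Obj C; Y' \<in> Obj C; f \<in> Hom C X Y; f' \<in> Hom C X' Y'\<rbrakk>
      \<Longrightarrow> scal C c f \<star> f' = scal C c (f \<star> f')"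
    and tensa_scalr: "\<lbrakk>X \<in> Obj C; Y \<in> Obj C; X' \<in> Obj C; Y' \<in> Obj C; f \<in> Hom C X Y; f' \<in> Hom C X' Y'\<rbrakk>
      \<Longrightarrow> f \<star> scal C c f' = scal C c (f \<star> f')"
    and assoc_iso: "\<lbrakk>X \<in> Obj C; Y \<in> Obj C; Z \<in> Obj C\<rbrakk>
      \<Longrightarrow> is_iso C ((X \<otimes> Y) \<otimes> Z) (X \<otimes> (Y \<otimes> Z)) (assoc C X Y Z)"
    and lunit_iso: "X \<in> Obj C \<Longrightarrow> is_iso C (\<I> \<otimes> X) X (lunit C X)"
    and runit_iso: "X \<in> Obj C \<Longrightarrow> is_iso C (X \<otimes> \<I>) X (runit C X)"
    and assoc_natural: "\<lbrakk>X \<in> Obj C; Y \<in> Obj C; Z \<in> Obj C; X' \<in> Obj C; Y' \<in> Obj C; Z' \<in> Obj C;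
        f \<in> Hom C X X'; g \<in> Hom C Y Y'; h \<in> Hom C Z Z'\<rbrakk>
      \<Longrightarrow> assoc C X' Y' Z' \<cdot> ((f \<star> g) \<star> h) = (f \<star> (g \<star> h)) \<cdot> assoc C X Y Z"
    and lunit_natural: "\<lbrakk>X \<in> Obj C; Y \<in> Obj C; f \<in> Hom C X Y\<rbrakk>
      \<Longrightarrow> lunit C Y \<cdot> (idm C \<I> \<star> f) = f \<cdot> lunit C X"
    and runit_natural: "\<lbrakk>X \<in> Obj C; Y \<in> Obj C; f \<in> Hom C X Y\<rbrakk>
      \<Longrightarrow> runit C Y \<cdot> (f \<star> idm C \<I>) = f \<cdot> runit C X"
    and pentagon: "\<lbrakk>W \<in> Obj C; X \<in> Obj C; Y \<in> Obj C; Z \<in> Obj C\<rbrakk>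
      \<Longrightarrow> (idm C W \<star> assoc C X Y Z) \<cdot> assoc C W (X \<otimes> Y) Z \<cdot> (assoc C W X Y \<star> idm C Z)
        = assoc C W X (Y \<otimes> Z) \<cdot> assoc C (W \<otimes> X) Y Z"
    and triangle: "\<lbrakk>X \<in> Obj C; Y \<in> Obj C\<rbrakk>
      \<Longrightarrow> (idm C X \<star> lunit C Y) \<cdot> assoc C X \<I> Y = runit C X \<star> idm C Y"


subsection \<open>Formulas with suppressed associators\<close>

text \<open>
  Formulas in which associators and unit isomorphisms are suppressed are written as follows.
  A list of objects stands for its tensor product bracketed to the right, and
  \<open>Str Xs f Ys\<close> stands for an arrow \<open>f\<close> from \<open>word Xs\<close> to \<open>word Ys\<close>. The tensor product
  \<open>f \<odot> g\<close> concatenates sources and targets and inserts the coherence isomorphisms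
  \<open>join Xs Ys : word Xs \<otimes> word Ys \<rightarrow> word (Xs @ Ys)\<close>; the composition \<open>f \<bullet> g\<close>
  is that of arrows and is meaningful when the list \<open>scod g\<close> is the list \<open>sdom f\<close>.
  The identity arrows \<open>pack\<close> and \<open>unpack\<close> pass between a list and the single object
  which is its tensor product.
\<close>

datatype ('o, 'a) strarr = Str (sdom: "'o list") (sarr: 'a) (scod: "'o list")

locale monoidal_data =
  fixes C :: "('k, 'o, 'a, 'z) moncat_scheme" (structure)
begin

fun word :: "'o list \<Rightarrow> 'o" where
  "word [] = \<I>"
| "word [X] = X"
| "word (X # Y # Zs) = X \<otimes> word (Y # Zs)"

fun join :: "'o list \<Rightarrow> 'o list \<Rightarrow> 'a" where
  "join [] Ys = lunit C (word Ys)"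
| "join [X] [] = runit C X"
| "join [X] (Y # Ys) = idm C (X \<otimes> word (Y # Ys))"
| "join (X # Y # Zs) Ys = (idm C X \<star> join (Y # Zs) Ys) \<cdot> assoc C X (word (Y # Zs)) (word Ys)"

definition strand :: "'o list \<Rightarrow> ('o, 'a) strarr" where
  "strand Xs = Str Xs (idm C (word Xs)) Xs"

definition stens :: "('o, 'a) strarr \<Rightarrow> ('o, 'a) strarr \<Rightarrow> ('o, 'a) strarr"  (infixr "\<odot>" 75) where
  "f \<odot> g = Str (sdom f @ sdom g)
     (join (scod f) (scod g) \<cdot> (sarr f \<star> sarr g) \<cdot>
      arr_inv C (word (sdom f) \<otimes> word (sdom g)) (word (sdom f @ sdom g)) (join (sdom f) (sdom g)))
     (scod f @ scod g)"

definition scomp :: "('o, 'a) strarr \<Rightarrow> ('o, 'a) strarr \<Rightarrow> ('o, 'a) strarr"  (infixr "\<bullet>" 65) where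
  "f \<bullet> g = Str (sdom g) (sarr f \<cdot> sarr g) (scod f)"

definition pack :: "'o list \<Rightarrow> ('o, 'a) strarr" where
  "pack Xs = Str Xs (idm C (word Xs)) [word Xs]"

definition unpack :: "'o list \<Rightarrow> ('o, 'a) strarr" where
  "unpack Xs = Str [word Xs] (idm C (word Xs)) Xs"

end


section \<open>Rigid categories\<close>

text \<open>
  A choice of left duals \<open>X\<^sup>*\<close> (\<open>evl : X\<^sup>* \<otimes> X \<rightarrow> 1\<close>, \<open>coevl : 1 \<rightarrow> X \<otimes> X\<^sup>*\<close>) and of right duals
  \<open>\<^sup>*X\<close> (\<open>evr : X \<otimes> \<^sup>*X \<rightarrow> 1\<close>, \<open>coevr : 1 \<rightarrow> \<^sup>*X \<otimes> X\<close>) is part of the data. The canonical isomorphisms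
  relating duals of tensor products, of the unit and of duals, which are usually suppressed, are
  written out below.
\<close>

record ('k, 'o, 'a) rigcat = "('k, 'o, 'a) moncat" +
  ldual :: "'o \<Rightarrow> 'o"
  evl :: "'o \<Rightarrow> 'a"
  coevl :: "'o \<Rightarrow> 'a"
  rdual :: "'o \<Rightarrow> 'o"
  evr :: "'o \<Rightarrow> 'a"
  coevr :: "'o \<Rightarrow> 'a"

locale rigid_data = monoidal_data C
  for C :: "('k, 'o, 'a, 'z) rigcat_scheme" (structure)
begin

abbreviation LD :: "'o \<Rightarrow> 'o" where "LD \<equiv> ldual C"
abbreviation RD :: "'o \<Rightarrow> 'o" where "RD \<equiv> rdual C"

abbreviation sevl :: "'o \<Rightarrow> ('o, 'a) strarr" where "sevl X \<equiv> Str [LD X, X] (evl C X) []"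
abbreviation scoevl :: "'o \<Rightarrow> ('o, 'a) strarr" where "scoevl X \<equiv> Str [] (coevl C X) [X, LD X]"
abbreviation sevr :: "'o \<Rightarrow> ('o, 'a) strarr" where "sevr X \<equiv> Str [X, RD X] (evr C X) []"
abbreviation scoevr :: "'o \<Rightarrow> ('o, 'a) strarr" where "scoevr X \<equiv> Str [] (coevr C X) [RD X, X]"

definition lmap :: "'o \<Rightarrow> 'o \<Rightarrow> 'a \<Rightarrow> 'a" where
  "lmap X Y f = sarr (
     (sevl Y \<odot> strand [LD X]) \<bullet>
     (strand [LD Y] \<odot> Str [X] f [Y] \<odot> strand [LD X]) \<bullet>
     (strand [LD Y] \<odot> scoevl X))"

definition rmap :: "'o \<Rightarrow> 'o \<Rightarrow> 'a \<Rightarrow> 'a" where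
  "rmap X Y f = sarr (
     (strand [RD X] \<odot> sevr Y) \<bullet>
     (strand [RD X] \<odot> Str [X] f [Y] \<odot> strand [RD Y]) \<bullet>
     (scoevr X \<odot> strand [RD Y]))"

text \<open>\<open>lsh X\<close> is \<open>X\<^sup>#\<close>, the double left dual, and \<open>rsh X\<close> is \<open>\<^sup>#X\<close>, the double right dual.\<close>

definition lsh :: "'o \<Rightarrow> 'o" where "lsh X = LD (LD X)"
definition rsh :: "'o \<Rightarrow> 'o" where "rsh X = RD (RD X)"

definition lshmap :: "'o \<Rightarrow> 'o \<Rightarrow> 'a \<Rightarrow> 'a" where
  "lshmap X Y f = lmap (LD Y) (LD X) (lmap X Y f)"

definition rshmap :: "'o \<Rightarrow> 'o \<Rightarrow> 'a \<Rightarrow> 'a" where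
  "rshmap X Y f = rmap (RD Y) (RD X) (rmap X Y f)"

text \<open>
  \<open>ldual_tens X Y : Y\<^sup>* \<otimes> X\<^sup>* \<rightarrow> (X \<otimes> Y)\<^sup>*\<close> and its inverse \<open>ldual_tens'\<close>, from the nested
  evaluation and coevaluation; likewise for the unit and for right duals.
\<close>

definition ldual_tens :: "'o \<Rightarrow> 'o \<Rightarrow> ('o, 'a) strarr" where
  "ldual_tens X Y =
     ((sevl Y \<bullet> (strand [LD Y] \<odot> sevl X \<odot> strand [Y])) \<odot> strand [LD (X \<otimes> Y)]) \<bullet>
     (strand [LD Y, LD X] \<odot> ((unpack [X, Y] \<odot> strand [LD (X \<otimes> Y)]) \<bullet> scoevl (X \<otimes> Y)))"

definition ldual_tens' :: "'o \<Rightarrow> 'o \<Rightarrow> ('o, 'a) strarr" where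
  "ldual_tens' X Y =
     ((sevl (X \<otimes> Y) \<bullet> (strand [LD (X \<otimes> Y)] \<odot> pack [X, Y])) \<odot> strand [LD Y, LD X]) \<bullet>
     (strand [LD (X \<otimes> Y)] \<odot> ((strand [X] \<odot> scoevl Y \<odot> strand [LD X]) \<bullet> scoevl X))"

definition ldual_unit :: "('o, 'a) strarr" where
  "ldual_unit = (unpack [] \<odot> strand [LD \<I>]) \<bullet> scoevl \<I>"

definition ldual_unit' :: "('o, 'a) strarr" where
  "ldual_unit' = sevl \<I> \<bullet> (strand [LD \<I>] \<odot> pack [])"

definition rdual_tens :: "'o \<Rightarrow> 'o \<Rightarrow> ('o, 'a) strarr" where
  "rdual_tens X Y =
     (strand [RD (X \<otimes> Y)] \<odot> (sevr X \<bullet> (strand [X] \<odot> sevr Y \<odot> strand [RD X]))) \<bullet>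
     (((strand [RD (X \<otimes> Y)] \<odot> unpack [X, Y]) \<bullet> scoevr (X \<otimes> Y)) \<odot> strand [RD Y, RD X])"

definition rdual_tens' :: "'o \<Rightarrow> 'o \<Rightarrow> ('o, 'a) strarr" where
  "rdual_tens' X Y =
     (strand [RD Y, RD X] \<odot> (sevr (X \<otimes> Y) \<bullet> (pack [X, Y] \<odot> strand [RD (X \<otimes> Y)]))) \<bullet>
     (((strand [RD Y] \<odot> scoevr X \<odot> strand [Y]) \<bullet> scoevr Y) \<odot> strand [RD (X \<otimes> Y)])"

definition rdual_unit :: "('o, 'a) strarr" where
  "rdual_unit = (strand [RD \<I>] \<odot> unpack []) \<bullet> scoevr \<I>"

definition rdual_unit' :: "('o, 'a) strarr" where
  "rdual_unit' = sevr \<I> \<bullet> (pack [] \<odot> strand [RD \<I>])"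

text \<open>
  The canonical isomorphisms \<open>(X \<otimes> Y)\<^sup># \<rightarrow> X\<^sup># \<otimes> Y\<^sup>#\<close>, \<open>1\<^sup># \<rightarrow> 1\<close>,
  \<open>\<^sup>#(X \<otimes> Y) \<rightarrow> \<^sup>#X \<otimes> \<^sup>#Y\<close>, \<open>\<^sup>#1 \<rightarrow> 1\<close>.
\<close>

definition lsh_tens :: "'o \<Rightarrow> 'o \<Rightarrow> ('o, 'a) strarr" where
  "lsh_tens X Y = ldual_tens' (LD Y) (LD X) \<bullet>
     Str [lsh (X \<otimes> Y)] (lmap (LD Y \<otimes> LD X) (LD (X \<otimes> Y)) (sarr (ldual_tens X Y))) [LD (LD Y \<otimes> LD X)]"

definition lsh_unit :: "('o, 'a) strarr" where
  "lsh_unit = ldual_unit' \<bullet> Str [lsh \<I>] (lmap \<I> (LD \<I>) (sarr ldual_unit)) [LD \<I>]"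

definition rsh_tens :: "'o \<Rightarrow> 'o \<Rightarrow> ('o, 'a) strarr" where
  "rsh_tens X Y = rdual_tens' (RD Y) (RD X) \<bullet>
     Str [rsh (X \<otimes> Y)] (rmap (RD Y \<otimes> RD X) (RD (X \<otimes> Y)) (sarr (rdual_tens X Y))) [RD (RD Y \<otimes> RD X)]"

definition rsh_unit :: "('o, 'a) strarr" where
  "rsh_unit = rdual_unit' \<bullet> Str [rsh \<I>] (rmap \<I> (RD \<I>) (sarr rdual_unit)) [RD \<I>]"

text \<open>The canonical isomorphisms \<open>\<^sup>*(X\<^sup>*) \<rightarrow> X\<close>, its inverse, and \<open>\<^sup>#(X\<^sup>#) \<rightarrow> X\<close>.\<close>

definition rd_ld :: "'o \<Rightarrow> ('o, 'a) strarr" where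
  "rd_ld X = (strand [X] \<odot> sevr (LD X)) \<bullet> (scoevl X \<odot> strand [RD (LD X)])"

definition rd_ld' :: "'o \<Rightarrow> ('o, 'a) strarr" where
  "rd_ld' X = (strand [RD (LD X)] \<odot> sevl X) \<bullet> (scoevr (LD X) \<odot> strand [X])"

definition rsh_lsh :: "'o \<Rightarrow> ('o, 'a) strarr" where
  "rsh_lsh X = rd_ld X \<bullet>
     Str [rsh (lsh X)] (rmap (LD X) (RD (lsh X)) (sarr (rd_ld' (LD X)))) [RD (LD X)]"

end

locale rigid_category = rigid_data C + monoidal_category C
  for C :: "('k::field, 'o, 'a, 'z) rigcat_scheme" (structure) +
  assumes ldual_obj: "X \<in> Obj C \<Longrightarrow> LD X \<in> Obj C"
    and rdual_obj: "X \<in> Obj C \<Longrightarrow> RD X \<in> Obj C"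
    and evl_hom: "X \<in> Obj C \<Longrightarrow> evl C X \<in> Hom C (LD X \<otimes> X) \<I>"
    and coevl_hom: "X \<in> Obj C \<Longrightarrow> coevl C X \<in> Hom C \<I> (X \<otimes> LD X)"
    and evr_hom: "X \<in> Obj C \<Longrightarrow> evr C X \<in> Hom C (X \<otimes> RD X) \<I>"
    and coevr_hom: "X \<in> Obj C \<Longrightarrow> coevr C X \<in> Hom C \<I> (RD X \<otimes> X)"
    and ldual_zigzag: "X \<in> Obj C \<Longrightarrow>
      (strand [X] \<odot> sevl X) \<bullet> (scoevl X \<odot> strand [X]) = strand [X]"
    and ldual_zigzag': "X \<in> Obj C \<Longrightarrow>
      (sevl X \<odot> strand [LD X]) \<bullet> (strand [LD X] \<odot> scoevl X) = strand [LD X]"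
    and rdual_zigzag: "X \<in> Obj C \<Longrightarrow>
      (sevr X \<odot> strand [X]) \<bullet> (strand [X] \<odot> scoevr X) = strand [X]"
    and rdual_zigzag': "X \<in> Obj C \<Longrightarrow>
      (strand [RD X] \<odot> sevr X) \<bullet> (scoevr X \<odot> strand [RD X]) = strand [RD X]"


subsection \<open>The category \<open>HH(C)\<close> of a rigid category\<close>

context rigid_data
begin

text \<open>\<open>t X\<close> is \<open>\<tau>\<^sup>\<bullet>\<close> for \<open>M\<close> and \<open>X\<close>, an arrow \<open>M \<otimes> X \<rightarrow> \<^sup>#X \<otimes> M\<close>.\<close>

abbreviation shalf :: "'o \<Rightarrow> ('o \<Rightarrow> 'a) \<Rightarrow> 'o \<Rightarrow> ('o, 'a) strarr" where
  "shalf M t X \<equiv> Str [M, X] (t X) [rsh X, M]"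

definition half_braiding :: "'o \<Rightarrow> ('o \<Rightarrow> 'a) \<Rightarrow> bool" where
  "half_braiding M t \<longleftrightarrow>
     t \<in> extensional (Obj C) \<and>
     (\<forall>X \<in> Obj C. is_iso C (M \<otimes> X) (rsh X \<otimes> M) (t X)) \<and>
     (\<forall>X \<in> Obj C. \<forall>Y \<in> Obj C. \<forall>f \<in> Hom C X Y.
        t Y \<cdot> (idm C M \<star> f) = (rshmap X Y f \<star> idm C M) \<cdot> t X) \<and>
     (rsh_unit \<odot> strand [M]) \<bullet> shalf M t \<I> = strand [M] \<odot> unpack [] \<and>
     (\<forall>X \<in> Obj C. \<forall>Y \<in> Obj C.
        (rsh_tens X Y \<odot> strand [M]) \<bullet> shalf M t (X \<otimes> Y) =
        (strand [rsh X] \<odot> shalf M t Y) \<bullet> (shalf M t X \<odot> strand [Y]) \<bullet>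
        (strand [M] \<odot> unpack [X, Y]))"

text \<open>\<open>half_left M t X : X \<otimes> M \<rightarrow> M \<otimes> X\<^sup>#\<close> is the arrow written \<open>\<tau>\<^sup>\<bullet>\<close> for \<open>X\<close> and \<open>M\<close>.\<close>

definition half_left :: "'o \<Rightarrow> ('o \<Rightarrow> 'a) \<Rightarrow> 'o \<Rightarrow> 'a" where
  "half_left M t X = arr_inv C (M \<otimes> lsh X) (X \<otimes> M)
     (sarr ((rsh_lsh X \<odot> strand [M]) \<bullet> shalf M t (lsh X)))"

definition HH :: "('k, 'o \<times> ('o \<Rightarrow> 'a), 'a) lincat" where
  "HH = \<lparr>
     Obj = {(M, t). M \<in> Obj C \<and> half_braiding M t},
     Hom = (\<lambda>(M, t) (N, s). {f \<in> Hom C M N.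
       \<forall>X \<in> Obj C. (idm C (rsh X) \<star> f) \<cdot> t X = s X \<cdot> (f \<star> idm C X)}),
     idm = (\<lambda>(M, t). idm C M),
     comp = comp C,
     zeroa = (\<lambda>(M, t) (N, s). zeroa C M N),
     adda = adda C,
     scal = scal C\<rparr>"

text \<open>
  In \<open>\<varsigma>\<^sub>M = (Id \<otimes> ev) (\<tau>\<^sup>\<bullet> \<otimes> Id) (Id \<otimes> coev)\<close> the middle arrow has to be the
  one \<open>X \<otimes> M \<rightarrow> M \<otimes> X\<^sup>#\<close> at \<open>X = M\<close>, since \<open>ev : M\<^sup># \<otimes> M\<^sup>* \<rightarrow> 1\<close>.
\<close>

definition HH_aut :: "'o \<times> ('o \<Rightarrow> 'a) \<Rightarrow> 'a" where
  "HH_aut = (\<lambda>(M, t). sarr (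
     (strand [M] \<odot> sevl (LD M)) \<bullet>
     (Str [M, M] (half_left M t M) [M, lsh M] \<odot> strand [LD M]) \<bullet>
     (strand [M] \<odot> scoevl M)))"

end


section \<open>Rigid braided categories, pivots and anti-twists\<close>

record ('k, 'o, 'a) brcat = "('k, 'o, 'a) rigcat" +
  braid :: "'o \<Rightarrow> 'o \<Rightarrow> 'a"  ("\<tau>\<index>")

locale rigid_braided_category = rigid_category B
  for B :: "('k::field, 'o, 'a, 'z) brcat_scheme" (structure) +
  assumes braid_iso: "\<lbrakk>X \<in> Obj B; Y \<in> Obj B\<rbrakk> \<Longrightarrow> is_iso B (X \<otimes> Y) (Y \<otimes> X) (\<tau> X Y)"
    and braid_natural: "\<lbrakk>X \<in> Obj B; Y \<in> Obj B; X' \<in> Obj B; Y' \<in> Obj B; f \<in> Hom B X X'; g \<in> Hom B Y Y'\<rbrakk>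
      \<Longrightarrow> \<tau> X' Y' \<cdot> (f \<star> g) = (g \<star> f) \<cdot> \<tau> X Y"
    and hexagon: "\<lbrakk>X \<in> Obj B; Y \<in> Obj B; Z \<in> Obj B\<rbrakk>
      \<Longrightarrow> assoc B Y Z X \<cdot> \<tau> X (Y \<otimes> Z) \<cdot> assoc B X Y Z
        = (idm B Y \<star> \<tau> X Z) \<cdot> assoc B Y X Z \<cdot> (\<tau> X Y \<star> idm B Z)"
    and hexagon': "\<lbrakk>X \<in> Obj B; Y \<in> Obj B; Z \<in> Obj B\<rbrakk>
      \<Longrightarrow> \<tau> (X \<otimes> Y) Z
        = assoc B Z X Y \<cdot> (\<tau> X Z \<star> idm B Y) \<cdot>
          arr_inv B ((X \<otimes> Z) \<otimes> Y) (X \<otimes> (Z \<otimes> Y)) (assoc B X Z Y) \<cdot>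
          (idm B X \<star> \<tau> Y Z) \<cdot> assoc B X Y Z"

locale braided_data = rigid_data B
  for B :: "('k, 'o, 'a, 'z) brcat_scheme" (structure)
begin

notation stens (infixr "\<odot>" 75) and scomp (infixr "\<bullet>" 65)

text \<open>\<open>ibraid X Y : X \<otimes> Y \<rightarrow> Y \<otimes> X\<close> is the inverse of \<open>\<tau> Y X\<close>.\<close>

definition ibraid :: "'o \<Rightarrow> 'o \<Rightarrow> 'a" where
  "ibraid X Y = arr_inv B (Y \<otimes> X) (X \<otimes> Y) (\<tau> Y X)"

abbreviation sbraid :: "'o \<Rightarrow> 'o \<Rightarrow> ('o, 'a) strarr" where
  "sbraid X Y \<equiv> Str [X, Y] (\<tau> X Y) [Y, X]"

abbreviation sibraid :: "'o \<Rightarrow> 'o \<Rightarrow> ('o, 'a) strarr" where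
  "sibraid X Y \<equiv> Str [X, Y] (ibraid X Y) [Y, X]"

abbreviation spivot :: "('o \<Rightarrow> 'a) \<Rightarrow> 'o \<Rightarrow> ('o, 'a) strarr" where
  "spivot \<rho> X \<equiv> Str [X] (\<rho> X) [lsh X]"

definition pivot :: "('o \<Rightarrow> 'a) \<Rightarrow> bool" where
  "pivot \<rho> \<longleftrightarrow>
     (\<forall>X \<in> Obj B. is_iso B X (lsh X) (\<rho> X)) \<and>
     (\<forall>X \<in> Obj B. \<forall>Y \<in> Obj B. \<forall>f \<in> Hom B X Y. \<rho> Y \<cdot> f = lshmap X Y f \<cdot> \<rho> X) \<and>
     (\<forall>X \<in> Obj B. \<forall>Y \<in> Obj B.
        lsh_tens X Y \<bullet> spivot \<rho> (X \<otimes> Y) = (spivot \<rho> X \<odot> spivot \<rho> Y) \<bullet> unpack [X, Y]) \<and>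
     lsh_unit \<bullet> spivot \<rho> \<I> = unpack []"

definition anti_twist :: "('o \<Rightarrow> 'a) \<Rightarrow> 'o \<Rightarrow> 'a" where
  "anti_twist \<rho> M = sarr (
     (strand [M] \<odot> sevl (LD M)) \<bullet>
     (((strand [M] \<odot> spivot \<rho> M) \<bullet> sibraid M M) \<odot> strand [LD M]) \<bullet>
     (strand [M] \<odot> scoevl M))"

definition twist_E :: "('o \<Rightarrow> 'a) \<Rightarrow> 'o \<Rightarrow> 'o \<Rightarrow> 'a" where
  "twist_E s X M = s (X \<otimes> M) \<cdot> arr_inv B (X \<otimes> M) (X \<otimes> M) (idm B X \<star> s M)"

end


section \<open>Hopf algebras in a braided category and their modules\<close>

record ('o, 'a) hopf =
  carr :: "'o"
  mul :: "'a"
  unt :: "'a"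
  com :: "'a"
  cou :: "'a"
  ant :: "'a"

context monoidal_data
begin

definition is_algebra :: "'o \<Rightarrow> 'a \<Rightarrow> 'a \<Rightarrow> bool" where
  "is_algebra A m u \<longleftrightarrow>
     A \<in> Obj C \<and> m \<in> Hom C (A \<otimes> A) A \<and> u \<in> Hom C \<I> A \<and>
     Str [A, A] m [A] \<bullet> (Str [A, A] m [A] \<odot> strand [A]) =
       Str [A, A] m [A] \<bullet> (strand [A] \<odot> Str [A, A] m [A]) \<and>
     Str [A, A] m [A] \<bullet> (Str [] u [A] \<odot> strand [A]) = strand [A] \<and>
     Str [A, A] m [A] \<bullet> (strand [A] \<odot> Str [] u [A]) = strand [A]"

definition is_coalgebra :: "'o \<Rightarrow> 'a \<Rightarrow> 'a \<Rightarrow> bool" where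
  "is_coalgebra A d e \<longleftrightarrow>
     A \<in> Obj C \<and> d \<in> Hom C A (A \<otimes> A) \<and> e \<in> Hom C A \<I> \<and>
     (Str [A] d [A, A] \<odot> strand [A]) \<bullet> Str [A] d [A, A] =
       (strand [A] \<odot> Str [A] d [A, A]) \<bullet> Str [A] d [A, A] \<and>
     (Str [A] e [] \<odot> strand [A]) \<bullet> Str [A] d [A, A] = strand [A] \<and>
     (strand [A] \<odot> Str [A] e []) \<bullet> Str [A] d [A, A] = strand [A]"

definition is_module :: "'o \<Rightarrow> 'a \<Rightarrow> 'a \<Rightarrow> 'o \<Rightarrow> 'a \<Rightarrow> bool" where
  "is_module A m u M a \<longleftrightarrow>
     M \<in> Obj C \<and> a \<in> Hom C (A \<otimes> M) M \<and>
     Str [A, M] a [M] \<bullet> (Str [A, A] m [A] \<odot> strand [M]) =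
       Str [A, M] a [M] \<bullet> (strand [A] \<odot> Str [A, M] a [M]) \<and>
     Str [A, M] a [M] \<bullet> (Str [] u [A] \<odot> strand [M]) = strand [M]"

end

locale hopf_data = braided_data B
  for B :: "('k, 'o, 'a, 'z) brcat_scheme" (structure) +
  fixes Ha :: "('o, 'a) hopf"
begin

abbreviation H :: "'o" where "H \<equiv> carr Ha"
abbreviation smul :: "('o, 'a) strarr" where "smul \<equiv> Str [H, H] (mul Ha) [H]"
abbreviation sunt :: "('o, 'a) strarr" where "sunt \<equiv> Str [] (unt Ha) [H]"
abbreviation scom :: "('o, 'a) strarr" where "scom \<equiv> Str [H] (com Ha) [H, H]"
abbreviation scou :: "('o, 'a) strarr" where "scou \<equiv> Str [H] (cou Ha) []"
abbreviation sant :: "('o, 'a) strarr" where "sant \<equiv> Str [H] (ant Ha) [H]"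

definition hopf_algebra :: bool where
  "hopf_algebra \<longleftrightarrow>
     is_algebra H (mul Ha) (unt Ha) \<and>
     is_coalgebra H (com Ha) (cou Ha) \<and>
     scom \<bullet> smul =
       (smul \<odot> smul) \<bullet> (strand [H] \<odot> sbraid H H \<odot> strand [H]) \<bullet> (scom \<odot> scom) \<and>
     scom \<bullet> sunt = sunt \<odot> sunt \<and>
     scou \<bullet> smul = scou \<odot> scou \<and>
     scou \<bullet> sunt = strand [] \<and>
     ant Ha \<in> Hom B H H \<and>
     smul \<bullet> (sant \<odot> strand [H]) \<bullet> scom = sunt \<bullet> scou \<and>
     smul \<bullet> (strand [H] \<odot> sant) \<bullet> scom = sunt \<bullet> scou"

definition invertible_antipode :: bool where
  "invertible_antipode \<longleftrightarrow> is_iso B H H (ant Ha)"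


subsection \<open>The rigid category of \<open>H\<close>-modules\<close>

abbreviation H_module :: "'o \<Rightarrow> 'a \<Rightarrow> bool" where
  "H_module M a \<equiv> is_module H (mul Ha) (unt Ha) M a"

abbreviation sact :: "'o \<times> 'a \<Rightarrow> ('o, 'a) strarr" where
  "sact V \<equiv> Str [H, fst V] (snd V) [fst V]"

definition H_hom :: "'o \<times> 'a \<Rightarrow> 'o \<times> 'a \<Rightarrow> 'a set" where
  "H_hom V W = {f \<in> Hom B (fst V) (fst W). f \<cdot> snd V = snd W \<cdot> (idm B H \<star> f)}"

definition H_triv :: "'o \<Rightarrow> 'o \<times> 'a" where
  "H_triv X = (X, sarr (scou \<odot> strand [X]))"

definition H_tens :: "'o \<times> 'a \<Rightarrow> 'o \<times> 'a \<Rightarrow> 'o \<times> 'a" where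
  "H_tens V W = (fst V \<otimes> fst W, sarr (
     (sact V \<odot> sact W) \<bullet>
     (strand [H] \<odot> sbraid H (fst V) \<odot> strand [fst W]) \<bullet>
     (scom \<odot> unpack [fst V, fst W])))"

text \<open>The duals of an \<open>H\<close>-module are its duals in \<open>B\<close>, with the unique action for which evaluation
  and coevaluation are \<open>H\<close>-linear.\<close>

definition H_ldual :: "'o \<times> 'a \<Rightarrow> 'o \<times> 'a" where
  "H_ldual V = (LD (fst V), THE b. H_module (LD (fst V)) b \<and>
     evl B (fst V) \<in> H_hom (H_tens (LD (fst V), b) V) (H_triv \<I>) \<and>
     coevl B (fst V) \<in> H_hom (H_triv \<I>) (H_tens V (LD (fst V), b)))"

definition H_rdual :: "'o \<times> 'a \<Rightarrow> 'o \<times> 'a" where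
  "H_rdual V = (RD (fst V), THE b. H_module (RD (fst V)) b \<and>
     evr B (fst V) \<in> H_hom (H_tens V (RD (fst V), b)) (H_triv \<I>) \<and>
     coevr B (fst V) \<in> H_hom (H_triv \<I>) (H_tens (RD (fst V), b) V))"

definition H_mod :: "('k, 'o \<times> 'a, 'a) rigcat" where
  "H_mod = \<lparr>
     Obj = {(M, a). H_module M a},
     Hom = H_hom,
     idm = (\<lambda>V. idm B (fst V)),
     comp = comp B,
     zeroa = (\<lambda>V W. zeroa B (fst V) (fst W)),
     adda = adda B,
     scal = scal B,
     munit = H_triv \<I>,
     tens = H_tens,
     tensa = tensa B,
     assoc = (\<lambda>U V W. assoc B (fst U) (fst V) (fst W)),
     lunit = (\<lambda>V. lunit B (fst V)),
     runit = (\<lambda>V. runit B (fst V)),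
     ldual = H_ldual,
     evl = (\<lambda>V. evl B (fst V)),
     coevl = (\<lambda>V. coevl B (fst V)),
     rdual = H_rdual,
     evr = (\<lambda>V. evr B (fst V)),
     coevr = (\<lambda>V. coevr B (fst V))\<rparr>"

definition HH_rho :: "('o \<Rightarrow> 'a) \<Rightarrow> ('k, ('o \<times> 'a) \<times> ('o \<times> 'a \<Rightarrow> 'a), 'a) lincat" where
  "HH_rho \<rho> = full_subcat (rigid_data.HH H_mod) (\<lambda>(M, t). \<forall>X \<in> Obj B.
     rigid_data.half_left H_mod M t (H_triv X) =
       (idm B (fst M) \<star> \<rho> X) \<cdot> ibraid X (fst M))"


subsection \<open>Anti-Yetter-Drinfeld modules\<close>

text \<open>
  \<open>adj f : Y \<rightarrow> \<^sup>*H \<otimes> Z\<close> is the arrow with adjoint \<open>f : H \<otimes> Y \<rightarrow> Z\<close>, that is,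
  \<open>f = (ev \<otimes> Id) (Id \<otimes> adj f)\<close>.
\<close>

definition adj :: "('o, 'a) strarr \<Rightarrow> ('o, 'a) strarr" where
  "adj f = (strand [RD H] \<odot> f) \<bullet> (scoevr H \<odot> strand (tl (sdom f)))"

text \<open>The unit is the right dual of the counit, precomposed with \<open>1 \<cong> \<^sup>*1\<close>.\<close>

definition Hd_unt :: "'a" where
  "Hd_unt = sarr (Str [RD \<I>] (rmap H \<I> (cou Ha)) [RD H] \<bullet> rdual_unit)"

definition Hd_mul :: "'a" where
  "Hd_mul = sarr (adj (
     sevr H \<bullet> (strand [H] \<odot> sevr H \<odot> strand [RD H]) \<bullet>
     ((sibraid H H \<bullet> scom) \<odot> strand [RD H, RD H])))"

abbreviation Hd_module :: "'o \<Rightarrow> 'a \<Rightarrow> bool" where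
  "Hd_module M b \<equiv> is_module (RD H) Hd_mul Hd_unt M b"

definition r_one :: "'o \<Rightarrow> ('o, 'a) strarr" where
  "r_one M = adj ((sevr H \<odot> strand [M]) \<bullet> (smul \<odot> strand [RD H, M]))"

definition r_zero :: "'o \<Rightarrow> 'a \<Rightarrow> ('o, 'a) strarr" where
  "r_zero M a = adj (
     Str [H, M] a [M] \<bullet>
     (strand [H] \<odot> sevr H \<odot> strand [M]) \<bullet>
     (strand [H] \<odot> smul \<odot> strand [RD H, M]) \<bullet>
     (strand [H] \<odot> sant \<odot> strand [H, RD H, M]) \<bullet>
     (scom \<odot> strand [H, RD H, M]) \<bullet>
     (sbraid H H \<odot> strand [RD H, M]))"

definition yd_act :: "('o \<Rightarrow> 'o \<Rightarrow> 'a) \<Rightarrow> 'o \<Rightarrow> 'a \<Rightarrow> ('o, 'a) strarr" where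
  "yd_act E M a =
     r_one M \<bullet>
     Str [H, RD H, M] (E H (RD H \<otimes> M)) [H, RD H, M] \<bullet>
     (strand [H] \<odot> r_zero M a) \<bullet>
     (scom \<odot> strand [RD H, M])"

text \<open>Objects are triples of \<open>M\<close>, the action of \<open>H\<close> and the action of \<open>\<^sup>*H\<close>; the parameter
  \<open>s\<close> is the automorphism of the identity of \<open>B\<close> that defines the module category.\<close>

definition aYD :: "('o \<Rightarrow> 'a) \<Rightarrow> ('k, 'o \<times> 'a \<times> 'a, 'a) lincat" where
  "aYD s = \<lparr>
     Obj = {(M, a, b). H_module M a \<and> Hd_module M b \<and>
       Str [H, M] a [M] \<bullet> (strand [H] \<odot> Str [RD H, M] b [M]) =
       Str [RD H, M] b [M] \<bullet> yd_act (twist_E s) M a},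
     Hom = (\<lambda>(M, a, b) (N, a', b'). {f \<in> Hom B M N.
       f \<cdot> a = a' \<cdot> (idm B H \<star> f) \<and> f \<cdot> b = b' \<cdot> (idm B (RD H) \<star> f)}),
     idm = (\<lambda>(M, a, b). idm B M),
     comp = comp B,
     zeroa = (\<lambda>(M, a, b) (N, a', b'). zeroa B M N),
     adda = adda B,
     scal = scal B\<rparr>"

definition aYD_aut :: "('o \<Rightarrow> 'a) \<Rightarrow> 'o \<times> 'a \<times> 'a \<Rightarrow> 'a" where
  "aYD_aut s = (\<lambda>(M, a, b). sarr (
     Str [RD H, M] b [M] \<bullet>
     (strand [RD H] \<odot> Str [H, M] a [M]) \<bullet>
     (scoevr H \<odot> strand [M]) \<bullet>
     Str [M] (s M) [M]))"

end

end

theory Submission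
  imports Defs
begin

text \<open>
  Both sides describe right comodules \<open>\<gamma> : M \<rightarrow> M \<otimes> H\<close> on an \<open>H\<close>-module \<open>M\<close>, subject to one compatibility.
  A half braiding whose arrows \<open>X \<otimes> M \<rightarrow> M \<otimes> X\<^sup>#\<close> are prescribed by the pivot for trivial \<open>X\<close> is
  determined by its value at the regular module, because every action \<open>H \<otimes> X \<rightarrow> X\<close> is a morphism out of
  a tensor product with a trivial module; there it is given by \<open>\<gamma>\<close>, and the tensor
  condition says that \<open>\<gamma>\<close> is coassociative. On the other side, the \<open>\<^sup>*H\<close>-action has to be conjugated
  by the anti-twist before it is dualised to \<open>\<gamma>\<close>. Bending \<open>X\<^sup>#\<close> around turns linearity of the half braiding
  into an equation of maps \<open>H \<otimes> X \<otimes> M \<otimes> X\<^sup>* \<rightarrow> M\<close>, which factors through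
  a map \<open>X \<otimes> M \<otimes> X\<^sup>* \<rightarrow> \<^sup>*H \<otimes> M\<close>, split epi for the regular module, and the
  anti-Yetter-Drinfeld condition; the anti-twist enters because it is the
  cost of rotating an action around the pivotal evaluation.
\<close>

sublocale monoidal_category \<subseteq> monoidal_data C .

section \<open>A strict calculus of arrows between words\<close>

context monoidal_category
begin

notation stens (infixr "**" 75) and scomp (infixr "oo" 65) and strand ("$_" [1000] 1000)

declare munit_obj [simp] tens_obj [simp] idm_hom [simp]

lemma word_obj [simp]: "set Xs <= Obj C ==> word Xs \<in> Obj C"
 by (induction Xs rule: word.induct) auto

definition wt :: "('o, 'a) strarr => bool" where
 "wt f \<longleftrightarrow> set (sdom f) <= Obj C \<and> set (scod f) <= Obj C \<and>
   sarr f \<in> Hom C (word (sdom f)) (word (scod f))"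

lemma wt_dom: "wt f ==> set (sdom f) <= Obj C"
 and wt_cod: "wt f ==> set (scod f) <= Obj C"
 and wt_hom: "wt f ==> sarr f \<in> Hom C (word (sdom f)) (word (scod f))"
 by (auto simp: wt_def)

lemma wt_Str: "wt (Str Xs f Ys) \<longleftrightarrow> set Xs <= Obj C \<and> set Ys <= Obj C \<and> f \<in> Hom C (word Xs) (word Ys)"
 by (simp add: wt_def)

lemma sdom_scomp [simp]: "sdom (f oo g) = sdom g"
 and scod_scomp [simp]: "scod (f oo g) = scod f"
 and sarr_scomp: "sarr (f oo g) = sarr f \<cdot> sarr g"
 and sdom_strand [simp]: "sdom ($Xs) = Xs"
 and scod_strand [simp]: "scod ($Xs) = Xs"
 and sdom_stens [simp]: "sdom (f ** g) = sdom f @ sdom g"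
 and scod_stens [simp]: "scod (f ** g) = scod f @ scod g"
 by (simp_all add: scomp_def strand_def stens_def)

lemma wt_strand [simp]: "wt ($Xs) \<longleftrightarrow> set Xs <= Obj C"
 by (auto simp: wt_def strand_def)

lemma wt_scomp [simp]: "[|wt f; wt g; sdom f = scod g|] ==> wt (f oo g)"
 unfolding wt_def sarr_scomp by (auto intro: comp_hom[of "word (sdom g)" "word (scod g)"])

lemma scomp_assoc:
 assumes "wt f" "wt g" "wt h" "sdom f = scod g" "sdom g = scod h"
 shows "(f oo g) oo h = f oo g oo h"
proof -
 have "(sarr f \<cdot> sarr g) \<cdot> sarr h = sarr f \<cdot> sarr g \<cdot> sarr h"
  by (rule comp_assoc[of "word (sdom h)" "word (scod h)" "word (scod g)" "word (scod f)"])
    (use assms in \<open>auto simp: wt_def\<close>)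
 then show ?thesis by (simp add: scomp_def)
qed

lemma strand_scomp: "[|wt f; scod f = Xs|] ==> $Xs oo f = f"
 using comp_idl[of "word (sdom f)" "word (scod f)" "sarr f"]
 by (cases f) (auto simp: wt_def scomp_def strand_def)

lemma scomp_strand: "[|wt f; sdom f = Xs|] ==> f oo $Xs = f"
 using comp_idr[of "word (sdom f)" "word (scod f)" "sarr f"]
 by (cases f) (auto simp: wt_def scomp_def strand_def)

definition inverses :: "('o, 'a) strarr => ('o, 'a) strarr => bool" where
 "inverses f g \<longleftrightarrow> wt f \<and> wt g \<and> sdom g = scod f \<and> scod g = sdom f \<and>
   g oo f = $(sdom f) \<and> f oo g = $(scod f)"

lemma inverses_sym: "inverses f g ==> inverses g f"
 by (auto simp: inverses_def)

lemma inverses_cancel_left: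
 assumes "inverses f g" "f oo a = f oo b" "wt a" "wt b" "scod a = sdom f" "scod b = sdom f"
 shows "a = b"
proof -
 have "g oo f oo a = g oo f oo b" using assms by simp
 then have "(g oo f) oo a = (g oo f) oo b"
  using assms by (subst (1 2) scomp_assoc) (auto simp: inverses_def)
 then show ?thesis using assms by (simp add: inverses_def strand_scomp)
qed

lemma inverses_cancel_right:
 assumes "inverses f g" "a oo f = b oo f" "wt a" "wt b" "sdom a = scod f" "sdom b = scod f"
 shows "a = b"
proof -
 have "a oo f oo g = b oo f oo g"
  using assms scomp_assoc[of a f g] scomp_assoc[of b f g] by (simp add: inverses_def)
 then show ?thesis using assms by (simp add: inverses_def scomp_strand)
qed

lemma inverses_unique:
 assumes "inverses f g" "inverses f h" shows "g = h"
 by (rule inverses_cancel_left[OF assms(1)]) (use assms in \<open>auto simp: inverses_def\<close>)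

lemma inverses_scomp:
 assumes "inverses f g" "inverses f' g'" "sdom f = scod f'"
 shows "inverses (f oo f') (g' oo g)"
proof -
 have "(g' oo g) oo f oo f' = g' oo (g oo f) oo f'" "(f oo f') oo g' oo g = f oo (f' oo g') oo g"
  using assms by (subst (1 2) scomp_assoc; simp add: inverses_def)+
 then show ?thesis
  using assms by (simp add: inverses_def strand_scomp)
qed

lemma inverses_strand: "set Xs <= Obj C ==> inverses ($Xs) ($Xs)"
 by (simp add: inverses_def scomp_strand)

lemma arr_inverse_unique:
 assumes "X \<in> Obj C" "Y \<in> Obj C" "f \<in> Hom C X Y" "arr_inverse C X Y f g" "arr_inverse C X Y f h"
 shows "g = h"
proof -
 have "h = h \<cdot> (f \<cdot> g)"
  using assms comp_idr[of Y X h] by (simp add: arr_inverse_def)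
 also have "... = (h \<cdot> f) \<cdot> g"
  using assms comp_assoc[of Y X Y X g f h] by (simp add: arr_inverse_def)
 also have "... = g"
  using assms comp_idl[of Y X g] by (simp add: arr_inverse_def)
 finally show ?thesis by simp
qed

lemma arr_inv_eqI:
 assumes "X \<in> Obj C" "Y \<in> Obj C" "f \<in> Hom C X Y" "arr_inverse C X Y f g"
 shows "arr_inv C X Y f = g"
 unfolding arr_inv_def using arr_inverse_unique[OF assms(1-3)] assms(4) by blast

lemma arr_inverse_arr_inv:
 assumes "X \<in> Obj C" "Y \<in> Obj C" "is_iso C X Y f"
 shows "arr_inverse C X Y f (arr_inv C X Y f)"
proof -
 obtain g where "f \<in> Hom C X Y" "arr_inverse C X Y f g" using assms by (auto simp: is_iso_def)
 then show ?thesis using arr_inv_eqI[OF assms(1,2)] by simp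
qed

lemma inverses_arr_inv:
 assumes "set Xs <= Obj C" "set Ys <= Obj C" "is_iso C (word Xs) (word Ys) f"
 shows "inverses (Str Xs f Ys) (Str Ys (arr_inv C (word Xs) (word Ys) f) Xs)"
 using arr_inverse_arr_inv[of "word Xs" "word Ys" f] assms
 by (simp add: inverses_def wt_Str is_iso_def arr_inverse_def scomp_def strand_def)

lemma inverses_iff:
 assumes "set Xs <= Obj C" "set Ys <= Obj C"
 shows "inverses (Str Xs f Ys) (Str Ys g Xs) \<longleftrightarrow>
  f \<in> Hom C (word Xs) (word Ys) \<and> arr_inverse C (word Xs) (word Ys) f g"
 using assms by (auto simp: inverses_def wt_Str arr_inverse_def scomp_def strand_def)

lemma inverses_is_iso:
 "inverses f g ==> is_iso C (word (sdom f)) (word (scod f)) (sarr f)"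
 by (cases f; cases g) (auto simp: is_iso_def wt_Str inverses_def arr_inverse_def
   scomp_def strand_def)

lemma inverses_arr_inv_eq:
 "inverses f g ==> arr_inv C (word (sdom f)) (word (scod f)) (sarr f) = sarr g"
 by (cases f; cases g) (auto intro!: arr_inv_eqI simp: wt_Str inverses_def arr_inverse_def
   scomp_def strand_def)

subsection \<open>Coherence\<close>

definition ntens :: "('o, 'a) strarr => ('o, 'a) strarr => ('o, 'a) strarr"  (infixr "***" 75) where
 "f *** g = Str [word (sdom f) \<otimes> word (sdom g)] (sarr f \<star> sarr g) [word (scod f) \<otimes> word (scod g)]"

definition sassoc :: "'o => 'o => 'o => ('o, 'a) strarr" where
 "sassoc X Y Z = Str [(X \<otimes> Y) \<otimes> Z] (assoc C X Y Z) [X \<otimes> (Y \<otimes> Z)]"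

definition slunit :: "'o => ('o, 'a) strarr" where
 "slunit X = Str [\<I> \<otimes> X] (lunit C X) [X]"

definition srunit :: "'o => ('o, 'a) strarr" where
 "srunit X = Str [X \<otimes> \<I>] (runit C X) [X]"

definition sjoin :: "'o list => 'o list => ('o, 'a) strarr" where
 "sjoin Xs Ys = Str [word Xs \<otimes> word Ys] (join Xs Ys) [word (Xs @ Ys)]"

lemma sdom_ntens [simp]: "sdom (f *** g) = [word (sdom f) \<otimes> word (sdom g)]"
 and scod_ntens [simp]: "scod (f *** g) = [word (scod f) \<otimes> word (scod g)]"
 and sdom_sassoc [simp]: "sdom (sassoc X Y Z) = [(X \<otimes> Y) \<otimes> Z]"
 and scod_sassoc [simp]: "scod (sassoc X Y Z) = [X \<otimes> (Y \<otimes> Z)]"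
 and sdom_slunit [simp]: "sdom (slunit X) = [\<I> \<otimes> X]"
 and scod_slunit [simp]: "scod (slunit X) = [X]"
 and sdom_srunit [simp]: "sdom (srunit X) = [X \<otimes> \<I>]"
 and scod_srunit [simp]: "scod (srunit X) = [X]"
 and sdom_sjoin [simp]: "sdom (sjoin Xs Ys) = [word Xs \<otimes> word Ys]"
 and scod_sjoin [simp]: "scod (sjoin Xs Ys) = [word (Xs @ Ys)]"
 by (simp_all add: ntens_def sassoc_def slunit_def srunit_def sjoin_def)

lemma wt_ntens [simp]: "wt f ==> wt g ==> wt (f *** g)"
 unfolding wt_def by (auto simp: ntens_def intro!: tensa_hom)

lemma ntens_scomp:
 assumes "wt f" "wt g" "wt f'" "wt g'" "sdom f = scod g" "sdom f' = scod g'"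
 shows "(f oo g) *** (f' oo g') = (f *** f') oo (g *** g')"
 using assms unfolding ntens_def scomp_def wt_def
 by (simp add: tensa_comp[of "word (sdom g)" "word (scod g)" "word (scod f)"
    "word (sdom g')" "word (scod g')" "word (scod f')"])

lemma ntens_strand [simp]:
 "[|X \<in> Obj C; Y \<in> Obj C|] ==> $[X] *** $[Y] = $[X \<otimes> Y]"
 by (simp add: ntens_def strand_def tensa_id)

lemma inverses_ntens:
 assumes "inverses f g" "inverses f' g'"
  "length (sdom f) = 1" "length (sdom f') = 1" "length (scod f) = 1" "length (scod f') = 1"
 shows "inverses (f *** f') (g *** g')"
proof -
 obtain X X' Y Y' where *: "sdom f = [X]" "sdom f' = [X']" "scod f = [Y]" "scod f' = [Y']"
  using assms by (auto simp: length_Suc_conv)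
 have "(g *** g') oo (f *** f') = $[X \<otimes> X']"
  using assms wt_dom[of f] wt_dom[of f']
  by (auto simp: * inverses_def simp flip: ntens_scomp)
 moreover have "(f *** f') oo (g *** g') = $[Y \<otimes> Y']"
  using assms wt_cod[of f] wt_cod[of f']
  by (auto simp: * inverses_def simp flip: ntens_scomp)
 ultimately show ?thesis using assms * by (simp add: inverses_def)
qed

lemma sassoc_iso: "[|X \<in> Obj C; Y \<in> Obj C; Z \<in> Obj C|] ==> \<exists>g. inverses (sassoc X Y Z) g"
 and slunit_iso: "X \<in> Obj C ==> \<exists>g. inverses (slunit X) g"
 and srunit_iso: "X \<in> Obj C ==> \<exists>g. inverses (srunit X) g"
 using inverses_arr_inv[of "[(X \<otimes> Y) \<otimes> Z]" "[X \<otimes> (Y \<otimes> Z)]" "assoc C X Y Z"]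
  inverses_arr_inv[of "[\<I> \<otimes> X]" "[X]" "lunit C X"]
  inverses_arr_inv[of "[X \<otimes> \<I>]" "[X]" "runit C X"]
  assoc_iso lunit_iso runit_iso
 by (auto simp: sassoc_def slunit_def srunit_def)

lemma wt_sassoc [simp]: "[|X \<in> Obj C; Y \<in> Obj C; Z \<in> Obj C|] ==> wt (sassoc X Y Z)"
 and wt_slunit [simp]: "X \<in> Obj C ==> wt (slunit X)"
 and wt_srunit [simp]: "X \<in> Obj C ==> wt (srunit X)"
 using sassoc_iso slunit_iso srunit_iso by (fastforce simp: inverses_def)+

lemma sassoc_natural:
 assumes "wt f" "wt g" "wt h" "sdom f = [X]" "sdom g = [Y]" "sdom h = [Z]"
  "scod f = [X']" "scod g = [Y']" "scod h = [Z']"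
 shows "sassoc X' Y' Z' oo ((f *** g) *** h) = (f *** (g *** h)) oo sassoc X Y Z"
 using assms assoc_natural[of X Y Z X' Y' Z' "sarr f" "sarr g" "sarr h"]
 by (simp add: scomp_def sassoc_def ntens_def wt_def)

lemma slunit_natural:
 assumes "wt f" "sdom f = [X]" "scod f = [Y]"
 shows "slunit Y oo ($[\<I>] *** f) = f oo slunit X"
 using assms lunit_natural[of X Y "sarr f"]
 by (simp add: scomp_def slunit_def ntens_def wt_def strand_def)

lemma srunit_natural:
 assumes "wt f" "sdom f = [X]" "scod f = [Y]"
 shows "srunit Y oo (f *** $[\<I>]) = f oo srunit X"
 using assms runit_natural[of X Y "sarr f"]
 by (simp add: scomp_def srunit_def ntens_def wt_def strand_def)

lemma spentagon:
 assumes "W \<in> Obj C" "X \<in> Obj C" "Y \<in> Obj C" "Z \<in> Obj C"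
 shows "($[W] *** sassoc X Y Z) oo sassoc W (X \<otimes> Y) Z oo (sassoc W X Y *** $[Z])
  = sassoc W X (Y \<otimes> Z) oo sassoc (W \<otimes> X) Y Z"
 using assms pentagon[of W X Y Z]
 by (simp add: scomp_def sassoc_def ntens_def strand_def)

lemma striangle:
 assumes "X \<in> Obj C" "Y \<in> Obj C"
 shows "($[X] *** slunit Y) oo sassoc X \<I> Y = srunit X *** $[Y]"
 using assms triangle[of X Y]
 by (simp add: scomp_def sassoc_def slunit_def srunit_def ntens_def strand_def)

lemma ntens_unit_faithful:
 assumes "wt f" "wt g" "sdom f = [X]" "scod f = [Y]" "sdom g = [X]" "scod g = [Y]"
 shows "$[\<I>] *** f = $[\<I>] *** g ==> f = g"
  and "f *** $[\<I>] = g *** $[\<I>] ==> f = g"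
proof -
 have X: "X \<in> Obj C" using assms wt_dom[of f] by simp
 obtain l r where "inverses (slunit X) l" "inverses (srunit X) r"
  using slunit_iso[OF X] srunit_iso[OF X] by blast
 note c = this[THEN inverses_cancel_right]
 show "f = g" if "$[\<I>] *** f = $[\<I>] *** g"
  by (rule c(1)) (use assms that X slunit_natural[of f X Y] slunit_natural[of g X Y] in auto)
 show "f = g" if "f *** $[\<I>] = g *** $[\<I>]"
  by (rule c(2)) (use assms that X srunit_natural[of f X Y] srunit_natural[of g X Y] in auto)
qed

lemma ntens_lscomp:
 assumes "wt f" "wt g" "X \<in> Obj C" "sdom f = scod g"
 shows "$[X] *** (f oo g) = ($[X] *** f) oo ($[X] *** g)"
 using assms ntens_scomp[of "$[X]" "$[X]" f g] by (simp add: scomp_strand)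

lemma ntens_rscomp:
 assumes "wt f" "wt g" "X \<in> Obj C" "sdom f = scod g"
 shows "(f oo g) *** $[X] = (f *** $[X]) oo (g *** $[X])"
 using assms ntens_scomp[of f g "$[X]" "$[X]"] by (simp add: scomp_strand)

text \<open>Kelly's redundancies: the unit constraints of a tensor product are determined by the triangle.\<close>

lemma slunit_tens:
 assumes X: "X \<in> Obj C" and Y: "Y \<in> Obj C"
 shows "slunit (X \<otimes> Y) oo sassoc \<I> X Y = slunit X *** $[Y]"
proof (rule ntens_unit_faithful(1))
 let ?I = "$[\<I>]" and ?a = "sassoc \<I> (\<I> \<otimes> X) Y oo (sassoc \<I> \<I> X *** $[Y])"
 obtain i j where ij: "inverses (sassoc \<I> (\<I> \<otimes> X) Y) i" "inverses (sassoc \<I> \<I> X) j"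
  using X Y sassoc_iso by (metis munit_obj tens_obj)
 have k: "inverses ?a ((j *** $[Y]) oo i)"
  using X Y ij by (intro inverses_scomp inverses_ntens inverses_strand) auto
 have "(?I *** (slunit (X \<otimes> Y) oo sassoc \<I> X Y)) oo ?a =
   (?I *** slunit (X \<otimes> Y)) oo (?I *** sassoc \<I> X Y) oo ?a"
  using X Y by (simp add: ntens_lscomp scomp_assoc)
 also have "... = ((?I *** slunit (X \<otimes> Y)) oo sassoc \<I> \<I> (X \<otimes> Y)) oo sassoc (\<I> \<otimes> \<I>) X Y"
  using X Y by (simp add: spentagon scomp_assoc)
 also have "... = (srunit \<I> *** $[X] *** $[Y]) oo sassoc (\<I> \<otimes> \<I>) X Y"
  using X Y by (simp add: striangle)
 also have "... = sassoc \<I> X Y oo ((srunit \<I> *** $[X]) *** $[Y])"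
  using X Y by (subst sassoc_natural) (auto simp del: ntens_strand)
 also have "... = sassoc \<I> X Y oo ((?I *** slunit X) *** $[Y]) oo (sassoc \<I> \<I> X *** $[Y])"
  using X Y by (simp flip: striangle add: ntens_rscomp)
 also have "... = (sassoc \<I> X Y oo ((?I *** slunit X) *** $[Y])) oo (sassoc \<I> \<I> X *** $[Y])"
  using X Y by (simp add: scomp_assoc)
 also have "sassoc \<I> X Y oo ((?I *** slunit X) *** $[Y]) =
   (?I *** slunit X *** $[Y]) oo sassoc \<I> (\<I> \<otimes> X) Y"
  using X Y by (intro sassoc_natural) auto
 finally have "(?I *** (slunit (X \<otimes> Y) oo sassoc \<I> X Y)) oo ?a = (?I *** slunit X *** $[Y]) oo ?a"
  using X Y by (simp add: scomp_assoc)
 then show "?I *** (slunit (X \<otimes> Y) oo sassoc \<I> X Y) = ?I *** slunit X *** $[Y]"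
  by (rule inverses_cancel_right[OF k]) (use X Y in auto)
qed (use X Y in auto)

lemma srunit_tens:
 assumes X: "X \<in> Obj C" and Y: "Y \<in> Obj C"
 shows "($[X] *** srunit Y) oo sassoc X Y \<I> = srunit (X \<otimes> Y)"
proof (rule ntens_unit_faithful(2))
 let ?I = "$[\<I>]"
 obtain k where k: "inverses (sassoc X Y \<I>) k"
  using sassoc_iso[OF X Y munit_obj] by blast
 have "sassoc X Y \<I> oo ((($[X] *** srunit Y) oo sassoc X Y \<I>) *** ?I) =
   (sassoc X Y \<I> oo (($[X] *** srunit Y) *** ?I)) oo (sassoc X Y \<I> *** ?I)"
  using X Y by (simp add: ntens_rscomp scomp_assoc)
 also have "sassoc X Y \<I> oo (($[X] *** srunit Y) *** ?I) =
   ($[X] *** srunit Y *** ?I) oo sassoc X (Y \<otimes> \<I>) \<I>"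
  using X Y by (intro sassoc_natural) auto
 also have "srunit Y *** ?I = ($[Y] *** slunit \<I>) oo sassoc Y \<I> \<I>"
  using X Y by (simp add: striangle)
 also have "(($[X] *** (($[Y] *** slunit \<I>) oo sassoc Y \<I> \<I>)) oo sassoc X (Y \<otimes> \<I>) \<I>)
   oo (sassoc X Y \<I> *** ?I) = ($[X] *** $[Y] *** slunit \<I>) oo
   (($[X] *** sassoc Y \<I> \<I>) oo sassoc X (Y \<otimes> \<I>) \<I> oo (sassoc X Y \<I> *** ?I))"
  using X Y by (simp add: ntens_lscomp scomp_assoc)
 also have "... = (($[X] *** $[Y] *** slunit \<I>) oo sassoc X Y (\<I> \<otimes> \<I>)) oo sassoc (X \<otimes> Y) \<I> \<I>"
  using X Y by (simp add: spentagon scomp_assoc)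
 also have "($[X] *** $[Y] *** slunit \<I>) oo sassoc X Y (\<I> \<otimes> \<I>) =
   sassoc X Y \<I> oo (($[X] *** $[Y]) *** slunit \<I>)"
  using X Y by (subst sassoc_natural) (auto simp del: ntens_strand)
 also have "... oo sassoc (X \<otimes> Y) \<I> \<I> = sassoc X Y \<I> oo (srunit (X \<otimes> Y) *** ?I)"
  using X Y by (simp add: striangle scomp_assoc)
 finally show "(($[X] *** srunit Y) oo sassoc X Y \<I>) *** ?I = srunit (X \<otimes> Y) *** ?I"
  by (rule inverses_cancel_left[OF k]) (use X Y in auto)
qed (use X Y in auto)

lemma slunit_unit: "slunit \<I> = srunit \<I>"
proof (rule ntens_unit_faithful(2))
 have "slunit \<I> oo ($[\<I>] *** slunit \<I>) = slunit \<I> oo slunit (\<I> \<otimes> \<I>)"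
  by (intro slunit_natural) auto
 moreover obtain k where "inverses (slunit \<I>) k" using slunit_iso[of \<I>] by auto
 ultimately have "slunit (\<I> \<otimes> \<I>) = $[\<I>] *** slunit \<I>"
  by (metis inverses_cancel_left munit_obj scod_slunit sdom_slunit tens_obj wt_ntens wt_slunit
    wt_strand scod_ntens scod_strand word.simps(2) empty_subsetI insert_subset list.set)
 then show "slunit \<I> *** $[\<I>] = srunit \<I> *** $[\<I>]"
  using slunit_tens[of \<I> \<I>] striangle[of \<I> \<I>] by simp
qed auto

lemma sjoin_simps:
 "sjoin [] Ys = slunit (word Ys)"
 "sjoin [X] [] = srunit X"
 "sjoin [X] (Y # Ys) = $[X \<otimes> word (Y # Ys)]"
 "[|X \<in> Obj C; Y \<in> Obj C|] ==> sjoin (X # Y # Zs) Ys =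
   ($[X] *** sjoin (Y # Zs) Ys) oo sassoc X (word (Y # Zs)) (word Ys)"
 by (simp_all add: sjoin_def slunit_def srunit_def strand_def sassoc_def ntens_def scomp_def)

lemma sjoin_iso:
 "set Xs <= Obj C ==> set Ys <= Obj C ==> \<exists>g. inverses (sjoin Xs Ys) g"
proof (induction Xs Ys rule: join.induct)
 case (1 Ys)
 then show ?case by (simp add: sjoin_simps slunit_iso del: word.simps)
next
 case (2 X)
 then show ?case by (simp add: sjoin_simps srunit_iso)
next
 case (3 X Y Ys)
 then show ?case by (auto simp: sjoin_simps simp del: word.simps intro!: exI inverses_strand)
next
 case (4 X Y Zs Ys)
 then obtain g h where "inverses (sjoin (Y # Zs) Ys) g"
  "inverses (sassoc X (word (Y # Zs)) (word Ys)) h"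
  by (metis insert_subset list.set(2) sassoc_iso word_obj)
 then have "inverses (($[X] *** sjoin (Y # Zs) Ys) oo sassoc X (word (Y # Zs)) (word Ys))
   (h oo ($[X] *** g))"
  using 4 by (intro inverses_scomp inverses_ntens inverses_strand) auto
 then show ?case using 4 by (auto simp: sjoin_simps simp del: word.simps)
qed

lemma wt_sjoin [simp]: "[|set Xs <= Obj C; set Ys <= Obj C|] ==> wt (sjoin Xs Ys)"
 using sjoin_iso by (auto simp: inverses_def)

lemma sjoin_Nil: "set Xs <= Obj C ==> sjoin Xs [] = srunit (word Xs)"
proof (induction Xs rule: word.induct)
 case 1
 then show ?case by (simp add: sjoin_simps slunit_unit)
next
 case (2 X)
 then show ?case by (simp add: sjoin_simps)
next
 case (3 X Y Zs)
 then show ?case using srunit_tens[of X "word (Y # Zs)"] word_obj[of "Y # Zs"]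
  by (simp add: sjoin_simps)
qed

lemma sjoin_assoc:
 assumes "set Xs <= Obj C" "set Ys <= Obj C" "set Zs <= Obj C"
 shows "sjoin (Xs @ Ys) Zs oo (sjoin Xs Ys *** $[word Zs]) =
  sjoin Xs (Ys @ Zs) oo ($[word Xs] *** sjoin Ys Zs) oo sassoc (word Xs) (word Ys) (word Zs)"
 using assms
proof (induction Xs rule: word.induct)
 case 1
 note [simp del] = word.simps
 have "sjoin Ys Zs oo (slunit (word Ys) *** $[word Zs]) =
   (sjoin Ys Zs oo slunit (word Ys \<otimes> word Zs)) oo sassoc \<I> (word Ys) (word Zs)"
  using 1 by (simp add: scomp_assoc flip: slunit_tens)
 also have "sjoin Ys Zs oo slunit (word Ys \<otimes> word Zs) =
   slunit (word (Ys @ Zs)) oo ($[\<I>] *** sjoin Ys Zs)"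
  using 1 by (subst slunit_natural) auto
 finally show ?case using 1 by (simp add: sjoin_simps word.simps(1) scomp_assoc word.simps(2))
next
 case (2 X)
 show ?case
 proof (cases Ys)
  case Nil
  have "sjoin [X] Zs oo (srunit X *** $[word Zs]) =
    sjoin [X] Zs oo ($[X] *** slunit (word Zs)) oo sassoc X \<I> (word Zs)"
   using 2 striangle[of X "word Zs"] by simp
  then show ?thesis using Nil by (simp add: sjoin_simps)
 next
  case (Cons Y Ys')
  then have "word Ys \<in> Obj C" using 2 by simp
  then show ?thesis using Cons 2
   by (cases Zs)
     (auto simp: sjoin_simps strand_scomp scomp_strand scomp_assoc simp del: word.simps(3))
 qed
next
 case (3 X Y Xs)
 note [simp del] = word.simps
 note [simp] = word.simps(2)
 let ?W = "word (Y # Xs)" let ?Y = "word Ys" let ?Z = "word Zs"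
 have W: "?W \<in> Obj C" "X \<in> Obj C" "?Y \<in> Obj C" "?Z \<in> Obj C" "word (Y # Xs @ Ys) \<in> Obj C"
  "word (Y # Xs @ Ys @ Zs) \<in> Obj C" "word (Ys @ Zs) \<in> Obj C" "Y \<in> Obj C" using 3 by auto
 have wts: "wt (sjoin (Y # Xs) Ys)" "wt (sjoin (Y # Xs @ Ys) Zs)" "wt (sjoin Ys Zs)"
  "wt (sjoin (Y # Xs) (Ys @ Zs))"
  using 3 by auto
 note [simp] = W wts
 have "sjoin (X # Y # Xs @ Ys) Zs oo (sjoin (X # Y # Xs) Ys *** $[?Z]) =
   ($[X] *** sjoin (Y # Xs @ Ys) Zs) oo
   (sassoc X (word (Y # Xs @ Ys)) ?Z oo (($[X] *** sjoin (Y # Xs) Ys) *** $[?Z])) oo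
   (sassoc X ?W ?Y *** $[?Z])"
  by (simp add: sjoin_simps ntens_rscomp scomp_assoc)
 also have "sassoc X (word (Y # Xs @ Ys)) ?Z oo (($[X] *** sjoin (Y # Xs) Ys) *** $[?Z]) =
   ($[X] *** sjoin (Y # Xs) Ys *** $[?Z]) oo sassoc X (?W \<otimes> ?Y) ?Z"
  by (intro sassoc_natural) auto
 also have "($[X] *** sjoin (Y # Xs @ Ys) Zs) oo
   (($[X] *** sjoin (Y # Xs) Ys *** $[?Z]) oo sassoc X (?W \<otimes> ?Y) ?Z) oo
   (sassoc X ?W ?Y *** $[?Z]) =
   ($[X] *** (sjoin (Y # Xs @ Ys) Zs oo (sjoin (Y # Xs) Ys *** $[?Z]))) oo
    sassoc X (?W \<otimes> ?Y) ?Z oo (sassoc X ?W ?Y *** $[?Z])"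
  by (simp add: ntens_lscomp scomp_assoc)
 also have "sjoin (Y # Xs @ Ys) Zs oo (sjoin (Y # Xs) Ys *** $[?Z]) =
   sjoin (Y # Xs) (Ys @ Zs) oo ($[?W] *** sjoin Ys Zs) oo sassoc ?W ?Y ?Z"
  using 3 by simp
 also have "($[X] *** (sjoin (Y # Xs) (Ys @ Zs) oo ($[?W] *** sjoin Ys Zs) oo sassoc ?W ?Y ?Z)) oo
    sassoc X (?W \<otimes> ?Y) ?Z oo (sassoc X ?W ?Y *** $[?Z]) =
   ($[X] *** sjoin (Y # Xs) (Ys @ Zs)) oo ($[X] *** $[?W] *** sjoin Ys Zs) oo
   (($[X] *** sassoc ?W ?Y ?Z) oo sassoc X (?W \<otimes> ?Y) ?Z oo (sassoc X ?W ?Y *** $[?Z]))"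
  by (simp add: ntens_lscomp scomp_assoc)
 also have "... = ($[X] *** sjoin (Y # Xs) (Ys @ Zs)) oo
   (($[X] *** $[?W] *** sjoin Ys Zs) oo sassoc X ?W (?Y \<otimes> ?Z)) oo sassoc (X \<otimes> ?W) ?Y ?Z"
  by (simp add: spentagon scomp_assoc)
 also have "($[X] *** $[?W] *** sjoin Ys Zs) oo sassoc X ?W (?Y \<otimes> ?Z) =
   sassoc X ?W (word (Ys @ Zs)) oo (($[X] *** $[?W]) *** sjoin Ys Zs)"
  by (subst sassoc_natural) (auto simp del: ntens_strand)
 finally show ?case
  by (simp add: sjoin_simps scomp_assoc word.simps(3))
qed

subsection \<open>The tensor product of strings is strictly associative\<close>

definition sjoin_inv :: "'o list => 'o list => ('o, 'a) strarr" where
 "sjoin_inv Xs Ys = Str [word (Xs @ Ys)]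
   (arr_inv C (word Xs \<otimes> word Ys) (word (Xs @ Ys)) (join Xs Ys)) [word Xs \<otimes> word Ys]"

definition single :: "('o, 'a) strarr => ('o, 'a) strarr" where
 "single f = Str [word (sdom f)] (sarr f) [word (scod f)]"

lemma sdom_sjoin_inv [simp]: "sdom (sjoin_inv Xs Ys) = [word (Xs @ Ys)]"
 and scod_sjoin_inv [simp]: "scod (sjoin_inv Xs Ys) = [word Xs \<otimes> word Ys]"
 and sdom_single [simp]: "sdom (single f) = [word (sdom f)]"
 and scod_single [simp]: "scod (single f) = [word (scod f)]"
 by (simp_all add: sjoin_inv_def single_def)

lemma wt_single [simp]: "wt f ==> wt (single f)"
 by (auto simp: wt_def single_def)

lemma single_scomp [simp]: "single (f oo g) = single f oo single g"
 by (simp add: single_def scomp_def)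

lemma single_strand [simp]: "single ($Xs) = $[word Xs]"
 by (simp add: single_def strand_def)

lemma single_eqD: "[|single f = single g; sdom f = sdom g; scod f = scod g|] ==> f = g"
 by (cases f; cases g) (auto simp: single_def)

lemma sjoin_inverse:
 assumes "set Xs <= Obj C" "set Ys <= Obj C"
 shows "inverses (sjoin Xs Ys) (sjoin_inv Xs Ys)"
proof -
 obtain g where "inverses (sjoin Xs Ys) g" using sjoin_iso assms by blast
 then have "is_iso C (word Xs \<otimes> word Ys) (word (Xs @ Ys)) (join Xs Ys)"
  by (auto dest: inverses_is_iso simp: sjoin_def)
 then show ?thesis
  using inverses_arr_inv[of "[word Xs \<otimes> word Ys]" "[word (Xs @ Ys)]" "join Xs Ys"] assms
  by (simp add: sjoin_inv_def sjoin_def)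
qed

lemma wt_sjoin_inv [simp]: "[|set Xs <= Obj C; set Ys <= Obj C|] ==> wt (sjoin_inv Xs Ys)"
 using sjoin_inverse by (auto simp: inverses_def)

lemma single_stens:
 "single (f ** g) = sjoin (scod f) (scod g) oo (single f *** single g) oo sjoin_inv (sdom f) (sdom g)"
 by (simp add: single_def stens_def sjoin_def sjoin_inv_def scomp_def ntens_def)

lemma wt_stens [simp]:
 assumes "wt f" "wt g" shows "wt (f ** g)"
proof -
 note d = wt_dom[OF assms(1)] wt_dom[OF assms(2)] wt_cod[OF assms(1)] wt_cod[OF assms(2)]
 have "wt (single (f ** g))" using assms d by (simp add: single_stens)
 then show ?thesis using d by (simp add: wt_def single_def)
qed

lemma stens_scomp:
 assumes "wt f" "wt g" "wt f'" "wt g'" "sdom f = scod g" "sdom f' = scod g'"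
 shows "(f oo g) ** (f' oo g') = (f ** f') oo (g ** g')"
proof (rule single_eqD)
 note d = assms(1-4)[THEN wt_dom] assms(1-4)[THEN wt_cod]
 let ?J = "sjoin (scod g) (scod g')" and ?K = "sjoin_inv (scod g) (scod g')"
 have "single ((f ** f') oo (g ** g')) = sjoin (scod f) (scod f') oo (single f *** single f') oo
   (?K oo ?J) oo (single g *** single g') oo sjoin_inv (sdom g) (sdom g')"
  using assms d by (simp add: single_stens scomp_assoc)
 also have "?K oo ?J = $[word (scod g) \<otimes> word (scod g')]"
  using sjoin_inverse[of "scod g" "scod g'"] d by (simp add: inverses_def)
 finally show "single ((f oo g) ** (f' oo g')) = single ((f ** f') oo (g ** g'))"
  using assms d by (simp add: single_stens scomp_assoc strand_scomp ntens_scomp)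
qed (use assms in auto)

lemma strand_stens:
 assumes "set Xs <= Obj C" "set Ys <= Obj C"
 shows "$Xs ** $Ys = $(Xs @ Ys)"
 by (rule single_eqD)
   (use assms sjoin_inverse[of Xs Ys] in \<open>auto simp: single_stens strand_scomp inverses_def\<close>)

lemma stens_assoc:
 assumes "wt f" "wt g" "wt h"
 shows "(f ** g) ** h = f ** g ** h"
proof (rule single_eqD)
 note d = assms(1-3)[THEN wt_dom] assms(1-3)[THEN wt_cod]
 let ?F = "single f" and ?G = "single g" and ?H = "single h"
 let ?X = "sdom f" and ?Y = "sdom g" and ?Z = "sdom h" and ?X' = "scod f" and ?Y' = "scod g" and ?Z' = "scod h"
 define J where "J Xs Ys Zs = sjoin (Xs @ Ys) Zs oo (sjoin Xs Ys *** $[word Zs])" for Xs Ys Zs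
 define J' where "J' Xs Ys Zs = sjoin Xs (Ys @ Zs) oo ($[word Xs] *** sjoin Ys Zs)" for Xs Ys Zs
 define K where "K Xs Ys Zs = (sjoin_inv Xs Ys *** $[word Zs]) oo sjoin_inv (Xs @ Ys) Zs" for Xs Ys Zs
 define K' where "K' Xs Ys Zs = ($[word Xs] *** sjoin_inv Ys Zs) oo sjoin_inv Xs (Ys @ Zs)" for Xs Ys Zs
 let ?A = "sassoc (word ?X) (word ?Y) (word ?Z)" and ?A' = "sassoc (word ?X') (word ?Y') (word ?Z')"
 have JK: "inverses (J ?X ?Y ?Z) (K ?X ?Y ?Z)"
  unfolding J_def K_def using d
  by (intro inverses_scomp inverses_ntens sjoin_inverse inverses_strand) auto
 have JK': "inverses (J' ?X ?Y ?Z) (K' ?X ?Y ?Z)"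
  unfolding J'_def K'_def using d
  by (intro inverses_scomp inverses_ntens sjoin_inverse inverses_strand) auto
 have JJ: "J Xs Ys Zs = J' Xs Ys Zs oo sassoc (word Xs) (word Ys) (word Zs)"
  if "set Xs <= Obj C" "set Ys <= Obj C" "set Zs <= Obj C" for Xs Ys Zs
  using sjoin_assoc[OF that] that by (simp add: J_def J'_def scomp_assoc)
 have dims [simp]: "sdom (J Xs Ys Zs) = [(word Xs \<otimes> word Ys) \<otimes> word Zs]" "scod (J Xs Ys Zs) = [word (Xs @ Ys @ Zs)]"
  "sdom (K Xs Ys Zs) = [word (Xs @ Ys @ Zs)]" "scod (K Xs Ys Zs) = [(word Xs \<otimes> word Ys) \<otimes> word Zs]"
  "sdom (J' Xs Ys Zs) = [word Xs \<otimes> word Ys \<otimes> word Zs]" "scod (J' Xs Ys Zs) = [word (Xs @ Ys @ Zs)]"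
  "sdom (K' Xs Ys Zs) = [word (Xs @ Ys @ Zs)]" "scod (K' Xs Ys Zs) = [word Xs \<otimes> word Ys \<otimes> word Zs]"
  for Xs Ys Zs by (simp_all add: J_def K_def J'_def K'_def)
 have wts [simp]: "wt (J Xs Ys Zs)" "wt (J' Xs Ys Zs)" "wt (K Xs Ys Zs)" "wt (K' Xs Ys Zs)"
  if "set Xs <= Obj C" "set Ys <= Obj C" "set Zs <= Obj C" for Xs Ys Zs
  using that by (simp_all add: J_def J'_def K_def K'_def)
 have AK: "?A oo K ?X ?Y ?Z = K' ?X ?Y ?Z"
 proof (rule inverses_cancel_left[OF JK'])
  show "J' ?X ?Y ?Z oo ?A oo K ?X ?Y ?Z = J' ?X ?Y ?Z oo K' ?X ?Y ?Z"
   using JK JK' JJ[of ?X ?Y ?Z] d by (simp add: inverses_def flip: scomp_assoc)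
 qed (use d in auto)
 have "single ((f ** g) ** h) = J ?X' ?Y' ?Z' oo ((?F *** ?G) *** ?H) oo K ?X ?Y ?Z"
 proof -
  have "single (f ** g) *** ?H = (sjoin ?X' ?Y' *** $[word ?Z']) oo ((?F *** ?G) *** ?H) oo
    (sjoin_inv ?X ?Y *** $[word ?Z])"
   using assms d by (simp add: single_stens strand_scomp scomp_strand flip: ntens_scomp)
  then show ?thesis using assms d by (simp add: single_stens[of "f ** g"] J_def K_def scomp_assoc)
 qed
 also have "... = J' ?X' ?Y' ?Z' oo (?A' oo ((?F *** ?G) *** ?H)) oo K ?X ?Y ?Z"
  using assms d by (simp add: JJ scomp_assoc)
 also have "?A' oo ((?F *** ?G) *** ?H) = (?F *** ?G *** ?H) oo ?A"
  using assms by (intro sassoc_natural) auto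
 also have "J' ?X' ?Y' ?Z' oo ((?F *** ?G *** ?H) oo ?A) oo K ?X ?Y ?Z =
   J' ?X' ?Y' ?Z' oo (?F *** ?G *** ?H) oo K' ?X ?Y ?Z"
  using assms d by (simp add: scomp_assoc AK)
 also have "... = single (f ** g ** h)"
 proof -
  have "?F *** single (g ** h) = ($[word ?X'] *** sjoin ?Y' ?Z') oo (?F *** ?G *** ?H) oo
    ($[word ?X] *** sjoin_inv ?Y ?Z)"
   using assms d by (simp add: single_stens strand_scomp scomp_strand flip: ntens_scomp)
  then show ?thesis using assms d by (simp add: single_stens[of f] J'_def K'_def scomp_assoc)
 qed
 finally show "single ((f ** g) ** h) = single (f ** g ** h)" .
qed auto

lemma stens_unit_left:
 assumes "wt f" shows "$[] ** f = f"
proof (rule single_eqD)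
 let ?X = "word (sdom f)" let ?Y = "word (scod f)"
 have d: "?X \<in> Obj C" "?Y \<in> Obj C" using assms wt_dom wt_cod by auto
 have "single ($[] ** f) = (slunit ?Y oo ($[\<I>] *** single f)) oo sjoin_inv [] (sdom f)"
  using assms d by (simp add: single_stens sjoin_simps scomp_assoc wt_dom)
 also have "slunit ?Y oo ($[\<I>] *** single f) = single f oo slunit ?X"
  using assms by (intro slunit_natural) auto
 also have "(single f oo slunit ?X) oo sjoin_inv [] (sdom f) = single f"
  using assms d sjoin_inverse[of "[]" "sdom f"]
  by (simp add: scomp_assoc sjoin_simps inverses_def scomp_strand wt_dom)
 finally show "single ($[] ** f) = single f" .
qed auto

lemma stens_unit_right:
 assumes "wt f" shows "f ** $[] = f"
proof (rule single_eqD)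
 let ?X = "word (sdom f)" let ?Y = "word (scod f)"
 have d: "?X \<in> Obj C" "?Y \<in> Obj C" using assms wt_dom wt_cod by auto
 have "single (f ** $[]) = (srunit ?Y oo (single f *** $[\<I>])) oo sjoin_inv (sdom f) []"
  using assms d by (simp add: single_stens sjoin_Nil scomp_assoc wt_dom wt_cod)
 also have "srunit ?Y oo (single f *** $[\<I>]) = single f oo srunit ?X"
  using assms by (intro srunit_natural) auto
 also have "(single f oo srunit ?X) oo sjoin_inv (sdom f) [] = single f"
  using assms d sjoin_inverse[of "sdom f" "[]"]
  by (simp add: scomp_assoc sjoin_Nil inverses_def scomp_strand wt_dom)
 finally show "single (f ** $[]) = single f" .
qed auto

end

subsection \<open>Layer normal form\<close>

context monoidal_category
begin

text \<open>
 The simplification rules \<open>layer_simps\<close> turn a string diagram into a composite of layers, each with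
 a single generator, in which layers further to the right are performed first. Diagrams that
 differ by interchange thus get the same normal form.
\<close>

definition layer :: "'o list => 'o list => 'a => 'o list => 'o list => ('o, 'a) strarr" where
 "layer L A f A' R = $L ** Str A f A' ** $R"

definition pad_left :: "'o list => ('o, 'a) strarr => ('o, 'a) strarr" where
 "pad_left L f = $L ** f"

definition pad_right :: "('o, 'a) strarr => 'o list => ('o, 'a) strarr" where
 "pad_right f R = f ** $R"

lemma sdom_layer [simp]: "sdom (layer L A f A' R) = L @ A @ R"
 and scod_layer [simp]: "scod (layer L A f A' R) = L @ A' @ R"
 and sdom_pad_left [simp]: "sdom (pad_left L h) = L @ sdom h"
 and scod_pad_left [simp]: "scod (pad_left L h) = L @ scod h"
 and sdom_pad_right [simp]: "sdom (pad_right h R) = sdom h @ R"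
 and scod_pad_right [simp]: "scod (pad_right h R) = scod h @ R"
 by (simp_all add: layer_def pad_left_def pad_right_def)

lemma wt_layer [simp]:
 "[|set L <= Obj C; set A <= Obj C; set A' <= Obj C; set R <= Obj C; f \<in> Hom C (word A) (word A')|]
  ==> wt (layer L A f A' R)"
 by (simp add: layer_def wt_Str)

lemma wt_pad [simp]:
 "[|wt h; set L <= Obj C|] ==> wt (pad_left L h)"
 "[|wt h; set L <= Obj C|] ==> wt (pad_right h L)"
 by (simp_all add: pad_left_def pad_right_def)

lemma pad_scomp:
 assumes "wt f" "wt g" "sdom f = scod g" "set L <= Obj C"
 shows "pad_left L (f oo g) = pad_left L f oo pad_left L g"
  and "pad_right (f oo g) L = pad_right f L oo pad_right g L"
 using assms stens_scomp[of "$L" "$L" f g] stens_scomp[of f g "$L" "$L"]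
 by (simp_all add: pad_left_def pad_right_def scomp_strand)

lemma pad_strand:
 assumes "set L <= Obj C" "set Xs <= Obj C"
 shows "pad_left L ($Xs) = $(L @ Xs)" "pad_right ($Xs) L = $(Xs @ L)"
 using assms by (simp_all add: pad_left_def pad_right_def strand_stens)

lemma pad_layer:
 assumes "set L <= Obj C" "set A <= Obj C" "set A' <= Obj C" "set R <= Obj C" "set L' <= Obj C"
  "f \<in> Hom C (word A) (word A')"
 shows "pad_left L' (layer L A f A' R) = layer (L' @ L) A f A' R"
  and "pad_right (layer L A f A' R) L' = layer L A f A' (R @ L')"
 using assms by (simp_all add: pad_left_def pad_right_def layer_def wt_Str stens_assoc
   flip: strand_stens)

lemma stens_pad:
 assumes "wt f" "wt g"
 shows "f ** g = pad_right f (scod g) oo pad_left (sdom f) g"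
 using assms stens_scomp[of f "$(sdom f)" "$(scod g)" g] wt_dom[of f] wt_cod[of g]
 by (simp add: pad_left_def pad_right_def scomp_strand strand_scomp)

lemma Str_layer:
 assumes "set A <= Obj C" "set A' <= Obj C" "f \<in> Hom C (word A) (word A')"
 shows "Str A f A' = layer [] A f A' []"
 using assms by (simp add: layer_def wt_Str stens_unit_left stens_unit_right)

lemma layer_swap:
 assumes "length L' + length B' \<le> length L" "L @ A @ R = L' @ B' @ R'"
  and "set L <= Obj C" "set A <= Obj C" "set A' <= Obj C" "set R <= Obj C" "f \<in> Hom C (word A) (word A')"
  and "set L' <= Obj C" "set B <= Obj C" "set B' <= Obj C" "set R' <= Obj C" "g \<in> Hom C (word B) (word B')"
 shows "layer L A f A' R oo layer L' B g B' R' =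
  layer L' B g B' (drop (length L' + length B') L @ A' @ R) oo
  layer (L' @ B @ drop (length L' + length B') L) A f A' R"
proof -
 define M where "M = drop (length L' + length B') L"
 have L: "L = L' @ B' @ M"
 proof -
  have "take (length L' + length B') (L @ A @ R) = L' @ B'" using assms(2) by simp
  then show ?thesis using assms(1) append_take_drop_id[of "length L' + length B'" L]
   by (simp add: M_def)
 qed
 then have R': "R' = M @ A @ R" using assms(2) by simp
 have M: "set M <= Obj C" using L assms(3) by auto
 let ?f = "Str A f A'" and ?g = "Str B g B'"
 have wt: "wt ?f" "wt ?g" using assms by (auto simp: wt_Str)
 note w = assms wt M
 have "layer L A f A' R = $L' ** $B' ** $M ** ?f ** $R"
  using w unfolding layer_def L by (simp add: stens_assoc flip: strand_stens)
 moreover have "layer L' B g B' R' = $L' ** ?g ** $M ** $A ** $R"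
  using w unfolding layer_def R' by (simp add: strand_stens)
 moreover have "layer L' B g B' (M @ A' @ R) = $L' ** ?g ** $M ** $A' ** $R"
  using w unfolding layer_def by (simp add: strand_stens)
 moreover have "layer (L' @ B @ M) A f A' R = $L' ** $B ** $M ** ?f ** $R"
  using w unfolding layer_def by (simp add: stens_assoc flip: strand_stens)
 ultimately show ?thesis
  using w unfolding M_def[symmetric] by (simp add: strand_scomp scomp_strand flip: stens_scomp)
qed

lemma layer_swap_tail:
 assumes "length L' + length B' \<le> length L" "L @ A @ R = L' @ B' @ R'"
  and "set L <= Obj C" "set A <= Obj C" "set A' <= Obj C" "set R <= Obj C" "f \<in> Hom C (word A) (word A')"
  and "set L' <= Obj C" "set B <= Obj C" "set B' <= Obj C" "set R' <= Obj C" "g \<in> Hom C (word B) (word B')"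
  and "wt h" "scod h = L' @ B @ R'"
 shows "layer L A f A' R oo layer L' B g B' R' oo h =
  layer L' B g B' (drop (length L' + length B') L @ A' @ R) oo
  layer (L' @ B @ drop (length L' + length B') L) A f A' R oo h"
proof -
 note s = layer_swap[OF assms(1-12)]
 let ?f = "layer L A f A' R" and ?g = "layer L' B g B' R'"
 let ?g' = "layer L' B g B' (drop (length L' + length B') L @ A' @ R)"
 let ?f' = "layer (L' @ B @ drop (length L' + length B') L) A f A' R"
 have L: "L = L' @ B' @ drop (length L' + length B') L"
 proof -
  have "take (length L' + length B') (L @ A @ R) = L' @ B'" using assms(2) by simp
  then show ?thesis using assms(1) append_take_drop_id[of "length L' + length B'" L]
   by simp
 qed
 then have R': "R' = drop (length L' + length B') L @ A @ R"
  using assms(2) by (metis append.assoc same_append_eq)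
 have D: "set (drop (length L' + length B') L) <= Obj C"
  using assms(3) set_drop_subset by fast
 have "?f oo ?g oo h = (?f oo ?g) oo h"
  using assms by (simp add: scomp_assoc)
 also have "... = (?g' oo ?f') oo h" unfolding s ..
 also have "... = ?g' oo ?f' oo h"
  by (rule scomp_assoc) (use assms D in \<open>auto simp: R'\<close>)
 finally show ?thesis .
qed

lemmas layer_simps = pad_scomp pad_strand pad_layer stens_pad Str_layer layer_swap layer_swap_tail
 scomp_assoc strand_scomp scomp_strand

end

section \<open>Duality\<close>

context monoidal_category
begin

lemma Str_sarr: "[|sdom f = Xs; scod f = Ys|] ==> Str Xs (sarr f) Ys = f"
 by (cases f) auto

lemma wt_StrE:
 assumes "wt f" "sdom f = Xs" "scod f = Ys"
 obtains d where "f = Str Xs d Ys" "d \<in> Hom C (word Xs) (word Ys)"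
 using assms by (cases f) (auto simp: wt_Str)

lemma sarr_hom: "[|wt f; sdom f = Xs; scod f = Ys|] ==> sarr f \<in> Hom C (word Xs) (word Ys)"
 by (auto simp: wt_def)

lemma single_stens_Cons:
 assumes "X \<in> Obj C" "X' \<in> Obj C" "set (Y # Ys) <= Obj C" "set (Y' # Ys') <= Obj C"
  "f \<in> Hom C X X'" "g \<in> Hom C (word (Y # Ys)) (word (Y' # Ys'))"
 shows "Str [X] f [X'] ** Str (Y # Ys) g (Y' # Ys') = Str (X # Y # Ys) (f \<star> g) (X' # Y' # Ys')"
proof (rule single_eqD)
 note [simp del] = word.simps(3)
 have o: "word (Y # Ys) \<in> Obj C" "word (Y' # Ys') \<in> Obj C" using assms by auto
 have *: "inverses ($[X \<otimes> word (Y # Ys)]) (sjoin_inv [X] (Y # Ys))"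
  using sjoin_inverse[of "[X]" "Y # Ys"] assms by (simp add: sjoin_simps)
 have "sjoin_inv [X] (Y # Ys) = $[X \<otimes> word (Y # Ys)]"
  by (rule inverses_unique[OF *]) (use assms o in \<open>auto intro!: inverses_strand\<close>)
 moreover have "wt (single (Str [X] f [X']) *** single (Str (Y # Ys) g (Y' # Ys')))"
  using assms by (intro wt_ntens wt_single) (auto simp: wt_Str)
 ultimately show "single (Str [X] f [X'] ** Str (Y # Ys) g (Y' # Ys')) = single (Str (X # Y # Ys) (f \<star> g) (X' # Y' # Ys'))"
  by (simp add: single_stens sjoin_simps strand_scomp scomp_strand)
    (simp add: single_def ntens_def word.simps(3))
qed auto

lemma stens_strand1:
 assumes "X \<in> Obj C" "X' \<in> Obj C" "Y \<in> Obj C" "f \<in> Hom C X X'"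
 shows "Str [X] f [X'] ** $[Y] = Str [X, Y] (f \<star> idm C Y) [X', Y]"
  and "$[Y] ** Str [X] f [X'] = Str [Y, X] (idm C Y \<star> f) [Y, X']"
 using assms by (simp_all add: strand_def single_stens_Cons)

lemma wt_pack [simp]: "set Xs <= Obj C ==> wt (pack Xs)"
 and wt_unpack [simp]: "set Xs <= Obj C ==> wt (unpack Xs)"
 and sdom_pack [simp]: "sdom (pack Xs) = Xs"
 and scod_pack [simp]: "scod (pack Xs) = [word Xs]"
 and sdom_unpack [simp]: "sdom (unpack Xs) = [word Xs]"
 and scod_unpack [simp]: "scod (unpack Xs) = Xs"
 by (simp_all add: pack_def unpack_def wt_Str)

lemma pack_layer: "set Xs <= Obj C ==> pack Xs = layer [] Xs (idm C (word Xs)) [word Xs] []"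
 and unpack_layer: "set Xs <= Obj C ==> unpack Xs = layer [] [word Xs] (idm C (word Xs)) Xs []"
 by (simp_all add: pack_def unpack_def Str_layer)

lemmas diag = layer_simps pack_layer unpack_layer

lemma inverses_pack: "set Xs <= Obj C ==> inverses (pack Xs) (unpack Xs)"
 by (auto simp: inverses_def pack_def unpack_def scomp_def strand_def wt_Str
   comp_idl[of "word Xs" "word Xs"])

lemma unpack_pack: "set Xs <= Obj C ==> unpack Xs oo pack Xs = $Xs"
 and pack_unpack: "set Xs <= Obj C ==> pack Xs oo unpack Xs = $[word Xs]"
 using inverses_pack[of Xs] by (auto simp: inverses_def)

definition dual_pair :: "'o list => 'o list => ('o, 'a) strarr => ('o, 'a) strarr => bool" where
 "dual_pair Ls Xs e c \<longleftrightarrow> set Ls <= Obj C \<and> set Xs <= Obj C \<and>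
   wt e \<and> wt c \<and> sdom e = Ls @ Xs \<and> scod e = [] \<and> sdom c = [] \<and> scod c = Xs @ Ls \<and>
   ($Xs ** e) oo (c ** $Xs) = $Xs \<and>
   (e ** $Ls) oo ($Ls ** c) = $Ls"

lemma dual_pair_cancel_left:
 assumes "dual_pair Ls Xs e c" "e oo (f ** $Xs) = e oo (g ** $Xs)"
  "wt f" "wt g" "sdom f = sdom g" "scod f = Ls" "scod g = Ls"
 shows "f = g"
proof -
 have *: "h = ((e oo (h ** $Xs)) ** $Ls) oo ($(sdom h) ** c)"
  if w: "wt h" "scod h = Ls" for h
 proof -
  obtain Ws d where h: "h = Str Ws d Ls" "d \<in> Hom C (word Ws) (word Ls)" "set Ws <= Obj C"
   using w by (cases h) (auto simp: wt_Str)
  obtain e' where e: "e = Str (Ls @ Xs) e' []" "e' \<in> Hom C (word (Ls @ Xs)) (word [])"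
   using assms(1) by (cases e) (auto simp: dual_pair_def wt_Str simp del: word.simps)
  obtain c' where c: "c = Str [] c' (Xs @ Ls)" "c' \<in> Hom C (word []) (word (Xs @ Ls))"
   using assms(1) by (cases c) (auto simp: dual_pair_def wt_Str simp del: word.simps)
  have o: "set Ls <= Obj C" "set Xs <= Obj C"
   using assms(1) by (auto simp: dual_pair_def)
  have "h = ((e ** $Ls) oo ($Ls ** c)) oo h"
   using assms(1) w by (simp add: dual_pair_def strand_scomp)
  also have "... = ((e oo (h ** $Xs)) ** $Ls) oo ($(sdom h) ** c)"
   using h(2,3) e(2) c(2) o unfolding h(1) e(1) c(1) by (simp del: word.simps add: layer_simps)
  finally show ?thesis .
 qed
 show ?thesis using *[of f] *[of g] assms by metis
qed

lemma dual_pair_cancel_right: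
 assumes "dual_pair Ls Xs e c" "e oo ($Ls ** f) = e oo ($Ls ** g)"
  "wt f" "wt g" "sdom f = sdom g" "scod f = Xs" "scod g = Xs"
 shows "f = g"
proof -
 have *: "h = ($Xs ** (e oo ($Ls ** h))) oo (c ** $(sdom h))"
  if w: "wt h" "scod h = Xs" for h
 proof -
  obtain Ws d where h: "h = Str Ws d Xs" "d \<in> Hom C (word Ws) (word Xs)" "set Ws <= Obj C"
   using w by (cases h) (auto simp: wt_Str)
  obtain e' where e: "e = Str (Ls @ Xs) e' []" "e' \<in> Hom C (word (Ls @ Xs)) (word [])"
   using assms(1) by (cases e) (auto simp: dual_pair_def wt_Str simp del: word.simps)
  obtain c' where c: "c = Str [] c' (Xs @ Ls)" "c' \<in> Hom C (word []) (word (Xs @ Ls))"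
   using assms(1) by (cases c) (auto simp: dual_pair_def wt_Str simp del: word.simps)
  have o: "set Ls <= Obj C" "set Xs <= Obj C"
   using assms(1) by (auto simp: dual_pair_def)
  have "h = (($Xs ** e) oo (c ** $Xs)) oo h"
   using assms(1) w by (simp add: dual_pair_def strand_scomp)
  also have "... = ($Xs ** (e oo ($Ls ** h))) oo (c ** $(sdom h))"
   using h(2,3) e(2) c(2) o unfolding h(1) e(1) c(1) by (simp del: word.simps add: layer_simps)
  finally show ?thesis .
 qed
 show ?thesis using *[of f] *[of g] assms by metis
qed

lemma dual_pair_nest:
 assumes "dual_pair [L1] [X1] e1 c1" "dual_pair [L2] [X2] e2 c2"
 shows "dual_pair [L2, L1] [X1, X2] (e2 oo ($[L2] ** e1 ** $[X2]))
  (($[X1] ** c2 ** $[L1]) oo c1)"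
proof -
 obtain e1' where e1 [simp]: "e1 = Str [L1, X1] e1' []" "e1' \<in> Hom C (L1 \<otimes> X1) \<I>"
  using assms(1) unfolding dual_pair_def by (auto elim!: wt_StrE)
 obtain c1' where c1 [simp]: "c1 = Str [] c1' [X1, L1]" "c1' \<in> Hom C \<I> (X1 \<otimes> L1)"
  using assms(1) unfolding dual_pair_def by (auto elim!: wt_StrE)
 obtain e2' where e2 [simp]: "e2 = Str [L2, X2] e2' []" "e2' \<in> Hom C (L2 \<otimes> X2) \<I>"
  using assms(2) unfolding dual_pair_def by (auto elim!: wt_StrE)
 obtain c2' where c2 [simp]: "c2 = Str [] c2' [X2, L2]" "c2' \<in> Hom C \<I> (X2 \<otimes> L2)"
  using assms(2) unfolding dual_pair_def by (auto elim!: wt_StrE)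
 have [simp]: "L1 \<in> Obj C" "L2 \<in> Obj C" "X1 \<in> Obj C" "X2 \<in> Obj C"
  using assms by (auto simp: dual_pair_def)
 have z: "($[X1] ** e1) oo (c1 ** $[X1]) = $[X1]"
  "(e1 ** $[L1]) oo ($[L1] ** c1) = $[L1]"
  "($[X2] ** e2) oo (c2 ** $[X2]) = $[X2]"
  "(e2 ** $[L2]) oo ($[L2] ** c2) = $[L2]"
  using assms by (simp_all add: dual_pair_def del: e1 e2 c1 c2)
 let ?e = "e2 oo ($[L2] ** e1 ** $[X2])"
 let ?c = "($[X1] ** c2 ** $[L1]) oo c1"
 have "($[X1, X2] ** ?e) oo (?c ** $[X1, X2]) =
  ($[X1] ** (($[X2] ** e2) oo (c2 ** $[X2]))) oo
  ((($[X1] ** e1) oo (c1 ** $[X1])) ** $[X2])"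
  by (simp add: layer_simps)
 moreover have "(?e ** $[L2, L1]) oo ($[L2, L1] ** ?c) =
  (((e2 ** $[L2]) oo ($[L2] ** c2)) ** $[L1]) oo
  ($[L2] ** ((e1 ** $[L1]) oo ($[L1] ** c1)))"
  by (simp add: layer_simps)
 ultimately show ?thesis
  unfolding dual_pair_def z by (auto simp: strand_stens strand_scomp wt_Str)
qed

end

context rigid_category
begin

notation stens (infixr "**" 75) and scomp (infixr "oo" 65) and strand ("$_" [1000] 1000)

declare ldual_obj [simp] rdual_obj [simp] evl_hom [simp] coevl_hom [simp] evr_hom [simp] coevr_hom [simp]

lemma lsh_obj [simp]: "X \<in> Obj C ==> lsh X \<in> Obj C"
 and rsh_obj [simp]: "X \<in> Obj C ==> rsh X \<in> Obj C"
 by (simp_all add: lsh_def rsh_def)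

lemma dual_pair_evl: "X \<in> Obj C ==> dual_pair [LD X] [X] (sevl X) (scoevl X)"
 and dual_pair_evr: "X \<in> Obj C ==> dual_pair [X] [RD X] (sevr X) (scoevr X)"
 by (auto simp: dual_pair_def wt_Str ldual_zigzag ldual_zigzag' rdual_zigzag rdual_zigzag')

definition nestl :: "'o => 'o => ('o, 'a) strarr" where
 "nestl X Y = sevl Y oo ($[LD Y] ** sevl X ** $[Y])"

definition nestr :: "'o => 'o => ('o, 'a) strarr" where
 "nestr X Y = sevr X oo ($[X] ** sevr Y ** $[RD X])"

lemma dual_pair_nestl:
 "[|X \<in> Obj C; Y \<in> Obj C|] ==> dual_pair [LD Y, LD X] [X, Y] (nestl X Y)
   (($[X] ** scoevl Y ** $[LD X]) oo scoevl X)"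
 and dual_pair_nestr:
 "[|X \<in> Obj C; Y \<in> Obj C|] ==> dual_pair [X, Y] [RD Y, RD X] (nestr X Y)
   (($[RD Y] ** scoevr X ** $[Y]) oo scoevr Y)"
 unfolding nestl_def nestr_def by (intro dual_pair_nest dual_pair_evl dual_pair_evr; simp)+

lemma lmap_Str: "Str [LD Y] (lmap X Y f) [LD X] = (sevl Y ** $[LD X]) oo
   ($[LD Y] ** Str [X] f [Y] ** $[LD X]) oo ($[LD Y] ** scoevl X)"
 unfolding lmap_def by (rule Str_sarr) auto

lemma rmap_Str: "Str [RD Y] (rmap X Y f) [RD X] = ($[RD X] ** sevr Y) oo
   ($[RD X] ** Str [X] f [Y] ** $[RD Y]) oo (scoevr X ** $[RD Y])"
 unfolding rmap_def by (rule Str_sarr) auto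

lemma lmap_hom [simp]:
 assumes "X \<in> Obj C" "Y \<in> Obj C" "f \<in> Hom C X Y"
 shows "lmap X Y f \<in> Hom C (LD Y) (LD X)" "rmap X Y f \<in> Hom C (RD Y) (RD X)"
proof -
 have "wt (Str [LD Y] (lmap X Y f) [LD X])" "wt (Str [RD Y] (rmap X Y f) [RD X])"
  using assms unfolding lmap_Str rmap_Str by (auto simp: wt_Str)
 then show "lmap X Y f \<in> Hom C (LD Y) (LD X)" "rmap X Y f \<in> Hom C (RD Y) (RD X)"
  by (simp_all add: wt_Str)
qed

lemma evl_lmap:
 assumes [simp]: "X \<in> Obj C" "Y \<in> Obj C" "f \<in> Hom C X Y"
 shows "sevl X oo (Str [LD Y] (lmap X Y f) [LD X] ** $[X]) = sevl Y oo ($[LD Y] ** Str [X] f [Y])"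
proof -
 have "sevl X oo (Str [LD Y] (lmap X Y f) [LD X] ** $[X]) =
  (sevl Y oo ($[LD Y] ** Str [X] f [Y])) oo
  ($[LD Y] ** (($[X] ** sevl X) oo (scoevl X ** $[X])))"
  unfolding lmap_Str by (simp add: diag)
 then show ?thesis unfolding ldual_zigzag[OF assms(1)] by (simp add: diag)
qed

lemma evr_rmap:
 assumes [simp]: "X \<in> Obj C" "Y \<in> Obj C" "f \<in> Hom C X Y"
 shows "sevr X oo ($[X] ** Str [RD Y] (rmap X Y f) [RD X]) = sevr Y oo (Str [X] f [Y] ** $[RD Y])"
proof -
 have "sevr X oo ($[X] ** Str [RD Y] (rmap X Y f) [RD X]) =
  (sevr Y oo (Str [X] f [Y] ** $[RD Y])) oo
  (((sevr X ** $[X]) oo ($[X] ** scoevr X)) ** $[RD Y])"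
  unfolding rmap_Str by (simp add: diag)
 then show ?thesis unfolding rdual_zigzag[OF assms(1)] by (simp add: diag)
qed

lemma evl_cancel:
 assumes "sevl X oo (f ** $[X]) = sevl X oo (g ** $[X])"
  "wt f" "wt g" "sdom f = sdom g" "scod f = [LD X]" "scod g = [LD X]" "X \<in> Obj C"
 shows "f = g"
 using dual_pair_cancel_left[OF dual_pair_evl] assms by blast

lemma evl_cancel_right:
 assumes "sevl X oo ($[LD X] ** f) = sevl X oo ($[LD X] ** g)"
  "wt f" "wt g" "sdom f = sdom g" "scod f = [X]" "scod g = [X]" "X \<in> Obj C"
 shows "f = g"
 using dual_pair_cancel_right[OF dual_pair_evl] assms by blast

lemma evr_cancel:
 assumes "sevr X oo (f ** $[RD X]) = sevr X oo (g ** $[RD X])"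
  "wt f" "wt g" "sdom f = sdom g" "scod f = [X]" "scod g = [X]" "X \<in> Obj C"
 shows "f = g"
 using dual_pair_cancel_left[OF dual_pair_evr] assms by blast

lemma evr_cancel_right:
 assumes "sevr X oo ($[X] ** f) = sevr X oo ($[X] ** g)"
  "wt f" "wt g" "sdom f = sdom g" "scod f = [RD X]" "scod g = [RD X]" "X \<in> Obj C"
 shows "f = g"
 using dual_pair_cancel_right[OF dual_pair_evr] assms by blast

lemma lmap_scomp:
 assumes [simp]: "X \<in> Obj C" "Y \<in> Obj C" "Z \<in> Obj C" "f \<in> Hom C X Y" "g \<in> Hom C Y Z"
 shows "Str [LD Y] (lmap X Y f) [LD X] oo Str [LD Z] (lmap Y Z g) [LD Y] = Str [LD Z] (lmap X Z (g \<cdot> f)) [LD X]"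
  (is "?f oo ?g = ?h")
proof (rule evl_cancel)
 have [simp]: "g \<cdot> f \<in> Hom C X Z" by (rule comp_hom[of X Y Z]) auto
 have "sevl X oo ((?f oo ?g) ** $[X]) = (sevl X oo (?f ** $[X])) oo (?g ** $[X])"
  by (simp add: diag)
 also have "... = (sevl Y oo (?g ** $[Y])) oo ($[LD Z] ** Str [X] f [Y])"
  unfolding evl_lmap[OF assms(1,2,4)] by (simp add: diag)
 also have "... = sevl Z oo ($[LD Z] ** (Str [Y] g [Z] oo Str [X] f [Y]))"
  unfolding evl_lmap[OF assms(2,3,5)] by (simp add: diag)
 also have "Str [Y] g [Z] oo Str [X] f [Y] = Str [X] (g \<cdot> f) [Z]"
  by (simp add: scomp_def)
 also have "sevl Z oo ($[LD Z] ** ...) = sevl X oo (?h ** $[X])"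
  by (simp add: evl_lmap)
 finally show "sevl X oo ((?f oo ?g) ** $[X]) = sevl X oo (?h ** $[X])" .
 show "wt ?h" by (simp add: wt_Str)
qed (auto simp: wt_Str)

lemma rmap_scomp:
 assumes [simp]: "X \<in> Obj C" "Y \<in> Obj C" "Z \<in> Obj C" "f \<in> Hom C X Y" "g \<in> Hom C Y Z"
 shows "Str [RD Y] (rmap X Y f) [RD X] oo Str [RD Z] (rmap Y Z g) [RD Y] = Str [RD Z] (rmap X Z (g \<cdot> f)) [RD X]"
  (is "?f oo ?g = ?h")
proof (rule evr_cancel_right)
 have [simp]: "g \<cdot> f \<in> Hom C X Z" by (rule comp_hom[of X Y Z]) auto
 have "sevr X oo ($[X] ** (?f oo ?g)) = (sevr X oo ($[X] ** ?f)) oo ($[X] ** ?g)"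
  by (simp add: diag)
 also have "... = (sevr Y oo ($[Y] ** ?g)) oo (Str [X] f [Y] ** $[RD Z])"
  unfolding evr_rmap[OF assms(1,2,4)] by (simp add: diag)
 also have "... = sevr Z oo ((Str [Y] g [Z] oo Str [X] f [Y]) ** $[RD Z])"
  unfolding evr_rmap[OF assms(2,3,5)] by (simp add: diag)
 also have "Str [Y] g [Z] oo Str [X] f [Y] = Str [X] (g \<cdot> f) [Z]"
  by (simp add: scomp_def)
 also have "sevr Z oo (... ** $[RD Z]) = sevr X oo ($[X] ** ?h)"
  by (simp add: evr_rmap)
 finally show "sevr X oo ($[X] ** (?f oo ?g)) = sevr X oo ($[X] ** ?h)" .
 show "wt ?h" by (simp add: wt_Str)
qed (auto simp: wt_Str)

lemma lmap_id: "X \<in> Obj C ==> Str [LD X] (lmap X X (idm C X)) [LD X] = $[LD X]"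
 by (rule evl_cancel) (auto simp: wt_Str evl_lmap strand_stens scomp_strand simp flip: strand_def[of "[_]", simplified])

lemma rmap_id: "X \<in> Obj C ==> Str [RD X] (rmap X X (idm C X)) [RD X] = $[RD X]"
 by (rule evr_cancel_right) (auto simp: wt_Str evr_rmap strand_stens scomp_strand simp flip: strand_def[of "[_]", simplified])

lemma inverses_lmap:
 assumes "inverses (Str [X] f [Y]) (Str [Y] g [X])"
 shows "inverses (Str [LD Y] (lmap X Y f) [LD X]) (Str [LD X] (lmap Y X g) [LD Y])"
  and "inverses (Str [RD Y] (rmap X Y f) [RD X]) (Str [RD X] (rmap Y X g) [RD Y])"
proof -
 have [simp]: "X \<in> Obj C" "Y \<in> Obj C" "f \<in> Hom C X Y" "g \<in> Hom C Y X" and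
  gf: "g \<cdot> f = idm C X" "f \<cdot> g = idm C Y"
  using assms by (auto simp: inverses_def wt_Str scomp_def strand_def)
 show "inverses (Str [LD Y] (lmap X Y f) [LD X]) (Str [LD X] (lmap Y X g) [LD Y])"
  "inverses (Str [RD Y] (rmap X Y f) [RD X]) (Str [RD X] (rmap Y X g) [RD Y])"
  by (simp_all add: inverses_def lmap_scomp rmap_scomp gf lmap_id rmap_id wt_Str)
qed

subsection \<open>Duals of tensor products\<close>

lemma
 assumes [simp]: "X \<in> Obj C" "Y \<in> Obj C"
 shows evl_ldual_tens: "sevl (X \<otimes> Y) oo (ldual_tens X Y ** pack [X, Y]) = nestl X Y"
  and evl_ldual_tens': "nestl X Y oo (ldual_tens' X Y ** $[X, Y]) =
   sevl (X \<otimes> Y) oo ($[LD (X \<otimes> Y)] ** pack [X, Y])"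
  and evr_rdual_tens: "sevr (X \<otimes> Y) oo (pack [X, Y] ** rdual_tens X Y) = nestr X Y"
  and evr_rdual_tens': "nestr X Y oo ($[X, Y] ** rdual_tens' X Y) =
   sevr (X \<otimes> Y) oo (pack [X, Y] ** $[RD (X \<otimes> Y)])"
proof -
 have "sevl (X \<otimes> Y) oo (ldual_tens X Y ** pack [X, Y]) = nestl X Y oo ($[LD Y, LD X] **
   (unpack [X, Y] oo (($[X \<otimes> Y] ** sevl (X \<otimes> Y)) oo (scoevl (X \<otimes> Y) ** $[X \<otimes> Y])) oo pack [X, Y]))"
  unfolding ldual_tens_def nestl_def by (simp add: diag)
 also have "... = nestl X Y"
  by (simp add: ldual_zigzag strand_scomp unpack_pack strand_stens) (simp add: nestl_def diag)
 finally show "sevl (X \<otimes> Y) oo (ldual_tens X Y ** pack [X, Y]) = nestl X Y" .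
 let ?c = "($[X] ** scoevl Y ** $[LD X]) oo scoevl X"
 have "nestl X Y oo (ldual_tens' X Y ** $[X, Y]) = sevl (X \<otimes> Y) oo ($[LD (X \<otimes> Y)] ** pack [X, Y]) oo
   ($[LD (X \<otimes> Y)] ** (($[X, Y] ** nestl X Y) oo (?c ** $[X, Y])))"
  unfolding ldual_tens'_def nestl_def by (simp add: diag)
 also have "... = sevl (X \<otimes> Y) oo ($[LD (X \<otimes> Y)] ** pack [X, Y])"
  using dual_pair_nestl[of X Y] by (simp add: dual_pair_def) (simp add: diag)
 finally show "nestl X Y oo (ldual_tens' X Y ** $[X, Y]) =
   sevl (X \<otimes> Y) oo ($[LD (X \<otimes> Y)] ** pack [X, Y])" .
 have "sevr (X \<otimes> Y) oo (pack [X, Y] ** rdual_tens X Y) = nestr X Y oo ((unpack [X, Y] oo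
   ((sevr (X \<otimes> Y) ** $[X \<otimes> Y]) oo ($[X \<otimes> Y] ** scoevr (X \<otimes> Y))) oo pack [X, Y]) ** $[RD Y, RD X])"
  unfolding rdual_tens_def nestr_def by (simp add: diag)
 also have "... = nestr X Y"
  by (simp add: rdual_zigzag strand_scomp unpack_pack strand_stens) (simp add: nestr_def diag)
 finally show "sevr (X \<otimes> Y) oo (pack [X, Y] ** rdual_tens X Y) = nestr X Y" .
 let ?d = "($[RD Y] ** scoevr X ** $[Y]) oo scoevr Y"
 have "nestr X Y oo ($[X, Y] ** rdual_tens' X Y) = sevr (X \<otimes> Y) oo (pack [X, Y] ** $[RD (X \<otimes> Y)]) oo
   (((nestr X Y ** $[X, Y]) oo ($[X, Y] ** ?d)) ** $[RD (X \<otimes> Y)])"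
  unfolding rdual_tens'_def nestr_def by (simp add: diag)
 also have "... = sevr (X \<otimes> Y) oo (pack [X, Y] ** $[RD (X \<otimes> Y)])"
  using dual_pair_nestr[of X Y] by (simp add: dual_pair_def) (simp add: diag)
 finally show "nestr X Y oo ($[X, Y] ** rdual_tens' X Y) =
   sevr (X \<otimes> Y) oo (pack [X, Y] ** $[RD (X \<otimes> Y)])" .
qed

lemma Str_pack: "f \<in> Hom C (word Xs) (word Ys) ==> set Xs <= Obj C ==> set Ys <= Obj C ==>
  Str [word Xs] f Ys oo pack Xs = Str Xs f Ys"
 by (simp add: pack_def scomp_def comp_idr[of "word Xs" "word Ys"])

lemma pack_Str: "f \<in> Hom C (word Xs) (word Ys) ==> set Xs <= Obj C ==> set Ys <= Obj C ==>
  pack Ys oo Str Xs f Ys = Str Xs f [word Ys]"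
 by (simp add: pack_def scomp_def comp_idl[of "word Xs" "word Ys"])

definition "ldual_tens_arr X Y = sarr (ldual_tens X Y)"
definition "ldual_tens_arr' X Y = sarr (ldual_tens' X Y)"
definition "rdual_tens_arr X Y = sarr (rdual_tens X Y)"
definition "rdual_tens_arr' X Y = sarr (rdual_tens' X Y)"
definition "rd_ld_arr X = sarr (rd_ld X)"
definition "rd_ld_arr' X = sarr (rd_ld' X)"

lemma dual_tens_Str:
 "ldual_tens X Y = Str [LD Y, LD X] (ldual_tens_arr X Y) [LD (X \<otimes> Y)]"
 "ldual_tens' X Y = Str [LD (X \<otimes> Y)] (ldual_tens_arr' X Y) [LD Y, LD X]"
 "rdual_tens X Y = Str [RD Y, RD X] (rdual_tens_arr X Y) [RD (X \<otimes> Y)]"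
 "rdual_tens' X Y = Str [RD (X \<otimes> Y)] (rdual_tens_arr' X Y) [RD Y, RD X]"
 "rd_ld X = Str [RD (LD X)] (rd_ld_arr X) [X]"
 "rd_ld' X = Str [X] (rd_ld_arr' X) [RD (LD X)]"
 unfolding ldual_tens_arr_def ldual_tens_arr'_def rdual_tens_arr_def rdual_tens_arr'_def
  rd_ld_arr_def rd_ld_arr'_def
 by (rule Str_sarr[symmetric]; simp add: ldual_tens_def ldual_tens'_def rdual_tens_def
   rdual_tens'_def rd_ld_def rd_ld'_def)+

lemma dual_tens_hom [simp]:
 assumes [simp]: "X \<in> Obj C" "Y \<in> Obj C"
 shows "ldual_tens_arr X Y \<in> Hom C (LD Y \<otimes> LD X) (LD (X \<otimes> Y))"
  "ldual_tens_arr' X Y \<in> Hom C (LD (X \<otimes> Y)) (LD Y \<otimes> LD X)"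
  "rdual_tens_arr X Y \<in> Hom C (RD Y \<otimes> RD X) (RD (X \<otimes> Y))"
  "rdual_tens_arr' X Y \<in> Hom C (RD (X \<otimes> Y)) (RD Y \<otimes> RD X)"
proof -
 have "wt (ldual_tens X Y)" "wt (ldual_tens' X Y)" "wt (rdual_tens X Y)" "wt (rdual_tens' X Y)"
  unfolding ldual_tens_def ldual_tens'_def rdual_tens_def rdual_tens'_def
  by (simp_all add: wt_Str)
 then show "ldual_tens_arr X Y \<in> Hom C (LD Y \<otimes> LD X) (LD (X \<otimes> Y))"
  "ldual_tens_arr' X Y \<in> Hom C (LD (X \<otimes> Y)) (LD Y \<otimes> LD X)"
  "rdual_tens_arr X Y \<in> Hom C (RD Y \<otimes> RD X) (RD (X \<otimes> Y))"
  "rdual_tens_arr' X Y \<in> Hom C (RD (X \<otimes> Y)) (RD Y \<otimes> RD X)"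
  unfolding dual_tens_Str by (simp_all add: wt_Str)
qed

lemma rd_ld_hom [simp]:
 assumes [simp]: "X \<in> Obj C"
 shows "rd_ld_arr X \<in> Hom C (RD (LD X)) X" "rd_ld_arr' X \<in> Hom C X (RD (LD X))"
proof -
 have "wt (rd_ld X)" "wt (rd_ld' X)"
  unfolding rd_ld_def rd_ld'_def by (simp_all add: wt_Str)
 then show "rd_ld_arr X \<in> Hom C (RD (LD X)) X" "rd_ld_arr' X \<in> Hom C X (RD (LD X))"
  unfolding dual_tens_Str by (simp_all add: wt_Str)
qed

lemma sdom_lsh_tens [simp]: "sdom (lsh_tens X Y) = [lsh (X \<otimes> Y)]"
 and scod_lsh_tens [simp]: "scod (lsh_tens X Y) = [lsh X, lsh Y]"
 and sdom_rsh_tens [simp]: "sdom (rsh_tens X Y) = [rsh (X \<otimes> Y)]"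
 and scod_rsh_tens [simp]: "scod (rsh_tens X Y) = [rsh X, rsh Y]"
 by (simp_all add: lsh_tens_def rsh_tens_def dual_tens_Str lsh_def rsh_def)

lemma lmap_hom' [simp]:
 assumes "X \<in> Obj C" "Y \<in> Obj C" "f \<in> Hom C X Y"
 shows "lmap X Y f \<in> Hom C (LD Y) (LD X)" "rmap X Y f \<in> Hom C (RD Y) (RD X)"
  "lshmap X Y f \<in> Hom C (lsh X) (lsh Y)" "rshmap X Y f \<in> Hom C (rsh X) (rsh Y)"
 using assms by (simp_all add: lshmap_def rshmap_def lsh_def rsh_def)

lemma wt_lsh_tens [simp]: "[|X \<in> Obj C; Y \<in> Obj C|] ==> wt (lsh_tens X Y)"
 and wt_rsh_tens [simp]: "[|X \<in> Obj C; Y \<in> Obj C|] ==> wt (rsh_tens X Y)"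
 unfolding lsh_tens_def rsh_tens_def
 by (simp_all add: dual_tens_Str wt_Str lsh_def rsh_def flip: ldual_tens_arr_def rdual_tens_arr_def)

definition "lsh_tens_arr X Y = sarr (lsh_tens X Y)"
definition "rsh_tens_arr X Y = sarr (rsh_tens X Y)"

lemma sh_tens_Str:
 "lsh_tens X Y = Str [lsh (X \<otimes> Y)] (lsh_tens_arr X Y) [lsh X, lsh Y]"
 "rsh_tens X Y = Str [rsh (X \<otimes> Y)] (rsh_tens_arr X Y) [rsh X, rsh Y]"
 unfolding lsh_tens_arr_def rsh_tens_arr_def by (simp_all add: Str_sarr)

lemma sh_tens_hom [simp]:
 assumes "X \<in> Obj C" "Y \<in> Obj C"
 shows "lsh_tens_arr X Y \<in> Hom C (lsh (X \<otimes> Y)) (lsh X \<otimes> lsh Y)"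
  "rsh_tens_arr X Y \<in> Hom C (rsh (X \<otimes> Y)) (rsh X \<otimes> rsh Y)"
 using wt_lsh_tens[OF assms] wt_rsh_tens[OF assms] by (simp_all add: sh_tens_Str wt_Str)

lemma evl_lsh_tens:
 assumes [simp]: "X \<in> Obj C" "Y \<in> Obj C"
 shows "nestl (LD Y) (LD X) oo (lsh_tens X Y ** $[LD Y, LD X]) =
  sevl (LD (X \<otimes> Y)) oo ($[lsh (X \<otimes> Y)] ** ldual_tens X Y)"
proof -
 let ?m = "Str [lsh (X \<otimes> Y)] (lmap (LD Y \<otimes> LD X) (LD (X \<otimes> Y)) (ldual_tens_arr X Y)) [LD (LD Y \<otimes> LD X)]"
 have "nestl (LD Y) (LD X) oo (lsh_tens X Y ** $[LD Y, LD X]) =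
  (nestl (LD Y) (LD X) oo (ldual_tens' (LD Y) (LD X) ** $[LD Y, LD X])) oo (?m ** $[LD Y, LD X])"
  unfolding lsh_tens_def nestl_def ldual_tens_arr_def[symmetric] unfolding dual_tens_Str
  by (simp add: diag lsh_def)
 also have "... = (sevl (LD Y \<otimes> LD X) oo (?m ** $[LD Y \<otimes> LD X])) oo ($[lsh (X \<otimes> Y)] ** pack [LD Y, LD X])"
  unfolding evl_ldual_tens'[OF ldual_obj[OF assms(2)] ldual_obj[OF assms(1)]]
  by (simp add: diag lsh_def)
 also have "... = sevl (LD (X \<otimes> Y)) oo ($[lsh (X \<otimes> Y)] **
   (Str [LD Y \<otimes> LD X] (ldual_tens_arr X Y) [LD (X \<otimes> Y)] oo pack [LD Y, LD X]))"
  unfolding lsh_def by (subst evl_lmap) (simp_all add: diag)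
 finally show ?thesis using Str_pack[of "ldual_tens_arr X Y" "[LD Y, LD X]" "[LD (X \<otimes> Y)]"]
  by (simp add: dual_tens_Str)
qed

lemma evr_rsh_tens:
 assumes [simp]: "X \<in> Obj C" "Y \<in> Obj C"
 shows "nestr (RD Y) (RD X) oo ($[RD Y, RD X] ** rsh_tens X Y) =
  sevr (RD (X \<otimes> Y)) oo (rdual_tens X Y ** $[rsh (X \<otimes> Y)])"
proof -
 let ?m = "Str [rsh (X \<otimes> Y)] (rmap (RD Y \<otimes> RD X) (RD (X \<otimes> Y)) (rdual_tens_arr X Y)) [RD (RD Y \<otimes> RD X)]"
 have "nestr (RD Y) (RD X) oo ($[RD Y, RD X] ** rsh_tens X Y) =
  (nestr (RD Y) (RD X) oo ($[RD Y, RD X] ** rdual_tens' (RD Y) (RD X))) oo ($[RD Y, RD X] ** ?m)"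
  unfolding rsh_tens_def nestr_def rdual_tens_arr_def[symmetric] unfolding dual_tens_Str
  by (simp add: diag rsh_def)
 also have "... = (sevr (RD Y \<otimes> RD X) oo ($[RD Y \<otimes> RD X] ** ?m)) oo (pack [RD Y, RD X] ** $[rsh (X \<otimes> Y)])"
  unfolding evr_rdual_tens'[OF rdual_obj[OF assms(2)] rdual_obj[OF assms(1)]]
  by (simp add: diag rsh_def)
 also have "... = sevr (RD (X \<otimes> Y)) oo (
   (Str [RD Y \<otimes> RD X] (rdual_tens_arr X Y) [RD (X \<otimes> Y)] oo pack [RD Y, RD X]) ** $[rsh (X \<otimes> Y)])"
  unfolding rsh_def by (subst evr_rmap) (simp_all add: diag)
 finally show ?thesis using Str_pack[of "rdual_tens_arr X Y" "[RD Y, RD X]" "[RD (X \<otimes> Y)]"]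
  by (simp add: dual_tens_Str)
qed

subsection \<open>The double duals are inverse to each other\<close>

definition ld_rd :: "'o => ('o, 'a) strarr" where
 "ld_rd X = (sevl (RD X) ** $[X]) oo ($[LD (RD X)] ** scoevr X)"

definition ld_rd' :: "'o => ('o, 'a) strarr" where
 "ld_rd' X = (sevr X ** $[LD (RD X)]) oo ($[X] ** scoevl (RD X))"

definition "ld_rd_arr X = sarr (ld_rd X)"
definition "ld_rd_arr' X = sarr (ld_rd' X)"

lemma ld_rd_Str:
 "ld_rd X = Str [LD (RD X)] (ld_rd_arr X) [X]"
 "ld_rd' X = Str [X] (ld_rd_arr' X) [LD (RD X)]"
 unfolding ld_rd_arr_def ld_rd_arr'_def
 by (rule Str_sarr[symmetric]; simp add: ld_rd_def ld_rd'_def)+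

lemma ld_rd_hom [simp]:
 assumes [simp]: "X \<in> Obj C"
 shows "ld_rd_arr X \<in> Hom C (LD (RD X)) X" "ld_rd_arr' X \<in> Hom C X (LD (RD X))"
proof -
 have "wt (ld_rd X)" "wt (ld_rd' X)" by (simp_all add: ld_rd_def ld_rd'_def wt_Str)
 then show "ld_rd_arr X \<in> Hom C (LD (RD X)) X" "ld_rd_arr' X \<in> Hom C X (LD (RD X))"
  by (simp_all add: ld_rd_Str wt_Str)
qed

lemma
 assumes [simp]: "X \<in> Obj C"
 shows evl_rd_ld: "sevl X oo ($[LD X] ** rd_ld X) = sevr (LD X)"
  and evr_rd_ld': "sevr (LD X) oo ($[LD X] ** rd_ld' X) = sevl X"
  and evr_ld_rd: "sevr X oo (ld_rd X ** $[RD X]) = sevl (RD X)"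
  and evl_ld_rd': "sevl (RD X) oo (ld_rd' X ** $[RD X]) = sevr X"
proof -
 have "sevl X oo ($[LD X] ** rd_ld X) =
   sevr (LD X) oo (((sevl X ** $[LD X]) oo ($[LD X] ** scoevl X)) ** $[RD (LD X)])"
  unfolding rd_ld_def by (simp add: diag)
 then show "sevl X oo ($[LD X] ** rd_ld X) = sevr (LD X)"
  unfolding ldual_zigzag'[OF assms] dual_tens_Str by (simp add: diag)
 have "sevr (LD X) oo ($[LD X] ** rd_ld' X) =
   sevl X oo (((sevr (LD X) ** $[LD X]) oo ($[LD X] ** scoevr (LD X))) ** $[X])"
  unfolding rd_ld'_def by (simp add: diag)
 then show "sevr (LD X) oo ($[LD X] ** rd_ld' X) = sevl X"
  unfolding rdual_zigzag[OF ldual_obj[OF assms]] dual_tens_Str by (simp add: diag)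
 have "sevr X oo (ld_rd X ** $[RD X]) =
   sevl (RD X) oo ($[LD (RD X)] ** (($[RD X] ** sevr X) oo (scoevr X ** $[RD X])))"
  unfolding ld_rd_def by (simp add: diag)
 then show "sevr X oo (ld_rd X ** $[RD X]) = sevl (RD X)"
  unfolding rdual_zigzag'[OF assms] ld_rd_Str by (simp add: diag)
 have "sevl (RD X) oo (ld_rd' X ** $[RD X]) =
   sevr X oo ($[X] ** (($[RD X] ** sevl (RD X)) oo (scoevl (RD X) ** $[RD X])))"
  unfolding ld_rd'_def by (simp add: diag)
 then show "sevl (RD X) oo (ld_rd' X ** $[RD X]) = sevr X"
  unfolding ldual_zigzag[OF rdual_obj[OF assms]] ld_rd_Str by (simp add: diag)
qed

lemma inverses_rd_ld:
 assumes [simp]: "X \<in> Obj C"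
 shows "inverses (rd_ld X) (rd_ld' X)"
proof -
 have "rd_ld X oo rd_ld' X = $[X]"
 proof (rule evl_cancel_right)
  have "sevl X oo ($[LD X] ** (rd_ld X oo rd_ld' X)) =
    (sevl X oo ($[LD X] ** rd_ld X)) oo ($[LD X] ** rd_ld' X)"
   by (simp add: dual_tens_Str diag)
  then show "sevl X oo ($[LD X] ** (rd_ld X oo rd_ld' X)) = sevl X oo ($[LD X] ** $[X])"
   by (simp add: evl_rd_ld evr_rd_ld') (simp add: diag)
 qed (auto simp: dual_tens_Str wt_Str)
 moreover have "rd_ld' X oo rd_ld X = $[RD (LD X)]"
 proof (rule evr_cancel_right)
  have "sevr (LD X) oo ($[LD X] ** (rd_ld' X oo rd_ld X)) =
    (sevr (LD X) oo ($[LD X] ** rd_ld' X)) oo ($[LD X] ** rd_ld X)"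
   by (simp add: dual_tens_Str diag)
  then show "sevr (LD X) oo ($[LD X] ** (rd_ld' X oo rd_ld X)) = sevr (LD X) oo ($[LD X] ** $[RD (LD X)])"
   by (simp add: evl_rd_ld evr_rd_ld') (simp add: diag)
 qed (auto simp: dual_tens_Str wt_Str)
 ultimately show ?thesis by (simp add: inverses_def dual_tens_Str wt_Str)
qed

lemma inverses_ld_rd:
 assumes [simp]: "X \<in> Obj C"
 shows "inverses (ld_rd X) (ld_rd' X)"
proof -
 have "ld_rd X oo ld_rd' X = $[X]"
 proof (rule evr_cancel)
  have "sevr X oo ((ld_rd X oo ld_rd' X) ** $[RD X]) =
    (sevr X oo (ld_rd X ** $[RD X])) oo (ld_rd' X ** $[RD X])"
   by (simp add: ld_rd_Str diag)
  then show "sevr X oo ((ld_rd X oo ld_rd' X) ** $[RD X]) = sevr X oo ($[X] ** $[RD X])"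
   by (simp add: evr_ld_rd evl_ld_rd') (simp add: diag)
 qed (auto simp: ld_rd_Str wt_Str)
 moreover have "ld_rd' X oo ld_rd X = $[LD (RD X)]"
 proof (rule evl_cancel)
  have "sevl (RD X) oo ((ld_rd' X oo ld_rd X) ** $[RD X]) =
    (sevl (RD X) oo (ld_rd' X ** $[RD X])) oo (ld_rd X ** $[RD X])"
   by (simp add: ld_rd_Str diag)
  then show "sevl (RD X) oo ((ld_rd' X oo ld_rd X) ** $[RD X]) = sevl (RD X) oo ($[LD (RD X)] ** $[RD X])"
   by (simp add: evr_ld_rd evl_ld_rd') (simp add: diag)
 qed (auto simp: ld_rd_Str wt_Str)
 ultimately show ?thesis by (simp add: inverses_def ld_rd_Str wt_Str)
qed

definition lsh_rsh :: "'o => ('o, 'a) strarr" where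
 "lsh_rsh X = ld_rd X oo Str [lsh (rsh X)] (lmap (RD X) (LD (rsh X)) (ld_rd_arr' (RD X))) [LD (RD X)]"

definition "rsh_lsh_arr X = sarr (rsh_lsh X)"
definition "lsh_rsh_arr X = sarr (lsh_rsh X)"

lemma inverses_sh:
 assumes [simp]: "X \<in> Obj C"
 shows "\<exists>g. inverses (rsh_lsh X) g" "\<exists>g. inverses (lsh_rsh X) g"
proof -
 have "inverses (Str [RD (LD (LD X))] (rd_ld_arr (LD X)) [LD X]) (Str [LD X] (rd_ld_arr' (LD X)) [RD (LD (LD X))])"
  using inverses_rd_ld[of "LD X"] by (simp add: dual_tens_Str)
 from inverses_lmap(2)[OF inverses_sym[OF this]]
 show "\<exists>g. inverses (rsh_lsh X) g"
  unfolding rsh_lsh_def rd_ld_arr'_def[symmetric] rsh_def lsh_def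
  using inverses_rd_ld[of X] by (metis assms inverses_scomp scod_scomp strarr.sel dual_tens_Str(5))
 have "inverses (Str [LD (RD (RD X))] (ld_rd_arr (RD X)) [RD X]) (Str [RD X] (ld_rd_arr' (RD X)) [LD (RD (RD X))])"
  using inverses_ld_rd[of "RD X"] by (simp add: ld_rd_Str)
 from inverses_lmap(1)[OF inverses_sym[OF this]]
 show "\<exists>g. inverses (lsh_rsh X) g"
  unfolding lsh_rsh_def rsh_def lsh_def
  using inverses_ld_rd[of X] by (metis assms inverses_scomp scod_scomp strarr.sel ld_rd_Str(1))
qed

lemma sh_Str:
 "rsh_lsh X = Str [rsh (lsh X)] (rsh_lsh_arr X) [X]"
 "lsh_rsh X = Str [lsh (rsh X)] (lsh_rsh_arr X) [X]"
 unfolding rsh_lsh_arr_def lsh_rsh_arr_def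
 by (rule Str_sarr[symmetric]; simp add: rsh_lsh_def lsh_rsh_def dual_tens_Str ld_rd_Str)+

lemma sh_hom [simp]:
 assumes "X \<in> Obj C"
 shows "rsh_lsh_arr X \<in> Hom C (rsh (lsh X)) X" "lsh_rsh_arr X \<in> Hom C (lsh (rsh X)) X"
 using inverses_sh[OF assms] by (auto simp: inverses_def sh_Str wt_Str)

lemma
 assumes [simp]: "X \<in> Obj C"
 shows evl_rsh_lsh: "sevl X oo ($[LD X] ** rsh_lsh X) =
   sevr (RD (lsh X)) oo (rd_ld' (LD X) ** $[rsh (lsh X)])"
  and evr_lsh_rsh: "sevr X oo (lsh_rsh X ** $[RD X]) =
   sevl (LD (rsh X)) oo ($[lsh (rsh X)] ** ld_rd' (RD X))"
proof -
 let ?r = "Str [rsh (lsh X)] (rmap (LD X) (RD (lsh X)) (rd_ld_arr' (LD X))) [RD (LD X)]"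
 have "sevl X oo ($[LD X] ** rsh_lsh X) = (sevl X oo ($[LD X] ** rd_ld X)) oo ($[LD X] ** ?r)"
  unfolding rsh_lsh_def rd_ld_arr'_def[symmetric] unfolding dual_tens_Str
  by (simp add: lsh_def rsh_def diag)
 also have "... = sevr (LD X) oo ($[LD X] ** ?r)" by (simp add: evl_rd_ld)
 finally show "sevl X oo ($[LD X] ** rsh_lsh X) =
   sevr (RD (lsh X)) oo (rd_ld' (LD X) ** $[rsh (lsh X)])"
  unfolding rsh_def by (simp add: evr_rmap dual_tens_Str lsh_def)
 let ?l = "Str [lsh (rsh X)] (lmap (RD X) (LD (rsh X)) (ld_rd_arr' (RD X))) [LD (RD X)]"
 have "sevr X oo (lsh_rsh X ** $[RD X]) = (sevr X oo (ld_rd X ** $[RD X])) oo (?l ** $[RD X])"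
  unfolding lsh_rsh_def ld_rd_Str by (simp add: lsh_def rsh_def diag)
 also have "... = sevl (RD X) oo (?l ** $[RD X])" by (simp add: evr_ld_rd)
 finally show "sevr X oo (lsh_rsh X ** $[RD X]) =
   sevl (LD (rsh X)) oo ($[lsh (rsh X)] ** ld_rd' (RD X))"
  unfolding lsh_def by (simp add: evl_lmap ld_rd_Str rsh_def)
qed

lemma rd_ld'_natural:
 assumes [simp]: "X \<in> Obj C" "Y \<in> Obj C" "f \<in> Hom C X Y"
 shows "rd_ld' Y oo Str [X] f [Y] =
  Str [RD (LD X)] (rmap (LD Y) (LD X) (lmap X Y f)) [RD (LD Y)] oo rd_ld' X" (is "?l = ?m oo _")
proof (rule evr_cancel_right)
 have "sevr (LD Y) oo ($[LD Y] ** ?l) = (sevr (LD Y) oo ($[LD Y] ** rd_ld' Y)) oo ($[LD Y] ** Str [X] f [Y])"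
  by (simp add: dual_tens_Str diag)
 also have "... = sevl X oo (Str [LD Y] (lmap X Y f) [LD X] ** $[X])"
  by (simp add: evr_rd_ld' evl_lmap)
 also have "... = (sevr (LD X) oo ($[LD X] ** rd_ld' X)) oo (Str [LD Y] (lmap X Y f) [LD X] ** $[X])"
  by (simp add: evr_rd_ld')
 also have "... = (sevr (LD X) oo (Str [LD Y] (lmap X Y f) [LD X] ** $[RD (LD X)])) oo ($[LD Y] ** rd_ld' X)"
  by (simp add: dual_tens_Str diag)
 also have "... = sevr (LD Y) oo ($[LD Y] ** (?m oo rd_ld' X))"
  by (subst evr_rmap[symmetric]) (simp_all add: dual_tens_Str diag)
 finally show "sevr (LD Y) oo ($[LD Y] ** ?l) = sevr (LD Y) oo ($[LD Y] ** (?m oo rd_ld' X))" .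
qed (auto simp: dual_tens_Str wt_Str)

lemma ld_rd'_natural:
 assumes [simp]: "X \<in> Obj C" "Y \<in> Obj C" "f \<in> Hom C X Y"
 shows "ld_rd' Y oo Str [X] f [Y] =
  Str [LD (RD X)] (lmap (RD Y) (RD X) (rmap X Y f)) [LD (RD Y)] oo ld_rd' X" (is "?l = ?m oo _")
proof (rule evl_cancel)
 have "sevl (RD Y) oo (?l ** $[RD Y]) = (sevl (RD Y) oo (ld_rd' Y ** $[RD Y])) oo (Str [X] f [Y] ** $[RD Y])"
  by (simp add: ld_rd_Str diag)
 also have "... = sevr X oo ($[X] ** Str [RD Y] (rmap X Y f) [RD X])"
  by (simp add: evl_ld_rd' evr_rmap)
 also have "... = (sevl (RD X) oo (ld_rd' X ** $[RD X])) oo ($[X] ** Str [RD Y] (rmap X Y f) [RD X])"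
  by (simp add: evl_ld_rd')
 also have "... = (sevl (RD X) oo ($[LD (RD X)] ** Str [RD Y] (rmap X Y f) [RD X])) oo (ld_rd' X ** $[RD Y])"
  by (simp add: ld_rd_Str diag)
 also have "... = sevl (RD Y) oo ((?m oo ld_rd' X) ** $[RD Y])"
  by (subst evl_lmap[symmetric]) (simp_all add: ld_rd_Str diag)
 finally show "sevl (RD Y) oo (?l ** $[RD Y]) = sevl (RD Y) oo ((?m oo ld_rd' X) ** $[RD Y])" .
qed (auto simp: ld_rd_Str wt_Str)

lemmas sh_hom_unfolded [simp] = sh_tens_hom[unfolded lsh_def rsh_def] sh_hom[unfolded lsh_def rsh_def]
 lmap_hom'[unfolded lsh_def rsh_def]

lemma rsh_lsh_natural:
 assumes [simp]: "X \<in> Obj C" "Y \<in> Obj C" "f \<in> Hom C X Y"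
 shows "Str [X] f [Y] oo rsh_lsh X =
  rsh_lsh Y oo Str [rsh (lsh X)] (rshmap (lsh X) (lsh Y) (lshmap X Y f)) [rsh (lsh Y)]" (is "?l = _ oo ?m")
proof (rule evl_cancel_right)
 let ?h = "Str [RD (lsh Y)] (rmap (lsh X) (lsh Y) (lshmap X Y f)) [RD (lsh X)]"
 have "sevl Y oo ($[LD Y] ** ?l) = (sevl Y oo ($[LD Y] ** Str [X] f [Y])) oo ($[LD Y] ** rsh_lsh X)"
  by (simp add: sh_Str diag)
 also have "... = (sevl X oo (Str [LD Y] (lmap X Y f) [LD X] ** $[X])) oo ($[LD Y] ** rsh_lsh X)"
  by (simp add: evl_lmap)
 also have "... = (sevl X oo ($[LD X] ** rsh_lsh X)) oo (Str [LD Y] (lmap X Y f) [LD X] ** $[rsh (lsh X)])"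
  by (simp add: sh_Str diag)
 also have "... = sevr (RD (lsh X)) oo ((rd_ld' (LD X) oo Str [LD Y] (lmap X Y f) [LD X]) ** $[rsh (lsh X)])"
  by (simp add: evl_rsh_lsh) (simp add: dual_tens_Str diag lsh_def rsh_def)
 also have "... = (sevr (RD (lsh X)) oo (?h ** $[rsh (lsh X)])) oo (rd_ld' (LD Y) ** $[rsh (lsh X)])"
  by (simp add: rd_ld'_natural) (simp add: dual_tens_Str diag lsh_def rsh_def lshmap_def)
 also have "sevr (RD (lsh X)) oo (?h ** $[rsh (lsh X)]) = sevr (RD (lsh Y)) oo ($[RD (lsh Y)] ** ?m)"
  unfolding rsh_def rshmap_def by (simp add: evr_rmap)
 also have "... oo (rd_ld' (LD Y) ** $[rsh (lsh X)]) =
   (sevr (RD (lsh Y)) oo (rd_ld' (LD Y) ** $[rsh (lsh Y)])) oo ($[LD Y] ** ?m)"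
  by (simp add: dual_tens_Str diag lsh_def rsh_def lshmap_def rshmap_def)
 also have "... = sevl Y oo ($[LD Y] ** (rsh_lsh Y oo ?m))"
  by (simp flip: evl_rsh_lsh) (simp add: sh_Str diag)
 finally show "sevl Y oo ($[LD Y] ** ?l) = sevl Y oo ($[LD Y] ** (rsh_lsh Y oo ?m))" .
qed (auto simp: sh_Str wt_Str)

lemma lsh_rsh_natural:
 assumes [simp]: "X \<in> Obj C" "Y \<in> Obj C" "f \<in> Hom C X Y"
 shows "Str [X] f [Y] oo lsh_rsh X =
  lsh_rsh Y oo Str [lsh (rsh X)] (lshmap (rsh X) (rsh Y) (rshmap X Y f)) [lsh (rsh Y)]" (is "?l = _ oo ?m")
proof (rule evr_cancel)
 let ?h = "Str [LD (rsh Y)] (lmap (rsh X) (rsh Y) (rshmap X Y f)) [LD (rsh X)]"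
 have "sevr Y oo (?l ** $[RD Y]) = (sevr Y oo (Str [X] f [Y] ** $[RD Y])) oo (lsh_rsh X ** $[RD Y])"
  by (simp add: sh_Str diag)
 also have "... = (sevr X oo ($[X] ** Str [RD Y] (rmap X Y f) [RD X])) oo (lsh_rsh X ** $[RD Y])"
  by (simp add: evr_rmap)
 also have "... = (sevr X oo (lsh_rsh X ** $[RD X])) oo ($[lsh (rsh X)] ** Str [RD Y] (rmap X Y f) [RD X])"
  by (simp add: sh_Str diag)
 also have "... = sevl (LD (rsh X)) oo ($[lsh (rsh X)] ** (ld_rd' (RD X) oo Str [RD Y] (rmap X Y f) [RD X]))"
  by (simp add: evr_lsh_rsh) (simp add: ld_rd_Str diag lsh_def rsh_def)
 also have "... = (sevl (LD (rsh X)) oo ($[lsh (rsh X)] ** ?h)) oo ($[lsh (rsh X)] ** ld_rd' (RD Y))"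
  by (simp add: ld_rd'_natural) (simp add: ld_rd_Str diag lsh_def rsh_def rshmap_def)
 also have "sevl (LD (rsh X)) oo ($[lsh (rsh X)] ** ?h) = sevl (LD (rsh Y)) oo (?m ** $[LD (rsh Y)])"
  unfolding lsh_def lshmap_def by (simp add: evl_lmap)
 also have "... oo ($[lsh (rsh X)] ** ld_rd' (RD Y)) =
   (sevl (LD (rsh Y)) oo ($[lsh (rsh Y)] ** ld_rd' (RD Y))) oo (?m ** $[RD Y])"
  by (simp add: ld_rd_Str diag lsh_def rsh_def lshmap_def rshmap_def)
 also have "... = sevr Y oo ((lsh_rsh Y oo ?m) ** $[RD Y])"
  by (simp flip: evr_lsh_rsh) (simp add: sh_Str diag)
 finally show "sevr Y oo (?l ** $[RD Y]) = sevr Y oo ((lsh_rsh Y oo ?m) ** $[RD Y])" .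
qed (auto simp: sh_Str wt_Str)

lemma rsh_lsh_tens:
 assumes [simp]: "X \<in> Obj C" "Y \<in> Obj C"
 shows "(rsh_lsh X ** rsh_lsh Y) oo rsh_tens (lsh X) (lsh Y) oo
   Str [rsh (lsh (X \<otimes> Y))] (rshmap (lsh (X \<otimes> Y)) (lsh X \<otimes> lsh Y) (lsh_tens_arr X Y)) [rsh (lsh X \<otimes> lsh Y)] =
  unpack [X, Y] oo rsh_lsh (X \<otimes> Y)" (is "?l oo ?t oo ?u = _")
proof (rule dual_pair_cancel_right[OF dual_pair_nestl[OF assms]])
 let ?Z = "lsh (X \<otimes> Y)" and ?W = "lsh X \<otimes> lsh Y"
 let ?v = "Str [?Z] (lsh_tens_arr X Y) [?W]"
 let ?r = "Str [RD ?W] (rmap ?Z ?W (lsh_tens_arr X Y)) [RD ?Z]"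
 let ?i = "rd_ld' (LD Y) ** rd_ld' (LD X)" and ?t' = "rdual_tens (lsh X) (lsh Y)"
 have key: "?r oo ?t' oo ?i = rd_ld' (LD (X \<otimes> Y)) oo ldual_tens X Y"
 proof (rule evr_cancel_right)
  have "sevr ?Z oo ($[?Z] ** (?r oo ?t' oo ?i)) = (sevr ?Z oo ($[?Z] ** ?r)) oo ($[?Z] ** (?t' oo ?i))"
   by (simp add: dual_tens_Str diag lsh_def rsh_def)
  also have "... = (sevr ?W oo (?v ** $[RD ?W])) oo ($[?Z] ** (?t' oo ?i))"
   by (simp add: evr_rmap)
  also have "... = (sevr ?W oo ((pack [lsh X, lsh Y] oo lsh_tens X Y) ** $[RD ?W])) oo ($[?Z] ** (?t' oo ?i))"
   using pack_Str[of "lsh_tens_arr X Y" "[?Z]" "[lsh X, lsh Y]"] by (simp add: sh_tens_Str)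
  also have "... = (sevr ?W oo (pack [lsh X, lsh Y] ** ?t')) oo (lsh_tens X Y ** ?i)"
   by (simp add: dual_tens_Str sh_tens_Str diag lsh_def rsh_def)
  also have "... = nestr (lsh X) (lsh Y) oo (lsh_tens X Y ** ?i)"
   by (simp add: evr_rdual_tens)
  also have "... = (sevr (lsh X) oo ($[lsh X] ** rd_ld' (LD X))) oo
    ($[lsh X] ** (sevr (lsh Y) oo ($[lsh Y] ** rd_ld' (LD Y))) ** $[LD X]) oo (lsh_tens X Y ** $[LD Y, LD X])"
   unfolding nestr_def by (simp add: dual_tens_Str sh_tens_Str diag lsh_def rsh_def)
  also have "... = (sevl (LD X)) oo ($[lsh X] ** sevl (LD Y) ** $[LD X]) oo (lsh_tens X Y ** $[LD Y, LD X])"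
   using evr_rd_ld'[of "LD X"] evr_rd_ld'[of "LD Y"] by (simp add: lsh_def)
  also have "... = nestl (LD Y) (LD X) oo (lsh_tens X Y ** $[LD Y, LD X])"
   unfolding nestl_def by (simp add: sh_tens_Str diag lsh_def)
  also have "... = (sevr ?Z oo ($[?Z] ** rd_ld' (LD (X \<otimes> Y)))) oo ($[?Z] ** ldual_tens X Y)"
   using evr_rd_ld'[of "LD (X \<otimes> Y)"] by (simp add: evl_lsh_tens lsh_def)
  also have "... = sevr ?Z oo ($[?Z] ** (rd_ld' (LD (X \<otimes> Y)) oo ldual_tens X Y))"
   by (simp add: dual_tens_Str diag lsh_def)
  finally show "sevr ?Z oo ($[?Z] ** (?r oo ?t' oo ?i)) = ..." .
 qed (auto simp: wt_Str dual_tens_Str lsh_def)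
 have "nestl X Y oo ($[LD Y, LD X] ** (?l oo ?t oo ?u)) =
   (sevl Y oo ($[LD Y] ** rsh_lsh Y)) oo
   ($[LD Y] ** (sevl X oo ($[LD X] ** rsh_lsh X)) ** $[rsh (lsh Y)]) oo
   ($[LD Y, LD X] ** (?t oo ?u))"
  unfolding nestl_def by (simp add: sh_Str sh_tens_Str diag)
 also have "... = (nestr (RD (lsh Y)) (RD (lsh X)) oo ($[RD (lsh Y), RD (lsh X)] ** ?t)) oo (?i ** ?u)"
  by (simp add: evl_rsh_lsh) (simp add: nestr_def dual_tens_Str sh_tens_Str diag lsh_def rsh_def)
 also have "... = sevr (RD ?W) oo (?t' ** $[rsh ?W]) oo (?i ** ?u)"
  by (simp add: evr_rsh_tens) (simp add: dual_tens_Str sh_tens_Str diag lsh_def rsh_def)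
 also have "... = (sevr (RD ?W) oo ($[RD ?W] ** ?u)) oo ((?t' oo ?i) ** $[rsh ?Z])"
  by (simp add: dual_tens_Str sh_tens_Str diag lsh_def rsh_def rshmap_def)
 also have "... = (sevr (RD ?Z) oo (?r ** $[rsh ?Z])) oo ((?t' oo ?i) ** $[rsh ?Z])"
  unfolding rsh_def rshmap_def by (simp add: evr_rmap)
 also have "... = sevr (RD ?Z) oo ((?r oo ?t' oo ?i) ** $[rsh ?Z])"
  by (simp add: dual_tens_Str sh_tens_Str diag lsh_def rsh_def rshmap_def)
 also have "... = (sevr (RD ?Z) oo (rd_ld' (LD (X \<otimes> Y)) ** $[rsh ?Z])) oo (ldual_tens X Y ** $[rsh ?Z])"
  by (simp add: key) (simp add: dual_tens_Str sh_tens_Str diag lsh_def rsh_def)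
 also have "... = (sevl (X \<otimes> Y) oo ($[LD (X \<otimes> Y)] ** ((pack [X, Y] oo unpack [X, Y]) oo rsh_lsh (X \<otimes> Y)))) oo (ldual_tens X Y ** $[rsh ?Z])"
 proof -
  have "(pack [X, Y] oo unpack [X, Y]) oo rsh_lsh (X \<otimes> Y) = rsh_lsh (X \<otimes> Y)"
   by (simp add: pack_unpack sh_Str wt_Str strand_scomp)
  then show ?thesis by (simp add: evl_rsh_lsh)
 qed
 also have "... = (sevl (X \<otimes> Y) oo (ldual_tens X Y ** pack [X, Y])) oo ($[LD Y, LD X] ** (unpack [X, Y] oo rsh_lsh (X \<otimes> Y)))"
  by (simp add: dual_tens_Str sh_Str diag)
 also have "... = nestl X Y oo ($[LD Y, LD X] ** (unpack [X, Y] oo rsh_lsh (X \<otimes> Y)))"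
  by (simp add: evl_ldual_tens)
 finally show "nestl X Y oo ($[LD Y, LD X] ** (?l oo ?t oo ?u)) = ..." .
qed (auto simp: sh_Str wt_Str)

lemma lsh_rsh_tens:
 assumes [simp]: "X \<in> Obj C" "Y \<in> Obj C"
 shows "(lsh_rsh X ** lsh_rsh Y) oo lsh_tens (rsh X) (rsh Y) oo
   Str [lsh (rsh (X \<otimes> Y))] (lshmap (rsh (X \<otimes> Y)) (rsh X \<otimes> rsh Y) (rsh_tens_arr X Y)) [lsh (rsh X \<otimes> rsh Y)] =
  unpack [X, Y] oo lsh_rsh (X \<otimes> Y)" (is "?l oo ?t oo ?u = _")
proof (rule dual_pair_cancel_left[OF dual_pair_nestr[OF assms]])
 let ?Z = "rsh (X \<otimes> Y)" and ?W = "rsh X \<otimes> rsh Y"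
 let ?v = "Str [?Z] (rsh_tens_arr X Y) [?W]"
 let ?r = "Str [LD ?W] (lmap ?Z ?W (rsh_tens_arr X Y)) [LD ?Z]"
 let ?i = "ld_rd' (RD Y) ** ld_rd' (RD X)" and ?t' = "ldual_tens (rsh X) (rsh Y)"
 have key: "?r oo ?t' oo ?i = ld_rd' (RD (X \<otimes> Y)) oo rdual_tens X Y"
 proof (rule evl_cancel)
  have "sevl ?Z oo ((?r oo ?t' oo ?i) ** $[?Z]) = (sevl ?Z oo (?r ** $[?Z])) oo ((?t' oo ?i) ** $[?Z])"
   by (simp add: dual_tens_Str ld_rd_Str diag lsh_def rsh_def)
  also have "... = (sevl ?W oo ($[LD ?W] ** ?v)) oo ((?t' oo ?i) ** $[?Z])"
   by (simp add: evl_lmap)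
  also have "... = (sevl ?W oo ($[LD ?W] ** (pack [rsh X, rsh Y] oo rsh_tens X Y))) oo ((?t' oo ?i) ** $[?Z])"
   using pack_Str[of "rsh_tens_arr X Y" "[?Z]" "[rsh X, rsh Y]"] by (simp add: sh_tens_Str)
  also have "... = (sevl ?W oo (?t' ** pack [rsh X, rsh Y])) oo (?i ** rsh_tens X Y)"
   by (simp add: dual_tens_Str ld_rd_Str sh_tens_Str diag lsh_def rsh_def)
  also have "... = nestl (rsh X) (rsh Y) oo (?i ** rsh_tens X Y)"
   by (simp add: evl_ldual_tens)
  also have "... = (sevl (rsh Y) oo (ld_rd' (RD Y) ** $[rsh Y])) oo
    ($[RD Y] ** (sevl (rsh X) oo (ld_rd' (RD X) ** $[rsh X])) ** $[rsh Y]) oo ($[RD Y, RD X] ** rsh_tens X Y)"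
   unfolding nestl_def by (simp add: ld_rd_Str sh_tens_Str diag lsh_def rsh_def)
  also have "... = (sevr (RD Y)) oo ($[RD Y] ** sevr (RD X) ** $[rsh Y]) oo ($[RD Y, RD X] ** rsh_tens X Y)"
   using evl_ld_rd'[of "RD X"] evl_ld_rd'[of "RD Y"] by (simp add: rsh_def)
  also have "... = nestr (RD Y) (RD X) oo ($[RD Y, RD X] ** rsh_tens X Y)"
   unfolding nestr_def by (simp add: sh_tens_Str diag rsh_def)
  also have "... = (sevl ?Z oo (ld_rd' (RD (X \<otimes> Y)) ** $[?Z])) oo (rdual_tens X Y ** $[?Z])"
   using evl_ld_rd'[of "RD (X \<otimes> Y)"] by (simp add: evr_rsh_tens rsh_def)
  also have "... = sevl ?Z oo ((ld_rd' (RD (X \<otimes> Y)) oo rdual_tens X Y) ** $[?Z])"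
   by (simp add: dual_tens_Str ld_rd_Str diag rsh_def)
  finally show "sevl ?Z oo ((?r oo ?t' oo ?i) ** $[?Z]) = ..." .
 qed (auto simp: wt_Str dual_tens_Str ld_rd_Str rsh_def)
 have "nestr X Y oo ((?l oo ?t oo ?u) ** $[RD Y, RD X]) =
   (sevr X oo (lsh_rsh X ** $[RD X])) oo
   ($[lsh (rsh X)] ** (sevr Y oo (lsh_rsh Y ** $[RD Y])) ** $[RD X]) oo
   ((?t oo ?u) ** $[RD Y, RD X])"
  unfolding nestr_def by (simp add: sh_Str sh_tens_Str diag)
 also have "... = (nestl (LD (rsh Y)) (LD (rsh X)) oo (?t ** $[LD (rsh Y), LD (rsh X)])) oo (?u ** ?i)"
  by (simp add: evr_lsh_rsh) (simp add: nestl_def ld_rd_Str sh_tens_Str diag lsh_def rsh_def)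
 also have "... = sevl (LD ?W) oo ($[lsh ?W] ** ?t') oo (?u ** ?i)"
  by (simp add: evl_lsh_tens) (simp add: dual_tens_Str ld_rd_Str sh_tens_Str diag lsh_def rsh_def)
 also have "... = (sevl (LD ?W) oo (?u ** $[LD ?W])) oo ($[lsh ?Z] ** (?t' oo ?i))"
  by (simp add: dual_tens_Str ld_rd_Str sh_tens_Str diag lsh_def rsh_def lshmap_def)
 also have "... = (sevl (LD ?Z) oo ($[lsh ?Z] ** ?r)) oo ($[lsh ?Z] ** (?t' oo ?i))"
  unfolding lsh_def lshmap_def by (simp add: evl_lmap)
 also have "... = sevl (LD ?Z) oo ($[lsh ?Z] ** (?r oo ?t' oo ?i))"
  by (simp add: dual_tens_Str ld_rd_Str sh_tens_Str diag lsh_def rsh_def lshmap_def)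
 also have "... = (sevl (LD ?Z) oo ($[lsh ?Z] ** ld_rd' (RD (X \<otimes> Y)))) oo ($[lsh ?Z] ** rdual_tens X Y)"
  by (simp add: key) (simp add: dual_tens_Str ld_rd_Str sh_tens_Str diag lsh_def rsh_def)
 also have "... = (sevr (X \<otimes> Y) oo (((pack [X, Y] oo unpack [X, Y]) oo lsh_rsh (X \<otimes> Y)) ** $[RD (X \<otimes> Y)])) oo ($[lsh ?Z] ** rdual_tens X Y)"
 proof -
  have "(pack [X, Y] oo unpack [X, Y]) oo lsh_rsh (X \<otimes> Y) = lsh_rsh (X \<otimes> Y)"
   by (simp add: pack_unpack sh_Str wt_Str strand_scomp)
  then show ?thesis by (simp add: evr_lsh_rsh)
 qed
 also have "... = (sevr (X \<otimes> Y) oo (pack [X, Y] ** rdual_tens X Y)) oo ((unpack [X, Y] oo lsh_rsh (X \<otimes> Y)) ** $[RD Y, RD X])"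
  by (simp add: dual_tens_Str sh_Str diag)
 also have "... = nestr X Y oo ((unpack [X, Y] oo lsh_rsh (X \<otimes> Y)) ** $[RD Y, RD X])"
  by (simp add: evr_rdual_tens)
 finally show "nestr X Y oo ((?l oo ?t oo ?u) ** $[RD Y, RD X]) = ..." .
qed (auto simp: sh_Str wt_Str)

lemma lshmap_rsh_lsh:
 assumes [simp]: "X \<in> Obj C"
 shows "Str [lsh (rsh (lsh X))] (lshmap (rsh (lsh X)) X (rsh_lsh_arr X)) [lsh X] = lsh_rsh (lsh X)" (is "?l = _")
proof -
 let ?X = "rsh (lsh X)" and ?i = "rd_ld' (LD X)"
 let ?m = "Str [LD X] (lmap ?X X (rsh_lsh_arr X)) [LD ?X]"
 have key: "?m = ld_rd' (RD (lsh X)) oo ?i"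
 proof (rule evl_cancel)
  have "sevl ?X oo (?m ** $[?X]) = sevr (RD (lsh X)) oo (?i ** $[?X])"
   by (simp add: evl_lmap evl_rsh_lsh flip: sh_Str)
  also have "... = (sevl ?X oo (ld_rd' (RD (lsh X)) ** $[?X])) oo (?i ** $[?X])"
   using evl_ld_rd'[of "RD (lsh X)"] by (simp add: rsh_def)
  also have "... = sevl ?X oo ((ld_rd' (RD (lsh X)) oo ?i) ** $[?X])"
   by (simp add: dual_tens_Str ld_rd_Str diag lsh_def rsh_def)
  finally show "sevl ?X oo (?m ** $[?X]) = ..." .
 qed (auto simp: wt_Str dual_tens_Str ld_rd_Str lsh_def rsh_def)
 show ?thesis
 proof (rule evl_cancel)
  have "sevl (LD X) oo (?l ** $[LD X]) = sevl (LD ?X) oo ($[lsh ?X] ** (ld_rd' (RD (lsh X)) oo ?i))"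
   using evl_lmap[of "LD X" "LD ?X" "lmap ?X X (rsh_lsh_arr X)"]
   unfolding key[symmetric] lshmap_def lsh_def[of ?X] by (simp add: lsh_def[symmetric])
  also have "... = (sevl (LD ?X) oo ($[lsh ?X] ** ld_rd' (RD (lsh X)))) oo ($[lsh ?X] ** ?i)"
   by (simp add: dual_tens_Str ld_rd_Str diag lsh_def rsh_def)
  also have "... = (sevr (lsh X) oo (lsh_rsh (lsh X) ** $[RD (lsh X)])) oo ($[lsh ?X] ** ?i)"
   by (simp add: evr_lsh_rsh)
  also have "... = (sevr (lsh X) oo ($[lsh X] ** ?i)) oo (lsh_rsh (lsh X) ** $[LD X])"
   by (simp add: sh_Str dual_tens_Str diag lsh_def rsh_def)
  also have "... = sevl (LD X) oo (lsh_rsh (lsh X) ** $[LD X])"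
   using evr_rd_ld'[of "LD X"] by (simp add: lsh_def)
  finally show "sevl (LD X) oo (?l ** $[LD X]) = ..." .
 qed (auto simp: wt_Str sh_Str simp flip: lsh_def)
qed

definition "lsh_unit_arr = sarr lsh_unit"
definition "rsh_unit_arr = sarr rsh_unit"
definition "ldual_unit_arr = sarr ldual_unit"
definition "rdual_unit_arr = sarr rdual_unit"

lemma unit_Str:
 "lsh_unit = Str [lsh \<I>] lsh_unit_arr []"
 "rsh_unit = Str [rsh \<I>] rsh_unit_arr []"
 "ldual_unit = Str [] ldual_unit_arr [LD \<I>]"
 "rdual_unit = Str [] rdual_unit_arr [RD \<I>]"
 unfolding lsh_unit_arr_def rsh_unit_arr_def ldual_unit_arr_def rdual_unit_arr_def
 by (rule Str_sarr[symmetric]; simp add: lsh_unit_def rsh_unit_def ldual_unit_def rdual_unit_def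
   ldual_unit'_def rdual_unit'_def)+

lemma dual_unit_hom [simp]:
 "ldual_unit_arr \<in> Hom C \<I> (LD \<I>)" "rdual_unit_arr \<in> Hom C \<I> (RD \<I>)"
proof -
 have "wt ldual_unit" "wt rdual_unit" by (simp_all add: ldual_unit_def rdual_unit_def wt_Str)
 then show "ldual_unit_arr \<in> Hom C \<I> (LD \<I>)" "rdual_unit_arr \<in> Hom C \<I> (RD \<I>)"
  by (simp_all add: unit_Str wt_Str)
qed

lemma sh_unit_hom [simp]:
 "lsh_unit_arr \<in> Hom C (lsh \<I>) \<I>" "rsh_unit_arr \<in> Hom C (rsh \<I>) \<I>"
proof -
 have "wt lsh_unit" "wt rsh_unit"
  unfolding lsh_unit_def rsh_unit_def ldual_unit'_def rdual_unit'_def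
   ldual_unit_arr_def[symmetric] rdual_unit_arr_def[symmetric]
  by (simp_all add: wt_Str lsh_def rsh_def)
 then show "lsh_unit_arr \<in> Hom C (lsh \<I>) \<I>" "rsh_unit_arr \<in> Hom C (rsh \<I>) \<I>"
  by (simp_all add: unit_Str wt_Str)
qed

lemmas sh_unit_hom_unfolded [simp] = sh_unit_hom[unfolded lsh_def rsh_def]

lemma evl_ldual_unit: "sevl \<I> oo (ldual_unit ** $[\<I>]) = unpack []"
 and evr_rdual_unit: "sevr \<I> oo ($[\<I>] ** rdual_unit) = unpack []"
proof -
 have "sevl \<I> oo (ldual_unit ** $[\<I>]) = unpack [] oo (($[\<I>] ** sevl \<I>) oo (scoevl \<I> ** $[\<I>]))"
  unfolding ldual_unit_def by (simp add: diag)
 then show "sevl \<I> oo (ldual_unit ** $[\<I>]) = unpack []"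
  unfolding ldual_zigzag[OF munit_obj] unit_Str by (simp add: diag)
 have "sevr \<I> oo ($[\<I>] ** rdual_unit) = unpack [] oo ((sevr \<I> ** $[\<I>]) oo ($[\<I>] ** scoevr \<I>))"
  unfolding rdual_unit_def by (simp add: diag)
 then show "sevr \<I> oo ($[\<I>] ** rdual_unit) = unpack []"
  unfolding rdual_zigzag[OF munit_obj] unit_Str by (simp add: diag)
qed

lemma lsh_unit_eq: "lsh_unit = sevl (LD \<I>) oo ($[lsh \<I>] ** ldual_unit)"
proof -
 let ?m = "Str [lsh \<I>] (lmap \<I> (LD \<I>) ldual_unit_arr) [LD \<I>]"
 have "lsh_unit = (sevl \<I> oo (?m ** $[\<I>])) oo ($[lsh \<I>] ** pack [])"
  unfolding lsh_unit_def ldual_unit'_def ldual_unit_arr_def[symmetric] by (simp add: lsh_def diag)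
 also have "... = (sevl (LD \<I>) oo ($[lsh \<I>] ** Str [\<I>] ldual_unit_arr [LD \<I>])) oo ($[lsh \<I>] ** pack [])"
  unfolding lsh_def by (simp add: evl_lmap)
 also have "... = sevl (LD \<I>) oo ($[lsh \<I>] ** (Str [\<I>] ldual_unit_arr [LD \<I>] oo pack []))"
  by (simp add: diag lsh_def)
 finally show ?thesis using Str_pack[of ldual_unit_arr "[]" "[LD \<I>]"] by (simp add: unit_Str)
qed

lemma rsh_unit_eq: "rsh_unit = sevr (RD \<I>) oo (rdual_unit ** $[rsh \<I>])"
proof -
 let ?m = "Str [rsh \<I>] (rmap \<I> (RD \<I>) rdual_unit_arr) [RD \<I>]"
 have "rsh_unit = (sevr \<I> oo ($[\<I>] ** ?m)) oo (pack [] ** $[rsh \<I>])"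
  unfolding rsh_unit_def rdual_unit'_def rdual_unit_arr_def[symmetric] by (simp add: rsh_def diag)
 also have "... = (sevr (RD \<I>) oo (Str [\<I>] rdual_unit_arr [RD \<I>] ** $[rsh \<I>])) oo (pack [] ** $[rsh \<I>])"
  unfolding rsh_def by (simp add: evr_rmap)
 also have "... = sevr (RD \<I>) oo ((Str [\<I>] rdual_unit_arr [RD \<I>] oo pack []) ** $[rsh \<I>])"
  by (simp add: diag rsh_def)
 finally show ?thesis using Str_pack[of rdual_unit_arr "[]" "[RD \<I>]"] by (simp add: unit_Str)
qed

lemma rsh_lsh_unit:
 "rsh_unit oo Str [rsh (lsh \<I>)] (rshmap (lsh \<I>) \<I> lsh_unit_arr) [rsh \<I>] = unpack [] oo rsh_lsh \<I>" (is "_ oo ?u = _")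
proof -
 let ?Z = "lsh \<I>"
 let ?r = "Str [RD \<I>] (rmap ?Z \<I> lsh_unit_arr) [RD ?Z]"
 have key: "?r oo rdual_unit = rd_ld' (LD \<I>) oo ldual_unit"
 proof (rule evr_cancel_right)
  have "sevr ?Z oo ($[?Z] ** (?r oo rdual_unit)) = (sevr ?Z oo ($[?Z] ** ?r)) oo ($[?Z] ** rdual_unit)"
   by (simp add: unit_Str diag)
  also have "... = (sevr \<I> oo ($[\<I>] ** rdual_unit)) oo Str [?Z] lsh_unit_arr [\<I>]"
   by (simp add: evr_rmap) (simp add: unit_Str diag)
  also have "... = lsh_unit"
   unfolding evr_rdual_unit using comp_idl[of "lsh \<I>" \<I> lsh_unit_arr]
   by (simp add: unit_Str unpack_def scomp_def)
  also have "... = (sevr ?Z oo ($[?Z] ** rd_ld' (LD \<I>))) oo ($[?Z] ** ldual_unit)"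
   using evr_rd_ld'[of "LD \<I>"] by (simp add: lsh_unit_eq lsh_def)
  also have "... = sevr ?Z oo ($[?Z] ** (rd_ld' (LD \<I>) oo ldual_unit))"
   by (simp add: unit_Str dual_tens_Str diag lsh_def)
  finally show "sevr ?Z oo ($[?Z] ** (?r oo rdual_unit)) = ..." .
 qed (auto simp: unit_Str dual_tens_Str wt_Str lsh_def)
 have "rsh_unit oo ?u = (sevr (RD \<I>) oo ($[RD \<I>] ** ?u)) oo (rdual_unit ** $[rsh ?Z])"
  unfolding rsh_unit_eq by (simp add: unit_Str diag rsh_def rshmap_def)
 also have "... = (sevr (RD ?Z) oo (?r ** $[rsh ?Z])) oo (rdual_unit ** $[rsh ?Z])"
  unfolding rsh_def rshmap_def by (simp add: evr_rmap)
 also have "... = sevr (RD ?Z) oo ((?r oo rdual_unit) ** $[rsh ?Z])"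
  by (simp add: unit_Str diag rsh_def)
 also have "... = (sevr (RD ?Z) oo (rd_ld' (LD \<I>) ** $[rsh ?Z])) oo (ldual_unit ** $[rsh ?Z])"
  unfolding key by (simp add: unit_Str dual_tens_Str diag rsh_def lsh_def)
 also have "... = (sevl \<I> oo (ldual_unit ** $[\<I>])) oo rsh_lsh \<I>"
  by (simp flip: evl_rsh_lsh) (simp add: unit_Str sh_Str diag)
 finally show ?thesis by (simp add: evl_ldual_unit)
qed

lemma lsh_rsh_unit:
 "lsh_unit oo Str [lsh (rsh \<I>)] (lshmap (rsh \<I>) \<I> rsh_unit_arr) [lsh \<I>] = unpack [] oo lsh_rsh \<I>" (is "_ oo ?u = _")
proof -
 let ?Z = "rsh \<I>"
 let ?r = "Str [LD \<I>] (lmap ?Z \<I> rsh_unit_arr) [LD ?Z]"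
 have key: "?r oo ldual_unit = ld_rd' (RD \<I>) oo rdual_unit"
 proof (rule evl_cancel)
  have "sevl ?Z oo ((?r oo ldual_unit) ** $[?Z]) = (sevl ?Z oo (?r ** $[?Z])) oo (ldual_unit ** $[?Z])"
   by (simp add: unit_Str diag)
  also have "... = (sevl \<I> oo (ldual_unit ** $[\<I>])) oo Str [?Z] rsh_unit_arr [\<I>]"
   by (simp add: evl_lmap) (simp add: unit_Str diag)
  also have "... = rsh_unit"
   unfolding evl_ldual_unit using comp_idl[of "rsh \<I>" \<I> rsh_unit_arr]
   by (simp add: unit_Str unpack_def scomp_def)
  also have "... = (sevl ?Z oo (ld_rd' (RD \<I>) ** $[?Z])) oo (rdual_unit ** $[?Z])"
   using evl_ld_rd'[of "RD \<I>"] by (simp add: rsh_unit_eq rsh_def)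
  also have "... = sevl ?Z oo ((ld_rd' (RD \<I>) oo rdual_unit) ** $[?Z])"
   by (simp add: unit_Str ld_rd_Str diag rsh_def)
  finally show "sevl ?Z oo ((?r oo ldual_unit) ** $[?Z]) = ..." .
 qed (auto simp: unit_Str ld_rd_Str wt_Str rsh_def)
 have "lsh_unit oo ?u = (sevl (LD \<I>) oo (?u ** $[LD \<I>])) oo ($[lsh ?Z] ** ldual_unit)"
  unfolding lsh_unit_eq by (simp add: unit_Str diag lsh_def lshmap_def)
 also have "... = (sevl (LD ?Z) oo ($[lsh ?Z] ** ?r)) oo ($[lsh ?Z] ** ldual_unit)"
  unfolding lsh_def lshmap_def by (simp add: evl_lmap)
 also have "... = sevl (LD ?Z) oo ($[lsh ?Z] ** (?r oo ldual_unit))"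
  by (simp add: unit_Str diag lsh_def)
 also have "... = (sevl (LD ?Z) oo ($[lsh ?Z] ** ld_rd' (RD \<I>))) oo ($[lsh ?Z] ** rdual_unit)"
  unfolding key by (simp add: unit_Str ld_rd_Str diag rsh_def lsh_def)
 also have "... = (sevr \<I> oo ($[\<I>] ** rdual_unit)) oo lsh_rsh \<I>"
  by (simp flip: evr_lsh_rsh) (simp add: unit_Str sh_Str diag)
 finally show ?thesis by (simp add: evr_rdual_unit)
qed

end

section \<open>Half-braidings from the left\<close>

context monoidal_category
begin

lemma inverses_move:
 assumes "inverses a a'" "inverses b b'" "p oo a = b oo q" "wt p" "wt q"
  "sdom p = scod a" "scod q = sdom b" "scod p = scod b" "sdom q = sdom a"
 shows "b' oo p = q oo a'"
proof -
 have 1: "(p oo a) oo a' = p"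
  using assms(1,4-) by (simp add: scomp_assoc inverses_def scomp_strand)
 have 2: "b' oo b oo q = q"
  using assms(2,4-) scomp_assoc[of b' b q] by (simp add: inverses_def strand_scomp)
 have "b' oo p = b' oo (b oo q) oo a'" using 1 assms(3) by simp
 also have "... = (b' oo b oo q) oo a'"
  using assms(1,2,4-) by (simp add: scomp_assoc inverses_def)
 finally show ?thesis unfolding 2 .
qed

lemma inverses_stens:
 assumes "inverses f g" "inverses f' g'"
 shows "inverses (f ** f') (g ** g')"
proof -
 have "set (sdom f) <= Obj C" "set (sdom f') <= Obj C" "set (scod f) <= Obj C" "set (scod f') <= Obj C"
  using assms wt_dom wt_cod by (auto simp: inverses_def)
 then show ?thesis
  using assms by (simp add: inverses_def strand_stens flip: stens_scomp)
qed

end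

context rigid_category
begin

definition left_half_braiding :: "'o => ('o => 'a) => bool" where
 "left_half_braiding M l \<longleftrightarrow>
   (\<forall>X \<in> Obj C. is_iso C (X \<otimes> M) (M \<otimes> lsh X) (l X)) \<and>
   (\<forall>X \<in> Obj C. \<forall>Y \<in> Obj C. \<forall>f \<in> Hom C X Y.
    Str [Y, M] (l Y) [M, lsh Y] oo (Str [X] f [Y] ** $[M]) =
    ($[M] ** Str [lsh X] (lshmap X Y f) [lsh Y]) oo Str [X, M] (l X) [M, lsh X]) \<and>
   ($[M] ** lsh_unit) oo Str [\<I>, M] (l \<I>) [M, lsh \<I>] = unpack [] ** $[M] \<and>
   (\<forall>X \<in> Obj C. \<forall>Y \<in> Obj C.
    ($[M] ** lsh_tens X Y) oo Str [X \<otimes> Y, M] (l (X \<otimes> Y)) [M, lsh (X \<otimes> Y)] =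
    (Str [X, M] (l X) [M, lsh X] ** $[lsh Y]) oo ($[X] ** Str [Y, M] (l Y) [M, lsh Y]) oo
    (unpack [X, Y] ** $[M]))"

definition shalf_left :: "'o => ('o => 'a) => 'o => ('o, 'a) strarr" where
 "shalf_left M t X = (rsh_lsh X ** $[M]) oo shalf M t (lsh X)"

lemma half_braiding_natural:
 assumes "half_braiding M t" and [simp]: "M \<in> Obj C" "X \<in> Obj C" "Y \<in> Obj C" "f \<in> Hom C X Y"
 shows "shalf M t Y oo ($[M] ** Str [X] f [Y]) =
  (Str [rsh X] (rshmap X Y f) [rsh Y] ** $[M]) oo shalf M t X"
proof -
 have "t Y \<cdot> (idm C M \<star> f) = (rshmap X Y f \<star> idm C M) \<cdot> t X"
  using assms by (auto simp: half_braiding_def)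
 then show ?thesis by (simp add: stens_strand1 scomp_def)
qed

lemma half_braiding_hom:
 assumes "half_braiding M t" "X \<in> Obj C"
 shows "is_iso C (M \<otimes> X) (rsh X \<otimes> M) (t X)" "t X \<in> Hom C (M \<otimes> X) (rsh X \<otimes> M)"
 using assms by (auto simp: half_braiding_def is_iso_def)

lemma inverses_shalf_left:
 assumes "half_braiding M t" and [simp]: "M \<in> Obj C" "X \<in> Obj C"
 shows "inverses (shalf_left M t X) (Str [X, M] (half_left M t X) [M, lsh X])"
proof -
 obtain r where "inverses (rsh_lsh X) r" using inverses_sh[of X] by auto
 then have "inverses (rsh_lsh X ** $[M]) (r ** $[M])"
  by (intro inverses_stens inverses_strand) auto
 moreover have "inverses (shalf M t (lsh X)) (Str [rsh (lsh X), M] (arr_inv C (M \<otimes> lsh X) (rsh (lsh X) \<otimes> M) (t (lsh X))) [M, lsh X])"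
  using inverses_arr_inv[of "[M, lsh X]" "[rsh (lsh X), M]" "t (lsh X)"]
   half_braiding_hom[OF assms(1), of "lsh X"] by simp
 ultimately have "\<exists>g. inverses (shalf_left M t X) g"
  unfolding shalf_left_def using inverses_scomp by (metis sdom_stens scod_scomp strarr.sel(3) sdom_strand sh_Str(1) strarr.sel(1) append_Cons append_Nil)
 then obtain g where g: "inverses (shalf_left M t X) g" by blast
 have d: "sdom (shalf_left M t X) = [M, lsh X]" "scod (shalf_left M t X) = [X, M]"
  by (simp_all add: shalf_left_def sh_Str)
 have "half_left M t X = sarr g"
  using inverses_arr_inv_eq[OF g] d by (simp add: half_left_def shalf_left_def)
 then have "Str [X, M] (half_left M t X) [M, lsh X] = g"
  using g d by (cases g) (auto simp: inverses_def)
 then show ?thesis using g by simp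
qed

lemma sdom_shalf_left [simp]: "sdom (shalf_left M t X) = [M, lsh X]"
 and scod_shalf_left [simp]: "scod (shalf_left M t X) = [X, M]"
 by (simp_all add: shalf_left_def sh_Str)

lemma left_half_braiding_half_left:
 assumes t: "half_braiding M t" and [simp]: "M \<in> Obj C"
 shows "left_half_braiding M (half_left M t)"
proof -
 let ?l = "half_left M t"
 define T where "T = shalf_left M t"
 let ?L = "\<lambda>X. Str [X, M] (?l X) [M, lsh X]"
 have TL: "inverses (T X) (?L X)" if "X \<in> Obj C" for X
  using inverses_shalf_left[OF t] that by (simp add: T_def)
 have dT [simp]: "sdom (T X) = [M, lsh X]" "scod (T X) = [X, M]" for X by (simp_all add: T_def)
 have wT [simp]: "wt (T X)" "wt (?L X)" if "X \<in> Obj C" for X using TL[OF that] by (auto simp: inverses_def)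
 have [simp]: "?l X \<in> Hom C (X \<otimes> M) (M \<otimes> lsh X)" if "X \<in> Obj C" for X using wT(2)[OF that] by (simp add: wt_Str)
 have [simp]: "t X \<in> Hom C (M \<otimes> X) (rsh X \<otimes> M)" if "X \<in> Obj C" for X using half_braiding_hom[OF t that] by simp
 have iso: "is_iso C (X \<otimes> M) (M \<otimes> lsh X) (?l X)" if "X \<in> Obj C" for X
  using inverses_is_iso[OF inverses_sym[OF TL[OF that]]] that by simp
 have nat: "?L Y oo (Str [X] f [Y] ** $[M]) = ($[M] ** Str [lsh X] (lshmap X Y f) [lsh Y]) oo ?L X"
  if [simp]: "X \<in> Obj C" "Y \<in> Obj C" "f \<in> Hom C X Y" for X Y f
 proof (rule inverses_move[OF TL TL])
  have "(Str [X] f [Y] ** $[M]) oo T X = ((Str [X] f [Y] oo rsh_lsh X) ** $[M]) oo shalf M t (lsh X)"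
   unfolding T_def shalf_left_def by (simp add: sh_Str diag)
  also have "... = (rsh_lsh Y ** $[M]) oo
    (Str [rsh (lsh X)] (rshmap (lsh X) (lsh Y) (lshmap X Y f)) [rsh (lsh Y)] ** $[M]) oo shalf M t (lsh X)"
   unfolding rsh_lsh_natural[OF that] by (simp add: sh_Str diag)
  also have "... = T Y oo ($[M] ** Str [lsh X] (lshmap X Y f) [lsh Y])"
   by (subst half_braiding_natural[OF t, symmetric])
     (simp_all add: T_def shalf_left_def sh_Str diag)
  finally show "(Str [X] f [Y] ** $[M]) oo T X = ..." .
 qed (auto simp: wt_Str)
 have unit: "($[M] ** lsh_unit) oo ?L \<I> = unpack [] ** $[M]"
 proof -
  let ?r = "Str [rsh (lsh \<I>)] (rshmap (lsh \<I>) \<I> lsh_unit_arr) [rsh \<I>]"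
  have "(unpack [] ** $[M]) oo T \<I> = ((unpack [] oo rsh_lsh \<I>) ** $[M]) oo shalf M t (lsh \<I>)"
   unfolding T_def shalf_left_def by (simp add: sh_Str diag)
  also have "... = (rsh_unit ** $[M]) oo (?r ** $[M]) oo shalf M t (lsh \<I>)"
   by (simp flip: rsh_lsh_unit) (simp add: unit_Str diag)
  also have "... = ((rsh_unit ** $[M]) oo shalf M t \<I>) oo ($[M] ** Str [lsh \<I>] lsh_unit_arr [\<I>])"
   by (subst half_braiding_natural[OF t, symmetric]) (simp_all add: unit_Str diag)
  also have "(rsh_unit ** $[M]) oo shalf M t \<I> = $[M] ** unpack []"
   using t by (simp add: half_braiding_def)
  also have "... oo ($[M] ** Str [lsh \<I>] lsh_unit_arr [\<I>]) = $[M] ** (unpack [] oo pack [] oo lsh_unit)"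
   using pack_Str[of lsh_unit_arr "[lsh \<I>]" "[]"] by (simp add: unit_Str) (simp add: diag)
  also have "... = $[M] ** lsh_unit"
   using unpack_pack[of "[]"] by (simp add: unit_Str wt_Str strand_scomp flip: scomp_assoc)
  finally have "($[M] ** lsh_unit) oo ?L \<I> = ((unpack [] ** $[M]) oo T \<I>) oo ?L \<I>" by simp
  also have "... = (unpack [] ** $[M])"
   using TL[of \<I>] by (simp add: scomp_assoc inverses_def scomp_strand)
  finally show ?thesis .
 qed
 have mult: "($[M] ** lsh_tens X Y) oo ?L (X \<otimes> Y) =
   (?L X ** $[lsh Y]) oo ($[X] ** ?L Y) oo (unpack [X, Y] ** $[M])"
  if [simp]: "X \<in> Obj C" "Y \<in> Obj C" for X Y
 proof -
  let ?W = "lsh X \<otimes> lsh Y" and ?Z = "lsh (X \<otimes> Y)"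
  let ?r = "Str [rsh ?Z] (rshmap ?Z ?W (lsh_tens_arr X Y)) [rsh ?W]"
  have "(unpack [X, Y] ** $[M]) oo T (X \<otimes> Y) = ((unpack [X, Y] oo rsh_lsh (X \<otimes> Y)) ** $[M]) oo shalf M t ?Z"
   unfolding T_def shalf_left_def by (simp add: sh_Str diag)
  also have "... = ((rsh_lsh X ** rsh_lsh Y) ** $[M]) oo (rsh_tens (lsh X) (lsh Y) ** $[M]) oo (?r ** $[M]) oo shalf M t ?Z"
   by (simp flip: rsh_lsh_tens) (simp add: sh_Str sh_tens_Str diag)
  also have "... = ((rsh_lsh X ** rsh_lsh Y) ** $[M]) oo ((rsh_tens (lsh X) (lsh Y) ** $[M]) oo shalf M t ?W) oo
     ($[M] ** Str [?Z] (lsh_tens_arr X Y) [?W])"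
   by (subst half_braiding_natural[OF t, symmetric]) (simp_all add: sh_Str sh_tens_Str diag)
  also have "(rsh_tens (lsh X) (lsh Y) ** $[M]) oo shalf M t ?W =
   ($[rsh (lsh X)] ** shalf M t (lsh Y)) oo (shalf M t (lsh X) ** $[lsh Y]) oo ($[M] ** unpack [lsh X, lsh Y])"
   using t by (simp add: half_braiding_def)
  also have "((rsh_lsh X ** rsh_lsh Y) ** $[M]) oo ... oo ($[M] ** Str [?Z] (lsh_tens_arr X Y) [?W]) =
    ($[X] ** T Y) oo (T X ** $[lsh Y]) oo ($[M] ** (unpack [lsh X, lsh Y] oo pack [lsh X, lsh Y] oo lsh_tens X Y))"
   using pack_Str[of "lsh_tens_arr X Y" "[?Z]" "[lsh X, lsh Y]"]
   by (simp add: sh_tens_Str T_def shalf_left_def) (simp add: sh_Str diag)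
  also have "unpack [lsh X, lsh Y] oo pack [lsh X, lsh Y] oo lsh_tens X Y = lsh_tens X Y"
   using unpack_pack[of "[lsh X, lsh Y]"] by (simp add: strand_scomp flip: scomp_assoc)
  finally have e: "($[X] ** T Y) oo (T X ** $[lsh Y]) oo ($[M] ** lsh_tens X Y) =
    (unpack [X, Y] ** $[M]) oo T (X \<otimes> Y)" by simp
  have i: "inverses (($[X] ** T Y) oo (T X ** $[lsh Y])) ((?L X ** $[lsh Y]) oo ($[X] ** ?L Y))"
   by (intro inverses_scomp inverses_stens inverses_strand TL) auto
  have "((?L X ** $[lsh Y]) oo ($[X] ** ?L Y)) oo (unpack [X, Y] ** $[M]) =
    ($[M] ** lsh_tens X Y) oo ?L (X \<otimes> Y)"
   by (rule inverses_move[OF TL i]) (simp_all add: e scomp_assoc)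
  then show ?thesis by (simp add: scomp_assoc)
 qed
 show ?thesis unfolding left_half_braiding_def using iso nat unit mult by blast
qed

lemma half_braiding_of_left:
 assumes l: "left_half_braiding M l" and [simp]: "M \<in> Obj C"
 shows "\<exists>t. half_braiding M t \<and> (\<forall>X \<in> Obj C. half_left M t X = l X)"
proof -
 let ?L = "\<lambda>X. Str [X, M] (l X) [M, lsh X]"
 define T where "T X = ($[M] ** lsh_rsh X) oo ?L (rsh X)" for X
 define t where "t = (\<lambda>X \<in> Obj C. arr_inv C (rsh X \<otimes> M) (M \<otimes> X) (sarr (T X)))"
 have liso: "is_iso C (X \<otimes> M) (M \<otimes> lsh X) (l X)" if "X \<in> Obj C" for X
  using l that by (simp add: left_half_braiding_def)
 then have [simp]: "l X \<in> Hom C (X \<otimes> M) (M \<otimes> lsh X)" if "X \<in> Obj C" for X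
  using that by (auto simp: is_iso_def)
 have lnat: "?L Y oo (Str [X] f [Y] ** $[M]) = ($[M] ** Str [lsh X] (lshmap X Y f) [lsh Y]) oo ?L X"
  if "X \<in> Obj C" "Y \<in> Obj C" "f \<in> Hom C X Y" for X Y f
  using l that by (simp add: left_half_braiding_def)
 have dT [simp]: "sdom (T X) = [rsh X, M]" "scod (T X) = [M, X]" for X by (simp_all add: T_def sh_Str)
 have Tt: "inverses (T X) (shalf M t X)" if [simp]: "X \<in> Obj C" for X
 proof -
  obtain e where e: "inverses (lsh_rsh X) e" using inverses_sh[of X] by auto
  have "inverses (?L (rsh X)) (Str [M, lsh (rsh X)] (arr_inv C (rsh X \<otimes> M) (M \<otimes> lsh (rsh X)) (l (rsh X))) [rsh X, M])"
   using inverses_arr_inv[of "[rsh X, M]" "[M, lsh (rsh X)]" "l (rsh X)"] liso[of "rsh X"] by simp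
  from inverses_scomp[OF inverses_stens[OF inverses_strand[of "[M]"] e] this]
  have "\<exists>g. inverses (T X) g" by (auto simp: T_def sh_Str)
  then obtain g where g: "inverses (T X) g" by blast
  then have "t X = sarr g"
   using inverses_arr_inv_eq[OF g] by (simp add: t_def)
  then have "shalf M t X = g" using g by (cases g) (auto simp: inverses_def)
  then show ?thesis using g by simp
 qed
 have wT [simp]: "wt (T X)" "t X \<in> Hom C (M \<otimes> X) (rsh X \<otimes> M)" if "X \<in> Obj C" for X
  using Tt[OF that] by (auto simp: inverses_def wt_Str)
 have nat: "shalf M t Y oo ($[M] ** Str [X] f [Y]) = (Str [rsh X] (rshmap X Y f) [rsh Y] ** $[M]) oo shalf M t X"
  if [simp]: "X \<in> Obj C" "Y \<in> Obj C" "f \<in> Hom C X Y" for X Y f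
 proof (rule inverses_move[OF Tt Tt])
  have "($[M] ** Str [X] f [Y]) oo T X = ($[M] ** (Str [X] f [Y] oo lsh_rsh X)) oo ?L (rsh X)"
   unfolding T_def by (simp add: sh_Str diag)
  also have "... = ($[M] ** lsh_rsh Y) oo
    ($[M] ** Str [lsh (rsh X)] (lshmap (rsh X) (rsh Y) (rshmap X Y f)) [lsh (rsh Y)]) oo ?L (rsh X)"
   unfolding lsh_rsh_natural[OF that] by (simp add: sh_Str diag)
  also have "... = T Y oo (Str [rsh X] (rshmap X Y f) [rsh Y] ** $[M])"
   by (subst lnat[symmetric]) (simp_all add: T_def sh_Str diag)
  finally show "($[M] ** Str [X] f [Y]) oo T X = ..." .
 qed (auto simp: wt_Str)
 have unit: "(rsh_unit ** $[M]) oo shalf M t \<I> = $[M] ** unpack []"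
 proof -
  let ?r = "Str [lsh (rsh \<I>)] (lshmap (rsh \<I>) \<I> rsh_unit_arr) [lsh \<I>]"
  have "($[M] ** unpack []) oo T \<I> = ($[M] ** (unpack [] oo lsh_rsh \<I>)) oo ?L (rsh \<I>)"
   unfolding T_def by (simp add: sh_Str diag)
  also have "... = ($[M] ** lsh_unit) oo ($[M] ** ?r) oo ?L (rsh \<I>)"
   by (simp flip: lsh_rsh_unit) (simp add: unit_Str diag)
  also have "... = (($[M] ** lsh_unit) oo ?L \<I>) oo (Str [rsh \<I>] rsh_unit_arr [\<I>] ** $[M])"
   by (subst lnat[symmetric]) (simp_all add: unit_Str diag)
  also have "($[M] ** lsh_unit) oo ?L \<I> = unpack [] ** $[M]"
   using l by (simp add: left_half_braiding_def)
  also have "... oo (Str [rsh \<I>] rsh_unit_arr [\<I>] ** $[M]) = (unpack [] oo pack [] oo rsh_unit) ** $[M]"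
   using pack_Str[of rsh_unit_arr "[rsh \<I>]" "[]"] by (simp add: unit_Str) (simp add: diag)
  also have "... = rsh_unit ** $[M]"
   using unpack_pack[of "[]"] by (simp add: unit_Str wt_Str strand_scomp flip: scomp_assoc)
  finally have "(rsh_unit ** $[M]) oo shalf M t \<I> = (($[M] ** unpack []) oo T \<I>) oo shalf M t \<I>" by simp
  also have "... = $[M] ** unpack []"
   using Tt[of \<I>] by (simp add: scomp_assoc inverses_def scomp_strand)
  finally show ?thesis .
 qed
 have mult: "(rsh_tens X Y ** $[M]) oo shalf M t (X \<otimes> Y) =
    ($[rsh X] ** shalf M t Y) oo (shalf M t X ** $[Y]) oo ($[M] ** unpack [X, Y])"
  if [simp]: "X \<in> Obj C" "Y \<in> Obj C" for X Y
 proof -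
  let ?W = "rsh X \<otimes> rsh Y" and ?Z = "rsh (X \<otimes> Y)"
  let ?r = "Str [lsh ?Z] (lshmap ?Z ?W (rsh_tens_arr X Y)) [lsh ?W]"
  have "($[M] ** unpack [X, Y]) oo T (X \<otimes> Y) = ($[M] ** (unpack [X, Y] oo lsh_rsh (X \<otimes> Y))) oo ?L ?Z"
   unfolding T_def by (simp add: sh_Str diag)
  also have "... = ($[M] ** (lsh_rsh X ** lsh_rsh Y)) oo ($[M] ** lsh_tens (rsh X) (rsh Y)) oo ($[M] ** ?r) oo ?L ?Z"
   by (simp flip: lsh_rsh_tens) (simp add: sh_Str sh_tens_Str diag)
  also have "... = ($[M] ** (lsh_rsh X ** lsh_rsh Y)) oo (($[M] ** lsh_tens (rsh X) (rsh Y)) oo ?L ?W) oo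
     (Str [?Z] (rsh_tens_arr X Y) [?W] ** $[M])"
   by (subst lnat[symmetric]) (simp_all add: sh_Str sh_tens_Str diag)
  also have "($[M] ** lsh_tens (rsh X) (rsh Y)) oo ?L ?W =
    (?L (rsh X) ** $[lsh (rsh Y)]) oo ($[rsh X] ** ?L (rsh Y)) oo (unpack [rsh X, rsh Y] ** $[M])"
   using l by (simp add: left_half_braiding_def)
  also have "($[M] ** (lsh_rsh X ** lsh_rsh Y)) oo ... oo (Str [?Z] (rsh_tens_arr X Y) [?W] ** $[M]) =
    (T X ** $[Y]) oo ($[rsh X] ** T Y) oo ((unpack [rsh X, rsh Y] oo pack [rsh X, rsh Y] oo rsh_tens X Y) ** $[M])"
   using pack_Str[of "rsh_tens_arr X Y" "[?Z]" "[rsh X, rsh Y]"]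
   by (simp add: sh_tens_Str T_def) (simp add: sh_Str diag)
  also have "unpack [rsh X, rsh Y] oo pack [rsh X, rsh Y] oo rsh_tens X Y = rsh_tens X Y"
   using unpack_pack[of "[rsh X, rsh Y]"] by (simp add: strand_scomp flip: scomp_assoc)
  finally have e: "(T X ** $[Y]) oo ($[rsh X] ** T Y) oo (rsh_tens X Y ** $[M]) =
    ($[M] ** unpack [X, Y]) oo T (X \<otimes> Y)" by simp
  have i: "inverses ((T X ** $[Y]) oo ($[rsh X] ** T Y)) (($[rsh X] ** shalf M t Y) oo (shalf M t X ** $[Y]))"
   by (intro inverses_scomp inverses_stens inverses_strand Tt) auto
  have "(($[rsh X] ** shalf M t Y) oo (shalf M t X ** $[Y])) oo ($[M] ** unpack [X, Y]) =
    (rsh_tens X Y ** $[M]) oo shalf M t (X \<otimes> Y)"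
   by (rule inverses_move[OF Tt i]) (simp_all add: e scomp_assoc)
  then show ?thesis by (simp add: scomp_assoc wt_Str)
 qed
 have t: "half_braiding M t"
  unfolding half_braiding_def
 proof (intro conjI ballI unit mult)
  show "t \<in> extensional (Obj C)" by (simp add: t_def)
  show "is_iso C (M \<otimes> X) (rsh X \<otimes> M) (t X)" if "X \<in> Obj C" for X
   using inverses_is_iso[OF inverses_sym[OF Tt[OF that]]] by simp
  show "t Y \<cdot> (idm C M \<star> f) = (rshmap X Y f \<star> idm C M) \<cdot> t X"
   if "X \<in> Obj C" "Y \<in> Obj C" "f \<in> Hom C X Y" for X Y f
   using nat[OF that] that by (simp add: stens_strand1 scomp_def)
 qed
 moreover have "half_left M t X = l X" if [simp]: "X \<in> Obj C" for X
 proof -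
  let ?S = "shalf_left M t X"
  note S = inverses_shalf_left[OF t assms(2) that]
  have "?L X oo ?S = (?L X oo (Str [rsh (lsh X)] (rsh_lsh_arr X) [X] ** $[M])) oo shalf M t (lsh X)"
   by (simp add: shalf_left_def sh_Str diag)
  also have "... = T (lsh X) oo shalf M t (lsh X)"
   by (subst lnat) (simp_all add: T_def lshmap_rsh_lsh)
  also have "... = $[M, lsh X]"
   using Tt[of "lsh X"] by (simp add: inverses_def)
  finally have 1: "?L X oo ?S = $[M, lsh X]" .
  have 2: "Str [X, M] (half_left M t X) [M, lsh X] oo ?S = $[M, lsh X]"
   using S by (simp add: inverses_def)
  have "?L X = Str [X, M] (half_left M t X) [M, lsh X]"
   by (rule inverses_cancel_right[OF S]) (use S in \<open>auto simp: 1 2 inverses_def wt_Str\<close>)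
  then show ?thesis by simp
 qed
 ultimately show ?thesis by blast
qed

lemma half_braiding_morphism_iff:
 assumes t: "half_braiding M t" and s: "half_braiding N s"
  and [simp]: "M \<in> Obj C" "N \<in> Obj C" "f \<in> Hom C M N"
 shows "(\<forall>X \<in> Obj C. (idm C (rsh X) \<star> f) \<cdot> t X = s X \<cdot> (f \<star> idm C X)) \<longleftrightarrow>
  (\<forall>X \<in> Obj C. (Str [M] f [N] ** $[lsh X]) oo Str [X, M] (half_left M t X) [M, lsh X] =
    Str [X, N] (half_left N s X) [N, lsh X] oo ($[X] ** Str [M] f [N]))"
  (is "?A \<longleftrightarrow> ?B")
proof -
 let ?f = "Str [M] f [N]"
 have A: "?A \<longleftrightarrow> (\<forall>X \<in> Obj C. ($[rsh X] ** ?f) oo shalf M t X = shalf N s X oo (?f ** $[X]))"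
  by (simp add: stens_strand1 scomp_def)
 note [simp] = half_braiding_hom[OF t] half_braiding_hom[OF s]
 note M = inverses_shalf_left[OF t assms(3)] and N = inverses_shalf_left[OF s assms(4)]
 have wS [simp]: "wt (shalf_left M t X)" "wt (shalf_left N s X)" if "X \<in> Obj C" for X
  using M[OF that] N[OF that] by (auto simp: inverses_def)
 show ?thesis
 proof
  assume "?A"
  show ?B
  proof
   fix X assume X [simp]: "X \<in> Obj C"
   have "($[X] ** ?f) oo shalf_left M t X =
     (rsh_lsh X ** $[N]) oo ($[rsh (lsh X)] ** ?f) oo shalf M t (lsh X)"
    by (simp add: shalf_left_def sh_Str diag)
   also have "($[rsh (lsh X)] ** ?f) oo shalf M t (lsh X) = shalf N s (lsh X) oo (?f ** $[lsh X])"
    using \<open>?A\<close> A by simp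
   also have "(rsh_lsh X ** $[N]) oo ... = shalf_left N s X oo (?f ** $[lsh X])"
    by (simp add: shalf_left_def sh_Str diag)
   finally have e: "($[X] ** ?f) oo shalf_left M t X = shalf_left N s X oo (?f ** $[lsh X])" .
   show "(?f ** $[lsh X]) oo Str [X, M] (half_left M t X) [M, lsh X] =
     Str [X, N] (half_left N s X) [N, lsh X] oo ($[X] ** ?f)"
    by (rule inverses_move[OF M[OF X] N[OF X] e, symmetric]) (auto simp: wt_Str)
  qed
 next
  assume B: ?B
  have 1: "($[rsh (lsh X)] ** ?f) oo shalf M t (lsh X) = shalf N s (lsh X) oo (?f ** $[lsh X])"
   if [simp]: "X \<in> Obj C" for X
  proof -
   obtain r where r: "inverses (rsh_lsh X) r" using inverses_sh[of X] by auto
   have e: "Str [X, N] (half_left N s X) [N, lsh X] oo ($[X] ** ?f) =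
     (?f ** $[lsh X]) oo Str [X, M] (half_left M t X) [M, lsh X]" using B by simp
   have "shalf_left N s X oo (?f ** $[lsh X]) = ($[X] ** ?f) oo shalf_left M t X"
    by (rule inverses_move[OF inverses_sym[OF M[OF that]] inverses_sym[OF N[OF that]] e[symmetric]])
      (auto simp: wt_Str)
   then have eq: "(rsh_lsh X ** $[N]) oo shalf N s (lsh X) oo (?f ** $[lsh X]) =
     (rsh_lsh X ** $[N]) oo ($[rsh (lsh X)] ** ?f) oo shalf M t (lsh X)"
    by (simp add: shalf_left_def sh_Str diag)
   have i: "inverses (rsh_lsh X ** $[N]) (r ** $[N])"
    using inverses_stens[OF r inverses_strand[of "[N]"]] by simp
   show ?thesis
    by (rule inverses_cancel_left[OF i eq, symmetric]) (auto simp: wt_Str sh_Str)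
  qed
  show ?A unfolding A
  proof
   fix X assume X [simp]: "X \<in> Obj C"
   obtain e where e: "inverses (lsh_rsh X) e" using inverses_sh[of X] by auto
   let ?e = "Str [lsh (rsh X)] (lsh_rsh_arr X) [X]" and ?Y = "lsh (rsh X)"
   let ?e' = "Str [rsh ?Y] (rshmap ?Y X (lsh_rsh_arr X)) [rsh X]"
   have "(($[rsh X] ** ?f) oo shalf M t X) oo ($[M] ** ?e) =
     ($[rsh X] ** ?f) oo (?e' ** $[M]) oo shalf M t ?Y"
    by (subst half_braiding_natural[OF t, symmetric]) (simp_all add: diag)
   also have "... = (?e' ** $[N]) oo (($[rsh ?Y] ** ?f) oo shalf M t ?Y)"
    by (simp add: diag)
   also have "... = ((?e' ** $[N]) oo shalf N s ?Y) oo (?f ** $[?Y])"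
    unfolding 1[OF rsh_obj[OF X]] by (simp add: diag)
   also have "... = (shalf N s X oo (?f ** $[X])) oo ($[M] ** ?e)"
    by (subst half_braiding_natural[OF s, symmetric]) (simp_all add: diag)
   finally have eq: "(($[rsh X] ** ?f) oo shalf M t X) oo ($[M] ** ?e) = ..." .
   have i: "inverses ($[M] ** ?e) ($[M] ** e)"
    using inverses_stens[OF inverses_strand[of "[M]"] e] by (simp add: sh_Str)
   show "($[rsh X] ** ?f) oo shalf M t X = shalf N s X oo (?f ** $[X])"
    by (rule inverses_cancel_right[OF i eq]) (auto simp: wt_Str)
  qed
 qed
qed

subsection \<open>The canonical automorphism\<close>

definition lflat :: "'o => ('o => 'a) => 'o => ('o, 'a) strarr" where
 "lflat M l X = ($[M] ** sevl (LD X)) oo (Str [X, M] (l X) [M, lsh X] ** $[LD X])"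

lemma sdom_lflat [simp]: "sdom (lflat M l X) = [X, M, LD X]"
 and scod_lflat [simp]: "scod (lflat M l X) = [M]"
 by (simp_all add: lflat_def)

lemma coevl_lmap:
 assumes [simp]: "X \<in> Obj C" "Y \<in> Obj C" "f \<in> Hom C X Y"
 shows "($[Y] ** Str [LD Y] (lmap X Y f) [LD X]) oo scoevl Y = (Str [X] f [Y] ** $[LD X]) oo scoevl X"
proof -
 have "($[Y] ** Str [LD Y] (lmap X Y f) [LD X]) oo scoevl Y =
  ((($[Y] ** sevl Y) oo (scoevl Y ** $[Y])) ** $[LD X]) oo (Str [X] f [Y] ** $[LD X]) oo scoevl X"
  unfolding lmap_Str by (simp add: diag)
 then show ?thesis unfolding ldual_zigzag[OF assms(2)] by (simp add: diag)
qed

lemma coevl_tens: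
 assumes [simp]: "X \<in> Obj C" "Y \<in> Obj C"
 shows "scoevl (X \<otimes> Y) = (pack [X, Y] ** ldual_tens X Y) oo ($[X] ** scoevl Y ** $[LD X]) oo scoevl X"
proof -
 have z: "($[X, Y] ** nestl X Y) oo ((($[X] ** scoevl Y ** $[LD X]) oo scoevl X) ** $[X, Y]) = $[X, Y]"
  using dual_pair_nestl[OF assms] unfolding dual_pair_def by blast
 have "(pack [X, Y] ** ldual_tens X Y) oo ($[X] ** scoevl Y ** $[LD X]) oo scoevl X =
  (pack [X, Y] ** $[LD (X \<otimes> Y)]) oo
  ((($[X, Y] ** nestl X Y) oo ((($[X] ** scoevl Y ** $[LD X]) oo scoevl X) ** $[X, Y])) ** $[LD (X \<otimes> Y)]) oo
  (unpack [X, Y] ** $[LD (X \<otimes> Y)]) oo scoevl (X \<otimes> Y)"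
  unfolding ldual_tens_def nestl_def by (simp add: diag)
 also have "... = ((pack [X, Y] oo unpack [X, Y]) ** $[LD (X \<otimes> Y)]) oo scoevl (X \<otimes> Y)"
  unfolding z by (simp add: diag)
 also have "... = scoevl (X \<otimes> Y)"
  unfolding pack_unpack[of "[X, Y]", simplified] by (simp add: diag)
 finally show ?thesis ..
qed

lemma lmap_evl_unit:
 assumes [simp]: "X \<in> Obj C"
 shows "Str [LD \<I>] (lmap (LD X \<otimes> X) \<I> (evl C X)) [LD (LD X \<otimes> X)] oo ldual_unit = ldual_tens (LD X) X oo scoevl (LD X)"
  (is "?m oo _ = ?r")
proof (rule inverses_cancel_right[OF inverses_strand[of "[]"]])
 show "(?m oo ldual_unit) oo $[] = ?r oo $[]"
 proof (rule dual_pair_cancel_left[OF dual_pair_evl[of "LD X \<otimes> X"]])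
  let ?W = "LD X \<otimes> X" and ?p = "pack [LD X, X]"
  have "sevl ?W oo ((?m oo ldual_unit) ** ?p) = (sevl ?W oo (?m ** $[?W])) oo (ldual_unit ** ?p)"
   by (simp add: unit_Str diag)
  also have "... = (sevl \<I> oo (ldual_unit ** $[\<I>])) oo (Str [?W] (evl C X) [\<I>] oo ?p)"
   by (simp add: evl_lmap) (simp add: unit_Str diag)
  also have "... = sevl X"
   unfolding evl_ldual_unit using comp_idl[of ?W \<I> "evl C X"] comp_idr[of ?W \<I> "evl C X"]
   by (simp add: scomp_def unpack_def pack_def)
  also have "... = sevl X oo ((($[LD X] ** sevl (LD X)) oo (scoevl (LD X) ** $[LD X])) ** $[X])"
   unfolding ldual_zigzag[OF ldual_obj[OF assms]] by (simp add: diag)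
  also have "... = nestl (LD X) X oo (scoevl (LD X) ** $[LD X, X])"
   unfolding nestl_def by (simp add: diag)
  also have "... = sevl ?W oo (?r ** ?p)"
   by (simp flip: evl_ldual_tens) (simp add: dual_tens_Str diag)
  finally have e: "sevl ?W oo ((?m oo ldual_unit) ** ?p) = sevl ?W oo (?r ** ?p)" .
  show "sevl ?W oo (((?m oo ldual_unit) oo $[]) ** $[?W]) = sevl ?W oo ((?r oo $[]) ** $[?W])"
  proof (rule inverses_cancel_right)
   show "inverses ?p (unpack [LD X, X])" by (rule inverses_pack) simp
   show "(sevl ?W oo (((?m oo ldual_unit) oo $[]) ** $[?W])) oo ?p = (sevl ?W oo ((?r oo $[]) ** $[?W])) oo ?p"
    using e by (simp add: unit_Str dual_tens_Str diag)
  qed (auto simp: unit_Str dual_tens_Str wt_Str)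
 qed (auto simp: unit_Str dual_tens_Str wt_Str)
qed (auto simp: unit_Str dual_tens_Str wt_Str)

context
 fixes M :: 'o and l :: "'o => 'a"
 assumes l: "left_half_braiding M l" and M [simp]: "M \<in> Obj C"
begin

lemma left_half_braiding_hom [simp]: "X \<in> Obj C ==> l X \<in> Hom C (X \<otimes> M) (M \<otimes> lsh X)"
 using l by (auto simp: left_half_braiding_def is_iso_def)

lemmas left_half_braiding_hom' [simp] = left_half_braiding_hom[unfolded lsh_def]

lemma wt_lflat [simp]: "X \<in> Obj C ==> wt (lflat M l X)"
 by (simp add: lflat_def wt_Str lsh_def)

lemma lflat_natural:
 assumes [simp]: "X \<in> Obj C" "Y \<in> Obj C" "f \<in> Hom C X Y"
 shows "lflat M l Y oo (Str [X] f [Y] ** $[M, LD Y]) =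
  lflat M l X oo ($[X, M] ** Str [LD Y] (lmap X Y f) [LD X])"
proof -
 let ?L = "\<lambda>X. Str [X, M] (l X) [M, lsh X]"
 have "lflat M l Y oo (Str [X] f [Y] ** $[M, LD Y]) =
   ($[M] ** sevl (LD Y)) oo ((?L Y oo (Str [X] f [Y] ** $[M])) ** $[LD Y])"
  unfolding lflat_def by (simp add: diag lsh_def)
 also have "?L Y oo (Str [X] f [Y] ** $[M]) = ($[M] ** Str [lsh X] (lshmap X Y f) [lsh Y]) oo ?L X"
  using l by (simp add: left_half_braiding_def)
 also have "($[M] ** sevl (LD Y)) oo (... ** $[LD Y]) =
   ($[M] ** (sevl (LD Y) oo (Str [lsh X] (lshmap X Y f) [lsh Y] ** $[LD Y]))) oo (?L X ** $[LD Y])"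
  by (simp add: diag lsh_def lshmap_def)
 also have "sevl (LD Y) oo (Str [lsh X] (lshmap X Y f) [lsh Y] ** $[LD Y]) =
   sevl (LD X) oo ($[lsh X] ** Str [LD Y] (lmap X Y f) [LD X])"
  unfolding lsh_def lshmap_def by (simp add: evl_lmap)
 finally show ?thesis unfolding lflat_def by (simp add: diag lsh_def)
qed

lemma lflat_tens:
 assumes [simp]: "X \<in> Obj C" "Y \<in> Obj C"
 shows "lflat M l (X \<otimes> Y) oo (pack [X, Y] ** $[M] ** ldual_tens X Y) =
  lflat M l X oo ($[X] ** lflat M l Y ** $[LD X])"
proof -
 let ?L = "\<lambda>X. Str [X, M] (l X) [M, lsh X]" and ?Z = "lsh (X \<otimes> Y)"
 have "lflat M l (X \<otimes> Y) oo (pack [X, Y] ** $[M] ** ldual_tens X Y) =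
  ($[M] ** (sevl (LD (X \<otimes> Y)) oo ($[?Z] ** ldual_tens X Y))) oo
  (?L (X \<otimes> Y) ** $[LD Y, LD X]) oo (pack [X, Y] ** $[M, LD Y, LD X])"
  unfolding lflat_def by (simp add: dual_tens_Str diag lsh_def)
 also have "... = ($[M] ** nestl (LD Y) (LD X)) oo
   ((($[M] ** lsh_tens X Y) oo ?L (X \<otimes> Y)) ** $[LD Y, LD X]) oo (pack [X, Y] ** $[M, LD Y, LD X])"
  by (simp flip: evl_lsh_tens) (simp add: sh_tens_Str nestl_def diag lsh_def)
 also have "($[M] ** lsh_tens X Y) oo ?L (X \<otimes> Y) =
    (?L X ** $[lsh Y]) oo ($[X] ** ?L Y) oo (unpack [X, Y] ** $[M])"
  using l by (simp add: left_half_braiding_def)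
 also have "($[M] ** nestl (LD Y) (LD X)) oo (... ** $[LD Y, LD X]) oo (pack [X, Y] ** $[M, LD Y, LD X]) =
   lflat M l X oo ($[X] ** lflat M l Y ** $[LD X]) oo ((unpack [X, Y] oo pack [X, Y]) ** $[M, LD Y, LD X])"
  unfolding lflat_def nestl_def by (simp add: diag lsh_def)
 also have "... = lflat M l X oo ($[X] ** lflat M l Y ** $[LD X])"
  unfolding unpack_pack[of "[X, Y]", simplified] by (simp add: strand_stens scomp_strand)
 finally show ?thesis .
qed

lemma lflat_unit: "lflat M l \<I> oo (pack [] ** $[M] ** ldual_unit) = $[M]"
proof -
 let ?L = "Str [\<I>, M] (l \<I>) [M, lsh \<I>]"
 have "lflat M l \<I> oo (pack [] ** $[M] ** ldual_unit) =
   ($[M] ** (sevl (LD \<I>) oo ($[lsh \<I>] ** ldual_unit))) oo ?L oo (pack [] ** $[M])"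
  unfolding lflat_def by (simp add: unit_Str diag lsh_def)
 also have "... = (($[M] ** lsh_unit) oo ?L) oo (pack [] ** $[M])"
  unfolding lsh_unit_eq[symmetric] by (simp add: unit_Str diag)
 also have "($[M] ** lsh_unit) oo ?L = unpack [] ** $[M]"
  using l by (simp add: left_half_braiding_def)
 also have "(unpack [] ** $[M]) oo (pack [] ** $[M]) = (unpack [] oo pack []) ** $[M]"
  by (simp add: diag)
 finally show ?thesis using unpack_pack[of "[]"] by (simp add: strand_stens)
qed

definition saut :: "('o, 'a) strarr" where
 "saut = lflat M l M oo ($[M] ** scoevl M)"

lemma sdom_saut [simp]: "sdom saut = [M]" and scod_saut [simp]: "scod saut = [M]"
 and wt_saut [simp]: "wt saut"
 by (simp_all add: saut_def wt_Str)

text \<open>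
 Naturality of \<open>lflat\<close> in its index, applied to the morphism \<open>lflat M l X : X \<otimes> M \<otimes> X\<^sup>* \<rightarrow> M\<close>
 and to evaluation.
\<close>

lemma saut_lflat:
 assumes X [simp]: "X \<in> Obj C"
 shows "saut oo lflat M l X = lflat M l X oo ($[X] ** saut ** $[LD X])"
proof -
 let ?l = "lflat M l" and ?D = "LD X"
 let ?Z = "M \<otimes> ?D" let ?Y = "X \<otimes> ?Z"
 obtain g where g: "?l X = Str [X, M, ?D] g [M]" and [simp]: "g \<in> Hom C ?Y M"
  using wt_StrE[OF wt_lflat[OF X] sdom_lflat scod_lflat] by auto
 have [simp]: "lmap ?Y M g \<in> Hom C (LD M) (LD ?Y)" by simp
 obtain x where x: "?l M = Str [M, M, LD M] x [M]" and [simp]: "x \<in> Hom C (M \<otimes> M \<otimes> LD M) M"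
  using wt_StrE[OF wt_lflat[OF M] sdom_lflat scod_lflat] by auto
 obtain y where y: "?l ?Y = Str [?Y, M, LD ?Y] y [M]" and [simp]: "y \<in> Hom C (?Y \<otimes> M \<otimes> LD ?Y) M"
  using wt_StrE[OF wt_lflat sdom_lflat scod_lflat, of ?Y] by auto
 obtain z where z: "?l ?Z = Str [?Z, M, LD ?Z] z [M]" and [simp]: "z \<in> Hom C (?Z \<otimes> M \<otimes> LD ?Z) M"
  using wt_StrE[OF wt_lflat sdom_lflat scod_lflat, of ?Z] by auto
 obtain d where d: "?l ?D = Str [?D, M, LD ?D] d [M]" and [simp]: "d \<in> Hom C (?D \<otimes> M \<otimes> LD ?D) M"
  using wt_StrE[OF wt_lflat sdom_lflat scod_lflat, of ?D] by auto
 obtain e where e: "?l (?D \<otimes> X) = Str [?D \<otimes> X, M, LD (?D \<otimes> X)] e [M]" and [simp]: "e \<in> Hom C ((?D \<otimes> X) \<otimes> M \<otimes> LD (?D \<otimes> X)) M"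
  using wt_StrE[OF wt_lflat sdom_lflat scod_lflat, of "?D \<otimes> X"] by auto
 obtain u where u: "?l \<I> = Str [\<I>, M, LD \<I>] u [M]" and [simp]: "u \<in> Hom C (\<I> \<otimes> M \<otimes> LD \<I>) M"
  using wt_StrE[OF wt_lflat sdom_lflat scod_lflat, of "\<I>"] by auto
 note S = g x y z d e u
 let ?p = "pack [X, ?Z] oo ($[X] ** pack [M, ?D])"
 let ?q = "($[X] ** unpack [M, ?D]) oo unpack [X, ?Z]"
 have gp: "Str [?Y] g [M] oo ?p = ?l X" "?l X oo ?q = Str [?Y] g [M]"
 proof -
  have 1: "?p = pack [X, M, ?D]" "?q = unpack [X, M, ?D]"
   unfolding pack_def unpack_def strand_def
   by (simp_all add: single_stens_Cons tensa_id scomp_def comp_idl[of ?Y ?Y])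
  show "Str [?Y] g [M] oo ?p = ?l X" unfolding 1
   using Str_pack[of g "[X, M, ?D]" "[M]"] by (simp add: g)
  show "?l X oo ?q = Str [?Y] g [M]" unfolding 1
   by (simp add: unpack_def g scomp_def comp_idr[of ?Y M])
 qed
 have qp: "?q oo ?p = $[X, M, ?D]"
 proof -
  have "?q oo ?p = ($[X] ** unpack [M, ?D]) oo (unpack [X, ?Z] oo pack [X, ?Z]) oo ($[X] ** pack [M, ?D])"
   by (simp add: scomp_assoc)
  also have "... = $[X] ** (unpack [M, ?D] oo pack [M, ?D])"
   unfolding unpack_pack[of "[X, ?Z]", simplified] by (simp add: diag)
  finally show ?thesis by (simp add: unpack_pack strand_stens)
 qed
 have ev: "?l (?D \<otimes> X) oo (pack [?D, X] ** $[M] ** ldual_tens ?D X) oo ($[?D, X, M] ** scoevl ?D) = sevl X ** $[M]"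
 proof -
  let ?W = "?D \<otimes> X"
  have "?l ?W oo (pack [?D, X] ** $[M] ** ldual_tens ?D X) oo ($[?D, X, M] ** scoevl ?D) =
    ?l ?W oo (pack [?D, X] ** $[M] ** (ldual_tens ?D X oo scoevl ?D))"
   unfolding S by (simp add: dual_tens_Str diag)
  also have "... = (?l ?W oo ($[?W, M] ** Str [LD \<I>] (lmap ?W \<I> (evl C X)) [LD ?W])) oo (pack [?D, X] ** $[M] ** ldual_unit)"
   unfolding lmap_evl_unit[OF X, symmetric] S by (simp add: unit_Str diag)
  also have "... = ?l \<I> oo ((Str [?W] (evl C X) [\<I>] oo pack [?D, X]) ** $[M] ** ldual_unit)"
   by (subst lflat_natural[symmetric]) (simp_all add: S unit_Str diag)
  also have "Str [?W] (evl C X) [\<I>] oo pack [?D, X] = pack [] oo sevl X"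
   using comp_idl[of ?W \<I> "evl C X"] comp_idr[of ?W \<I> "evl C X"]
   by (simp add: scomp_def unpack_def pack_def)
  also have "?l \<I> oo (... ** $[M] ** ldual_unit) = (?l \<I> oo (pack [] ** $[M] ** ldual_unit)) oo (sevl X ** $[M])"
   by (simp add: S unit_Str diag)
  also have "... = sevl X ** $[M]"
   unfolding lflat_unit by (simp add: wt_Str strand_scomp)
  finally show ?thesis .
 qed
 let ?t = "ldual_tens X ?Z oo (ldual_tens M ?D ** $[?D])"
 let ?n = "($[X] ** (($[M] ** scoevl ?D ** $[LD M]) oo scoevl M) ** $[?D]) oo scoevl X"
 have coev: "scoevl ?Y = (?p ** ?t) oo ?n"
  unfolding coevl_tens[OF X tens_obj[OF M ldual_obj[OF X]]] coevl_tens[OF M ldual_obj[OF X]]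
  by (simp add: dual_tens_Str diag)
 have "saut oo ?l X = ?l M oo (?l X ** scoevl M)"
  unfolding saut_def S by (simp add: diag)
 also have "... = (?l M oo (Str [?Y] g [M] ** $[M, LD M])) oo (?p ** scoevl M)"
  unfolding gp(1)[symmetric] x by (simp add: diag)
 also have "... = ?l ?Y oo (?p ** (($[M] ** Str [LD M] (lmap ?Y M g) [LD ?Y]) oo scoevl M))"
  unfolding lflat_natural[OF tens_obj[OF X tens_obj[OF M ldual_obj[OF X]]] M \<open>g \<in> Hom C ?Y M\<close>] y
  by (simp add: diag)
 also have "($[M] ** Str [LD M] (lmap ?Y M g) [LD ?Y]) oo scoevl M = (?l X ** $[LD ?Y]) oo (?q ** $[LD ?Y]) oo scoevl ?Y"
  by (simp add: coevl_lmap flip: gp(2)) (simp add: g diag)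
 also have "... = (?l X ** ?t) oo ((?q oo ?p) ** $[LD ?D, LD M, ?D]) oo ?n"
  unfolding coev S by (simp add: dual_tens_Str diag)
 also have "... = (?l X ** ?t) oo ?n"
  unfolding qp S by (simp add: dual_tens_Str diag)
 also have "?l ?Y oo (?p ** ...) = (?l ?Y oo (?p ** $[M] ** ?t)) oo
   ($[X, M, ?D] ** ?l X ** $[LD ?D, LD M, ?D]) oo ($[X, M, ?D] ** ?n)"
  unfolding S by (simp add: dual_tens_Str diag)
 also have "?l ?Y oo (?p ** $[M] ** ?t) =
   (?l ?Y oo (pack [X, ?Z] ** $[M] ** ldual_tens X ?Z)) oo ($[X] ** pack [M, ?D] ** $[M] ** ldual_tens M ?D ** $[?D])"
  unfolding S by (simp add: dual_tens_Str diag)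
 also have "... = ?l X oo ($[X] ** (?l ?Z oo (pack [M, ?D] ** $[M] ** ldual_tens M ?D)) ** $[?D])"
  unfolding lflat_tens[OF X tens_obj[OF M ldual_obj[OF X]]] unfolding S by (simp add: dual_tens_Str diag)
 also have "... = ?l X oo ($[X] ** (?l M oo ($[M] ** ?l ?D ** $[LD M])) ** $[?D])"
  unfolding lflat_tens[OF M ldual_obj[OF X]] ..
 also have "... oo ($[X, M, ?D] ** ?l X ** $[LD ?D, LD M, ?D]) oo ($[X, M, ?D] ** ?n) =
   ?l X oo ($[X] ** ?l M ** $[?D]) oo ($[X, M] ** (?l ?D oo ($[?D] ** ?l X ** $[LD ?D]))
    ** $[LD M, ?D]) oo ($[X, M, ?D] ** ?n)"
  unfolding S by (simp add: diag)
 also have "... = ?l X oo ($[X] ** ?l M ** $[?D]) oo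
   ($[X, M] ** (?l (?D \<otimes> X) oo (pack [?D, X] ** $[M] ** ldual_tens ?D X) oo ($[?D, X, M] ** scoevl ?D))
    ** $[LD M, ?D]) oo ($[X, M, ?D] ** (($[X] ** scoevl M ** $[?D]) oo scoevl X))"
  unfolding lflat_tens[OF ldual_obj[OF X] X, symmetric] unfolding S by (simp add: dual_tens_Str diag)
 also have "?l (?D \<otimes> X) oo (pack [?D, X] ** $[M] ** ldual_tens ?D X) oo ($[?D, X, M] ** scoevl ?D) = sevl X ** $[M]"
  by (rule ev)
 also have "?l X oo ($[X] ** ?l M ** $[?D]) oo ($[X, M] ** (sevl X ** $[M])
    ** $[LD M, ?D]) oo ($[X, M, ?D] ** (($[X] ** scoevl M ** $[?D]) oo scoevl X)) =
   ?l X oo ($[X] ** saut ** $[?D]) oo ($[X, M] ** ((sevl X ** $[?D]) oo ($[?D] ** scoevl X)))"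
  unfolding saut_def S by (simp add: diag)
 also have "... = ?l X oo ($[X] ** saut ** $[?D])"
  unfolding ldual_zigzag'[OF X] by (simp add: strand_stens scomp_strand)
 finally show ?thesis .
qed

lemma saut_left_half_braiding:
 assumes X [simp]: "X \<in> Obj C"
 shows "(saut ** $[lsh X]) oo Str [X, M] (l X) [M, lsh X] = Str [X, M] (l X) [M, lsh X] oo ($[X] ** saut)"
proof -
 let ?L = "Str [X, M] (l X) [M, lsh X]"
 obtain g where g: "lflat M l X = Str [X, M, LD X] g [M]" and [simp]: "g \<in> Hom C (X \<otimes> M \<otimes> LD X) M"
  using wt_StrE[OF wt_lflat[OF X] sdom_lflat scod_lflat] by auto
 obtain s where s: "saut = Str [M] s [M]" and [simp]: "s \<in> Hom C M M"
  using wt_StrE[OF wt_saut sdom_saut scod_saut] by auto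
 have "?L = ($[M] ** ((sevl (LD X) ** $[lsh X]) oo ($[lsh X] ** scoevl (LD X)))) oo ?L"
  unfolding lsh_def ldual_zigzag'[OF ldual_obj[OF X]] by (simp add: diag)
 also have "... = (lflat M l X ** $[lsh X]) oo ($[X, M] ** scoevl (LD X))"
  unfolding lflat_def by (simp add: diag lsh_def)
 finally have L: "?L = (lflat M l X ** $[lsh X]) oo ($[X, M] ** scoevl (LD X))" .
 have "(saut ** $[lsh X]) oo ?L = ((saut oo lflat M l X) ** $[lsh X]) oo ($[X, M] ** scoevl (LD X))"
  unfolding L g s by (simp add: diag lsh_def)
 also have "... = ?L oo ($[X] ** saut)"
  unfolding saut_lflat[OF X] unfolding L g s by (simp add: diag lsh_def)
 finally show ?thesis .
qed

end

end

section \<open>Braidings of words\<close>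

sublocale rigid_braided_category \<subseteq> braided_data B .

context rigid_braided_category
begin

notation stens (infixr "**" 75) and scomp (infixr "oo" 65) and strand ("$_" [1000] 1000)

lemma braid_hom [simp]: "[|X \<in> Obj B; Y \<in> Obj B|] ==> \<tau> X Y \<in> Hom B (X \<otimes> Y) (Y \<otimes> X)"
 using braid_iso by (auto simp: is_iso_def)

lemma inverses_braid: "[|X \<in> Obj B; Y \<in> Obj B|] ==> inverses (sbraid Y X) (sibraid X Y)"
 unfolding ibraid_def using inverses_arr_inv[of "[Y, X]" "[X, Y]"] braid_iso by simp

lemma ibraid_hom [simp]: "[|X \<in> Obj B; Y \<in> Obj B|] ==> ibraid X Y \<in> Hom B (X \<otimes> Y) (Y \<otimes> X)"
 using inverses_braid[of X Y] by (simp add: inverses_def wt_Str)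

definition br :: "'o list => 'o list => ('o, 'a) strarr" where
 "br Xs Ys = (unpack Ys ** unpack Xs) oo sbraid (word Xs) (word Ys) oo (pack Xs ** pack Ys)"

definition ibr :: "'o list => 'o list => ('o, 'a) strarr" where
 "ibr Xs Ys = (unpack Ys ** unpack Xs) oo sibraid (word Xs) (word Ys) oo (pack Xs ** pack Ys)"

lemma sdom_br [simp]: "sdom (br Xs Ys) = Xs @ Ys" and scod_br [simp]: "scod (br Xs Ys) = Ys @ Xs"
 and sdom_ibr [simp]: "sdom (ibr Xs Ys) = Xs @ Ys" and scod_ibr [simp]: "scod (ibr Xs Ys) = Ys @ Xs"
 by (simp_all add: br_def ibr_def)

lemma inverses_br:
 "[|set Xs <= Obj B; set Ys <= Obj B|] ==> inverses (br Ys Xs) (ibr Xs Ys)"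
proof -
 assume *: "set Xs <= Obj B" "set Ys <= Obj B"
 have "inverses ((unpack Xs ** unpack Ys) oo sbraid (word Ys) (word Xs) oo (pack Ys ** pack Xs))
  (((unpack Ys ** unpack Xs) oo sibraid (word Xs) (word Ys)) oo (pack Xs ** pack Ys))"
  using * by (intro inverses_scomp inverses_stens inverses_braid inverses_pack
    inverses_sym[OF inverses_pack]) auto
 then show ?thesis using * by (simp add: br_def ibr_def scomp_assoc wt_Str)
qed

lemma wt_br [simp]: "[|set Xs <= Obj B; set Ys <= Obj B|] ==> wt (br Xs Ys)"
 and wt_ibr [simp]: "[|set Xs <= Obj B; set Ys <= Obj B|] ==> wt (ibr Xs Ys)"
 using inverses_br[of Ys Xs] inverses_br[of Xs Ys] by (auto simp: inverses_def)

definition "br_arr Xs Ys = sarr (br Xs Ys)"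
definition "ibr_arr Xs Ys = sarr (ibr Xs Ys)"

lemma br_Str: "br Xs Ys = Str (Xs @ Ys) (br_arr Xs Ys) (Ys @ Xs)"
 and ibr_Str: "ibr Xs Ys = Str (Xs @ Ys) (ibr_arr Xs Ys) (Ys @ Xs)"
 unfolding br_arr_def ibr_arr_def by (simp_all add: Str_sarr)

lemma br_arr_hom [simp]:
 assumes "set Xs <= Obj B" "set Ys <= Obj B" "W = word (Xs @ Ys)" "W' = word (Ys @ Xs)"
 shows "br_arr Xs Ys \<in> Hom B W W'" and "ibr_arr Xs Ys \<in> Hom B W W'"
 using wt_br[OF assms(1,2)] wt_ibr[OF assms(1,2)] assms by (simp_all add: br_Str ibr_Str wt_Str)

lemma br_single:
 assumes "X \<in> Obj B" "Y \<in> Obj B"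
 shows "br [X] [Y] = sbraid X Y" "ibr [X] [Y] = sibraid X Y"
proof -
 have *: "pack [Z] = $[Z]" "unpack [Z] = $[Z]" for Z
  by (simp_all add: pack_def unpack_def strand_def)
 show "br [X] [Y] = sbraid X Y" "ibr [X] [Y] = sibraid X Y"
  using assms by (simp_all add: br_def ibr_def * strand_stens strand_scomp scomp_strand wt_Str)
qed

lemma pack_single:
 assumes "wt f"
 shows "pack (scod f) oo f = single f oo pack (sdom f)"
 using assms comp_idl[of "word (sdom f)" "word (scod f)" "sarr f"]
  comp_idr[of "word (sdom f)" "word (scod f)" "sarr f"]
 by (simp add: scomp_def pack_def single_def wt_def)

lemma br_natural:
 assumes "wt f" "wt g" "sdom f = Xs" "sdom g = Ys" "scod f = Xs'" "scod g = Ys'"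
 shows "br Xs' Ys' oo (f ** g) = (g ** f) oo br Xs Ys"
proof -
 note o [simp] = assms(3-)[symmetric] wt_dom[OF assms(1)] wt_dom[OF assms(2)] wt_cod[OF assms(1)] wt_cod[OF assms(2)]
 note [simp] = assms(1,2)
 let ?F = "single f" and ?G = "single g"
 have s: "sbraid (word (scod f)) (word (scod g)) oo (?F ** ?G) = (?G ** ?F) oo sbraid (word (sdom f)) (word (sdom g))"
  using assms(1,2) single_stens_Cons[of "word (sdom f)" "word (scod f)" "word (sdom g)" "[]" "word (scod g)" "[]" "sarr f" "sarr g"]
   single_stens_Cons[of "word (sdom g)" "word (scod g)" "word (sdom f)" "[]" "word (scod f)" "[]" "sarr g" "sarr f"]
   braid_natural[of "word (sdom f)" "word (sdom g)" "word (scod f)" "word (scod g)" "sarr f" "sarr g"]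
  by (simp add: single_def scomp_def wt_def)
 have c: "(unpack (scod h) oo single h) oo pack (sdom h) = h" if "wt h" for h
 proof -
  have "(unpack (scod h) oo single h) oo pack (sdom h) = (unpack (scod h) oo pack (scod h)) oo h"
   using that by (simp add: scomp_assoc wt_dom wt_cod pack_single)
  then show ?thesis using that by (simp add: unpack_pack wt_cod strand_scomp)
 qed
 have u: "unpack (scod h) oo single h = h oo unpack (sdom h)" if "wt h" for h
 proof (rule inverses_cancel_right[OF inverses_pack[OF wt_dom[OF that]]])
  show "(unpack (scod h) oo single h) oo pack (sdom h) = (h oo unpack (sdom h)) oo pack (sdom h)"
   using that by (simp add: c) (simp add: scomp_assoc wt_dom unpack_pack scomp_strand)
 qed (use that in \<open>auto simp: wt_dom wt_cod\<close>)
 have "br Xs' Ys' oo (f ** g) = (unpack (scod g) ** unpack (scod f)) oo sbraid (word (scod f)) (word (scod g)) oo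
   ((pack (scod f) oo f) ** (pack (scod g) oo g))"
  by (simp add: br_def scomp_assoc stens_scomp wt_Str)
 also have "... = (unpack (scod g) ** unpack (scod f)) oo (sbraid (word (scod f)) (word (scod g)) oo (?F ** ?G)) oo
   (pack (sdom f) ** pack (sdom g))"
  by (simp add: pack_single stens_scomp scomp_assoc wt_Str)
 also have "... = ((unpack (scod g) oo ?G) ** (unpack (scod f) oo ?F)) oo sbraid (word (sdom f)) (word (sdom g)) oo
   (pack (sdom f) ** pack (sdom g))"
  unfolding s by (simp add: stens_scomp scomp_assoc wt_Str)
 also have "... = (g ** f) oo br Xs Ys"
  by (simp add: u stens_scomp br_def scomp_assoc wt_Str)
 finally show ?thesis .
qed

lemma ibr_natural:
 assumes "wt f" "wt g" "sdom f = Xs" "sdom g = Ys" "scod f = Xs'" "scod g = Ys'"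
 shows "ibr Xs' Ys' oo (f ** g) = (g ** f) oo ibr Xs Ys"
proof -
 have "set Xs <= Obj B" "set Ys <= Obj B" "set Xs' <= Obj B" "set Ys' <= Obj B"
  using assms wt_dom wt_cod by auto
 then show ?thesis
  by (intro inverses_move[OF inverses_br inverses_br])
    (use assms br_natural[of g f Ys Xs Ys' Xs'] in auto)
qed

lemma hexagon_words:
 assumes [simp]: "X \<in> Obj B" "Y \<in> Obj B" "Z \<in> Obj B"
 shows "br [X] [Y, Z] = ($[Y] ** br [X] [Z]) oo (br [X] [Y] ** $[Z])"
  and "br [X, Y] [Z] = (br [X] [Z] ** $[Y]) oo ($[X] ** br [Y] [Z])"
proof -
 have i1: "arr_inv B (W \<otimes> V) (W \<otimes> V) (idm B (W \<otimes> V)) = idm B (W \<otimes> V)" if "W \<in> Obj B" "V \<in> Obj B" for W V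
  using that by (intro arr_inv_eqI) (auto simp: arr_inverse_def comp_idl[of "W \<otimes> V" "W \<otimes> V"])
 have a [simp]: "assoc B X Y Z \<in> Hom B ((X \<otimes> Y) \<otimes> Z) (X \<otimes> Y \<otimes> Z)" if "X \<in> Obj B" "Y \<in> Obj B" "Z \<in> Obj B" for X Y Z
  using assoc_iso[OF that] by (simp add: is_iso_def)
 have ai [simp]: "arr_inverse B ((X \<otimes> Y) \<otimes> Z) (X \<otimes> Y \<otimes> Z) (assoc B X Y Z) (arr_inv B ((X \<otimes> Y) \<otimes> Z) (X \<otimes> Y \<otimes> Z) (assoc B X Y Z))"
  if "X \<in> Obj B" "Y \<in> Obj B" "Z \<in> Obj B" for X Y Z
  using that by (intro arr_inverse_arr_inv assoc_iso) auto
 then have ai' [simp]: "arr_inv B ((X \<otimes> Y) \<otimes> Z) (X \<otimes> Y \<otimes> Z) (assoc B X Y Z) \<in> Hom B (X \<otimes> Y \<otimes> Z) ((X \<otimes> Y) \<otimes> Z)"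
  if "X \<in> Obj B" "Y \<in> Obj B" "Z \<in> Obj B" for X Y Z
  using that by (simp add: arr_inverse_def)
 have t2 [simp]: "f \<star> g \<in> Hom B (X \<otimes> Y) (X' \<otimes> Y')"
  if "X \<in> Obj B" "Y \<in> Obj B" "X' \<in> Obj B" "Y' \<in> Obj B" "f \<in> Hom B X X'" "g \<in> Hom B Y Y'" for f g X Y X' Y'
  using that by (rule_tac tensa_hom) auto
 have s1: "Str [V, W] f [V', W'] ** $[U] = Str [V, W, U] (assoc B V' W' U \<cdot> (f \<star> idm B U) \<cdot> arr_inv B ((V \<otimes> W) \<otimes> U) (V \<otimes> W \<otimes> U) (assoc B V W U)) [V', W', U]"
  if [simp]: "V \<in> Obj B" "W \<in> Obj B" "V' \<in> Obj B" "W' \<in> Obj B" "U \<in> Obj B" "f \<in> Hom B (V \<otimes> W) (V' \<otimes> W')" for V W V' W' U f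
  unfolding stens_def by (simp add: strand_def tensa_id comp_idl[of "(P \<otimes> Q) \<otimes> R" "P \<otimes> Q \<otimes> R" for P Q R])
 have s2: "Str [V \<otimes> W] f [V', W'] ** $[U] = Str [V \<otimes> W, U] (assoc B V' W' U \<cdot> (f \<star> idm B U)) [V', W', U]"
  if [simp]: "V \<in> Obj B" "W \<in> Obj B" "V' \<in> Obj B" "W' \<in> Obj B" "U \<in> Obj B" "f \<in> Hom B (V \<otimes> W) (V' \<otimes> W')" for V W V' W' U f
  unfolding stens_def
  by (simp add: strand_def tensa_id i1 comp_idl[of "(P \<otimes> Q) \<otimes> R" "P \<otimes> Q \<otimes> R" for P Q R]
    comp_idr[of "(V \<otimes> W) \<otimes> U" "(V' \<otimes> W') \<otimes> U"])
 have s3: "Str [V, W] f [V' \<otimes> W'] ** $[U] = Str [V, W, U] ((f \<star> idm B U) \<cdot> arr_inv B ((V \<otimes> W) \<otimes> U) (V \<otimes> W \<otimes> U) (assoc B V W U)) [V' \<otimes> W', U]"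
  if [simp]: "V \<in> Obj B" "W \<in> Obj B" "V' \<in> Obj B" "W' \<in> Obj B" "U \<in> Obj B" "f \<in> Hom B (V \<otimes> W) (V' \<otimes> W')" for V W V' W' U f
 proof -
  have "(f \<star> idm B U) \<cdot> arr_inv B ((V \<otimes> W) \<otimes> U) (V \<otimes> W \<otimes> U) (assoc B V W U) \<in> Hom B (V \<otimes> W \<otimes> U) ((V' \<otimes> W') \<otimes> U)"
   by (rule comp_hom[of _ "(V \<otimes> W) \<otimes> U"]) auto
  then show ?thesis unfolding stens_def
   by (simp add: strand_def tensa_id comp_idl[of "P \<otimes> Q" "P \<otimes> Q" for P Q]
    comp_idl[of "V \<otimes> W \<otimes> U" "(V' \<otimes> W') \<otimes> U"] comp_idl[of "(P \<otimes> Q) \<otimes> R" "P \<otimes> Q \<otimes> R" for P Q R])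
 qed
 have s4: "$[U] ** Str [V, W] f [V', W'] = Str [U, V, W] (idm B U \<star> f) [U, V', W']"
  "$[U] ** Str [V \<otimes> W] f [V', W'] = Str [U, V \<otimes> W] (idm B U \<star> f) [U, V', W']"
  "$[U] ** Str [V, W] f [V' \<otimes> W'] = Str [U, V, W] (idm B U \<star> f) [U, V' \<otimes> W']"
  if "V \<in> Obj B" "W \<in> Obj B" "V' \<in> Obj B" "W' \<in> Obj B" "U \<in> Obj B" "f \<in> Hom B (V \<otimes> W) (V' \<otimes> W')" for V W V' W' U f
  using that by (simp_all add: strand_def single_stens_Cons)
 have p1: "pack [V] = $[V]" "unpack [V] = $[V]" "pack [V, W] = Str [V, W] (idm B (V \<otimes> W)) [V \<otimes> W]"
  "unpack [V, W] = Str [V \<otimes> W] (idm B (V \<otimes> W)) [V, W]" for V W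
  by (simp_all add: pack_def unpack_def strand_def)
 let ?i = "arr_inv B ((X \<otimes> Y) \<otimes> Z) (X \<otimes> Y \<otimes> Z) (assoc B X Y Z)"
 have h1: "assoc B Y Z X \<cdot> \<tau> X (Y \<otimes> Z) = (idm B Y \<star> \<tau> X Z) \<cdot> (assoc B Y X Z \<cdot> (\<tau> X Y \<star> idm B Z) \<cdot> ?i)"
 proof -
  have "Str [X \<otimes> Y \<otimes> Z] (assoc B Y Z X) [Y \<otimes> Z \<otimes> X] = Str [X \<otimes> Y \<otimes> Z] (assoc B Y Z X) [Y \<otimes> Z \<otimes> X]" ..
  let ?S = "\<lambda>X f Y. Str [X] f [Y]"
  have e: "?S ((Y \<otimes> Z) \<otimes> X) (assoc B Y Z X) (Y \<otimes> Z \<otimes> X) oo ?S (X \<otimes> Y \<otimes> Z) (\<tau> X (Y \<otimes> Z)) ((Y \<otimes> Z) \<otimes> X) oo ?S ((X \<otimes> Y) \<otimes> Z) (assoc B X Y Z) (X \<otimes> Y \<otimes> Z)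
   = ?S (Y \<otimes> X \<otimes> Z) (idm B Y \<star> \<tau> X Z) (Y \<otimes> Z \<otimes> X) oo ?S ((Y \<otimes> X) \<otimes> Z) (assoc B Y X Z) (Y \<otimes> X \<otimes> Z) oo ?S ((X \<otimes> Y) \<otimes> Z) (\<tau> X Y \<star> idm B Z) ((Y \<otimes> X) \<otimes> Z)"
   using hexagon[OF assms] by (simp add: scomp_def)
  have i: "inverses (?S ((X \<otimes> Y) \<otimes> Z) (assoc B X Y Z) (X \<otimes> Y \<otimes> Z)) (?S (X \<otimes> Y \<otimes> Z) ?i ((X \<otimes> Y) \<otimes> Z))"
   by (subst inverses_iff) auto
  have "?S ((Y \<otimes> Z) \<otimes> X) (assoc B Y Z X) (Y \<otimes> Z \<otimes> X) oo ?S (X \<otimes> Y \<otimes> Z) (\<tau> X (Y \<otimes> Z)) ((Y \<otimes> Z) \<otimes> X) =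
    ?S (Y \<otimes> X \<otimes> Z) (idm B Y \<star> \<tau> X Z) (Y \<otimes> Z \<otimes> X) oo ?S ((Y \<otimes> X) \<otimes> Z) (assoc B Y X Z) (Y \<otimes> X \<otimes> Z) oo ?S ((X \<otimes> Y) \<otimes> Z) (\<tau> X Y \<star> idm B Z) ((Y \<otimes> X) \<otimes> Z) oo ?S (X \<otimes> Y \<otimes> Z) ?i ((X \<otimes> Y) \<otimes> Z)"
   by (rule inverses_cancel_right[OF i]) (use i e in \<open>auto simp: inverses_def wt_Str scomp_assoc scomp_strand\<close>)
  then show ?thesis by (simp add: scomp_def)
 qed
 have "br [X] [Y, Z] = Str [X, Y, Z] (assoc B Y Z X \<cdot> \<tau> X (Y \<otimes> Z)) [Y, Z, X]"
  unfolding br_def p1 by (simp add: s2 s4 scomp_def tensa_id comp_idr[of "(Y \<otimes> Z) \<otimes> X" "Y \<otimes> Z \<otimes> X"]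
    comp_idr[of "X \<otimes> Y \<otimes> Z" "(Y \<otimes> Z) \<otimes> X"])
 then show "br [X] [Y, Z] = ($[Y] ** br [X] [Z]) oo (br [X] [Y] ** $[Z])"
  by (simp add: br_single s1 s4 h1 scomp_def)
 have h2: "\<tau> (X \<otimes> Y) Z \<cdot> ?i = (assoc B Z X Y \<cdot> (\<tau> X Z \<star> idm B Y) \<cdot>
     arr_inv B ((X \<otimes> Z) \<otimes> Y) (X \<otimes> (Z \<otimes> Y)) (assoc B X Z Y)) \<cdot> (idm B X \<star> \<tau> Y Z)"
 proof -
  let ?S = "\<lambda>X f Y. Str [X] f [Y]"
  let ?j = "arr_inv B ((X \<otimes> Z) \<otimes> Y) (X \<otimes> (Z \<otimes> Y)) (assoc B X Z Y)"
  have e: "?S ((X \<otimes> Y) \<otimes> Z) (\<tau> (X \<otimes> Y) Z) (Z \<otimes> X \<otimes> Y) = ?S ((Z \<otimes> X) \<otimes> Y) (assoc B Z X Y) (Z \<otimes> X \<otimes> Y) oo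
   ?S ((X \<otimes> Z) \<otimes> Y) (\<tau> X Z \<star> idm B Y) ((Z \<otimes> X) \<otimes> Y) oo ?S (X \<otimes> Z \<otimes> Y) ?j ((X \<otimes> Z) \<otimes> Y) oo
   ?S (X \<otimes> Y \<otimes> Z) (idm B X \<star> \<tau> Y Z) (X \<otimes> Z \<otimes> Y) oo ?S ((X \<otimes> Y) \<otimes> Z) (assoc B X Y Z) (X \<otimes> Y \<otimes> Z)"
   using hexagon'[OF assms] by (simp add: scomp_def)
  have i: "inverses (?S ((X \<otimes> Y) \<otimes> Z) (assoc B X Y Z) (X \<otimes> Y \<otimes> Z)) (?S (X \<otimes> Y \<otimes> Z) ?i ((X \<otimes> Y) \<otimes> Z))"
   by (subst inverses_iff) auto
  have "?S ((X \<otimes> Y) \<otimes> Z) (\<tau> (X \<otimes> Y) Z) (Z \<otimes> X \<otimes> Y) oo ?S (X \<otimes> Y \<otimes> Z) ?i ((X \<otimes> Y) \<otimes> Z) =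
   (?S ((Z \<otimes> X) \<otimes> Y) (assoc B Z X Y) (Z \<otimes> X \<otimes> Y) oo ?S ((X \<otimes> Z) \<otimes> Y) (\<tau> X Z \<star> idm B Y) ((Z \<otimes> X) \<otimes> Y) oo
    ?S (X \<otimes> Z \<otimes> Y) ?j ((X \<otimes> Z) \<otimes> Y)) oo ?S (X \<otimes> Y \<otimes> Z) (idm B X \<star> \<tau> Y Z) (X \<otimes> Z \<otimes> Y)"
   using i unfolding e by (simp add: scomp_assoc wt_Str inverses_def scomp_strand)
  then show ?thesis by (simp add: scomp_def)
 qed
 have "br [X, Y] [Z] = Str [X, Y, Z] (\<tau> (X \<otimes> Y) Z \<cdot> ?i) [Z, X, Y]"
 proof -
  have "\<tau> (X \<otimes> Y) Z \<cdot> ?i \<in> Hom B (X \<otimes> Y \<otimes> Z) (Z \<otimes> X \<otimes> Y)" by (rule comp_hom[of _ "(X \<otimes> Y) \<otimes> Z"]) auto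
  then show ?thesis unfolding br_def p1
   by (simp add: s3 s4 scomp_def tensa_id comp_idl[of "X \<otimes> Y \<otimes> Z" "(X \<otimes> Y) \<otimes> Z"] comp_idl[of "X \<otimes> Y \<otimes> Z" "Z \<otimes> X \<otimes> Y"])
 qed
 then show "br [X, Y] [Z] = (br [X] [Z] ** $[Y]) oo ($[X] ** br [Y] [Z])"
  by (simp add: br_single s1 s4 h2 scomp_def)
qed

lemma
 assumes [simp]: "set Xs <= Obj B" "set Ys <= Obj B" "set Zs <= Obj B"
 shows br_append_right: "br Xs (Ys @ Zs) = ($Ys ** br Xs Zs) oo (br Xs Ys ** $Zs)"
  and br_append_left: "br (Xs @ Ys) Zs = (br Xs Zs ** $Ys) oo ($Xs ** br Ys Zs)"
proof -
 let ?X = "word Xs" and ?Y = "word Ys" and ?Z = "word Zs"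
 let ?x = "pack Xs" and ?y = "pack Ys" and ?z = "pack Zs"
 show "br Xs (Ys @ Zs) = ($Ys ** br Xs Zs) oo (br Xs Ys ** $Zs)"
 proof (rule inverses_cancel_left)
  show "inverses (?y ** ?z ** ?x) (unpack Ys ** unpack Zs ** unpack Xs)"
   by (intro inverses_stens inverses_pack) auto
  have "(?y ** ?z ** ?x) oo br Xs (Ys @ Zs) = br [?X] [?Y, ?Z] oo (?x ** (?y ** ?z))"
   using br_natural[of ?x "?y ** ?z" Xs "Ys @ Zs" "[?X]" "[?Y, ?Z]"] by (simp add: stens_assoc)
  also have "... = ($[?Y] ** br [?X] [?Z]) oo (br [?X] [?Y] ** $[?Z]) oo ((?x ** ?y) ** ?z)"
   by (simp add: hexagon_words scomp_assoc stens_assoc)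
  also have "(br [?X] [?Y] ** $[?Z]) oo ((?x ** ?y) ** ?z) = (br [?X] [?Y] oo (?x ** ?y)) ** ?z"
   by (simp add: strand_scomp flip: stens_scomp)
  also have "... = ((?y ** ?x) oo br Xs Ys) ** ?z"
   using br_natural[of ?x ?y Xs Ys] by simp
  also have "($[?Y] ** br [?X] [?Z]) oo ... = ($[?Y] ** br [?X] [?Z]) oo (?y ** ?x ** ?z) oo (br Xs Ys ** $Zs)"
   using stens_scomp[of "?y ** ?x" "br Xs Ys" ?z "$Zs"] by (simp add: scomp_strand stens_assoc)
  also have "... = (?y ** (br [?X] [?Z] oo (?x ** ?z))) oo (br Xs Ys ** $Zs)"
   using stens_scomp[of "$[?Y]" ?y "br [?X] [?Z]" "?x ** ?z"] by (simp add: strand_scomp scomp_assoc)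
  also have "... = (?y ** ((?z ** ?x) oo br Xs Zs)) oo (br Xs Ys ** $Zs)"
   using br_natural[of ?x ?z Xs Zs] by simp
  also have "... = (?y ** ?z ** ?x) oo ($Ys ** br Xs Zs) oo (br Xs Ys ** $Zs)"
   using stens_scomp[of ?y "$Ys" "?z ** ?x" "br Xs Zs"] by (simp add: scomp_strand scomp_assoc)
  finally show "(?y ** ?z ** ?x) oo br Xs (Ys @ Zs) = ..." .
 qed auto
 show "br (Xs @ Ys) Zs = (br Xs Zs ** $Ys) oo ($Xs ** br Ys Zs)"
 proof (rule inverses_cancel_left)
  show "inverses (?z ** ?x ** ?y) (unpack Zs ** unpack Xs ** unpack Ys)"
   by (intro inverses_stens inverses_pack) auto
  have "(?z ** ?x ** ?y) oo br (Xs @ Ys) Zs = br [?X, ?Y] [?Z] oo ((?x ** ?y) ** ?z)"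
   using br_natural[of "?x ** ?y" ?z "Xs @ Ys" Zs "[?X, ?Y]" "[?Z]"] by simp
  also have "... = (br [?X] [?Z] ** $[?Y]) oo ($[?X] ** br [?Y] [?Z]) oo (?x ** (?y ** ?z))"
   by (simp add: hexagon_words scomp_assoc stens_assoc)
  also have "($[?X] ** br [?Y] [?Z]) oo (?x ** (?y ** ?z)) = ?x ** (br [?Y] [?Z] oo (?y ** ?z))"
   by (simp add: strand_scomp flip: stens_scomp)
  also have "... = ?x ** ((?z ** ?y) oo br Ys Zs)"
   using br_natural[of ?y ?z Ys Zs] by simp
  also have "(br [?X] [?Z] ** $[?Y]) oo ... = (br [?X] [?Z] ** $[?Y]) oo ((?x ** ?z) ** ?y) oo ($Xs ** br Ys Zs)"
   using stens_scomp[of ?x "$Xs" "?z ** ?y" "br Ys Zs"] by (simp add: scomp_strand stens_assoc)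
  also have "... = ((br [?X] [?Z] oo (?x ** ?z)) ** ?y) oo ($Xs ** br Ys Zs)"
   using stens_scomp[of "br [?X] [?Z]" "?x ** ?z" "$[?Y]" ?y] by (simp add: strand_scomp scomp_assoc)
  also have "... = (((?z ** ?x) oo br Xs Zs) ** ?y) oo ($Xs ** br Ys Zs)"
   using br_natural[of ?x ?z Xs Zs] by simp
  also have "... = (?z ** ?x ** ?y) oo (br Xs Zs ** $Ys) oo ($Xs ** br Ys Zs)"
   using stens_scomp[of "?z ** ?x" "br Xs Zs" ?y "$Ys"] by (simp add: scomp_strand scomp_assoc stens_assoc)
  finally show "(?z ** ?x ** ?y) oo br (Xs @ Ys) Zs = ..." .
 qed auto
qed

lemma
 assumes [simp]: "set Xs <= Obj B" "set Ys <= Obj B" "set Zs <= Obj B"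
 shows ibr_append_right: "ibr Xs (Ys @ Zs) = ($Ys ** ibr Xs Zs) oo (ibr Xs Ys ** $Zs)"
  and ibr_append_left: "ibr (Xs @ Ys) Zs = (ibr Xs Zs ** $Ys) oo ($Xs ** ibr Ys Zs)"
proof -
 have "inverses ((br Ys Xs ** $Zs) oo ($Ys ** br Zs Xs))
   (($Ys ** ibr Xs Zs) oo (ibr Xs Ys ** $Zs))"
  by (intro inverses_scomp inverses_stens inverses_br inverses_strand) auto
 then show "ibr Xs (Ys @ Zs) = ($Ys ** ibr Xs Zs) oo (ibr Xs Ys ** $Zs)"
  using inverses_br[of Xs "Ys @ Zs"] inverses_unique by (simp add: br_append_left)
 have "inverses (($Xs ** br Zs Ys) oo (br Zs Xs ** $Ys))
   ((ibr Xs Zs ** $Ys) oo ($Xs ** ibr Ys Zs))"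
  by (intro inverses_scomp inverses_stens inverses_br inverses_strand) auto
 then show "ibr (Xs @ Ys) Zs = (ibr Xs Zs ** $Ys) oo ($Xs ** ibr Ys Zs)"
  using inverses_br[of "Xs @ Ys" Zs] inverses_unique by (simp add: br_append_right)
qed

lemma br_Nil:
 assumes X: "set Xs <= Obj B"
 shows "br [] Xs = $Xs" "br Xs [] = $Xs" "ibr [] Xs = $Xs" "ibr Xs [] = $Xs"
proof -
 have idem: "f = $Xs" if f: "f oo f = f" "inverses f g" "sdom f = Xs" "scod f = Xs" for f g
 proof (rule inverses_cancel_right[OF f(2)])
  show "f oo f = $Xs oo f" unfolding f(1) using f(2-) by (simp add: inverses_def strand_scomp)
 qed (use f X in \<open>auto simp: inverses_def\<close>)
 have e: "set [] <= Obj B" by simp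
 note i = inverses_br[OF e X] inverses_br[OF X e]
 show "br [] Xs = $Xs"
  by (rule idem[OF _ i(2)]) (use br_append_left[OF e e X] X in \<open>simp_all add: stens_unit_left stens_unit_right\<close>)
 show "br Xs [] = $Xs"
  by (rule idem[OF _ i(1)]) (use br_append_right[OF X e e] X in \<open>simp_all add: stens_unit_left stens_unit_right\<close>)
 show "ibr [] Xs = $Xs"
  by (rule idem[OF _ inverses_sym[OF i(1)]]) (use ibr_append_left[OF e e X] X in \<open>simp_all add: stens_unit_left stens_unit_right\<close>)
 show "ibr Xs [] = $Xs"
  by (rule idem[OF _ inverses_sym[OF i(2)]]) (use ibr_append_right[OF X e e] X in \<open>simp_all add: stens_unit_left stens_unit_right\<close>)
qed

lemma br_Cons_left:
 assumes "X \<in> Obj B" "set (Y # Ys) <= Obj B" "set Zs <= Obj B"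
 shows "br (X # Y # Ys) Zs = (br [X] Zs ** $(Y # Ys)) oo ($[X] ** br (Y # Ys) Zs)"
  and "ibr (X # Y # Ys) Zs = (ibr [X] Zs ** $(Y # Ys)) oo ($[X] ** ibr (Y # Ys) Zs)"
 using assms br_append_left[of "[X]" "Y # Ys" Zs] ibr_append_left[of "[X]" "Y # Ys" Zs] by simp_all

lemma br_Cons_right:
 assumes "X \<in> Obj B" "set (Y # Ys) <= Obj B" "Z \<in> Obj B"
 shows "br [X] (Z # Y # Ys) = ($[Z] ** br [X] (Y # Ys)) oo (br [X] [Z] ** $(Y # Ys))"
  and "ibr [X] (Z # Y # Ys) = ($[Z] ** ibr [X] (Y # Ys)) oo (ibr [X] [Z] ** $(Y # Ys))"
 using assms br_append_right[of "[X]" "[Z]" "Y # Ys"] ibr_append_right[of "[X]" "[Z]" "Y # Ys"] by simp_all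

lemmas br_simps = br_Nil br_Cons_left br_Cons_right br_single

lemma br_ibr: "[|set Xs <= Obj B; set Ys <= Obj B|] ==> br Ys Xs oo ibr Xs Ys = $(Xs @ Ys)"
 and ibr_br: "[|set Xs <= Obj B; set Ys <= Obj B|] ==> ibr Xs Ys oo br Ys Xs = $(Ys @ Xs)"
 using inverses_br[of Xs Ys] by (simp_all add: inverses_def)

end

section \<open>Pivots and anti-twists\<close>

locale pivotal_braided_category = rigid_braided_category B
 for B :: "('k::field, 'o, 'a, 'z) brcat_scheme" (structure) +
 fixes \<rho> :: "'o => 'a"
 assumes pivot: "pivot \<rho>"
begin

notation stens (infixr "**" 75) and scomp (infixr "oo" 65) and strand ("$_" [1000] 1000)

lemma pivot_iso: "X \<in> Obj B ==> is_iso B X (lsh X) (\<rho> X)"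
 using pivot by (simp add: pivot_def)

lemma pivot_hom [simp]: "X \<in> Obj B ==> \<rho> X \<in> Hom B X (lsh X)"
 using pivot_iso by (auto simp: is_iso_def)

lemmas pivot_hom' [simp] = pivot_hom[unfolded lsh_def]

definition "pivot_inv X = arr_inv B X (lsh X) (\<rho> X)"

lemma inverses_pivot: "X \<in> Obj B ==> inverses (spivot \<rho> X) (Str [lsh X] (pivot_inv X) [X])"
 unfolding pivot_inv_def using inverses_arr_inv[of "[X]" "[lsh X]"] pivot_iso by simp

lemma pivot_inv_hom [simp]: "X \<in> Obj B ==> pivot_inv X \<in> Hom B (lsh X) X"
 using inverses_pivot by (simp add: inverses_def wt_Str)

lemmas pivot_inv_hom' [simp] = pivot_inv_hom[unfolded lsh_def]

definition evp :: "'o => ('o, 'a) strarr" where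
 "evp X = sevl (LD X) oo (spivot \<rho> X ** $[LD X])"

definition coevp :: "'o => ('o, 'a) strarr" where
 "coevp X = ($[LD X] ** Str [lsh X] (pivot_inv X) [X]) oo scoevl (LD X)"

definition "evp_arr X = sarr (evp X)"

lemma evp_Str: "evp X = Str [X, LD X] (evp_arr X) []"
 unfolding evp_arr_def by (rule Str_sarr[symmetric]) (simp_all add: evp_def)

lemma evp_hom [simp]: "X \<in> Obj B ==> evp_arr X \<in> Hom B (X \<otimes> LD X) \<I>"
proof -
 assume "X \<in> Obj B"
 then have "wt (evp X)" by (simp add: evp_def wt_Str lsh_def)
 then show ?thesis by (simp add: evp_Str wt_Str)
qed

lemma dual_pair_evp:
 assumes [simp]: "X \<in> Obj B"
 shows "dual_pair [X] [LD X] (evp X) (coevp X)"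
proof -
 let ?r = "spivot \<rho> X" and ?s = "Str [lsh X] (pivot_inv X) [X]"
 have rs: "?r oo ?s = $[lsh X]" "?s oo ?r = $[X]"
  using inverses_pivot[of X] by (simp_all add: inverses_def)
 have "($[LD X] ** evp X) oo (coevp X ** $[LD X]) =
   ($[LD X] ** sevl (LD X)) oo ($[LD X] ** (?r oo ?s) ** $[LD X]) oo (scoevl (LD X) ** $[LD X])"
  unfolding evp_def coevp_def by (simp add: diag lsh_def)
 also have "... = ($[LD X] ** sevl (LD X)) oo (scoevl (LD X) ** $[LD X])"
  unfolding rs by (simp add: diag lsh_def)
 also have "... = $[LD X]" by (simp add: ldual_zigzag)
 finally have 1: "($[LD X] ** evp X) oo (coevp X ** $[LD X]) = $[LD X]" .
 have "(evp X ** $[X]) oo ($[X] ** coevp X) =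
   ?s oo ((sevl (LD X) ** $[LD (LD X)]) oo ($[LD (LD X)] ** scoevl (LD X))) oo ?r"
  unfolding evp_def coevp_def by (simp add: diag lsh_def)
 also have "... = ?s oo ?r"
  unfolding ldual_zigzag'[OF ldual_obj[OF assms]] by (simp add: diag lsh_def)
 finally have 2: "(evp X ** $[X]) oo ($[X] ** coevp X) = $[X]" unfolding rs .
 have "wt (evp X)" "wt (coevp X)" by (simp_all add: evp_def coevp_def wt_Str lsh_def)
 then show ?thesis using 1 2 by (simp add: dual_pair_def) (simp add: evp_Str coevp_def)
qed

lemma evp_natural:
 assumes [simp]: "X \<in> Obj B" "Y \<in> Obj B" "f \<in> Hom B X Y"
 shows "evp Y oo (Str [X] f [Y] ** $[LD Y]) = evp X oo ($[X] ** Str [LD Y] (lmap X Y f) [LD X])"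
proof -
 let ?l = "Str [lsh X] (lshmap X Y f) [lsh Y]"
 have "\<rho> Y \<cdot> f = lshmap X Y f \<cdot> \<rho> X" using pivot by (simp add: pivot_def)
 then have n: "spivot \<rho> Y oo Str [X] f [Y] = ?l oo spivot \<rho> X" by (simp add: scomp_def)
 have "evp Y oo (Str [X] f [Y] ** $[LD Y]) = sevl (LD Y) oo ((spivot \<rho> Y oo Str [X] f [Y]) ** $[LD Y])"
  unfolding evp_def by (simp add: diag lsh_def)
 also have "... = (sevl (LD Y) oo (?l ** $[LD Y])) oo (spivot \<rho> X ** $[LD Y])"
  unfolding n by (simp add: diag lsh_def lshmap_def)
 also have "sevl (LD Y) oo (?l ** $[LD Y]) = sevl (LD X) oo ($[lsh X] ** Str [LD Y] (lmap X Y f) [LD X])"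
  unfolding lsh_def lshmap_def by (simp add: evl_lmap)
 also have "... oo (spivot \<rho> X ** $[LD Y]) = evp X oo ($[X] ** Str [LD Y] (lmap X Y f) [LD X])"
  unfolding evp_def by (simp add: diag lsh_def)
 finally show ?thesis .
qed

lemma evp_tens:
 assumes [simp]: "X \<in> Obj B" "Y \<in> Obj B"
 shows "evp (X \<otimes> Y) oo (pack [X, Y] ** ldual_tens X Y) = evp X oo ($[X] ** evp Y ** $[LD X])"
proof -
 let ?Z = "lsh (X \<otimes> Y)"
 have p: "lsh_tens X Y oo spivot \<rho> (X \<otimes> Y) = (spivot \<rho> X ** spivot \<rho> Y) oo unpack [X, Y]"
  using pivot by (simp add: pivot_def)
 have "evp (X \<otimes> Y) oo (pack [X, Y] ** ldual_tens X Y) =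
   (sevl (LD (X \<otimes> Y)) oo ($[?Z] ** ldual_tens X Y)) oo ((spivot \<rho> (X \<otimes> Y) oo pack [X, Y]) ** $[LD Y, LD X])"
  unfolding evp_def by (simp add: dual_tens_Str diag lsh_def)
 also have "... = nestl (LD Y) (LD X) oo ((lsh_tens X Y oo spivot \<rho> (X \<otimes> Y)) ** $[LD Y, LD X]) oo (pack [X, Y] ** $[LD Y, LD X])"
  by (simp flip: evl_lsh_tens) (simp add: nestl_def sh_tens_Str diag lsh_def)
 also have "... = nestl (LD Y) (LD X) oo ((spivot \<rho> X ** spivot \<rho> Y) ** $[LD Y, LD X]) oo
   ((unpack [X, Y] oo pack [X, Y]) ** $[LD Y, LD X])"
  unfolding p by (simp add: nestl_def diag lsh_def)
 also have "... = evp X oo ($[X] ** evp Y ** $[LD X])"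
  unfolding unpack_pack[of "[X, Y]", simplified] by (simp add: nestl_def evp_def diag lsh_def)
 finally show ?thesis .
qed

abbreviation stw :: "'o => ('o, 'a) strarr" where
 "stw M \<equiv> Str [M] (anti_twist \<rho> M) [M]"

lemma stw_eq:
 assumes [simp]: "M \<in> Obj B"
 shows "stw M = ($[M] ** evp M) oo (ibr [M] [M] ** $[LD M]) oo ($[M] ** scoevl M)"
proof -
 have "stw M = ($[M] ** sevl (LD M)) oo ((($[M] ** spivot \<rho> M) oo sibraid M M) ** $[LD M]) oo
   ($[M] ** scoevl M)"
  unfolding anti_twist_def by (rule Str_sarr) auto
 then show ?thesis
  unfolding evp_def br_single[OF assms assms] by (simp add: diag lsh_def)
qed

lemma anti_twist_hom [simp]: "M \<in> Obj B ==> anti_twist \<rho> M \<in> Hom B M M"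
proof -
 assume [simp]: "M \<in> Obj B"
 have "wt (stw M)" unfolding stw_eq[OF \<open>M \<in> Obj B\<close>] by (simp add: evp_Str wt_Str)
 then show ?thesis by (simp add: wt_Str)
qed

text \<open>The right-hand side turns the last leg of \<open>v\<close> around to the left, over the top of the diagram.\<close>

lemma stw_rotate:
 assumes [simp]: "M \<in> Obj B" "set Zs <= Obj B" and v: "wt v" "sdom v = Zs @ [M]" "scod v = []"
 shows "v oo ibr [M] Zs oo (stw M ** $Zs) =
  evp M oo ($[M] ** v ** $[LD M]) oo ($(M # Zs) ** scoevl M)"
proof -
 have "$[M] ** v = ibr [M] [] oo ($[M] ** v)"
  using v by (simp add: br_Nil strand_scomp)
 also have "... = (v ** $[M]) oo ibr [M] (Zs @ [M])"
  using v by (simp add: ibr_natural)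
 also have "... = (v ** $[M]) oo ($Zs ** ibr [M] [M]) oo (ibr [M] Zs ** $[M])"
  by (simp add: ibr_append_right)
 finally have e: "$[M] ** v = (v ** $[M]) oo ($Zs ** ibr [M] [M]) oo (ibr [M] Zs ** $[M])" .
 have we [simp]: "wt (evp M)" "sdom (evp M) = [M, LD M]" "scod (evp M) = []"
  by (simp_all add: evp_Str wt_Str)
 have ev: "evp M oo (v ** $[M, LD M]) = v oo ($Zs ** $[M] ** evp M)"
  using v stens_scomp[of "$[]" v "evp M" "$[M, LD M]"]
   stens_scomp[of v "$(Zs @ [M])" "$[]" "evp M"]
  by (simp add: stens_unit_left stens_unit_right strand_scomp scomp_strand strand_stens flip: stens_assoc)
 have coev: "(ibr [M] Zs ** $[M, LD M]) oo ($(M # Zs) ** scoevl M) = ($Zs ** $[M] ** scoevl M) oo ibr [M] Zs"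
  using stens_scomp[of "ibr [M] Zs" "$(M # Zs)" "$[M, LD M]" "scoevl M"]
   stens_scomp[of "$(Zs @ [M])" "ibr [M] Zs" "scoevl M" "$[]"]
  by (simp add: stens_unit_left stens_unit_right strand_scomp scomp_strand wt_Str strand_stens flip: stens_assoc)
 let ?i = "$Zs ** ibr [M] [M] ** $[LD M]"
 have pad3: "(f oo g oo h) ** $[LD M] = (f ** $[LD M]) oo (g ** $[LD M]) oo (h ** $[LD M])"
  if "wt f" "wt g" "wt h" "sdom f = scod g" "sdom g = scod h" for f g h
  using that stens_scomp[of f "g oo h" "$[LD M]" "$[LD M]"] stens_scomp[of g h "$[LD M]" "$[LD M]"]
  by (simp add: scomp_strand)
 have "$[M] ** v ** $[LD M] = ((v ** $[M]) oo ($Zs ** ibr [M] [M]) oo (ibr [M] Zs ** $[M])) ** $[LD M]"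
  using v by (simp add: stens_assoc flip: e)
 then have e': "$[M] ** v ** $[LD M] = (v ** $[M, LD M]) oo ?i oo (ibr [M] Zs ** $[M, LD M])"
  using v by (simp add: pad3 stens_assoc strand_stens)
 have assoc3: "a oo (b oo c oo d) oo x = (a oo b) oo c oo (d oo x)"
  if "wt a" "wt b" "wt c" "wt d" "wt x" "sdom a = scod b" "sdom b = scod c" "sdom c = scod d" "sdom d = scod x" for a b c d x
  using that by (simp add: scomp_assoc)
 have assoc3': "(v oo b) oo c oo (d oo x) = v oo (b oo c oo d) oo x"
  if "wt b" "wt c" "wt d" "wt x" "sdom v = scod b" "sdom b = scod c" "sdom c = scod d" "sdom d = scod x" for b c d x
  using that v by (simp add: scomp_assoc)
 have st: "($Zs ** $[M] ** evp M) oo ?i oo ($Zs ** $[M] ** scoevl M) = $Zs ** stw M"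
  unfolding stw_eq[OF assms(1)] by (simp add: strand_scomp wt_Str flip: stens_scomp)
 have "evp M oo ($[M] ** v ** $[LD M]) oo ($(M # Zs) ** scoevl M) =
   (evp M oo (v ** $[M, LD M])) oo ?i oo ((ibr [M] Zs ** $[M, LD M]) oo ($(M # Zs) ** scoevl M))"
  unfolding e' by (rule assoc3) (use v in \<open>auto simp: wt_Str\<close>)
 moreover have "... = v oo (($Zs ** $[M] ** evp M) oo ?i oo ($Zs ** $[M] ** scoevl M)) oo ibr [M] Zs"
  unfolding ev coev by (rule assoc3') (use v in \<open>auto simp: wt_Str\<close>)
 moreover have "($Zs ** stw M) oo ibr [M] Zs = ibr [M] Zs oo (stw M ** $Zs)"
  by (rule ibr_natural[symmetric]) (auto simp: wt_Str)
 ultimately show ?thesis unfolding st by argo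
qed

lemma evl_ibr_stw:
 assumes [simp]: "M \<in> Obj B"
 shows "sevl M oo ibr [M] [LD M] oo (stw M ** $[LD M]) = evp M"
proof -
 have "sevl M oo ibr [M] [LD M] oo (stw M ** $[LD M]) =
   evp M oo ($[M] ** sevl M ** $[LD M]) oo ($[M, LD M] ** scoevl M)"
  using stw_rotate[of M "[LD M]" "sevl M"] by (simp add: wt_Str)
 also have "... = evp M oo ($[M] ** ((sevl M ** $[LD M]) oo ($[LD M] ** scoevl M)))"
  by (simp add: evp_Str diag)
 also have "... = evp M"
  unfolding ldual_zigzag'[OF assms] by (simp add: evp_Str diag)
 finally show ?thesis .
qed

lemma evl_ibr_cancel:
 assumes "sevl X oo ibr [X] [LD X] oo (f ** $[LD X]) = sevl X oo ibr [X] [LD X] oo (g ** $[LD X])"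
  and [simp]: "wt f" "wt g" "X \<in> Obj B" and s: "sdom f = sdom g" "scod f = [X]" "scod g = [X]"
 shows "f = g"
proof (rule evl_cancel_right[OF _ assms(2,3) s assms(4)])
 have *: "ibr [X] [LD X] oo (h ** $[LD X]) = ($[LD X] ** h) oo ibr (sdom h) [LD X]"
  if "wt h" "scod h = [X]" for h
  using that by (simp add: ibr_natural)
 have i: "inverses (ibr (sdom f) [LD X]) (br [LD X] (sdom f))"
  by (intro inverses_sym[OF inverses_br]) (simp_all add: wt_dom)
 show "sevl X oo ($[LD X] ** f) = sevl X oo ($[LD X] ** g)"
  by (rule inverses_cancel_right[OF i])
    (use assms(1) s in \<open>auto simp: * scomp_assoc wt_Str wt_dom\<close>)
qed

lemma stw_natural1:
 assumes [simp]: "X \<in> Obj B" "Y \<in> Obj B" "f \<in> Hom B X Y"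
 shows "stw Y oo Str [X] f [Y] = Str [X] f [Y] oo stw X"
proof (rule evl_ibr_cancel)
 let ?f = "Str [X] f [Y]" and ?f' = "Str [LD Y] (lmap X Y f) [LD X]"
 have "sevl Y oo ibr [Y] [LD Y] oo ((stw Y oo ?f) ** $[LD Y]) =
   (sevl Y oo ibr [Y] [LD Y] oo (stw Y ** $[LD Y])) oo (?f ** $[LD Y])"
  by (simp add: ibr_Str diag)
 also have "... = evp X oo ($[X] ** ?f')"
  by (simp add: evl_ibr_stw evp_natural)
 also have "... = sevl X oo (ibr [X] [LD X] oo ($[X] ** ?f')) oo (stw X ** $[LD Y])"
  unfolding evl_ibr_stw[OF assms(1), symmetric] by (simp add: ibr_Str diag)
 also have "ibr [X] [LD X] oo ($[X] ** ?f') = (?f' ** $[X]) oo ibr [X] [LD Y]"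
  by (rule ibr_natural) (auto simp: wt_Str)
 also have "sevl X oo ... oo (stw X ** $[LD Y]) = (sevl X oo (?f' ** $[X])) oo ibr [X] [LD Y] oo (stw X ** $[LD Y])"
  by (simp add: ibr_Str diag)
 also have "... = sevl Y oo (($[LD Y] ** ?f) oo ibr [X] [LD Y]) oo (stw X ** $[LD Y])"
  by (simp add: evl_lmap) (simp add: ibr_Str diag)
 also have "($[LD Y] ** ?f) oo ibr [X] [LD Y] = ibr [Y] [LD Y] oo (?f ** $[LD Y])"
  by (rule ibr_natural[symmetric]) (auto simp: wt_Str)
 also have "sevl Y oo ... oo (stw X ** $[LD Y]) = sevl Y oo ibr [Y] [LD Y] oo ((?f oo stw X) ** $[LD Y])"
  by (simp add: ibr_Str diag)
 finally show "sevl Y oo ibr [Y] [LD Y] oo ((stw Y oo ?f) ** $[LD Y]) = ..." .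
qed (auto simp: wt_Str)

lemma inverses_stw1:
 assumes [simp]: "M \<in> Obj B"
 shows "inverses (stw M) (Str [M] (arr_inv B M M (anti_twist \<rho> M)) [M])"
proof -
 let ?e = "sevl M oo ibr [M] [LD M]"
 let ?g = "(?e ** $[M]) oo ($[M] ** coevp M)"
 have [simp]: "wt (coevp M)" "sdom (coevp M) = []" "scod (coevp M) = [LD M, M]"
  using dual_pair_evp[of M] by (simp_all add: dual_pair_def)
 obtain c where c: "coevp M = Str [] c [LD M, M]" and [simp]: "c \<in> Hom B \<I> (LD M \<otimes> M)"
  using wt_StrE[of "coevp M" "[]" "[LD M, M]"] by auto
 have wg [simp]: "wt ?g" by (simp add: wt_Str)
 obtain g where g: "?g = Str [M] g [M]" and [simp]: "g \<in> Hom B M M"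
  using wt_StrE[OF wg, of "[M]" "[M]"] by auto
 have z: "($[LD M] ** evp M) oo (coevp M ** $[LD M]) = $[LD M]"
  using dual_pair_evp[of M] by (simp add: dual_pair_def)
 have "evp M oo (?g ** $[LD M]) = ?e oo ($[M] ** (($[LD M] ** evp M) oo (coevp M ** $[LD M])))"
  unfolding c evp_Str ibr_Str by (simp add: diag)
 then have eg: "evp M oo (?g ** $[LD M]) = ?e"
  unfolding z by (simp add: ibr_Str diag)
 have "?g oo stw M = $[M]"
 proof (rule dual_pair_cancel_left[OF dual_pair_evp[OF assms]])
  have "evp M oo ((?g oo stw M) ** $[LD M]) = (evp M oo (?g ** $[LD M])) oo (stw M ** $[LD M])"
   unfolding g by (simp add: evp_Str diag)
  also have "... = evp M"
   unfolding eg by (simp add: scomp_assoc wt_Str evl_ibr_stw)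
  finally show "evp M oo ((?g oo stw M) ** $[LD M]) = evp M oo ($[M] ** $[LD M])"
   by (simp add: evp_Str diag)
 qed (auto simp: wt_Str)
 moreover then have "stw M oo ?g = $[M]" unfolding g by (simp add: stw_natural1)
 ultimately have "inverses (stw M) ?g" unfolding g by (simp add: inverses_def wt_Str)
 from inverses_is_iso[OF this] show ?thesis
  using inverses_arr_inv[of "[M]" "[M]"] by simp
qed

definition swd :: "'o list => ('o, 'a) strarr" where
 "swd Xs = Str Xs (anti_twist \<rho> (word Xs)) Xs"

definition swd' :: "'o list => ('o, 'a) strarr" where
 "swd' Xs = Str Xs (arr_inv B (word Xs) (word Xs) (anti_twist \<rho> (word Xs))) Xs"

lemma swd_single: "swd [M] = stw M" by (simp add: swd_def)

lemma sdom_swd [simp]: "sdom (swd Xs) = Xs" "sdom (swd' Xs) = Xs"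
 and scod_swd [simp]: "scod (swd Xs) = Xs" "scod (swd' Xs) = Xs"
 by (simp_all add: swd_def swd'_def)

lemma inverses_swd:
 assumes "set Xs <= Obj B"
 shows "inverses (swd Xs) (swd' Xs)"
proof -
 have o: "word Xs \<in> Obj B" "set [word Xs] <= Obj B" using assms by auto
 show ?thesis
  using inverses_stw1[OF o(1)] unfolding swd_def swd'_def inverses_iff[OF assms assms]
   inverses_iff[OF o(2) o(2)] by (simp only: word.simps(2))
qed

lemma wt_swd [simp]: "set Xs <= Obj B ==> wt (swd Xs)" "set Xs <= Obj B ==> wt (swd' Xs)"
 using inverses_swd by (auto simp: inverses_def)

lemma swd_hom [simp]:
 "M \<in> Obj B ==> arr_inv B M M (anti_twist \<rho> M) \<in> Hom B M M"
 using inverses_stw1[of M] by (simp add: inverses_def wt_Str)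

lemma swd_inv: "set Xs <= Obj B ==> swd Xs oo swd' Xs = $Xs"
 "set Xs <= Obj B ==> swd' Xs oo swd Xs = $Xs"
 using inverses_swd by (auto simp: inverses_def)

lemma swd_natural:
 assumes "wt f" "sdom f = Xs" "scod f = Ys"
 shows "swd Ys oo f = f oo swd Xs"
proof -
 obtain g where f: "f = Str Xs g Ys" and "g \<in> Hom B (word Xs) (word Ys)" "set Xs <= Obj B" "set Ys <= Obj B"
  using assms by (cases f) (simp add: wt_Str)
 then have "stw (word Ys) oo Str [word Xs] g [word Ys] = Str [word Xs] g [word Ys] oo stw (word Xs)"
  by (intro stw_natural1) auto
 then show ?thesis by (simp add: f swd_def scomp_def)
qed

lemma swd'_natural:
 assumes "wt f" "sdom f = Xs" "scod f = Ys"
 shows "swd' Ys oo f = f oo swd' Xs"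
 by (rule inverses_move[OF inverses_swd inverses_swd])
   (use assms wt_dom[of f] wt_cod[of f] swd_natural[OF assms] in auto)

lemma swd_tens2:
 assumes X [simp]: "X \<in> Obj B" and Y [simp]: "Y \<in> Obj B"
 shows "swd [X, Y] = ibr [Y] [X] oo ibr [X] [Y] oo (stw X ** stw Y)"
proof -
 let ?W = "X \<otimes> Y" let ?Z = "LD ?W" let ?D = "ldual_tens X Y"
 let ?v = "sevl ?W oo ($[?Z] ** pack [X, Y])"
 let ?c = "($[X] ** scoevl Y ** $[LD X]) oo scoevl X"
 have v: "wt ?v" "sdom ?v = [?Z, X] @ [Y]" "scod ?v = []" by (simp_all add: wt_Str)
 obtain w where w: "?v = Str [?Z, X, Y] w []" and [simp]: "w \<in> Hom B (?Z \<otimes> X \<otimes> Y) \<I>"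
  using wt_StrE[OF v] by auto
 let ?v1 = "?v oo ibr [Y] [?Z, X] oo (stw Y ** $[?Z, X])"
 have v1: "wt ?v1" "sdom ?v1 = [Y, ?Z] @ [X]" "scod ?v1 = []" by (simp_all add: wt_Str)
 have "swd [?W] oo pack [X, Y] = pack [X, Y] oo swd [X, Y]"
  by (simp add: swd_natural)
 then have "?v oo ibr [X, Y] [?Z] oo (swd [X, Y] ** $[?Z]) =
   sevl ?W oo (($[?Z] ** pack [X, Y]) oo ibr [X, Y] [?Z]) oo (swd [X, Y] ** $[?Z])"
  by (simp add: scomp_assoc wt_Str)
 also have "($[?Z] ** pack [X, Y]) oo ibr [X, Y] [?Z] = ibr [?W] [?Z] oo (pack [X, Y] ** $[?Z])"
  by (rule ibr_natural[symmetric]) auto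
 also have "sevl ?W oo ... oo (swd [X, Y] ** $[?Z]) = sevl ?W oo ibr [?W] [?Z] oo ((pack [X, Y] oo swd [X, Y]) ** $[?Z])"
  by (simp add: scomp_assoc wt_Str) (simp flip: stens_scomp add: scomp_strand)
 also have "pack [X, Y] oo swd [X, Y] = stw ?W oo pack [X, Y]"
  by (simp add: swd_natural flip: swd_single)
 also have "sevl ?W oo ibr [?W] [?Z] oo ((stw ?W oo pack [X, Y]) ** $[?Z]) =
   (sevl ?W oo ibr [?W] [?Z] oo (stw ?W ** $[?Z])) oo (pack [X, Y] ** $[?Z])"
  by (simp add: ibr_Str diag)
 also have "... = (evp ?W oo ($[?W] ** ((sevl ?W ** $[?Z]) oo ($[?Z] ** scoevl ?W)))) oo (pack [X, Y] ** $[?Z])"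
  unfolding ldual_zigzag'[OF tens_obj[OF X Y]] evl_ibr_stw[OF tens_obj[OF X Y]] by (simp add: evp_Str diag)
 also have "... = (evp ?W oo (pack [X, Y] ** ?D)) oo ($[X, Y] ** ?v ** $[LD Y, LD X]) oo ($[X, Y, ?Z] ** ?c)"
  unfolding coevl_tens[OF X Y] by (simp add: evp_Str dual_tens_Str diag)
 also have "... = evp X oo ($[X] ** (evp Y oo ($[Y] ** ?v ** $[LD Y]) oo ($[Y, ?Z, X] ** scoevl Y)) ** $[LD X]) oo
   ($[X, Y, ?Z] ** scoevl X)"
  unfolding evp_tens[OF X Y] by (simp add: evp_Str diag)
 also have "evp Y oo ($[Y] ** ?v ** $[LD Y]) oo ($[Y, ?Z, X] ** scoevl Y) = ?v1"
  using stw_rotate[OF Y _ v] by simp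
 also have "evp X oo ($[X] ** ?v1 ** $[LD X]) oo ($[X, Y, ?Z] ** scoevl X) = ?v1 oo ibr [X] [Y, ?Z] oo (stw X ** $[Y, ?Z])"
  using stw_rotate[OF X _ v1] by simp
 also have "... = ?v oo ibr [Y] [?Z, X] oo ((stw Y ** $[?Z, X]) oo ibr [X] [Y, ?Z]) oo (stw X ** $[Y, ?Z])"
  by (simp add: scomp_assoc wt_Str)
 also have "(stw Y ** $[?Z, X]) oo ibr [X] [Y, ?Z] = ibr [X] [Y, ?Z] oo ($[X] ** stw Y ** $[?Z])"
  using ibr_natural[of "$[X]" "stw Y ** $[?Z]" "[X]" "[Y, ?Z]" "[X]" "[Y, ?Z]"]
  by (simp add: wt_Str stens_assoc strand_stens)
 also have "?v oo ibr [Y] [?Z, X] oo ... oo (stw X ** $[Y, ?Z]) =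
   ?v oo ($[?Z] ** ibr [Y] [X]) oo ((ibr [Y] [?Z] ** $[X]) oo ($[Y] ** ibr [X] [?Z])) oo
   (ibr [X] [Y] ** $[?Z]) oo (stw X ** stw Y ** $[?Z])"
  by (simp add: br_simps diag)
 also have "(ibr [Y] [?Z] ** $[X]) oo ($[Y] ** ibr [X] [?Z]) = ibr [Y, X] [?Z]"
  by (simp add: br_Cons_left)
 also have "?v oo ($[?Z] ** ibr [Y] [X]) oo ibr [Y, X] [?Z] oo (ibr [X] [Y] ** $[?Z]) oo (stw X ** stw Y ** $[?Z]) =
   ?v oo (($[?Z] ** ibr [Y] [X]) oo ibr [Y, X] [?Z]) oo (ibr [X] [Y] ** $[?Z]) oo (stw X ** stw Y ** $[?Z])"
  by (simp add: scomp_assoc wt_Str)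
 also have "($[?Z] ** ibr [Y] [X]) oo ibr [Y, X] [?Z] = ibr [X, Y] [?Z] oo (ibr [Y] [X] ** $[?Z])"
  by (rule ibr_natural[symmetric]) auto
 also have "?v oo ... oo (ibr [X] [Y] ** $[?Z]) oo (stw X ** stw Y ** $[?Z]) =
   ?v oo ibr [X, Y] [?Z] oo ((ibr [Y] [X] oo ibr [X] [Y] oo (stw X ** stw Y)) ** $[?Z])"
  by (simp add: ibr_Str diag)
 finally have e: "?v oo ibr [X, Y] [?Z] oo (swd [X, Y] ** $[?Z]) = ..." .
 let ?f = "swd [X, Y]" and ?g = "ibr [Y] [X] oo ibr [X] [Y] oo (stw X ** stw Y)"
 have n: "?v oo ibr [X, Y] [?Z] oo (h ** $[?Z]) = (sevl ?W oo ($[?Z] ** (pack [X, Y] oo h))) oo ibr [X, Y] [?Z]"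
  if [simp]: "wt h" "sdom h = [X, Y]" "scod h = [X, Y]" for h
  by (simp add: ibr_natural scomp_assoc wt_Str) (simp flip: stens_scomp scomp_assoc add: scomp_strand wt_Str)
 have "pack [X, Y] oo ?f = pack [X, Y] oo ?g"
 proof (rule evl_cancel_right[of ?W])
  show "sevl ?W oo ($[?Z] ** (pack [X, Y] oo ?f)) = sevl ?W oo ($[?Z] ** (pack [X, Y] oo ?g))"
   by (rule inverses_cancel_right[OF inverses_sym[OF inverses_br[of "[X, Y]" "[?Z]"]]])
     (use e n[of ?f] n[of ?g] in \<open>auto simp: wt_Str\<close>)
 qed (auto simp: wt_Str)
 then show ?thesis
  by (rule inverses_cancel_left[OF inverses_pack, rotated 1]) (auto simp: wt_Str)
qed

lemma swd_append:
 assumes [simp]: "set Xs <= Obj B" "set Ys <= Obj B"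
 shows "swd (Xs @ Ys) = ibr Ys Xs oo ibr Xs Ys oo (swd Xs ** swd Ys)"
proof (rule inverses_cancel_left)
 let ?X = "word Xs" and ?Y = "word Ys" and ?p = "pack Xs ** pack Ys"
 show "inverses ?p (unpack Xs ** unpack Ys)"
  by (intro inverses_stens inverses_pack) auto
 have n: "swd [word Zs] oo pack Zs = pack Zs oo swd Zs" if "set Zs <= Obj B" for Zs
  using that by (simp add: swd_natural)
 have "?p oo swd (Xs @ Ys) = swd [?X, ?Y] oo ?p"
  by (simp add: swd_natural)
 also have "... = ibr [?Y] [?X] oo ibr [?X] [?Y] oo ((swd [?X] oo pack Xs) ** (swd [?Y] oo pack Ys))"
  by (simp add: swd_tens2 swd_single scomp_assoc wt_Str stens_scomp)
 also have "... = ibr [?Y] [?X] oo (ibr [?X] [?Y] oo ?p) oo (swd Xs ** swd Ys)"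
  by (simp add: n stens_scomp scomp_assoc)
 also have "ibr [?X] [?Y] oo ?p = (pack Ys ** pack Xs) oo ibr Xs Ys"
  by (simp add: ibr_natural)
 also have "ibr [?Y] [?X] oo ... oo (swd Xs ** swd Ys) = (ibr [?Y] [?X] oo (pack Ys ** pack Xs)) oo ibr Xs Ys oo (swd Xs ** swd Ys)"
  by (simp add: scomp_assoc)
 also have "ibr [?Y] [?X] oo (pack Ys ** pack Xs) = ?p oo ibr Ys Xs"
  by (simp add: ibr_natural)
 finally show "?p oo swd (Xs @ Ys) = ?p oo ibr Ys Xs oo ibr Xs Ys oo (swd Xs ** swd Ys)"
  by (simp add: scomp_assoc)
qed auto

lemma stw_rotate_action:
 assumes [simp]: "H \<in> Obj B" "X \<in> Obj B" "a \<in> Hom B (H \<otimes> X) X"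
 defines "sa \<equiv> Str [H, X] a [X]"
 defines "v \<equiv> evp X oo ($[X] ** (((sevl X oo ($[LD X] ** sa)) ** $[LD X]) oo ($[LD X, H] ** scoevl X)))"
 shows "v oo ibr [H] [X, LD X] oo (stw H ** $[X, LD X]) = evp X oo (sa ** $[LD X])"
proof -
 let ?W = "H \<otimes> X" let ?A = "Str [?W] a [X]" and ?D = "ldual_tens H X"
 let ?c = "($[H] ** scoevl X ** $[LD H]) oo scoevl H"
 have A: "?A oo pack [H, X] = sa" using Str_pack[of a "[H, X]" "[X]"] by (simp add: sa_def)
 have v: "wt v" "sdom v = [X, LD X] @ [H]" "scod v = []"
  by (simp_all add: v_def sa_def wt_Str evp_Str)
 have "v oo ibr [H] [X, LD X] oo (stw H ** $[X, LD X]) =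
   evp H oo ($[H] ** v ** $[LD H]) oo ($[H, X, LD X] ** scoevl H)"
  using stw_rotate[OF _ _ v] by simp
 also have "... = (evp H oo ($[H] ** evp X ** $[LD H])) oo
   ($[H, X] ** (((sevl X oo ($[LD X] ** sa)) ** $[LD X, LD H]) oo ($[LD X] ** ?c)))"
  unfolding v_def sa_def by (simp add: evp_Str diag)
 also have "... = evp ?W oo (pack [H, X] ** (((sevl X oo ($[LD X] ** ?A)) ** $[LD ?W]) oo
   ($[LD X] ** ((pack [H, X] ** ?D) oo ?c))))"
  unfolding evp_tens[OF assms(1,2), symmetric] A[symmetric] by (simp add: evp_Str dual_tens_Str diag)
 also have "(pack [H, X] ** ?D) oo ?c = scoevl ?W"
  by (simp add: coevl_tens)
 also have "((sevl X oo ($[LD X] ** ?A)) ** $[LD ?W]) oo ($[LD X] ** scoevl ?W) =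
   Str [LD X] (lmap ?W X a) [LD ?W]"
  unfolding lmap_Str by (simp add: diag)
 also have "evp ?W oo (pack [H, X] ** ...) = (evp ?W oo ($[?W] ** Str [LD X] (lmap ?W X a) [LD ?W])) oo (pack [H, X] ** $[LD X])"
  by (simp add: evp_Str diag)
 also have "... = evp X oo ((?A oo pack [H, X]) ** $[LD X])"
  by (subst evp_natural[symmetric]) (simp_all add: evp_Str diag)
 finally show ?thesis unfolding A .
qed

end

section \<open>Hopf algebras\<close>

locale braided_hopf_algebra = rigid_braided_category B + hopf_data B Ha
 for B :: "('k::field, 'o, 'a, 'z) brcat_scheme" (structure) and Ha :: "('o, 'a) hopf" +
 assumes hopf: "hopf_algebra" and inv_ant: "invertible_antipode"
begin

notation stens (infixr "**" 75) and scomp (infixr "oo" 65) and strand ("$_" [1000] 1000)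

lemma H_obj [simp]: "H \<in> Obj B"
 and mul_hom [simp]: "mul Ha \<in> Hom B (H \<otimes> H) H"
 and unt_hom [simp]: "unt Ha \<in> Hom B \<I> H"
 and com_hom [simp]: "com Ha \<in> Hom B H (H \<otimes> H)"
 and cou_hom [simp]: "cou Ha \<in> Hom B H \<I>"
 and ant_hom [simp]: "ant Ha \<in> Hom B H H"
 using hopf by (auto simp: hopf_algebra_def is_algebra_def is_coalgebra_def)

lemma mul_assoc: "smul oo (smul ** $[H]) = smul oo ($[H] ** smul)"
 and mul_unit_left: "smul oo (sunt ** $[H]) = $[H]"
 and mul_unit_right: "smul oo ($[H] ** sunt) = $[H]"
 and com_assoc: "(scom ** $[H]) oo scom = ($[H] ** scom) oo scom"
 and com_cou_left: "(scou ** $[H]) oo scom = $[H]"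
 and com_cou_right: "($[H] ** scou) oo scom = $[H]"
 and com_unt: "scom oo sunt = sunt ** sunt"
 and cou_mul: "scou oo smul = scou ** scou"
 and cou_unt: "scou oo sunt = $[]"
 and ant_left: "smul oo (sant ** $[H]) oo scom = sunt oo scou"
 and ant_right: "smul oo ($[H] ** sant) oo scom = sunt oo scou"
 using hopf unfolding hopf_algebra_def is_algebra_def is_coalgebra_def by blast+

lemma com_mul: "scom oo smul = (smul ** smul) oo ($[H] ** br [H] [H] ** $[H]) oo (scom ** scom)"
 using hopf unfolding hopf_algebra_def by (simp add: br_single)

lemmas bdiag = diag br_simps

definition com2 :: "('o, 'a) strarr" where
 "com2 = ($[H] ** br [H] [H] ** $[H]) oo (scom ** scom)"

lemma sdom_com2 [simp]: "sdom com2 = [H, H]" and scod_com2 [simp]: "scod com2 = [H, H, H, H]"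
 and wt_com2 [simp]: "wt com2"
 by (simp_all add: com2_def wt_Str)

lemma com2_assoc: "(com2 ** $[H, H]) oo com2 = ($[H, H] ** com2) oo com2"
proof -
 let ?H = "$[H]"
 have n1: "(scom ** ?H) oo br [H] [H] = br [H] [H, H] oo (?H ** scom)"
  and n2: "(?H ** scom) oo br [H] [H] = br [H, H] [H] oo (scom ** ?H)"
  by (rule br_natural[symmetric]; simp add: wt_Str)+
 have "(com2 ** $[H, H]) oo com2 =
   (?H ** br [H] [H] ** $[H, H, H]) oo (scom ** ((scom ** ?H) oo br [H] [H]) ** ?H) oo (scom ** scom)"
  unfolding com2_def by (simp add: bdiag)
 also have "... = (?H ** br [H] [H] ** $[H, H, H]) oo ($[H, H] ** br [H] [H, H] ** ?H) oo
   (((scom ** ?H) oo scom) ** ((scom ** ?H) oo scom))"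
  unfolding n1 by (simp add: bdiag)
 also have "... = ($[H, H, H] ** br [H] [H] ** ?H) oo (?H ** br [H, H] [H] ** $[H, H]) oo
   (((?H ** scom) oo scom) ** ((?H ** scom) oo scom))"
  unfolding com_assoc by (simp add: bdiag)
 also have "... = ($[H, H, H] ** br [H] [H] ** ?H) oo (?H ** ((?H ** scom) oo br [H] [H]) ** scom) oo (scom ** scom)"
  unfolding n2 by (simp add: bdiag)
 also have "... = ($[H, H] ** com2) oo com2"
  unfolding com2_def by (simp add: bdiag)
 finally show ?thesis .
qed

lemma com2_cou:
 "(scou ** scou ** $[H, H]) oo com2 = $[H, H]"
 "($[H, H] ** scou ** scou) oo com2 = $[H, H]"
proof -
 let ?H = "$[H]"
 have n1: "(scou ** ?H) oo br [H] [H] = br [H] [] oo (?H ** scou)"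
  and n2: "(?H ** scou) oo br [H] [H] = br [] [H] oo (scou ** ?H)"
  by (rule br_natural[symmetric]; simp add: wt_Str)+
 have "(scou ** scou ** $[H, H]) oo com2 = (scou ** ((scou ** ?H) oo br [H] [H]) ** ?H) oo (scom ** scom)"
  unfolding com2_def by (simp add: bdiag)
 also have "... = ((scou ** ?H) oo scom) ** ((scou ** ?H) oo scom)"
  unfolding n1 by (simp add: bdiag)
 finally show "(scou ** scou ** $[H, H]) oo com2 = $[H, H]"
  unfolding com_cou_left by (simp add: strand_stens)
 have "($[H, H] ** scou ** scou) oo com2 = (?H ** ((?H ** scou) oo br [H] [H]) ** scou) oo (scom ** scom)"
  unfolding com2_def by (simp add: bdiag)
 also have "... = ((?H ** scou) oo scom) ** ((?H ** scou) oo scom)"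
  unfolding n2 by (simp add: bdiag)
 finally show "($[H, H] ** scou ** scou) oo com2 = $[H, H]"
  unfolding com_cou_right by (simp add: strand_stens)
qed

text \<open>Both sides are convolution inverses of the multiplication.\<close>

lemma ant_mul: "sant oo smul = smul oo (sant ** sant) oo br [H] [H]"
proof -
 let ?H = "$[H]" let ?P = "sant oo smul" and ?Q = "smul oo (sant ** sant) oo br [H] [H]"
 obtain d where d: "com2 = Str [H, H] d [H, H, H, H]" and [simp]: "d \<in> Hom B (H \<otimes> H) (H \<otimes> H \<otimes> H \<otimes> H)"
  using wt_StrE[OF wt_com2 sdom_com2 scod_com2] by auto
 have "smul oo (?P ** smul) oo com2 = (smul oo (sant ** ?H) oo scom) oo smul"
  by (simp add: com_mul com2_def scomp_assoc wt_Str) (simp add: bdiag)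
 also have "... = sunt oo (scou oo smul)"
  unfolding ant_left by (simp add: bdiag)
 finally have left: "smul oo (?P ** smul) oo com2 = sunt oo (scou ** scou)" unfolding cou_mul .
 have n: "(scom ** ?H) oo br [H] [H] = br [H] [H, H] oo (?H ** scom)"
  by (rule br_natural[symmetric]; simp add: wt_Str)
 have n2: "(scou ** ?H) oo br [H] [H] = br [H] [] oo (?H ** scou)"
  by (rule br_natural[symmetric]; simp add: wt_Str)
 have "smul oo (smul ** ?Q) oo com2 =
   smul oo (smul ** ?H) oo ($[H, H] ** smul) oo ($[H, H] ** sant ** sant) oo (?H ** br [H] [H, H] ** $[]) oo
   (scom ** scom)"
  unfolding com2_def by (simp add: bdiag)
 also have "... = (smul oo (smul ** ?H)) oo ($[H, H] ** smul) oo ($[H, H] ** sant ** sant) oo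
   (?H ** ((scom ** ?H) oo br [H] [H])) oo (scom ** ?H)"
  unfolding n by (simp add: bdiag)
 also have "... = smul oo (?H ** (smul oo (?H ** smul))) oo ($[H, H] ** sant ** sant) oo
   (?H ** ((scom ** ?H) oo br [H] [H])) oo (scom ** ?H)"
  unfolding mul_assoc by (simp add: bdiag)
 also have "... = smul oo (?H ** (smul oo ((smul oo (?H ** sant) oo scom) ** ?H))) oo (?H ** br [H] [H]) oo (?H ** sant ** ?H) oo (scom ** ?H)"
 proof -
  have "(?H ** sant) oo br [H] [H] = br [H] [H] oo (sant ** ?H)"
   by (rule br_natural[symmetric]; simp add: wt_Str)
  then have "smul oo (?H ** (smul oo ((smul oo (?H ** sant) oo scom) ** ?H))) oo (?H ** br [H] [H]) oo (?H ** sant ** ?H) oo (scom ** ?H) =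
   smul oo (?H ** (smul oo ((smul oo (?H ** sant) oo scom) ** ?H))) oo (?H ** ((?H ** sant) oo br [H] [H])) oo (scom ** ?H)"
   by simp (simp add: bdiag)
  also have "... = smul oo (?H ** (smul oo (smul ** ?H))) oo ($[H, H] ** sant ** sant) oo
   (?H ** ((scom ** ?H) oo br [H] [H])) oo (scom ** ?H)"
   by (simp add: bdiag)
  finally show ?thesis unfolding mul_assoc ..
 qed
 also have "... = smul oo (?H ** (smul oo (sunt ** ?H))) oo (?H ** ((scou ** ?H) oo br [H] [H])) oo (?H ** sant ** ?H) oo (scom ** ?H)"
  unfolding ant_right by (simp add: bdiag)
 also have "... = (smul oo (?H ** sant) oo scom) ** scou"
  unfolding mul_unit_left n2 by (simp add: bdiag)
 also have "... = sunt oo (scou ** scou)"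
  unfolding ant_right by (simp add: bdiag)
 finally have right: "smul oo (smul ** ?Q) oo com2 = sunt oo (scou ** scou)" .
 have "?P = (smul oo (?H ** sunt)) oo ?P oo (($[H, H] ** scou ** scou) oo com2)"
  unfolding mul_unit_right com2_cou by (simp add: bdiag)
 also have "... = smul oo (?P ** (sunt oo (scou ** scou))) oo com2"
  unfolding d by (simp add: bdiag)
 also have "... = (smul oo (?H ** smul)) oo (?P ** smul ** ?Q) oo (($[H, H] ** com2) oo com2)"
  unfolding right[symmetric] d by (simp add: bdiag)
 also have "... = smul oo ((smul oo (?P ** smul) oo com2) ** ?Q) oo com2"
  unfolding com2_assoc[symmetric] mul_assoc[symmetric] unfolding d by (simp add: bdiag)
 also have "... = (smul oo (sunt ** ?H)) oo ?Q oo ((scou ** scou ** $[H, H]) oo com2)"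
  unfolding left unfolding d by (simp add: bdiag)
 also have "... = ?Q"
  unfolding mul_unit_left com2_cou by (simp add: bdiag)
 finally show ?thesis .
qed

lemma ant_unt: "sant oo sunt = sunt"
proof -
 have "sant oo sunt = (smul oo ($[H] ** sunt)) oo sant oo sunt"
  unfolding mul_unit_right by (simp add: bdiag)
 also have "... = smul oo (sant ** $[H]) oo (sunt ** sunt)"
  by (simp add: bdiag)
 also have "... = (smul oo (sant ** $[H]) oo scom) oo sunt"
  unfolding com_unt[symmetric] by (simp add: bdiag)
 also have "... = sunt oo (scou oo sunt)"
  unfolding ant_left by (simp add: bdiag)
 finally show ?thesis unfolding cou_unt by (simp add: bdiag)
qed

definition "ant_inv = arr_inv B H H (ant Ha)"

abbreviation santi :: "('o, 'a) strarr" where "santi \<equiv> Str [H] ant_inv [H]"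

lemma inverses_ant: "inverses sant santi"
 using inv_ant inverses_arr_inv[of "[H]" "[H]" "ant Ha"]
 by (simp add: invertible_antipode_def ant_inv_def)

lemma ant_inv_hom [simp]: "ant_inv \<in> Hom B H H"
 using inverses_ant by (simp add: inverses_def wt_Str)

lemma ant_ant_inv: "sant oo santi = $[H]" "santi oo sant = $[H]"
 using inverses_ant by (simp_all add: inverses_def)

lemma ant_inv_unt: "santi oo sunt = sunt"
proof -
 have "santi oo sunt = (santi oo sant) oo sunt"
  by (subst ant_unt[symmetric]) (simp add: bdiag)
 then show ?thesis unfolding ant_ant_inv by (simp add: bdiag)
qed

lemma ant_inv_mul: "santi oo smul = smul oo ibr [H] [H] oo (santi ** santi)"
proof -
 have "smul oo ibr [H] [H] oo (santi ** santi) = (santi oo sant) oo smul oo ibr [H] [H] oo (santi ** santi)"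
  unfolding ant_ant_inv by (simp add: bdiag)
 also have "... = santi oo (sant oo smul) oo ibr [H] [H] oo (santi ** santi)"
  by (simp add: bdiag)
 also have "... = santi oo smul oo (sant ** sant) oo (br [H] [H] oo ibr [H] [H]) oo (santi ** santi)"
  unfolding ant_mul by (simp add: bdiag)
 also have "... = santi oo smul oo ((sant oo santi) ** (sant oo santi))"
  unfolding br_ibr[of "[H]" "[H]", simplified] by (simp add: bdiag)
 also have "... = santi oo smul"
  unfolding ant_ant_inv by (simp add: bdiag)
 finally show ?thesis ..
qed

lemma ant_inv_right: "smul oo (santi ** $[H]) oo ibr [H] [H] oo scom = sunt oo scou" (is "?l = _")
proof -
 have n: "br [H] [H] oo (santi ** $[H]) = ($[H] ** santi) oo br [H] [H]"
  by (rule br_natural) (auto simp: wt_Str)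
 have "sant oo ?l = (sant oo smul) oo (santi ** $[H]) oo ibr [H] [H] oo scom"
  by (simp add: bdiag)
 also have "... = smul oo (sant ** sant) oo (br [H] [H] oo (santi ** $[H])) oo ibr [H] [H] oo scom"
  unfolding ant_mul by (simp add: bdiag)
 also have "... = smul oo (sant ** (sant oo santi)) oo (br [H] [H] oo ibr [H] [H]) oo scom"
  unfolding n by (simp add: bdiag)
 also have "... = smul oo (sant ** $[H]) oo scom"
  unfolding ant_ant_inv br_ibr[of "[H]" "[H]", simplified] by (simp add: bdiag)
 also have "... = sant oo sunt oo scou"
  unfolding ant_left by (subst ant_unt[symmetric]) (simp add: bdiag)
 finally show ?thesis
  by (rule inverses_cancel_left[OF inverses_ant]) (auto simp: wt_Str)
qed

end

section \<open>Modules over a Hopf algebra\<close>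

context braided_hopf_algebra
begin

lemma ant_inv_left: "smul oo ($[H] ** santi) oo ibr [H] [H] oo scom = sunt oo scou" (is "?l = _")
proof -
 have n: "br [H] [H] oo ($[H] ** santi) = (santi ** $[H]) oo br [H] [H]"
  by (rule br_natural) (auto simp: wt_Str)
 have "sant oo ?l = (sant oo smul) oo ($[H] ** santi) oo ibr [H] [H] oo scom"
  by (simp add: bdiag)
 also have "... = smul oo (sant ** sant) oo (br [H] [H] oo ($[H] ** santi)) oo ibr [H] [H] oo scom"
  unfolding ant_mul by (simp add: bdiag)
 also have "... = smul oo ((sant oo santi) ** sant) oo (br [H] [H] oo ibr [H] [H]) oo scom"
  unfolding n by (simp add: bdiag)
 also have "... = smul oo ($[H] ** sant) oo scom"
  unfolding ant_ant_inv br_ibr[of "[H]" "[H]", simplified] by (simp add: bdiag)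
 also have "... = sant oo sunt oo scou"
  unfolding ant_right by (subst ant_unt[symmetric]) (simp add: bdiag)
 finally show ?thesis
  by (rule inverses_cancel_left[OF inverses_ant]) (auto simp: wt_Str)
qed

lemma H_moduleD:
 assumes "H_module M a"
 shows "M \<in> Obj B" "a \<in> Hom B (H \<otimes> M) M"
  "Str [H, M] a [M] oo (smul ** $[M]) = Str [H, M] a [M] oo ($[H] ** Str [H, M] a [M])"
  "Str [H, M] a [M] oo (sunt ** $[M]) = $[M]"
 using assms by (auto simp: is_module_def)

definition tens_act :: "'o => 'a => 'o => 'a => ('o, 'a) strarr" where
 "tens_act M a N b = (Str [H, M] a [M] ** Str [H, N] b [N]) oo ($[H] ** br [H] [M] ** $[N]) oo
   (scom ** $[M, N])"

lemma sdom_tens_act [simp]: "sdom (tens_act M a N b) = [H, M, N]"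
 and scod_tens_act [simp]: "scod (tens_act M a N b) = [M, N]"
 by (simp_all add: tens_act_def)

lemma fst_H_tens [simp]: "fst (H_tens V W) = fst V \<otimes> fst W"
 and fst_H_triv [simp]: "fst (H_triv X) = X"
 by (simp_all add: H_tens_def H_triv_def)

lemma sact_H_tens:
 assumes "H_module M a" "H_module N b"
 shows "sact (H_tens (M, a) (N, b)) = pack [M, N] oo tens_act M a N b oo ($[H] ** unpack [M, N])"
proof -
 note [simp] = H_moduleD(1,2)[OF assms(1)] H_moduleD(1,2)[OF assms(2)]
 let ?E = "(Str [H, M] a [M] ** Str [H, N] b [N]) oo ($[H] ** sbraid H M ** $[N]) oo (scom ** unpack [M, N])"
 have "?E = tens_act M a N b oo ($[H] ** unpack [M, N])"
  unfolding tens_act_def by (simp add: bdiag)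
 moreover have "pack [M, N] oo ?E = Str [H, M \<otimes> N] (sarr ?E) [M \<otimes> N]"
 proof -
  have "wt ?E" "sdom ?E = [H, M \<otimes> N]" "scod ?E = [M, N]" by (simp_all add: wt_Str)
  then have "sarr ?E \<in> Hom B (H \<otimes> M \<otimes> N) (M \<otimes> N)" using sarr_hom by fastforce
  then have "idm B (M \<otimes> N) \<cdot> sarr ?E = sarr ?E" by (intro comp_idl[of "H \<otimes> M \<otimes> N"]) auto
  then show ?thesis by (simp add: pack_def scomp_def)
 qed
 ultimately show ?thesis by (simp add: H_tens_def)
qed

lemma tens_act_module:
 assumes "H_module M a" "H_module N b"
 shows "tens_act M a N b oo (smul ** $[M, N]) = tens_act M a N b oo ($[H] ** tens_act M a N b)"
  and "tens_act M a N b oo (sunt ** $[M, N]) = $[M, N]"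
proof -
 note [simp] = H_moduleD(1,2)[OF assms(1)] H_moduleD(1,2)[OF assms(2)]
 let ?H = "$[H]" and ?a = "Str [H, M] a [M]" and ?b = "Str [H, N] b [N]"
 note mul = H_moduleD(3)[OF assms(1)] H_moduleD(3)[OF assms(2)]
 note unit = H_moduleD(4)[OF assms(1)] H_moduleD(4)[OF assms(2)]
 have n: "br [H] [M] oo (smul ** $[M]) = ($[M] ** smul) oo br [H, H] [M]"
  and n': "br [H] [M] oo (?H ** ?a) = (?a ** ?H) oo br [H] [H, M]"
  and n'': "br [H] [M] oo (sunt ** $[M]) = ($[M] ** sunt) oo br [] [M]"
  by (rule br_natural; simp add: wt_Str)+
 have "tens_act M a N b oo (smul ** $[M, N]) =
   (?a ** ?b) oo (?H ** br [H] [M] ** $[N]) oo ((scom oo smul) ** $[M, N])"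
  unfolding tens_act_def by (simp add: bdiag)
 also have "... = (?a ** ?b) oo (smul ** (br [H] [M] oo (smul ** $[M])) ** $[N]) oo
   (?H ** br [H] [H] ** $[H, M, N]) oo (scom ** scom ** $[M, N])"
  unfolding com_mul by (simp add: bdiag)
 also have "... = ((?a oo (smul ** $[M])) ** (?b oo (smul ** $[N]))) oo ($[H, H] ** br [H, H] [M] ** $[N]) oo
   (?H ** br [H] [H] ** $[H, M, N]) oo (scom ** scom ** $[M, N])"
  unfolding n by (simp add: bdiag)
 also have "... = (?a ** ?b) oo (?H ** ((?a ** ?H) oo br [H] [H, M]) ** ?b) oo (scom ** ?H ** br [H] [M] ** $[N]) oo
   (?H ** scom ** $[M, N])"
  unfolding mul by (simp add: bdiag)
 also have "... = tens_act M a N b oo (?H ** tens_act M a N b)"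
  unfolding n'[symmetric] tens_act_def by (simp add: bdiag)
 finally show "tens_act M a N b oo (smul ** $[M, N]) = tens_act M a N b oo (?H ** tens_act M a N b)" .
 have "tens_act M a N b oo (sunt ** $[M, N]) =
   (?a ** ?b) oo (?H ** br [H] [M] ** $[N]) oo ((scom oo sunt) ** $[M, N])"
  unfolding tens_act_def by (simp add: bdiag)
 also have "... = (?a ** ?b) oo (sunt ** (br [H] [M] oo (sunt ** $[M])) ** $[N])"
  unfolding com_unt by (simp add: bdiag)
 also have "... = (?a oo (sunt ** $[M])) ** (?b oo (sunt ** $[N]))"
  unfolding n'' by (simp add: bdiag)
 finally show "tens_act M a N b oo (sunt ** $[M, N]) = $[M, N]"
  unfolding unit by (simp add: strand_stens)
qed

lemma tens_act_Str:
 assumes "H_module M a" "H_module N b"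
 obtains c where "tens_act M a N b = Str [H, M, N] c [M, N]" "c \<in> Hom B (H \<otimes> M \<otimes> N) (M \<otimes> N)"
proof -
 note [simp] = H_moduleD(1,2)[OF assms(1)] H_moduleD(1,2)[OF assms(2)]
 have "wt (tens_act M a N b)" by (simp add: tens_act_def wt_Str)
 from wt_StrE[OF this sdom_tens_act scod_tens_act] that show ?thesis by auto
qed

lemma H_module_tens:
 assumes "H_module M a" "H_module N b"
 shows "H_module (M \<otimes> N) (snd (H_tens (M, a) (N, b)))"
proof -
 note [simp] = H_moduleD(1,2)[OF assms(1)] H_moduleD(1,2)[OF assms(2)]
 obtain c where c: "tens_act M a N b = Str [H, M, N] c [M, N]" and [simp]: "c \<in> Hom B (H \<otimes> M \<otimes> N) (M \<otimes> N)"
  using tens_act_Str[OF assms] .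
 let ?t = "tens_act M a N b" and ?p = "pack [M, N]" and ?u = "unpack [M, N]"
 have s: "Str [H, M \<otimes> N] (snd (H_tens (M, a) (N, b))) [M \<otimes> N] = ?p oo ?t oo ($[H] ** ?u)"
  using sact_H_tens[OF assms] by simp
 note up = unpack_pack[of "[M, N]", simplified] pack_unpack[of "[M, N]", simplified]
 have "wt (?p oo ?t oo ($[H] ** ?u))" unfolding c by (simp add: wt_Str)
 then have hom: "snd (H_tens (M, a) (N, b)) \<in> Hom B (H \<otimes> M \<otimes> N) (M \<otimes> N)"
  unfolding s[symmetric] by (simp add: wt_Str)
 have "(?p oo ?t oo ($[H] ** ?u)) oo (smul ** $[M \<otimes> N]) = ?p oo (?t oo (smul ** $[M, N])) oo ($[H, H] ** ?u)"
  unfolding c by (simp add: bdiag)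
 also have "... = ?p oo ?t oo ($[H] ** (?u oo ?p)) oo ($[H] ** ?t) oo ($[H, H] ** ?u)"
  unfolding tens_act_module[OF assms] up unfolding c by (simp add: bdiag)
 also have "... = (?p oo ?t oo ($[H] ** ?u)) oo ($[H] ** (?p oo ?t oo ($[H] ** ?u)))"
  unfolding c by (simp add: bdiag)
 finally have mul: "(?p oo ?t oo ($[H] ** ?u)) oo (smul ** $[M \<otimes> N]) = ..." .
 have "(?p oo ?t oo ($[H] ** ?u)) oo (sunt ** $[M \<otimes> N]) = ?p oo (?t oo (sunt ** $[M, N])) oo ?u"
  unfolding c by (simp add: bdiag)
 also have "... = ?p oo ?u"
  unfolding tens_act_module[OF assms] by (simp add: bdiag)
 finally have unit: "(?p oo ?t oo ($[H] ** ?u)) oo (sunt ** $[M \<otimes> N]) = $[M \<otimes> N]"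
  unfolding up .
 show ?thesis
  unfolding is_module_def s using hom mul unit by simp
qed

lemma sact_H_triv: "X \<in> Obj B ==> sact (H_triv X) = scou ** $[X]"
 unfolding H_triv_def by (simp add: Str_sarr)

lemma H_module_triv:
 assumes [simp]: "X \<in> Obj B"
 shows "H_module X (snd (H_triv X))"
proof -
 have s: "Str [H, X] (snd (H_triv X)) [X] = scou ** $[X]" using sact_H_triv[OF assms] by simp
 have "wt (scou ** $[X])" by (simp add: wt_Str)
 then have hom: "snd (H_triv X) \<in> Hom B (H \<otimes> X) X" unfolding s[symmetric] by (simp add: wt_Str)
 have "(scou ** $[X]) oo (smul ** $[X]) = (scou oo smul) ** $[X]" by (simp add: bdiag)
 moreover have "... = (scou ** $[X]) oo ($[H] ** scou ** $[X])"
  unfolding cou_mul by (simp add: bdiag)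
 moreover have "(scou ** $[X]) oo (sunt ** $[X]) = (scou oo sunt) ** $[X]" by (simp add: bdiag)
 moreover have "... = $[X]" unfolding cou_unt by (simp add: bdiag)
 ultimately show ?thesis unfolding is_module_def s using hom by simp
qed

subsection \<open>Linear maps\<close>

lemma H_hom_iff:
 assumes "H_module M a" "H_module N b"
 shows "f \<in> H_hom (M, a) (N, b) \<longleftrightarrow> f \<in> Hom B M N \<and>
  Str [M] f [N] oo Str [H, M] a [M] = Str [H, N] b [N] oo ($[H] ** Str [M] f [N])"
 using H_moduleD(1,2)[OF assms(1)] H_moduleD(1,2)[OF assms(2)]
 by (auto simp: H_hom_def stens_strand1 scomp_def)

lemma H_hom_inverse:
 assumes "H_module M a" "H_module N b" "f \<in> H_hom (M, a) (N, b)" "arr_inverse B M N f g"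
 shows "g \<in> H_hom (N, b) (M, a)"
proof -
 note [simp] = H_moduleD(1,2)[OF assms(1)] H_moduleD(1,2)[OF assms(2)]
 have f: "f \<in> Hom B M N" "Str [M] f [N] oo Str [H, M] a [M] = Str [H, N] b [N] oo ($[H] ** Str [M] f [N])"
  using assms(3) H_hom_iff[OF assms(1,2)] by auto
 then have i: "inverses (Str [M] f [N]) (Str [N] g [M])"
  using assms(4) by (subst inverses_iff) auto
 then have g: "g \<in> Hom B N M" by (simp add: inverses_def wt_Str)
 have "Str [N] g [M] oo Str [H, N] b [N] = Str [H, M] a [M] oo ($[H] ** Str [N] g [M])"
  by (rule inverses_move[OF inverses_stens[OF inverses_strand[of "[H]"] i] i])
    (use f in \<open>auto simp: wt_Str\<close>)
 then show ?thesis using g H_hom_iff[OF assms(2,1)] by simp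
qed

lemma H_hom_tens:
 assumes m: "H_module M a" "H_module N b" "H_module M' a'" "H_module N' b'"
  and f: "f \<in> H_hom (M, a) (N, b)" and f': "f' \<in> H_hom (M', a') (N', b')"
 shows "f \<star> f' \<in> H_hom (H_tens (M, a) (M', a')) (H_tens (N, b) (N', b'))"
proof -
 note [simp] = m[THEN H_moduleD(1)] m[THEN H_moduleD(2)]
 have [simp]: "f \<in> Hom B M N" "f' \<in> Hom B M' N'" using f f' by (auto simp: H_hom_def)
 let ?H = "$[H]" and ?f = "Str [M] f [N]" and ?f' = "Str [M'] f' [N']"
 let ?a = "Str [H, M] a [M]" and ?a' = "Str [H, M'] a' [M']" and ?b = "Str [H, N] b [N]" and ?b' = "Str [H, N'] b' [N']"
 have e: "?f oo ?a = ?b oo (?H ** ?f)" "?f' oo ?a' = ?b' oo (?H ** ?f')"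
  using f f' H_hom_iff m by auto
 have n: "br [H] [N] oo (?H ** ?f) = (?f ** ?H) oo br [H] [M]"
  by (rule br_natural) (auto simp: wt_Str)
 have "(?f ** ?f') oo tens_act M a M' a' = ((?f oo ?a) ** (?f' oo ?a')) oo (?H ** br [H] [M] ** $[M']) oo (scom ** $[M, M'])"
  unfolding tens_act_def by (simp add: bdiag)
 also have "... = (?b ** ?b') oo (?H ** ((?f ** ?H) oo br [H] [M]) ** ?f') oo (scom ** $[M, M'])"
  unfolding e by (simp add: bdiag)
 also have "... = tens_act N b N' b' oo (?H ** ?f ** ?f')"
  unfolding n[symmetric] tens_act_def by (simp add: bdiag)
 finally have t: "(?f ** ?f') oo tens_act M a M' a' = tens_act N b N' b' oo (?H ** ?f ** ?f')" .
 have hom: "f \<star> f' \<in> Hom B (M \<otimes> M') (N \<otimes> N')" by (rule tensa_hom) auto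
 have ff: "?f ** ?f' = Str [M, M'] (f \<star> f') [N, N']" by (simp add: single_stens_Cons)
 have ff': "Str [M \<otimes> M'] (f \<star> f') [N \<otimes> N'] = pack [N, N'] oo (?f ** ?f') oo unpack [M, M']"
  using hom unfolding ff by (simp add: pack_def unpack_def scomp_def comp_idl[of "M \<otimes> M'" "N \<otimes> N'"] comp_idr[of "M \<otimes> M'" "N \<otimes> N'"])
 note up = unpack_pack[of "[M, M']", simplified] unpack_pack[of "[N, N']", simplified]
 obtain c where c: "tens_act M a M' a' = Str [H, M, M'] c [M, M']" and [simp]: "c \<in> Hom B (H \<otimes> M \<otimes> M') (M \<otimes> M')"
  using tens_act_Str m by blast
 obtain d where d: "tens_act N b N' b' = Str [H, N, N'] d [N, N']" and [simp]: "d \<in> Hom B (H \<otimes> N \<otimes> N') (N \<otimes> N')"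
  using tens_act_Str m by blast
 have "Str [M \<otimes> M'] (f \<star> f') [N \<otimes> N'] oo sact (H_tens (M, a) (M', a')) =
   pack [N, N'] oo (?f ** ?f') oo (unpack [M, M'] oo pack [M, M']) oo tens_act M a M' a' oo (?H ** unpack [M, M'])"
  unfolding sact_H_tens[OF m(1,3)] ff' c by (simp add: bdiag)
 also have "... = pack [N, N'] oo ((?f ** ?f') oo tens_act M a M' a') oo (?H ** unpack [M, M'])"
  unfolding up c by (simp add: bdiag)
 also have "... = pack [N, N'] oo tens_act N b N' b' oo (?H ** (unpack [N, N'] oo pack [N, N'])) oo (?H ** ((?f ** ?f') oo unpack [M, M']))"
  unfolding t up unfolding d by (simp add: bdiag)
 also have "... = sact (H_tens (N, b) (N', b')) oo (?H ** Str [M \<otimes> M'] (f \<star> f') [N \<otimes> N'])"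
  unfolding sact_H_tens[OF m(2,4)] ff' d by (simp add: bdiag)
 finally show ?thesis
  using hom H_hom_iff[OF H_module_tens[OF m(1,3)] H_module_tens[OF m(2,4)]]
  by (simp add: H_tens_def)
qed

lemma unpack_stens:
 assumes [simp]: "X \<in> Obj B" "Y \<in> Obj B" "Z \<in> Obj B"
 shows "Str [(X \<otimes> Y) \<otimes> Z] (assoc B X Y Z) [X \<otimes> Y \<otimes> Z] =
   pack [X, Y \<otimes> Z] oo ($[X] ** pack [Y, Z]) oo (unpack [X, Y] ** $[Z]) oo unpack [X \<otimes> Y, Z]" (is ?assoc)
  and "Str [\<I> \<otimes> X] (lunit B X) [X] = (unpack [] ** $[X]) oo unpack [\<I>, X]" (is ?lunit)
  and "Str [X \<otimes> \<I>] (runit B X) [X] = ($[X] ** unpack []) oo unpack [X, \<I>]" (is ?runit)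
proof -
 have i1: "arr_inv B W W (idm B W) = idm B W" if "W \<in> Obj B" for W
  using that by (intro arr_inv_eqI) (auto simp: arr_inverse_def comp_idl[of W W])
 have a [simp]: "assoc B X Y Z \<in> Hom B ((X \<otimes> Y) \<otimes> Z) (X \<otimes> Y \<otimes> Z)" "lunit B X \<in> Hom B (\<I> \<otimes> X) X" "runit B X \<in> Hom B (X \<otimes> \<I>) X"
  using assoc_iso lunit_iso runit_iso by (simp_all add: is_iso_def)
 have "unpack [X, Y] ** $[Z] = Str [X \<otimes> Y, Z] (assoc B X Y Z) [X, Y, Z]"
  unfolding stens_def unpack_def
  by (simp add: strand_def tensa_id i1 comp_idl[of "(X \<otimes> Y) \<otimes> Z" "X \<otimes> Y \<otimes> Z"] comp_idr[of "(X \<otimes> Y) \<otimes> Z" "X \<otimes> Y \<otimes> Z"]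
    comp_idl[of "(X \<otimes> Y) \<otimes> Z" "(X \<otimes> Y) \<otimes> Z"] comp_idl[of "X \<otimes> Y \<otimes> Z" "X \<otimes> Y \<otimes> Z"])
 moreover have "$[X] ** pack [Y, Z] = Str [X, Y, Z] (idm B (X \<otimes> Y \<otimes> Z)) [X, Y \<otimes> Z]"
  unfolding strand_def pack_def by (simp add: single_stens_Cons tensa_id)
 ultimately show ?assoc
  by (simp add: pack_def unpack_def scomp_def comp_idl[of "(X \<otimes> Y) \<otimes> Z" "X \<otimes> Y \<otimes> Z"] comp_idr[of "(X \<otimes> Y) \<otimes> Z" "X \<otimes> Y \<otimes> Z"])
 have "unpack [] ** $[X] = Str [\<I>, X] (lunit B X) [X]"
  unfolding stens_def unpack_def
  by (simp add: strand_def tensa_id i1 comp_idr[of "\<I> \<otimes> X" X] comp_idl[of "\<I> \<otimes> X" "\<I> \<otimes> X"])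
 then show ?lunit by (simp add: unpack_def scomp_def comp_idr[of "\<I> \<otimes> X" X])
 have "$[X] ** unpack [] = Str [X, \<I>] (runit B X) [X]"
  unfolding stens_def unpack_def
  by (simp add: strand_def tensa_id i1 comp_idr[of "X \<otimes> \<I>" X] comp_idl[of "X \<otimes> \<I>" "X \<otimes> \<I>"])
 then show ?runit by (simp add: unpack_def scomp_def comp_idr[of "X \<otimes> \<I>" X])
qed

lemma H_hom_assoc:
 assumes m: "H_module X a" "H_module Y b" "H_module Z c"
 shows "assoc B X Y Z \<in> H_hom (H_tens (H_tens (X, a) (Y, b)) (Z, c)) (H_tens (X, a) (H_tens (Y, b) (Z, c)))"
proof -
 note [simp] = m[THEN H_moduleD(1)] m[THEN H_moduleD(2)]
 let ?H = "$[H]" and ?a = "Str [H, X] a [X]" and ?b = "Str [H, Y] b [Y]" and ?c = "Str [H, Z] c [Z]"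
 define d where "d = snd (H_tens (X, a) (Y, b))"
 define e where "e = snd (H_tens (Y, b) (Z, c))"
 note md = H_module_tens[OF m(1,2), folded d_def] and me = H_module_tens[OF m(2,3), folded e_def]
 note [simp] = md[THEN H_moduleD(2)] me[THEN H_moduleD(2)]
 have pr: "H_tens (X, a) (Y, b) = (X \<otimes> Y, d)" "H_tens (Y, b) (Z, c) = (Y \<otimes> Z, e)"
  unfolding d_def e_def by (auto simp: prod_eq_iff)
 have d: "Str [H, X \<otimes> Y] d [X \<otimes> Y] = pack [X, Y] oo tens_act X a Y b oo (?H ** unpack [X, Y])"
  using sact_H_tens[OF m(1,2)] unfolding pr by simp
 have e: "Str [H, Y \<otimes> Z] e [Y \<otimes> Z] = pack [Y, Z] oo tens_act Y b Z c oo (?H ** unpack [Y, Z])"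
  using sact_H_tens[OF m(2,3)] unfolding pr by simp
 let ?A = "Str [(X \<otimes> Y) \<otimes> Z] (assoc B X Y Z) [X \<otimes> Y \<otimes> Z]"
 let ?u = "(unpack [X, Y] ** $[Z]) oo unpack [X \<otimes> Y, Z]"
 let ?v = "pack [X, Y \<otimes> Z] oo ($[X] ** pack [Y, Z])"
 note up = unpack_pack[of "[X, Y]", simplified] unpack_pack[of "[Y, Z]", simplified]
   unpack_pack[of "[X \<otimes> Y, Z]", simplified] unpack_pack[of "[X, Y \<otimes> Z]", simplified]
 obtain x where x: "tens_act X a Y b = Str [H, X, Y] x [X, Y]" and [simp]: "x \<in> Hom B (H \<otimes> X \<otimes> Y) (X \<otimes> Y)"
  using tens_act_Str m by blast
 obtain y where y: "tens_act Y b Z c = Str [H, Y, Z] y [Y, Z]" and [simp]: "y \<in> Hom B (H \<otimes> Y \<otimes> Z) (Y \<otimes> Z)"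
  using tens_act_Str m by blast
 have A: "?A = ?v oo ?u" unfolding unpack_stens(1)[OF m[THEN H_moduleD(1)]] by (simp add: scomp_assoc)
 have com_br: "br [H, H] [X] oo (scom ** $[X]) = ($[X] ** scom) oo br [H] [X]"
  by (rule br_natural) (auto simp: wt_Str)
 let ?l = "(tens_act X a Y b ** ?c) oo (?H ** br [H] [X, Y] ** $[Z]) oo (scom ** $[X, Y, Z])"
 let ?r = "(?a ** tens_act Y b Z c) oo (?H ** br [H] [X] ** $[Y, Z]) oo (scom ** $[X, Y, Z])"
 have lr: "?l = ?r"
 proof -
  have "?l = (?a ** ?b ** ?c) oo (?H ** br [H] [X] ** $[Y, H, Z]) oo ($[H, H] ** br [H] [X, Y] ** $[Z]) oo
   (((scom ** ?H) oo scom) ** $[X, Y, Z])"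
   unfolding tens_act_def by (simp add: bdiag)
  also have "... = (?a ** ?b ** ?c) oo ($[H, X] ** $[H] ** br [H] [Y] ** $[Z]) oo
   (?H ** (br [H, H] [X] oo (scom ** $[X])) ** $[Y, Z]) oo (scom ** $[X, Y, Z])"
   unfolding com_assoc by (simp add: bdiag)
  also have "... = ?r"
   unfolding com_br tens_act_def by (simp add: bdiag)
  finally show ?thesis .
 qed
 have 1: "?u oo sact (H_tens (X \<otimes> Y, d) (Z, c)) = ?l oo (?H ** ?u)"
 proof -
  have "?u oo sact (H_tens (X \<otimes> Y, d) (Z, c)) = (unpack [X, Y] ** $[Z]) oo (unpack [X \<otimes> Y, Z] oo pack [X \<otimes> Y, Z]) oo
    (Str [H, X \<otimes> Y] d [X \<otimes> Y] ** ?c) oo (?H ** br [H] [X \<otimes> Y] ** $[Z]) oo (scom ** $[X \<otimes> Y, Z]) oo (?H ** unpack [X \<otimes> Y, Z])"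
   unfolding sact_H_tens[OF md m(3)] tens_act_def by (simp add: bdiag)
  also have "... = ((unpack [X, Y] oo pack [X, Y]) ** $[Z]) oo (tens_act X a Y b ** ?c) oo
    (?H ** ((unpack [X, Y] ** ?H) oo br [H] [X \<otimes> Y]) ** $[Z]) oo (scom ** $[X \<otimes> Y, Z]) oo (?H ** unpack [X \<otimes> Y, Z])"
   unfolding up(3) d x by (simp add: bdiag)
  also have "(unpack [X, Y] ** ?H) oo br [H] [X \<otimes> Y] = br [H] [X, Y] oo (?H ** unpack [X, Y])"
   by (rule br_natural[symmetric]) (auto simp: wt_Str)
  finally show ?thesis unfolding up x by (simp add: bdiag)
 qed
 have 2: "sact (H_tens (X, a) (Y \<otimes> Z, e)) oo (?H ** ?v) = ?v oo ?r"
 proof -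
  have "sact (H_tens (X, a) (Y \<otimes> Z, e)) oo (?H ** ?v) = pack [X, Y \<otimes> Z] oo
    (?a ** Str [H, Y \<otimes> Z] e [Y \<otimes> Z]) oo (?H ** br [H] [X] ** $[Y \<otimes> Z]) oo (scom ** $[X, Y \<otimes> Z]) oo
    (?H ** (unpack [X, Y \<otimes> Z] oo pack [X, Y \<otimes> Z])) oo ($[H, X] ** pack [Y, Z])"
   unfolding sact_H_tens[OF m(1) me] tens_act_def by (simp add: bdiag)
  also have "... = ?v oo (?a ** tens_act Y b Z c) oo (?H ** br [H] [X] ** (unpack [Y, Z] oo pack [Y, Z])) oo (scom ** $[X, Y, Z])"
   unfolding up(4) e y by (simp add: bdiag)
  finally show ?thesis unfolding up by (simp add: strand_stens)
 qed
 have w: "wt (sact (H_tens (X \<otimes> Y, d) (Z, c)))" "wt (sact (H_tens (X, a) (Y \<otimes> Z, e)))"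
  using H_module_tens[OF md m(3)] H_module_tens[OF m(1) me] by (auto simp: is_module_def wt_Str)
 note [simp] = w[simplified]
 have "?A oo sact (H_tens (X \<otimes> Y, d) (Z, c)) = ?v oo (?u oo sact (H_tens (X \<otimes> Y, d) (Z, c)))"
  unfolding A by (simp add: scomp_assoc)
 also have "... = (?v oo ?r) oo (?H ** ?u)"
  unfolding 1 lr unfolding y by (simp add: scomp_assoc wt_Str)
 also have "... = sact (H_tens (X, a) (Y \<otimes> Z, e)) oo (?H ** ?A)"
  unfolding 2[symmetric] A using stens_scomp[of ?H ?H ?v ?u] by (simp add: scomp_assoc scomp_strand)
 finally have "?A oo sact (H_tens (X \<otimes> Y, d) (Z, c)) = sact (H_tens (X, a) (Y \<otimes> Z, e)) oo (?H ** ?A)" .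
 moreover have "assoc B X Y Z \<in> Hom B ((X \<otimes> Y) \<otimes> Z) (X \<otimes> Y \<otimes> Z)"
  using assoc_iso by (simp add: is_iso_def)
 ultimately show ?thesis
  unfolding pr using H_hom_iff[OF H_module_tens[OF md m(3)] H_module_tens[OF m(1) me]]
  by (simp add: H_tens_def)
qed

lemma H_hom_units:
 assumes m: "H_module X a"
 shows "lunit B X \<in> H_hom (H_tens (H_triv \<I>) (X, a)) (X, a)"
  and "runit B X \<in> H_hom (H_tens (X, a) (H_triv \<I>)) (X, a)"
proof -
 note [simp] = m[THEN H_moduleD(1)] m[THEN H_moduleD(2)]
 let ?H = "$[H]" and ?a = "Str [H, X] a [X]"
 define e where "e = snd (H_triv \<I>)"
 have t: "H_triv \<I> = (\<I>, e)" by (simp add: e_def prod_eq_iff)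
 have me: "H_module \<I> e" using H_module_triv[of \<I>] by (simp add: e_def)
 have e: "Str [H, \<I>] e [\<I>] = scou ** $[\<I>]" using sact_H_triv[of \<I>] unfolding t by simp
 let ?u = "(unpack [] ** $[X]) oo unpack [\<I>, X]" and ?v = "($[X] ** unpack []) oo unpack [X, \<I>]"
 note up = unpack_pack[of "[\<I>, X]", simplified] unpack_pack[of "[X, \<I>]", simplified]
 note us = unpack_stens(2,3)[OF H_moduleD(1)[OF m] H_moduleD(1)[OF m] H_moduleD(1)[OF m]]
 have "?u oo sact (H_tens (\<I>, e) (X, a)) = (unpack [] ** $[X]) oo (unpack [\<I>, X] oo pack [\<I>, X]) oo
   ((scou ** $[\<I>]) ** ?a) oo (?H ** br [H] [\<I>] ** $[X]) oo (scom ** $[\<I>, X]) oo (?H ** unpack [\<I>, X])"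
  unfolding sact_H_tens[OF me m] tens_act_def e by (simp add: bdiag)
 also have "... = ?a oo (?H ** unpack [] ** $[X]) oo (scou ** ?H ** $[\<I>, X]) oo (scom ** $[\<I>, X]) oo (?H ** unpack [\<I>, X])"
 proof -
  have "(unpack [] ** ?H) oo br [H] [\<I>] = br [H] [] oo (?H ** unpack [])"
   by (rule br_natural[symmetric]) (auto simp: wt_Str)
  then have n: "(unpack [] ** ?H) oo br [H] [\<I>] = ?H ** unpack []" by (simp add: br_Nil strand_scomp)
  have "(unpack [] ** $[X]) oo (unpack [\<I>, X] oo pack [\<I>, X]) oo
   ((scou ** $[\<I>]) ** ?a) oo (?H ** br [H] [\<I>] ** $[X]) oo (scom ** $[\<I>, X]) oo (?H ** unpack [\<I>, X]) =
   ?a oo (scou ** ((unpack [] ** ?H) oo br [H] [\<I>]) ** $[X]) oo (scom ** $[\<I>, X]) oo (?H ** unpack [\<I>, X])"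
   unfolding up by (simp add: bdiag)
  then show ?thesis unfolding n by (simp add: bdiag)
 qed
 also have "... = ?a oo (((scou ** ?H) oo scom) ** $[X]) oo (?H ** ?u)"
  by (simp add: bdiag)
 also have "... = ?a oo (?H ** ?u)" unfolding com_cou_left by (simp add: bdiag)
 finally have 1: "?u oo sact (H_tens (\<I>, e) (X, a)) = ?a oo (?H ** ?u)" .
 have "?v oo sact (H_tens (X, a) (\<I>, e)) = ($[X] ** unpack []) oo (unpack [X, \<I>] oo pack [X, \<I>]) oo
   (?a ** (scou ** $[\<I>])) oo (?H ** br [H] [X] ** $[\<I>]) oo (scom ** $[X, \<I>]) oo (?H ** unpack [X, \<I>])"
  unfolding sact_H_tens[OF m me] tens_act_def e by (simp add: bdiag)
 also have "... = ?a oo (?H ** (($[X] ** scou) oo br [H] [X])) oo (scom ** $[X] ** unpack []) oo (?H ** unpack [X, \<I>])"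
  unfolding up by (simp add: bdiag)
 also have "($[X] ** scou) oo br [H] [X] = br [] [X] oo (scou ** $[X])"
  by (rule br_natural[symmetric]) (auto simp: wt_Str)
 also have "?a oo (?H ** ...) oo (scom ** $[X] ** unpack []) oo (?H ** unpack [X, \<I>]) =
   ?a oo (((?H ** scou) oo scom) ** $[X]) oo (?H ** ?v)"
  by (simp add: bdiag)
 also have "... = ?a oo (?H ** ?v)" unfolding com_cou_right by (simp add: bdiag)
 finally have 2: "?v oo sact (H_tens (X, a) (\<I>, e)) = ?a oo (?H ** ?v)" .
 have "lunit B X \<in> Hom B (\<I> \<otimes> X) X" "runit B X \<in> Hom B (X \<otimes> \<I>) X"
  using lunit_iso runit_iso by (simp_all add: is_iso_def)
 then show "lunit B X \<in> H_hom (H_tens (H_triv \<I>) (X, a)) (X, a)"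
  "runit B X \<in> H_hom (H_tens (X, a) (H_triv \<I>)) (X, a)"
  using 1 2 H_hom_iff[OF H_module_tens[OF me m] m] H_hom_iff[OF H_module_tens[OF m me] m]
  unfolding t us[symmetric] by (simp_all add: H_tens_def)
qed

end

subsection \<open>Dual modules\<close>

context braided_hopf_algebra
begin

definition ldual_act :: "'o => 'a => ('o, 'a) strarr" where
 "ldual_act X a = (sevl X ** $[LD X]) oo ($[LD X] ** (Str [H, X] a [X] oo (sant ** $[X])) ** $[LD X]) oo
   ($[LD X, H] ** scoevl X) oo br [H] [LD X]"

definition rdual_act :: "'o => 'a => ('o, 'a) strarr" where
 "rdual_act X a = ($[RD X] ** sevr X) oo
   ($[RD X] ** (Str [H, X] a [X] oo (santi ** $[X]) oo ibr [X] [H]) ** $[RD X]) oo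
   (scoevr X ** $[H, RD X])"

lemma sdom_dual_act [simp]: "sdom (ldual_act X a) = [H, LD X]" "sdom (rdual_act X a) = [H, RD X]"
 and scod_dual_act [simp]: "scod (ldual_act X a) = [LD X]" "scod (rdual_act X a) = [RD X]"
 by (simp_all add: ldual_act_def rdual_act_def)

definition "ldual_act_arr X a = sarr (ldual_act X a)"
definition "rdual_act_arr X a = sarr (rdual_act X a)"

lemma dual_act_Str:
 "ldual_act X a = Str [H, LD X] (ldual_act_arr X a) [LD X]"
 "rdual_act X a = Str [H, RD X] (rdual_act_arr X a) [RD X]"
 by (simp_all add: ldual_act_arr_def rdual_act_arr_def Str_sarr)

lemma ibr_scom_natural:
 "($[H] ** br [H] [H]) oo (scom ** $[H]) oo ibr [H] [H] oo scom = (ibr [H] [H] ** $[H]) oo (scom ** $[H]) oo scom"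
proof -
 have "ibr [H] [H, H] oo ($[H] ** scom) = (scom ** $[H]) oo ibr [H] [H]"
  by (rule ibr_natural) (auto simp: wt_Str)
 then have "($[H] ** br [H] [H]) oo (scom ** $[H]) oo ibr [H] [H] oo scom =
   ($[H] ** br [H] [H]) oo (ibr [H] [H, H] oo ($[H] ** scom)) oo scom"
  by (simp add: scomp_assoc wt_Str)
 also have "... = ($[H] ** (br [H] [H] oo ibr [H] [H])) oo (ibr [H] [H] ** $[H]) oo (($[H] ** scom) oo scom)"
  by (simp add: bdiag)
 finally show ?thesis
  unfolding br_ibr[of "[H]" "[H]", simplified] com_assoc[symmetric] by (simp add: bdiag)
qed

context
 fixes X :: 'o and a :: 'a
 assumes m: "H_module X a"
begin

private lemma act_hom [simp]: "X \<in> Obj B" "a \<in> Hom B (H \<otimes> X) X"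
 using H_moduleD[OF m] by auto

private abbreviation "A \<equiv> Str [H, X] a [X]"
private abbreviation "A' \<equiv> A oo (sant ** $[X])"
private abbreviation "A'' \<equiv> A oo (santi ** $[X]) oo ibr [X] [H]"

private lemma mul: "A oo (smul ** $[X]) = A oo ($[H] ** A)" and unit: "A oo (sunt ** $[X]) = $[X]"
 using H_moduleD[OF m] by auto

lemma dual_act_hom [simp]:
 "ldual_act_arr X a \<in> Hom B (H \<otimes> LD X) (LD X)" "rdual_act_arr X a \<in> Hom B (H \<otimes> RD X) (RD X)"
proof -
 have "wt (ldual_act X a)" "wt (rdual_act X a)" by (simp_all add: ldual_act_def rdual_act_def wt_Str)
 then show "ldual_act_arr X a \<in> Hom B (H \<otimes> LD X) (LD X)" "rdual_act_arr X a \<in> Hom B (H \<otimes> RD X) (RD X)"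
  by (simp_all add: dual_act_Str wt_Str)
qed

lemma evl_ldual_act: "sevl X oo (ldual_act X a ** $[X]) = sevl X oo ($[LD X] ** A') oo (br [H] [LD X] ** $[X])"
proof -
 have "sevl X oo (ldual_act X a ** $[X]) = sevl X oo ($[LD X] ** A') oo
   ($[LD X, H] ** (($[X] ** sevl X) oo (scoevl X ** $[X]))) oo (br [H] [LD X] ** $[X])"
  unfolding ldual_act_def by (simp add: bdiag)
 then show ?thesis unfolding ldual_zigzag[OF act_hom(1)] by (simp add: bdiag)
qed

lemma coevl_ldual_act: "($[X] ** ldual_act X a) oo (br [H] [X] ** $[LD X]) oo ($[H] ** scoevl X) = (A' ** $[LD X]) oo ($[H] ** scoevl X)"
proof -
 have n: "br [H] [X, LD X] oo ($[H] ** scoevl X) = (scoevl X ** $[H]) oo br [H] []"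
  by (rule br_natural) (auto simp: wt_Str)
 have "($[X] ** ldual_act X a) oo (br [H] [X] ** $[LD X]) oo ($[H] ** scoevl X) =
   ($[X] ** sevl X ** $[LD X]) oo ($[X, LD X] ** A' ** $[LD X]) oo ($[X, LD X, H] ** scoevl X) oo
   (br [H] [X, LD X] oo ($[H] ** scoevl X))"
  unfolding ldual_act_def by (simp add: bdiag)
 also have "... = ((($[X] ** sevl X) oo (scoevl X ** $[X])) ** $[LD X]) oo (A' ** $[LD X]) oo ($[H] ** scoevl X)"
  unfolding n by (simp add: bdiag)
 finally show ?thesis unfolding ldual_zigzag[OF act_hom(1)] by (simp add: bdiag)
qed

lemma evr_rdual_act: "sevr X oo ($[X] ** rdual_act X a) = sevr X oo (A'' ** $[RD X])"
proof -
 have "sevr X oo ($[X] ** rdual_act X a) = sevr X oo (A'' ** $[RD X]) oo (((sevr X ** $[X]) oo ($[X] ** scoevr X)) ** $[H, RD X])"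
  unfolding rdual_act_def by (simp add: bdiag)
 then show ?thesis unfolding rdual_zigzag[OF act_hom(1)] by (simp add: bdiag)
qed

lemma coevr_rdual_act: "(rdual_act X a ** $[X]) oo ($[H] ** scoevr X) = ($[RD X] ** A'') oo (scoevr X ** $[H])"
proof -
 have "(rdual_act X a ** $[X]) oo ($[H] ** scoevr X) = ($[RD X] ** ((sevr X ** $[X]) oo ($[X] ** scoevr X))) oo ($[RD X] ** A'') oo (scoevr X ** $[H])"
  unfolding rdual_act_def by (simp add: bdiag)
 then show ?thesis unfolding rdual_zigzag[OF act_hom(1)] by (simp add: bdiag)
qed

lemma H_module_ldual: "H_module (LD X) (ldual_act_arr X a)"
proof -
 let ?l = "ldual_act X a"
 have n1: "br [H] [LD X] oo (smul ** $[LD X]) = ($[LD X] ** smul) oo br [H, H] [LD X]"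
  and n2: "br [H] [LD X] oo ($[H] ** ?l) = (?l ** $[H]) oo br [H] [H, LD X]"
  and n3: "br [H] [LD X, H] oo ($[H] ** br [H] [LD X]) = (br [H] [LD X] ** $[H]) oo br [H] [H, LD X]"
  and n4: "br [H] [LD X] oo (sunt ** $[LD X]) = ($[LD X] ** sunt) oo br [] [LD X]"
  by (rule br_natural; simp add: wt_Str dual_act_Str)+
 have "sevl X oo ((?l oo (smul ** $[LD X])) ** $[X]) = (sevl X oo (?l ** $[X])) oo (smul ** $[LD X, X])"
  unfolding dual_act_Str by (simp add: bdiag)
 also have "... = sevl X oo ($[LD X] ** A') oo ((br [H] [LD X] oo (smul ** $[LD X])) ** $[X])"
  unfolding evl_ldual_act by (simp add: bdiag)
 also have "... = sevl X oo ($[LD X] ** (A oo ((sant oo smul) ** $[X]))) oo (br [H, H] [LD X] ** $[X])"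
  unfolding n1 by (simp add: bdiag)
 also have "... = sevl X oo ($[LD X] ** ((A oo (smul ** $[X])) oo ((sant ** sant) ** $[X]))) oo
   ((br [H] [LD X, H] oo ($[H] ** br [H] [LD X])) ** $[X])"
  unfolding ant_mul by (simp add: bdiag)
 also have "... = (sevl X oo ($[LD X] ** A') oo (br [H] [LD X] ** $[X])) oo ($[H, LD X] ** A') oo (br [H] [H, LD X] ** $[X])"
  unfolding n3 mul by (simp add: bdiag)
 also have "... = (sevl X oo ($[LD X] ** A')) oo (((?l ** $[H]) oo br [H] [H, LD X]) ** $[X])"
  unfolding evl_ldual_act[symmetric] unfolding dual_act_Str by (simp add: bdiag)
 also have "... = (sevl X oo ($[LD X] ** A') oo (br [H] [LD X] ** $[X])) oo ($[H] ** ?l ** $[X])"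
  unfolding n2[symmetric] unfolding dual_act_Str by (simp add: bdiag)
 also have "... = sevl X oo ((?l oo ($[H] ** ?l)) ** $[X])"
  unfolding evl_ldual_act[symmetric] unfolding dual_act_Str by (simp add: bdiag)
 finally have mul': "?l oo (smul ** $[LD X]) = ?l oo ($[H] ** ?l)"
  by (rule evl_cancel) (auto simp: wt_Str dual_act_Str)
 have "sevl X oo ((?l oo (sunt ** $[LD X])) ** $[X]) = (sevl X oo (?l ** $[X])) oo (sunt ** $[LD X, X])"
  unfolding dual_act_Str by (simp add: bdiag)
 also have "... = sevl X oo ($[LD X] ** A') oo ((br [H] [LD X] oo (sunt ** $[LD X])) ** $[X])"
  unfolding evl_ldual_act by (simp add: bdiag)
 also have "... = sevl X oo ($[LD X] ** (A oo ((sant oo sunt) ** $[X])))"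
  unfolding n4 by (simp add: bdiag)
 also have "... = sevl X oo ($[LD X] ** $[X])" unfolding ant_unt unit ..
 finally have unit': "?l oo (sunt ** $[LD X]) = $[LD X]"
  by (rule evl_cancel) (auto simp: wt_Str dual_act_Str)
 show ?thesis using mul' unit' unfolding is_module_def by (simp add: dual_act_Str)
qed

lemma H_module_rdual: "H_module (RD X) (rdual_act_arr X a)"
proof -
 let ?r = "rdual_act X a"
 have n1: "ibr [X] [H] oo ($[X] ** smul) = (smul ** $[X]) oo ibr [X] [H, H]"
  and n4: "ibr [X] [H] oo ($[X] ** sunt) = (sunt ** $[X]) oo ibr [X] []"
  and n5: "ibr [X] [H] oo (A'' ** $[H]) = ($[H] ** A'') oo ibr [X, H] [H]"
  and n6: "ibr [X] [H, H] oo ($[X] ** ibr [H] [H]) = (ibr [H] [H] ** $[X]) oo ibr [X] [H, H]"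
  by (rule ibr_natural; simp add: wt_Str)+
 have "sevr X oo ($[X] ** (?r oo (smul ** $[RD X]))) = (sevr X oo ($[X] ** ?r)) oo ($[X] ** smul ** $[RD X])"
  unfolding dual_act_Str by (simp add: bdiag)
 also have "... = sevr X oo ((A oo (santi ** $[X])) ** $[RD X]) oo ((ibr [X] [H] oo ($[X] ** smul)) ** $[RD X])"
  unfolding evr_rdual_act by (simp add: bdiag)
 also have "... = sevr X oo (A ** $[RD X]) oo ((santi oo smul) ** $[X, RD X]) oo (ibr [X] [H, H] ** $[RD X])"
  unfolding n1 by (simp add: bdiag)
 also have "... = sevr X oo ((A oo (smul ** $[X])) ** $[RD X]) oo ((ibr [H] [H] oo (santi ** santi)) ** $[X, RD X]) oo (ibr [X] [H, H] ** $[RD X])"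
  unfolding ant_inv_mul by (simp add: bdiag)
 also have "ibr [H] [H] oo (santi ** santi) = (santi ** santi) oo ibr [H] [H]"
  by (rule ibr_natural) (auto simp: wt_Str)
 also have "sevr X oo ((A oo (smul ** $[X])) ** $[RD X]) oo (... ** $[X, RD X]) oo (ibr [X] [H, H] ** $[RD X]) =
   sevr X oo ((A oo ($[H] ** A)) ** $[RD X]) oo (santi ** santi ** $[X, RD X]) oo
   (((ibr [H] [H] ** $[X]) oo ibr [X] [H, H]) ** $[RD X])"
  unfolding mul by (simp add: bdiag)
 also have "... = sevr X oo ((A oo (santi ** $[X]) oo (($[H] ** A'') oo ibr [X, H] [H])) ** $[RD X])"
  unfolding n6[symmetric] by (simp add: bdiag)
 also have "... = (sevr X oo (A'' ** $[RD X])) oo (A'' ** $[H, RD X])"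
  unfolding n5[symmetric] by (simp add: bdiag)
 also have "... = (sevr X oo ($[X] ** ?r)) oo (A'' ** $[H, RD X])"
  unfolding evr_rdual_act ..
 also have "... = (sevr X oo (A'' ** $[RD X])) oo ($[X, H] ** ?r)"
  unfolding dual_act_Str by (simp add: bdiag)
 also have "... = sevr X oo ($[X] ** (?r oo ($[H] ** ?r)))"
  unfolding evr_rdual_act[symmetric] unfolding dual_act_Str by (simp add: bdiag)
 finally have mul': "?r oo (smul ** $[RD X]) = ?r oo ($[H] ** ?r)"
  by (rule evr_cancel_right) (auto simp: wt_Str dual_act_Str)
 have "sevr X oo ($[X] ** (?r oo (sunt ** $[RD X]))) = (sevr X oo ($[X] ** ?r)) oo ($[X] ** sunt ** $[RD X])"
  unfolding dual_act_Str by (simp add: bdiag)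
 also have "... = sevr X oo ((A oo (santi ** $[X])) ** $[RD X]) oo ((ibr [X] [H] oo ($[X] ** sunt)) ** $[RD X])"
  unfolding evr_rdual_act by (simp add: bdiag)
 also have "... = sevr X oo ((A oo ((santi oo sunt) ** $[X])) ** $[RD X])"
  unfolding n4 by (simp add: bdiag)
 also have "... = sevr X oo ($[X] ** $[RD X])" unfolding ant_inv_unt unit ..
 finally have unit': "?r oo (sunt ** $[RD X]) = $[RD X]"
  by (rule evr_cancel_right) (auto simp: wt_Str dual_act_Str)
 show ?thesis using mul' unit' unfolding is_module_def by (simp add: dual_act_Str)
qed

lemma evl_ldual_linear: "sevl X oo tens_act (LD X) (ldual_act_arr X a) X a = scou ** sevl X"
proof -
 let ?l = "ldual_act X a"
 have n': "br [H, H] [LD X] oo (scom ** $[LD X]) = ($[LD X] ** scom) oo br [H] [LD X]"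
  and n4: "br [] [LD X] oo (scou ** $[LD X]) = ($[LD X] ** scou) oo br [H] [LD X]"
  by (rule br_natural; simp add: wt_Str dual_act_Str)+
 have "sevl X oo tens_act (LD X) (ldual_act_arr X a) X a = (sevl X oo (?l ** $[X])) oo ($[H, LD X] ** A) oo
   ($[H] ** br [H] [LD X] ** $[X]) oo (scom ** $[LD X, X])"
  unfolding tens_act_def dual_act_Str by (simp add: bdiag)
 also have "... = sevl X oo ($[LD X] ** (A oo ($[H] ** A) oo (sant ** $[H, X]))) oo
   ((br [H, H] [LD X] oo (scom ** $[LD X])) ** $[X])"
  unfolding evl_ldual_act by (simp add: bdiag)
 also have "... = sevl X oo ($[LD X] ** ((A oo ($[H] ** A)) oo (sant ** $[H, X]) oo (scom ** $[X]))) oo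
   (br [H] [LD X] ** $[X])"
  unfolding n' by (simp add: bdiag)
 also have "... = sevl X oo ($[LD X] ** (A oo ((smul oo (sant ** $[H]) oo scom) ** $[X]))) oo
   (br [H] [LD X] ** $[X])"
  unfolding mul[symmetric] by (simp add: bdiag)
 also have "... = sevl X oo ($[LD X] ** (A oo (sunt ** $[X]))) oo ((($[LD X] ** scou) oo br [H] [LD X]) ** $[X])"
  unfolding ant_left by (simp add: bdiag)
 also have "... = scou ** sevl X"
  unfolding n4[symmetric] unit by (simp add: bdiag)
 finally show ?thesis .
qed

lemma coevl_ldual_linear: "tens_act X a (LD X) (ldual_act_arr X a) oo ($[H] ** scoevl X) = scou ** scoevl X"
proof -
 let ?l = "ldual_act X a"
 have "tens_act X a (LD X) (ldual_act_arr X a) oo ($[H] ** scoevl X) = (A ** $[LD X]) oo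
   ($[H] ** (($[X] ** ?l) oo (br [H] [X] ** $[LD X]) oo ($[H] ** scoevl X))) oo scom"
  unfolding tens_act_def dual_act_Str by (simp add: bdiag)
 also have "... = ((A oo ($[H] ** A)) ** $[LD X]) oo ($[H] ** sant ** scoevl X) oo scom"
  unfolding coevl_ldual_act by (simp add: bdiag)
 also have "... = (A ** $[LD X]) oo ((smul oo ($[H] ** sant) oo scom) ** scoevl X)"
  unfolding mul[symmetric] by (simp add: bdiag)
 also have "... = ((A oo (sunt ** $[X])) ** $[LD X]) oo (scou ** scoevl X)"
  unfolding ant_right by (simp add: bdiag)
 also have "... = scou ** scoevl X"
  unfolding unit by (simp add: bdiag)
 finally show ?thesis .
qed

lemma evr_rdual_linear: "sevr X oo tens_act X a (RD X) (rdual_act_arr X a) = scou ** sevr X"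
proof -
 let ?r = "rdual_act X a"
 have n2: "ibr [X] [H] oo (A ** $[H]) = ($[H] ** A) oo ibr [H, X] [H]"
  by (rule ibr_natural; simp add: wt_Str)
 have "sevr X oo tens_act X a (RD X) (rdual_act_arr X a) = (sevr X oo ($[X] ** ?r)) oo (A ** $[H, RD X]) oo
   ($[H] ** br [H] [X] ** $[RD X]) oo (scom ** $[X, RD X])"
  unfolding tens_act_def dual_act_Str by (simp add: bdiag)
 also have "... = sevr X oo ((A oo (santi ** $[X])) ** $[RD X]) oo ((ibr [X] [H] oo (A ** $[H])) ** $[RD X]) oo
   ($[H] ** br [H] [X] ** $[RD X]) oo (scom ** $[X, RD X])"
  unfolding evr_rdual_act by (simp add: bdiag)
 also have "... = sevr X oo ((A oo ($[H] ** A)) ** $[RD X]) oo (santi ** $[H, X, RD X]) oo (ibr [H] [H] ** $[X, RD X]) oo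
   ($[H] ** (ibr [X] [H] oo br [H] [X]) ** $[RD X]) oo (scom ** $[X, RD X])"
  unfolding n2 by (simp add: bdiag)
 also have "... = sevr X oo (A ** $[RD X]) oo ((smul oo (santi ** $[H]) oo ibr [H] [H] oo scom) ** $[X, RD X])"
  unfolding mul[symmetric] ibr_br[of "[X]" "[H]", simplified] by (simp add: bdiag)
 also have "... = (scou ** sevr X) oo ($[H] ** (A oo (sunt ** $[X])) ** $[RD X])"
  unfolding ant_inv_right by (simp add: bdiag)
 also have "... = scou ** sevr X"
  unfolding unit by (simp add: bdiag)
 finally show ?thesis .
qed

lemma coevr_rdual_linear: "tens_act (RD X) (rdual_act_arr X a) X a oo ($[H] ** scoevr X) = scou ** scoevr X"
proof -
 let ?r = "rdual_act X a"
 have n: "br [H] [RD X, X] oo ($[H] ** scoevr X) = (scoevr X ** $[H]) oo br [H] []"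
  by (rule br_natural) (auto simp: wt_Str)
 have n2: "ibr [X] [H] oo (A'' ** $[H]) = ($[H] ** A'') oo ibr [X, H] [H]"
  and n3: "ibr [X] [H, H] oo ($[X] ** scom) = (scom ** $[X]) oo ibr [X] [H]"
  and n4: "ibr [X] [] oo ($[X] ** scou) = (scou ** $[X]) oo ibr [X] [H]"
  and n5: "ibr [X] [H, H] oo ($[X] ** ibr [H] [H]) = (ibr [H] [H] ** $[X]) oo ibr [X] [H, H]"
  by (rule ibr_natural; simp add: wt_Str)+
 have "tens_act (RD X) (rdual_act_arr X a) X a oo ($[H] ** scoevr X) =
   ($[RD X] ** (A oo ibr [X] [H])) oo (?r ** $[X, H]) oo ($[H] ** (br [H] [RD X, X] oo ($[H] ** scoevr X))) oo scom"
 proof -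
  have "tens_act (RD X) (rdual_act_arr X a) X a oo ($[H] ** scoevr X) =
   (?r ** A) oo ($[H, RD X] ** (ibr [X] [H] oo br [H] [X])) oo ($[H] ** br [H] [RD X] ** $[X]) oo (scom ** scoevr X)"
   unfolding ibr_br[of "[X]" "[H]", simplified] tens_act_def dual_act_Str by (simp add: bdiag)
  then show ?thesis unfolding dual_act_Str by (simp add: bdiag)
 qed
 also have "... = ($[RD X] ** (A oo ibr [X] [H])) oo (((?r ** $[X]) oo ($[H] ** scoevr X)) ** $[H]) oo scom"
  unfolding n dual_act_Str by (simp add: bdiag)
 also have "... = ($[RD X] ** (A oo (ibr [X] [H] oo (A'' ** $[H])))) oo (scoevr X ** scom)"
  unfolding coevr_rdual_act by (simp add: bdiag)
 also have "... = ($[RD X] ** ((A oo ($[H] ** A)) oo ($[H] ** santi ** $[X]) oo (ibr [H] [H] ** $[X]) oo (ibr [X] [H, H] oo ($[X] ** scom)))) oo (scoevr X ** $[H])"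
 proof -
  have "($[H] ** ibr [X] [H]) oo ibr [X, H] [H] = (ibr [H] [H] ** $[X]) oo ibr [X] [H, H]"
   using n5 by (simp add: bdiag)
  then have "($[H] ** A'') oo ibr [X, H] [H] = ($[H] ** A) oo ($[H] ** santi ** $[X]) oo (ibr [H] [H] ** $[X]) oo ibr [X] [H, H]"
   by (simp add: bdiag)
  then show ?thesis unfolding n2 by (simp add: bdiag)
 qed
 also have "... = ($[RD X] ** (A oo ((smul oo ($[H] ** santi) oo ibr [H] [H] oo scom) ** $[X]) oo ibr [X] [H])) oo (scoevr X ** $[H])"
  unfolding n3 mul[symmetric] by (simp add: bdiag)
 also have "... = ($[RD X] ** ((A oo (sunt ** $[X])) oo ((scou ** $[X]) oo ibr [X] [H]))) oo (scoevr X ** $[H])"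
  unfolding ant_inv_left by (simp add: bdiag)
 also have "... = scou ** scoevr X"
  unfolding n4[symmetric] unit by (simp add: bdiag)
 finally show ?thesis .
qed

lemma ldual_act_unique:
 assumes "H_module (LD X) b" and e: "sevl X oo tens_act (LD X) b X a = scou ** sevl X"
 shows "Str [H, LD X] b [LD X] = ldual_act X a"
proof -
 note [simp] = H_moduleD(2)[OF assms(1)]
 let ?b = "Str [H, LD X] b [LD X]" and ?W = "tens_act (LD X) b X a"
 let ?R = "($[H, LD X] ** A') oo ($[H] ** br [H] [LD X] ** $[X]) oo (scom ** $[LD X, X])"
 have n: "br [H, H] [LD X] oo (scom ** $[LD X]) = ($[LD X] ** scom) oo br [H] [LD X]"
  and n': "br [] [LD X] oo (scou ** $[LD X]) = ($[LD X] ** scou) oo br [H] [LD X]"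
  by (rule br_natural; simp add: wt_Str)+
 have "sevl X oo ?W oo ?R = (sevl X oo ?W) oo ?R"
  unfolding tens_act_def by (simp add: bdiag)
 also have "... = sevl X oo ($[LD X] ** A') oo (br [H] [LD X] ** $[X]) oo (((scou ** $[H]) oo scom) ** $[LD X, X])"
  unfolding e by (simp add: bdiag)
 also have "... = sevl X oo (ldual_act X a ** $[X])"
  unfolding com_cou_left evl_ldual_act by (simp add: bdiag)
 finally have 1: "sevl X oo ?W oo ?R = ..." .
 have "sevl X oo ?W oo ?R = sevl X oo (?b ** (A oo ($[H] ** A))) oo ($[H, LD X, H] ** sant ** $[X]) oo
   ($[H] ** br [H, H] [LD X] ** $[X]) oo (((scom ** $[H]) oo scom) ** $[LD X, X])"
  unfolding tens_act_def by (simp add: bdiag)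
 also have "... = sevl X oo (?b ** (A oo (smul ** $[X]))) oo ($[H, LD X, H] ** sant ** $[X]) oo
   ($[H] ** (br [H, H] [LD X] oo (scom ** $[LD X])) ** $[X]) oo (scom ** $[LD X, X])"
  unfolding com_assoc mul by (simp add: bdiag)
 also have "... = sevl X oo (?b ** A) oo ($[H, LD X] ** (smul oo ($[H] ** sant) oo scom) ** $[X]) oo
   ($[H] ** br [H] [LD X] ** $[X]) oo (scom ** $[LD X, X])"
  unfolding n by (simp add: bdiag)
 also have "... = sevl X oo (?b ** (A oo (sunt ** $[X]))) oo
   ($[H] ** (($[LD X] ** scou) oo br [H] [LD X]) ** $[X]) oo (scom ** $[LD X, X])"
  unfolding ant_right by (simp add: bdiag)
 also have "... = sevl X oo (?b ** $[X]) oo ((($[H] ** scou) oo scom) ** $[LD X, X])"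
  unfolding n'[symmetric] unit by (simp add: bdiag)
 also have "... = sevl X oo (?b ** $[X])"
  unfolding com_cou_right by (simp add: bdiag)
 finally have "sevl X oo (?b ** $[X]) = sevl X oo (ldual_act X a ** $[X])" using 1 by simp
 then show ?thesis by (rule evl_cancel) (auto simp: wt_Str dual_act_Str)
qed

lemma rdual_act_unique:
 assumes "H_module (RD X) b" and e: "sevr X oo tens_act X a (RD X) b = scou ** sevr X"
 shows "Str [H, RD X] b [RD X] = rdual_act X a"
proof -
 note [simp] = H_moduleD(2)[OF assms(1)]
 let ?b = "Str [H, RD X] b [RD X]" and ?W = "tens_act X a (RD X) b"
 let ?R = "($[H] ** (A oo (santi ** $[X])) ** $[RD X]) oo ((ibr [H] [H] oo scom) ** $[X, RD X]) oo (ibr [X] [H] ** $[RD X])"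
 have n: "br [H] [X] oo ($[H] ** A) = (A ** $[H]) oo br [H] [H, X]"
  and n': "br [H] [H] oo ($[H] ** santi) = (santi ** $[H]) oo br [H] [H]"
  by (rule br_natural; simp add: wt_Str)+
 have i: "(scou ** $[H]) oo ibr [H] [H] = ibr [H] [] oo ($[H] ** scou)"
  by (rule ibr_natural[symmetric]) (auto simp: wt_Str)
 have "sevr X oo ?W oo ?R = (sevr X oo ?W) oo ?R"
  unfolding tens_act_def by (simp add: bdiag)
 also have "... = sevr X oo ((A oo (santi ** $[X])) ** $[RD X]) oo ((((scou ** $[H]) oo ibr [H] [H]) oo scom) ** $[X, RD X]) oo (ibr [X] [H] ** $[RD X])"
  unfolding e by (simp add: bdiag)
 also have "... = sevr X oo ((A oo (santi ** $[X])) ** $[RD X]) oo ((($[H] ** scou) oo scom) ** $[X, RD X]) oo (ibr [X] [H] ** $[RD X])"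
  unfolding i by (simp add: bdiag)
 also have "... = sevr X oo ($[X] ** rdual_act X a)"
  unfolding com_cou_right evr_rdual_act by (simp add: bdiag)
 finally have 1: "sevr X oo ?W oo ?R = ..." .
 have "sevr X oo ?W oo ?R = sevr X oo (A ** ?b) oo ($[H] ** (br [H] [X] oo ($[H] ** A)) ** $[RD X]) oo
   (scom ** santi ** $[X, RD X]) oo ((ibr [H] [H] oo scom) ** $[X, RD X]) oo (ibr [X] [H] ** $[RD X])"
  unfolding tens_act_def by (simp add: bdiag)
 also have "... = sevr X oo ((A oo ($[H] ** A)) ** ?b) oo ($[H, H] ** br [H] [X] ** $[RD X]) oo ($[H] ** (br [H] [H] oo ($[H] ** santi)) ** $[X, RD X]) oo
   (scom ** $[H, X, RD X]) oo ((ibr [H] [H] oo scom) ** $[X, RD X]) oo (ibr [X] [H] ** $[RD X])"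
  unfolding n by (simp add: bdiag)
 also have "... = sevr X oo (A ** ?b) oo (smul ** br [H] [X] ** $[RD X]) oo ($[H] ** santi ** $[H, X, RD X]) oo
   ((($[H] ** br [H] [H]) oo (scom ** $[H]) oo ibr [H] [H] oo scom) ** $[X, RD X]) oo (ibr [X] [H] ** $[RD X])"
  unfolding n' mul[symmetric] by (simp add: bdiag)
 also have "... = sevr X oo (A ** ?b) oo ($[H] ** br [H] [X] ** $[RD X]) oo
   ((smul oo ($[H] ** santi) oo ibr [H] [H] oo scom) ** $[H, X, RD X]) oo (scom ** $[X, RD X]) oo (ibr [X] [H] ** $[RD X])"
  unfolding ibr_scom_natural by (simp add: bdiag)
 also have "... = sevr X oo ((A oo (sunt ** $[X])) ** ?b) oo
   (br [H] [X] ** $[RD X]) oo (((scou ** $[H]) oo scom) ** $[X, RD X]) oo (ibr [X] [H] ** $[RD X])"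
  unfolding ant_inv_left by (simp add: bdiag)
 also have "... = sevr X oo ($[X] ** ?b) oo ((br [H] [X] oo ibr [X] [H]) ** $[RD X])"
  unfolding com_cou_left unit by (simp add: bdiag)
 also have "... = sevr X oo ($[X] ** ?b)"
  unfolding br_ibr[of "[X]" "[H]", simplified] by (simp add: bdiag)
 finally have "sevr X oo ($[X] ** ?b) = sevr X oo ($[X] ** rdual_act X a)" using 1 by simp
 then show ?thesis by (rule evr_cancel_right) (auto simp: wt_Str dual_act_Str)
qed

end

end

subsection \<open>The rigid category of modules\<close>

context linear_category
begin

lemma add_idem_zero:
 assumes "X \<in> Obj C" "Y \<in> Obj C" "f \<in> Hom C X Y" "f \<oplus> f = f"
 shows "f = zeroa C X Y"
proof -
 obtain g where g: "g \<in> Hom C X Y" "g \<oplus> f = zeroa C X Y" using add_neg assms by blast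
 have "zeroa C X Y = g \<oplus> (f \<oplus> f)" using g assms by simp
 also have "... = f" using g assms add_assoc[of X Y g f f] add_zero by simp
 finally show ?thesis ..
qed

lemma comp_zero:
 assumes "X \<in> Obj C" "Y \<in> Obj C" "Z \<in> Obj C"
 shows "f \<in> Hom C X Y ==> zeroa C Y Z \<cdot> f = zeroa C X Z"
  and "g \<in> Hom C Y Z ==> g \<cdot> zeroa C X Y = zeroa C X Z"
 using assms zero_hom[of Y Z] zero_hom[of X Y] add_zero[of Y Z "zeroa C Y Z"] add_zero[of X Y "zeroa C X Y"]
  comp_addl[of X Y Z f "zeroa C Y Z" "zeroa C Y Z"] comp_addr[of X Y Z "zeroa C X Y" "zeroa C X Y" g]
 by (auto intro!: add_idem_zero comp_hom[of X Y Z])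

lemma scal_zero:
 assumes "X \<in> Obj C" "Y \<in> Obj C" "f \<in> Hom C X Y"
 shows "scal C 0 f = zeroa C X Y"
 using assms add_scal[of X Y f 0 0] by (auto intro!: add_idem_zero scal_hom)

end

context braided_hopf_algebra
begin

lemma H_mod_simps [simp]:
 "V \<in> Obj H_mod \<longleftrightarrow> H_module (fst V) (snd V)"
 "Hom H_mod = H_hom" "idm H_mod V = idm B (fst V)" "comp H_mod = comp B" "adda H_mod = adda B" "scal H_mod = scal B"
 "zeroa H_mod V W = zeroa B (fst V) (fst W)" "munit H_mod = H_triv \<I>" "tens H_mod = H_tens" "tensa H_mod = tensa B"
 "assoc H_mod U V W = assoc B (fst U) (fst V) (fst W)" "lunit H_mod V = lunit B (fst V)" "runit H_mod V = runit B (fst V)"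
 "ldual H_mod = H_ldual" "rdual H_mod = H_rdual" "evl H_mod V = evl B (fst V)" "coevl H_mod V = coevl B (fst V)"
 "evr H_mod V = evr B (fst V)" "coevr H_mod V = coevr B (fst V)"
 by (auto simp: H_mod_def)

lemma H_homD: "f \<in> H_hom V W ==> f \<in> Hom B (fst V) (fst W)"
 by (simp add: H_hom_def)

lemma H_mod_obj: "H_module (fst V) (snd V) ==> fst V \<in> Obj B"
 and H_mod_act: "H_module (fst V) (snd V) ==> snd V \<in> Hom B (H \<otimes> fst V) (fst V)"
 by (simp_all add: H_moduleD)

lemma H_hom_linear:
 assumes V: "H_module (fst V) (snd V)" and W: "H_module (fst W) (snd W)"
 shows "idm B (fst V) \<in> H_hom V V" "zeroa B (fst V) (fst W) \<in> H_hom V W"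
  and "[|f \<in> H_hom V W; g \<in> H_hom V W|] ==> f \<oplus> g \<in> H_hom V W"
  and "f \<in> H_hom V W ==> scal B c f \<in> H_hom V W"
proof -
 note [simp] = H_mod_obj[OF V] H_mod_act[OF V] H_mod_obj[OF W] H_mod_act[OF W]
 show "idm B (fst V) \<in> H_hom V V"
  by (simp add: H_hom_def tensa_id comp_idl[of "H \<otimes> fst V" "fst V"] comp_idr[of "H \<otimes> fst V" "fst V"])
 have z: "zeroa B (fst V) (fst W) \<in> Hom B (fst V) (fst W)" by (simp add: zero_hom)
 have "idm B H \<star> zeroa B (fst V) (fst W) = zeroa B (H \<otimes> fst V) (H \<otimes> fst W)"
  by (rule add_idem_zero)
    (use z add_zero[OF _ _ z] tensa_addr[of H H "fst V" "fst W" "idm B H" "zeroa B (fst V) (fst W)" "zeroa B (fst V) (fst W)"] in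
     \<open>auto intro: tensa_hom\<close>)
 then show "zeroa B (fst V) (fst W) \<in> H_hom V W"
  using z comp_zero(1)[of "H \<otimes> fst V" "fst V" "fst W" "snd V"] comp_zero(2)[of "H \<otimes> fst V" "H \<otimes> fst W" "fst W" "snd W"]
  by (simp add: H_hom_def)
 show "f \<oplus> g \<in> H_hom V W" if "f \<in> H_hom V W" "g \<in> H_hom V W"
  using that comp_addl[of "H \<otimes> fst V" "fst V" "fst W" "snd V" f g] tensa_addr[of H H "fst V" "fst W" "idm B H" f g]
   comp_addr[of "H \<otimes> fst V" "H \<otimes> fst W" "fst W" "idm B H \<star> f" "idm B H \<star> g" "snd W"] tensa_hom[of H H "fst V" "fst W" "idm B H"]
  by (simp add: H_hom_def add_hom)
 show "scal B c f \<in> H_hom V W" if "f \<in> H_hom V W"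
  using that comp_scall[of "H \<otimes> fst V" "fst V" "fst W" "snd V" f c] tensa_scalr[of H H "fst V" "fst W" "idm B H" f c]
   comp_scalr[of "H \<otimes> fst V" "H \<otimes> fst W" "fst W" "idm B H \<star> f" "snd W" c] tensa_hom[of H H "fst V" "fst W" "idm B H"]
  by (simp add: H_hom_def scal_hom)
qed

lemma H_hom_comp:
 assumes m: "H_module (fst U) (snd U)" "H_module (fst V) (snd V)" "H_module (fst W) (snd W)"
  and f: "f \<in> H_hom U V" and g: "g \<in> H_hom V W"
 shows "g \<cdot> f \<in> H_hom U W"
proof -
 note [simp] = m[THEN H_mod_obj] m[THEN H_mod_act] H_homD[OF f] H_homD[OF g]
  and [simp] = tensa_hom[of H H _ _ "idm B H"]
 have "(g \<cdot> f) \<cdot> snd U = g \<cdot> (f \<cdot> snd U)"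
  by (rule comp_assoc[of "H \<otimes> fst U" "fst U" "fst V" "fst W"]) auto
 also have "... = (g \<cdot> snd V) \<cdot> (idm B H \<star> f)"
  using f comp_assoc[of "H \<otimes> fst U" "H \<otimes> fst V" "fst V" "fst W" "idm B H \<star> f" "snd V" g] by (simp add: H_hom_def)
 also have "... = snd W \<cdot> (idm B H \<star> g) \<cdot> (idm B H \<star> f)"
  using g comp_assoc[of "H \<otimes> fst U" "H \<otimes> fst V" "H \<otimes> fst W" "fst W" "idm B H \<star> f" "idm B H \<star> g" "snd W"] by (simp add: H_hom_def)
 also have "(idm B H \<star> g) \<cdot> (idm B H \<star> f) = idm B H \<star> (g \<cdot> f)"
  using tensa_comp[of H H H "fst U" "fst V" "fst W" "idm B H" "idm B H" f g] by (simp add: comp_idl[of H H])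
 finally show ?thesis using comp_hom[of "fst U" "fst V" "fst W" f g] by (simp add: H_hom_def)
qed

lemma H_mod_is_iso:
 assumes m: "H_module (fst V) (snd V)" "H_module (fst W) (snd W)" "f \<in> H_hom V W"
 shows "is_iso H_mod V W f \<longleftrightarrow> is_iso B (fst V) (fst W) f"
 using H_hom_inverse[of "fst V" "snd V" "fst W" "snd W" f] assms
 by (auto simp: is_iso_def arr_inverse_def H_hom_def)

lemma H_tens_obj: "[|H_module (fst V) (snd V); H_module (fst W) (snd W)|] ==> H_module (fst V \<otimes> fst W) (snd (H_tens V W))"
 using H_module_tens[of "fst V" "snd V" "fst W" "snd W"] by simp

lemma monoidal_category_H_mod: "monoidal_category H_mod"
proof
 show "\<exists>g \<in> Hom H_mod V W. g \<oplus>\<^bsub>H_mod\<^esub> f = zeroa H_mod V W"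
  if "V \<in> Obj H_mod" "W \<in> Obj H_mod" "f \<in> Hom H_mod V W" for V W f
 proof -
  have o: "fst V \<in> Obj B" "fst W \<in> Obj B" "f \<in> Hom B (fst V) (fst W)"
   using that H_mod_obj H_homD by auto
  have "scal B (- 1) f \<oplus> f = scal B (- 1 + 1) f"
   using add_scal[OF o, of "- 1" 1] scal_one[OF o] by simp
  then show ?thesis using H_hom_linear(4)[of V W f "- 1"] that scal_zero[OF o] by auto
 qed
 show "is_iso H_mod ((U \<otimes>\<^bsub>H_mod\<^esub> V) \<otimes>\<^bsub>H_mod\<^esub> W) (U \<otimes>\<^bsub>H_mod\<^esub> V \<otimes>\<^bsub>H_mod\<^esub> W) (assoc H_mod U V W)"
  if "U \<in> Obj H_mod" "V \<in> Obj H_mod" "W \<in> Obj H_mod" for U V W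
  using that H_hom_assoc[of "fst U" "snd U" "fst V" "snd V" "fst W" "snd W"] H_tens_obj[of U V] H_tens_obj[of V W]
   H_tens_obj[of "H_tens U V" W] H_tens_obj[of U "H_tens V W"]
  by (simp add: H_mod_is_iso assoc_iso H_mod_obj)
 show "is_iso H_mod (\<I>\<^bsub>H_mod\<^esub> \<otimes>\<^bsub>H_mod\<^esub> V) V (lunit H_mod V)"
  "is_iso H_mod (V \<otimes>\<^bsub>H_mod\<^esub> \<I>\<^bsub>H_mod\<^esub>) V (runit H_mod V)" if "V \<in> Obj H_mod" for V
  using that H_hom_units[of "fst V" "snd V"] H_module_triv[of \<I>] H_tens_obj[of "H_triv \<I>" V] H_tens_obj[of V "H_triv \<I>"]
  by (simp_all add: H_mod_is_iso lunit_iso runit_iso H_mod_obj)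
 show "f \<star>\<^bsub>H_mod\<^esub> f' \<in> Hom H_mod (V \<otimes>\<^bsub>H_mod\<^esub> V') (W \<otimes>\<^bsub>H_mod\<^esub> W')"
  if "V \<in> Obj H_mod" "W \<in> Obj H_mod" "V' \<in> Obj H_mod" "W' \<in> Obj H_mod" "f \<in> Hom H_mod V W" "f' \<in> Hom H_mod V' W'" for V W V' W' f f'
  using that H_hom_tens[of "fst V" "snd V" "fst W" "snd W" "fst V'" "snd V'" "fst W'" "snd W'" f f'] by simp
 show "(h \<cdot>\<^bsub>H_mod\<^esub> g) \<cdot>\<^bsub>H_mod\<^esub> f = h \<cdot>\<^bsub>H_mod\<^esub> (g \<cdot>\<^bsub>H_mod\<^esub> f)"
  if "T \<in> Obj H_mod" "U \<in> Obj H_mod" "V \<in> Obj H_mod" "W \<in> Obj H_mod" "f \<in> Hom H_mod T U" "g \<in> Hom H_mod U V" "h \<in> Hom H_mod V W" for T U V W f g h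
  using that comp_assoc[of "fst T" "fst U" "fst V" "fst W" f g h] H_mod_obj H_homD by simp
qed (auto simp: H_hom_linear H_hom_comp H_tens_obj H_module_triv tensa_id dest!: H_mod_obj H_homD,
 (rule add_assoc add_commute add_zero scal_add add_scal scal_scal scal_one
  comp_idl comp_idr comp_addl comp_addr comp_scall comp_scalr tensa_comp tensa_addl tensa_addr tensa_scall tensa_scalr
  assoc_natural lunit_natural runit_natural pentagon triangle; assumption)+)

abbreviation mobs :: "('o \<times> 'a) list => bool" where
 "mobs Vs \<equiv> \<forall>V \<in> set Vs. H_module (fst V) (snd V)"

fun word_act :: "('o \<times> 'a) list => ('o, 'a) strarr" where
 "word_act [] = scou"
| "word_act [V] = sact V"
| "word_act (V # W # Vs) = (sact V ** word_act (W # Vs)) oo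
   ($[H] ** br [H] [fst V] ** $(map fst (W # Vs))) oo (scom ** $(map fst (V # W # Vs)))"

lemma sdom_word_act [simp]: "sdom (word_act Vs) = H # map fst Vs"
 and scod_word_act [simp]: "scod (word_act Vs) = map fst Vs"
 by (induction Vs rule: word_act.induct) simp_all

lemma mobs_obj: "mobs Vs ==> set (map fst Vs) <= Obj B"
 using H_mod_obj by auto

lemma wt_word_act [simp]: "mobs Vs ==> wt (word_act Vs)"
proof (induction Vs rule: word_act.induct)
 case (3 V W Vs)
 then show ?case using mobs_obj[OF 3(2)] H_mod_act[of V] by (simp add: wt_Str)
qed (auto simp: wt_Str H_mod_obj H_mod_act)

abbreviation "Hword \<equiv> monoidal_data.word H_mod"

lemma Hword_simps:
 "Hword [] = H_triv \<I>" "Hword [V] = V" "Hword (V # W # Vs) = H_tens V (Hword (W # Vs))"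
 by (simp_all add: monoidal_data.word.simps)

lemma fst_Hword [simp]: "fst (Hword Vs) = word (map fst Vs)"
 by (induction Vs rule: word_act.induct) (simp_all add: Hword_simps)

lemma Hword_module: "mobs Vs ==> H_module (fst (Hword Vs)) (snd (Hword Vs))"
proof (induction Vs rule: word_act.induct)
 case (3 V W Vs)
 then show ?case using H_tens_obj[of V "Hword (W # Vs)"] by (simp add: Hword_simps)
qed (simp_all add: Hword_simps H_module_triv)

lemma sact_Hword:
 "mobs Vs ==> sact (Hword Vs) = pack (map fst Vs) oo word_act Vs oo ($[H] ** unpack (map fst Vs))"
proof (induction Vs rule: word_act.induct)
 case 1
 have "pack [] oo scou oo ($[H] ** unpack []) = scou ** (pack [] oo unpack [])"
  by (simp add: bdiag)
 then show ?case unfolding Hword_simps sact_H_triv[OF munit_obj] using pack_unpack[of "[]"] by simp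
next
 case (2 V)
 moreover have "pack [fst V] = $[fst V]" "unpack [fst V] = $[fst V]"
  by (simp_all add: pack_def unpack_def strand_def)
 ultimately show ?case
  using H_mod_obj[of V] H_mod_act[of V] by (simp add: Hword_simps strand_stens strand_scomp scomp_strand wt_Str)
next
 case (3 V W Vs)
 define Xs t P where "Xs = map fst (W # Vs)" and "t = word_act (W # Vs)" and "P = Hword (W # Vs)"
 let ?x = "fst V"
 have o [simp]: "?x \<in> Obj B" "set Xs <= Obj B" "word Xs \<in> Obj B" "wt t" "sdom t = H # Xs" "scod t = Xs" "fst P = word Xs"
  using 3(2) mobs_obj[OF 3(2)] unfolding Xs_def t_def P_def by simp_all
 have [simp]: "snd V \<in> Hom B (H \<otimes> ?x) ?x" using 3(2) H_mod_act by simp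
 have sP: "sact P = pack Xs oo t oo ($[H] ** unpack Xs)"
  using 3 unfolding Xs_def t_def P_def by simp
 have mP: "H_module (fst P) (snd P)" using 3(2) unfolding P_def by (intro Hword_module) auto
 have pk: "pack [?x, word Xs] oo ($[?x] ** pack Xs) = pack (?x # Xs)"
  and up: "($[?x] ** unpack Xs) oo unpack [?x, word Xs] = unpack (?x # Xs)"
 proof -
  obtain Y Ys where Xs: "Xs = Y # Ys" unfolding Xs_def by auto
  show "pack [?x, word Xs] oo ($[?x] ** pack Xs) = pack (?x # Xs)"
   "($[?x] ** unpack Xs) oo unpack [?x, word Xs] = unpack (?x # Xs)"
   using o(1-3) unfolding Xs strand_def pack_def unpack_def
   by (auto simp: single_stens_Cons tensa_id scomp_def comp_idl[of "?x \<otimes> word (Y # Ys)" "?x \<otimes> word (Y # Ys)"])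
 qed
 have 1: "sact V ** sact P = ($[?x] ** pack Xs) oo (sact V ** t) oo ($[H, ?x, H] ** unpack Xs)"
  using stens_scomp[of "$[?x]" "sact V" "pack Xs" "t oo ($[H] ** unpack Xs)"]
   stens_scomp[of "sact V" "$[H, ?x]" t "$[H] ** unpack Xs"]
  unfolding sP by (simp add: stens_assoc[symmetric] strand_stens scomp_strand strand_scomp wt_Str)
 have 2: "($[H, ?x, H] ** unpack Xs) oo ($[H] ** br [H] [?x] ** $[word Xs]) =
   ($[H] ** br [H] [?x] ** $Xs) oo ($[H, H, ?x] ** unpack Xs)"
  using stens_scomp[of "$[H, ?x, H]" "$[H] ** br [H] [?x]" "unpack Xs" "$[word Xs]"]
   stens_scomp[of "$[H] ** br [H] [?x]" "$[H, H, ?x]" "$Xs" "unpack Xs"]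
  by (simp add: stens_assoc strand_scomp scomp_strand)
 have e3: "($[H, H, ?x] ** unpack Xs) oo (scom ** $[?x, word Xs]) =
   (scom ** $(?x # Xs)) oo ($[H, ?x] ** unpack Xs)"
  using stens_scomp[of "$[H, H, ?x]" "scom ** $[?x]" "unpack Xs" "$[word Xs]"]
   stens_scomp[of "scom ** $[?x]" "$[H, ?x]" "$Xs" "unpack Xs"]
  by (simp add: stens_assoc strand_scomp scomp_strand strand_stens wt_Str)
 have 4: "($[H, ?x] ** unpack Xs) oo ($[H] ** unpack [?x, word Xs]) = $[H] ** unpack (?x # Xs)"
  using stens_scomp[of "$[H]" "$[H]" "$[?x] ** unpack Xs" "unpack [?x, word Xs]"]
  by (simp add: up strand_scomp stens_assoc[symmetric] strand_stens)
 have "sact (H_tens V P) = pack [?x, word Xs] oo tens_act ?x (snd V) (fst P) (snd P) oo ($[H] ** unpack [?x, word Xs])"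
  using sact_H_tens[of ?x "snd V" "fst P" "snd P", unfolded prod.collapse] mP 3(2) by simp
 also have "... = (pack [?x, word Xs] oo ($[?x] ** pack Xs)) oo (sact V ** t) oo
   (($[H, ?x, H] ** unpack Xs) oo ($[H] ** br [H] [?x] ** $[word Xs])) oo (scom ** $[?x, word Xs]) oo
   ($[H] ** unpack [?x, word Xs])"
  using 1 by (simp add: tens_act_def scomp_assoc wt_Str)
 also have "... = pack (?x # Xs) oo (sact V ** t) oo ($[H] ** br [H] [?x] ** $Xs) oo
   (($[H, H, ?x] ** unpack Xs) oo (scom ** $[?x, word Xs])) oo ($[H] ** unpack [?x, word Xs])"
  unfolding pk 2 by (simp add: scomp_assoc wt_Str)
 also have "... = pack (?x # Xs) oo ((sact V ** t) oo ($[H] ** br [H] [?x] ** $Xs) oo (scom ** $(?x # Xs))) oo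
   (($[H, ?x] ** unpack Xs) oo ($[H] ** unpack [?x, word Xs]))"
  unfolding e3 by (simp add: scomp_assoc wt_Str)
 finally show ?case
  unfolding 4 by (simp add: Hword_simps P_def Xs_def t_def)
qed

lemma H_hom_Hword_iff:
 assumes m: "mobs Vs" "mobs Ws"
 shows "f \<in> H_hom (Hword Vs) (Hword Ws) \<longleftrightarrow> f \<in> Hom B (word (map fst Vs)) (word (map fst Ws)) \<and>
  Str (map fst Vs) f (map fst Ws) oo word_act Vs = word_act Ws oo ($[H] ** Str (map fst Vs) f (map fst Ws))"
proof (cases "f \<in> Hom B (word (map fst Vs)) (word (map fst Ws))")
 case True
 define Xs Ys t u where "Xs = map fst Vs" and "Ys = map fst Ws" and "t = word_act Vs" and "u = word_act Ws"
 have [simp]: "set Xs <= Obj B" "set Ys <= Obj B" "wt t" "wt u" "sdom t = H # Xs" "scod t = Xs" "sdom u = H # Ys" "scod u = Ys"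
  "f \<in> Hom B (word Xs) (word Ys)"
  using True m[THEN mobs_obj] m unfolding Xs_def Ys_def t_def u_def by auto
 let ?F = "Str Xs f Ys" and ?G = "Str [word Xs] f [word Ys]"
 have G: "?G = pack Ys oo ?F oo unpack Xs"
  by (simp add: pack_def unpack_def scomp_def comp_idl[of "word Xs" "word Ys"] comp_idr[of "word Xs" "word Ys"])
 have [simp]: "wt ?F" "wt ?G" by (auto simp: wt_Str)
 have h: "($[H] ** unpack Ys) oo ($[H] ** ?G) = ($[H] ** ?F) oo ($[H] ** unpack Xs)"
 proof -
  have "unpack Ys oo ?G = (unpack Ys oo pack Ys) oo ?F oo unpack Xs" unfolding G by (simp add: scomp_assoc)
  then have "unpack Ys oo ?G = ?F oo unpack Xs" by (simp add: unpack_pack strand_scomp)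
  then show ?thesis
   using stens_scomp[of "$[H]" "$[H]" "unpack Ys" ?G] stens_scomp[of "$[H]" "$[H]" ?F "unpack Xs"]
   by simp
 qed
 have "?G oo pack Xs = pack Ys oo ?F oo (unpack Xs oo pack Xs)" unfolding G by (simp add: scomp_assoc)
 then have "?G oo pack Xs = pack Ys oo ?F" by (simp add: unpack_pack scomp_strand)
 then have l: "?G oo pack Xs oo t oo ($[H] ** unpack Xs) = pack Ys oo (?F oo t) oo ($[H] ** unpack Xs)"
  using scomp_assoc[of ?G "pack Xs" "t oo ($[H] ** unpack Xs)"] by (simp add: scomp_assoc)
 have r: "(pack Ys oo u oo ($[H] ** unpack Ys)) oo ($[H] ** ?G) = pack Ys oo (u oo ($[H] ** ?F)) oo ($[H] ** unpack Xs)"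
  using h by (simp add: scomp_assoc)
 have p: "inverses (pack Ys) (unpack Ys)" "inverses ($[H] ** unpack Xs) ($[H] ** pack Xs)"
  using inverses_pack[of Ys] inverses_stens[OF inverses_strand[of "[H]"] inverses_sym[OF inverses_pack[of Xs]]]
  by simp_all
 have "f \<in> H_hom (Hword Vs) (Hword Ws) \<longleftrightarrow> ?G oo sact (Hword Vs) = sact (Hword Ws) oo ($[H] ** ?G)"
  using H_hom_iff[OF Hword_module[OF m(1)] Hword_module[OF m(2)], of f, unfolded prod.collapse]
  by (simp add: Xs_def[symmetric] Ys_def[symmetric])
 also have "... \<longleftrightarrow> pack Ys oo (?F oo t) oo ($[H] ** unpack Xs) = pack Ys oo (u oo ($[H] ** ?F)) oo ($[H] ** unpack Xs)"
  unfolding sact_Hword[OF m(1)] sact_Hword[OF m(2)] Xs_def[symmetric] Ys_def[symmetric] t_def[symmetric] u_def[symmetric] l r ..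
 also have "... \<longleftrightarrow> ?F oo t = u oo ($[H] ** ?F)"
 proof
  assume "pack Ys oo (?F oo t) oo ($[H] ** unpack Xs) = pack Ys oo (u oo ($[H] ** ?F)) oo ($[H] ** unpack Xs)"
  then have "(?F oo t) oo ($[H] ** unpack Xs) = (u oo ($[H] ** ?F)) oo ($[H] ** unpack Xs)"
   by (rule inverses_cancel_left[OF p(1)]) auto
  then show "?F oo t = u oo ($[H] ** ?F)"
   by (rule inverses_cancel_right[OF p(2)]) auto
 qed simp
 finally show ?thesis using True unfolding Xs_def Ys_def t_def u_def by simp
qed (auto dest: H_homD)

lemma word_act_pair: "word_act [V, W] = tens_act (fst V) (snd V) (fst W) (snd W)"
 by (simp add: tens_act_def)

lemma H_ldual_eq:
 assumes "H_module (fst V) (snd V)"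
 shows "H_ldual V = (LD (fst V), ldual_act_arr (fst V) (snd V))"
proof -
 note [simp] = H_mod_obj[OF assms]
 let ?P = "\<lambda>b. H_module (LD (fst V)) b \<and> evl B (fst V) \<in> H_hom (H_tens (LD (fst V), b) V) (H_triv \<I>) \<and>
   coevl B (fst V) \<in> H_hom (H_triv \<I>) (H_tens V (LD (fst V), b))"
 have e: "scou oo ($[H] ** sevl (fst V)) = scou ** sevl (fst V)" "scoevl (fst V) oo scou = scou ** scoevl (fst V)"
  by (simp_all add: bdiag)
 have P: "?P b \<longleftrightarrow> H_module (LD (fst V)) b \<and> sevl (fst V) oo tens_act (LD (fst V)) b (fst V) (snd V) = scou ** sevl (fst V) \<and>
   tens_act (fst V) (snd V) (LD (fst V)) b oo ($[H] ** scoevl (fst V)) = scou ** scoevl (fst V)" for b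
  using H_hom_Hword_iff[of "[(LD (fst V), b), V]" "[]" "evl B (fst V)"] H_hom_Hword_iff[of "[]" "[V, (LD (fst V), b)]" "coevl B (fst V)"] assms
  by (cases "H_module (LD (fst V)) b") (auto simp: Hword_simps word_act_pair e simp del: word_act.simps(3))
 have "(THE b. ?P b) = ldual_act_arr (fst V) (snd V)"
 proof (rule the_equality)
  show "?P (ldual_act_arr (fst V) (snd V))"
   unfolding P using H_module_ldual[OF assms] evl_ldual_linear[OF assms] coevl_ldual_linear[OF assms] by blast
  show "b = ldual_act_arr (fst V) (snd V)" if "?P b" for b
   using that ldual_act_unique[OF assms, of b] unfolding P dual_act_Str by simp
 qed
 then show ?thesis by (simp add: H_ldual_def)
qed

lemma H_rdual_eq:
 assumes "H_module (fst V) (snd V)"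
 shows "H_rdual V = (RD (fst V), rdual_act_arr (fst V) (snd V))"
proof -
 note [simp] = H_mod_obj[OF assms]
 let ?P = "\<lambda>b. H_module (RD (fst V)) b \<and> evr B (fst V) \<in> H_hom (H_tens V (RD (fst V), b)) (H_triv \<I>) \<and>
   coevr B (fst V) \<in> H_hom (H_triv \<I>) (H_tens (RD (fst V), b) V)"
 have e: "scou oo ($[H] ** sevr (fst V)) = scou ** sevr (fst V)" "scoevr (fst V) oo scou = scou ** scoevr (fst V)"
  by (simp_all add: bdiag)
 have P: "?P b \<longleftrightarrow> H_module (RD (fst V)) b \<and> sevr (fst V) oo tens_act (fst V) (snd V) (RD (fst V)) b = scou ** sevr (fst V) \<and>
   tens_act (RD (fst V)) b (fst V) (snd V) oo ($[H] ** scoevr (fst V)) = scou ** scoevr (fst V)" for b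
  using H_hom_Hword_iff[of "[V, (RD (fst V), b)]" "[]" "evr B (fst V)"] H_hom_Hword_iff[of "[]" "[(RD (fst V), b), V]" "coevr B (fst V)"] assms
  by (cases "H_module (RD (fst V)) b") (auto simp: Hword_simps word_act_pair e simp del: word_act.simps(3))
 have "(THE b. ?P b) = rdual_act_arr (fst V) (snd V)"
 proof (rule the_equality)
  show "?P (rdual_act_arr (fst V) (snd V))"
   unfolding P using H_module_rdual[OF assms] evr_rdual_linear[OF assms] coevr_rdual_linear[OF assms] by blast
  show "b = rdual_act_arr (fst V) (snd V)" if "?P b" for b
   using that rdual_act_unique[OF assms, of b] unfolding P dual_act_Str by simp
 qed
 then show ?thesis by (simp add: H_rdual_def)
qed

subsection \<open>The forgetful functor\<close>

definition forget :: "('o \<times> 'a, 'a) strarr => ('o, 'a) strarr" where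
 "forget f = Str (map fst (sdom f)) (sarr f) (map fst (scod f))"

lemma forget_Str [simp]: "forget (Str Vs f Ws) = Str (map fst Vs) f (map fst Ws)"
 by (simp add: forget_def)

lemma forget_eqD: "[|forget f = forget g; sdom f = sdom g; scod f = scod g|] ==> f = g"
 by (cases f; cases g) (simp add: forget_def)

lemma join_H_mod: "monoidal_data.join H_mod Vs Ws = join (map fst Vs) (map fst Ws)"
 by (induction Vs Ws rule: monoidal_data.join.induct) (simp_all add: monoidal_data.join.simps)

context
begin

interpretation HM: monoidal_category H_mod by (rule monoidal_category_H_mod)

lemma arr_inv_H_mod:
 assumes "H_module (fst V) (snd V)" "H_module (fst W) (snd W)" "is_iso H_mod V W f"
 shows "arr_inv H_mod V W f = arr_inv B (fst V) (fst W) f"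
proof -
 have i: "arr_inverse H_mod V W f (arr_inv H_mod V W f)"
  by (rule HM.arr_inverse_arr_inv) (use assms in auto)
 then show ?thesis using assms
  by (intro arr_inv_eqI[symmetric]) (auto simp: H_mod_obj H_homD is_iso_def arr_inverse_def)
qed

lemma HM_wt_forget:
 assumes "HM.wt f"
 shows "wt (forget f)" "mobs (sdom f)" "mobs (scod f)"
proof -
 have m: "mobs (sdom f)" "mobs (scod f)" using assms by (auto simp: HM.wt_def)
 then show "mobs (sdom f)" "mobs (scod f)" by simp_all
 have "sarr f \<in> H_hom (Hword (sdom f)) (Hword (scod f))" using assms by (simp add: HM.wt_def)
 from H_homD[OF this] show "wt (forget f)" using mobs_obj[OF m(1)] mobs_obj[OF m(2)] by (simp add: forget_def wt_Str)
qed

lemma HM_wt_iff: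
 assumes "mobs Vs" "mobs Ws"
 shows "HM.wt (Str Vs f Ws) \<longleftrightarrow> f \<in> Hom B (word (map fst Vs)) (word (map fst Ws)) \<and>
  Str (map fst Vs) f (map fst Ws) oo word_act Vs = word_act Ws oo ($[H] ** Str (map fst Vs) f (map fst Ws))"
 using H_hom_Hword_iff[OF assms] assms by (auto simp: HM.wt_Str)

lemma forget_scomp [simp]: "forget (HM.scomp f g) = forget f oo forget g"
 by (simp add: HM.scomp_def forget_def scomp_def)

lemma forget_strand [simp]: "forget (HM.strand Vs) = $(map fst Vs)"
 and forget_pack [simp]: "forget (HM.pack Vs) = pack (map fst Vs)"
 and forget_unpack [simp]: "forget (HM.unpack Vs) = unpack (map fst Vs)"
 by (simp_all add: HM.strand_def HM.pack_def HM.unpack_def strand_def pack_def unpack_def)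

lemma forget_stens:
 assumes "HM.wt f" "HM.wt g"
 shows "forget (HM.stens f g) = forget f ** forget g"
proof -
 note m = HM_wt_forget(2,3)[OF assms(1)] HM_wt_forget(2,3)[OF assms(2)]
 have m': "mobs (sdom f @ sdom g)" using m by auto
 have "HM.inverses (HM.sjoin (sdom f) (sdom g)) (HM.sjoin_inv (sdom f) (sdom g))"
  using m by (intro HM.sjoin_inverse) auto
 from HM.inverses_is_iso[OF this]
 have "is_iso H_mod (H_tens (Hword (sdom f)) (Hword (sdom g))) (Hword (sdom f @ sdom g)) (HM.join (sdom f) (sdom g))"
  by (simp add: HM.sjoin_def)
 then have "arr_inv H_mod (H_tens (Hword (sdom f)) (Hword (sdom g))) (Hword (sdom f @ sdom g)) (HM.join (sdom f) (sdom g)) =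
   arr_inv B (word (map fst (sdom f)) \<otimes> word (map fst (sdom g))) (word (map fst (sdom f @ sdom g))) (HM.join (sdom f) (sdom g))"
  using arr_inv_H_mod[of "H_tens (Hword (sdom f)) (Hword (sdom g))" "Hword (sdom f @ sdom g)"]
   Hword_module[OF m'] H_tens_obj[OF Hword_module[OF m(1)] Hword_module[OF m(3)]]
  by simp
 then show ?thesis
  by (simp add: HM.stens_def stens_def forget_def join_H_mod)
qed

end

lemma H_ldual_module: "H_module (fst V) (snd V) ==> H_module (fst (H_ldual V)) (snd (H_ldual V))"
 and H_rdual_module: "H_module (fst V) (snd V) ==> H_module (fst (H_rdual V)) (snd (H_rdual V))"
 by (simp_all add: H_ldual_eq H_rdual_eq H_module_ldual H_module_rdual)

lemma fst_H_ldual [simp]: "fst (H_ldual V) = LD (fst V)"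
 and fst_H_rdual [simp]: "fst (H_rdual V) = RD (fst V)"
 by (simp_all add: H_ldual_def H_rdual_def)

lemma HM_wt_dual:
 assumes m: "H_module (fst V) (snd V)"
 shows "monoidal_category.wt H_mod (Str [H_ldual V, V] (evl B (fst V)) [])"
  "monoidal_category.wt H_mod (Str [] (coevl B (fst V)) [V, H_ldual V])"
  "monoidal_category.wt H_mod (Str [V, H_rdual V] (evr B (fst V)) [])"
  "monoidal_category.wt H_mod (Str [] (coevr B (fst V)) [H_rdual V, V])"
proof -
 note [simp] = H_mod_obj[OF m]
 have e: "scou oo ($[H] ** sevl (fst V)) = scou ** sevl (fst V)" "scoevl (fst V) oo scou = scou ** scoevl (fst V)"
  "scou oo ($[H] ** sevr (fst V)) = scou ** sevr (fst V)" "scoevr (fst V) oo scou = scou ** scoevr (fst V)"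
  by (simp_all add: bdiag)
 show "monoidal_category.wt H_mod (Str [H_ldual V, V] (evl B (fst V)) [])"
  "monoidal_category.wt H_mod (Str [] (coevl B (fst V)) [V, H_ldual V])"
  "monoidal_category.wt H_mod (Str [V, H_rdual V] (evr B (fst V)) [])"
  "monoidal_category.wt H_mod (Str [] (coevr B (fst V)) [H_rdual V, V])"
  using m H_ldual_module[OF m] H_rdual_module[OF m]
   evl_ldual_linear[OF m] coevl_ldual_linear[OF m] evr_rdual_linear[OF m] coevr_rdual_linear[OF m]
  by (simp_all add: HM_wt_iff H_ldual_eq H_rdual_eq word_act_pair e del: word_act.simps(3))
qed

lemma rigid_category_H_mod: "rigid_category H_mod"
proof -
 interpret HM: monoidal_category H_mod by (rule monoidal_category_H_mod)
 show ?thesis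
 proof (intro rigid_category.intro rigid_category_axioms.intro HM.monoidal_category_axioms, goal_cases)
  case (3 V)
  then show ?case using HM_wt_dual(1)[of V] by (simp add: HM.wt_Str)
 next
  case (4 V)
  then show ?case using HM_wt_dual(2)[of V] by (simp add: HM.wt_Str)
 next
  case (5 V)
  then show ?case using HM_wt_dual(3)[of V] by (simp add: HM.wt_Str)
 next
  case (6 V)
  then show ?case using HM_wt_dual(4)[of V] by (simp add: HM.wt_Str)
 next
  case (7 V)
  then show ?case using HM_wt_dual(1,2)[of V] H_ldual_module[of V] H_mod_obj[of V]
   by (intro forget_eqD) (simp_all add: forget_stens ldual_zigzag)
 next
  case (8 V)
  then show ?case using HM_wt_dual(1,2)[of V] H_ldual_module[of V] H_mod_obj[of V]
   by (intro forget_eqD) (simp_all add: forget_stens ldual_zigzag')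
 next
  case (9 V)
  then show ?case using HM_wt_dual(3,4)[of V] H_rdual_module[of V] H_mod_obj[of V]
   by (intro forget_eqD) (simp_all add: forget_stens rdual_zigzag)
 next
  case (10 V)
  then show ?case using HM_wt_dual(3,4)[of V] H_rdual_module[of V] H_mod_obj[of V]
   by (intro forget_eqD) (simp_all add: forget_stens rdual_zigzag')
 qed (simp_all add: H_ldual_module H_rdual_module del: fst_H_ldual fst_H_rdual)
qed

interpretation HM: rigid_category H_mod by (rule rigid_category_H_mod)

lemma sarr_forget: "sarr (forget f) = sarr f"
 by (simp add: forget_def)

lemma sarr_eq_forget: "forget f = g ==> sarr f = sarr g"
 by (auto simp: forget_def)

lemma HM_lmap:
 assumes "H_module (fst V) (snd V)" "H_module (fst W) (snd W)" "f \<in> H_hom V W"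
 shows "HM.lmap V W f = lmap (fst V) (fst W) f"
 unfolding HM.lmap_def lmap_def
 by (rule sarr_eq_forget) (use assms HM_wt_dual[of V] HM_wt_dual[of W] H_ldual_module in \<open>simp add: forget_stens HM.wt_Str\<close>)

lemma fst_HM_lsh [simp]: "fst (HM.lsh V) = lsh (fst V)"
 by (simp add: HM.lsh_def lsh_def)

lemma HM_lsh_module: "H_module (fst V) (snd V) ==> H_module (lsh (fst V)) (snd (HM.lsh V))"
 using H_ldual_module[of "H_ldual V"] H_ldual_module[of V] by (simp add: HM.lsh_def lsh_def)

lemma HM_lshmap:
 assumes "H_module (fst V) (snd V)" "H_module (fst W) (snd W)" "f \<in> H_hom V W"
 shows "HM.lshmap V W f = lshmap (fst V) (fst W) f"
 using HM_lmap[of "H_ldual W" "H_ldual V" "HM.lmap V W f"] HM_lmap[OF assms] HM.lmap_hom[of V W f] assms H_ldual_module[of V] H_ldual_module[of W]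
 by (simp add: HM.lshmap_def lshmap_def)

lemma forget_ldual_tens:
 assumes "H_module (fst V) (snd V)" "H_module (fst W) (snd W)"
 shows "forget (HM.ldual_tens V W) = ldual_tens (fst V) (fst W)"
  and "forget (HM.ldual_tens' V W) = ldual_tens' (fst V) (fst W)"
 unfolding HM.ldual_tens_def HM.ldual_tens'_def ldual_tens_def ldual_tens'_def
 using assms HM_wt_dual[of V] HM_wt_dual[of W] HM_wt_dual[of "H_tens V W"] H_ldual_module[of V] H_ldual_module[of W]
  H_tens_obj[of V W] H_ldual_module[of "H_tens V W"]
 by (simp_all add: forget_stens)

lemma forget_ldual_unit:
 "forget HM.ldual_unit = ldual_unit" "forget HM.ldual_unit' = ldual_unit'"
 unfolding HM.ldual_unit_def HM.ldual_unit'_def ldual_unit_def ldual_unit'_def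
 using HM_wt_dual[of "H_triv \<I>"] H_ldual_module[of "H_triv \<I>"] H_module_triv[of \<I>]
 by (simp_all add: forget_stens)

lemma forget_lsh_tens:
 assumes m: "H_module (fst V) (snd V)" "H_module (fst W) (snd W)"
 shows "forget (HM.lsh_tens V W) = lsh_tens (fst V) (fst W)"
proof -
 note m' = m[THEN H_ldual_module] H_tens_obj[OF m]
 have "sarr (HM.ldual_tens V W) \<in> H_hom (H_tens (H_ldual W) (H_ldual V)) (H_ldual (H_tens V W))"
  using HM.dual_tens_hom(1)[of V W] m by (simp add: HM.ldual_tens_arr_def)
 then have "HM.lmap (H_tens (H_ldual W) (H_ldual V)) (H_ldual (H_tens V W)) (sarr (HM.ldual_tens V W)) =
   lmap (LD (fst W) \<otimes> LD (fst V)) (LD (fst V \<otimes> fst W)) (sarr (ldual_tens (fst V) (fst W)))"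
  using HM_lmap[of "H_tens (H_ldual W) (H_ldual V)" "H_ldual (H_tens V W)" "sarr (HM.ldual_tens V W)"]
   H_tens_obj[OF m'(2,1)] H_ldual_module[of "H_tens V W"] m' sarr_eq_forget[OF forget_ldual_tens(1)[OF m]] by simp
 then show ?thesis
  using forget_ldual_tens(2)[OF m'(2,1)] by (simp add: HM.lsh_tens_def lsh_tens_def)
qed

lemma forget_lsh_unit: "forget HM.lsh_unit = lsh_unit"
proof -
 have m: "H_module (fst (H_triv \<I>)) (snd (H_triv \<I>))" using H_module_triv[of \<I>] by simp
 have "sarr HM.ldual_unit \<in> H_hom (H_triv \<I>) (H_ldual (H_triv \<I>))"
  using HM.dual_unit_hom(1) by (simp add: HM.ldual_unit_arr_def)
 then have "HM.lmap (H_triv \<I>) (H_ldual (H_triv \<I>)) (sarr HM.ldual_unit) = lmap \<I> (LD \<I>) (sarr ldual_unit)"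
  using HM_lmap[of "H_triv \<I>" "H_ldual (H_triv \<I>)" "sarr HM.ldual_unit"] m H_ldual_module[OF m]
   sarr_eq_forget[OF forget_ldual_unit(1)] by simp
 then show ?thesis
  by (simp add: HM.lsh_unit_def lsh_unit_def forget_ldual_unit(2))
qed

lemma forget_eq_iff: "[|sdom f = sdom g; scod f = scod g|] ==> f = g \<longleftrightarrow> forget f = forget g"
 using forget_eqD by blast

abbreviation HM_left_half_braiding :: "'o \<times> 'a => ('o \<times> 'a => 'a) => bool" where
 "HM_left_half_braiding \<equiv> HM.left_half_braiding"

text \<open>Bending the double dual on the right of a half braiding around to the left trades
 linearity of \<open>l X\<close> for linearity of a map from \<open>X \<otimes> M \<otimes> X\<^sup>*\<close> to \<open>M\<close>, which involves
 only one dual action.\<close>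

lemma H_hom_bend_iff:
 assumes X: "H_module (fst X) (snd X)" and V: "H_module (fst V) (snd V)"
  and f: "f \<in> Hom B (fst X \<otimes> fst V) (fst V \<otimes> lsh (fst X))"
 defines "F \<equiv> ($[fst V] ** sevl (LD (fst X))) oo (Str [fst X, fst V] f [fst V, lsh (fst X)] ** $[LD (fst X)])"
 shows "f \<in> H_hom (H_tens X V) (H_tens V (HM.lsh X)) \<longleftrightarrow> F oo word_act [X, V, H_ldual X] = sact V oo ($[H] ** F)"
proof -
 note [simp] = H_mod_obj[OF X] H_mod_obj[OF V] f f[unfolded lsh_def]
 have m: "mobs [X, V, H_ldual X]" "mobs [V]" using X V H_ldual_module[OF X] by auto
 let ?L = "Str [X, V] f [V, HM.lsh X]"
 have L: "f \<in> H_hom (H_tens X V) (H_tens V (HM.lsh X)) \<longleftrightarrow> HM.wt ?L"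
  using X V HM_lsh_module[OF X] by (simp add: HM.wt_Str)
 let ?F = "HM.scomp (HM.stens (HM.strand [V]) (Str [HM.lsh X, H_ldual X] (evl B (LD (fst X))) [])) (HM.stens ?L (HM.strand [H_ldual X]))"
 have w: "HM.wt (Str [HM.lsh X, H_ldual X] (evl B (LD (fst X))) [])" "HM.wt (Str [] (coevl B (LD (fst X))) [H_ldual X, HM.lsh X])"
  using HM_wt_dual(1,2)[OF H_ldual_module[OF X]] by (simp_all add: HM.lsh_def)
 have wF: "wt F" unfolding F_def by (simp add: wt_Str lsh_def)
 then have hF: "sarr F \<in> Hom B (fst X \<otimes> fst V \<otimes> LD (fst X)) (fst V)"
  unfolding F_def by (drule_tac sarr_hom) auto
 have sF: "Str [fst X, fst V, LD (fst X)] (sarr F) [fst V] = F" unfolding F_def by (simp add: Str_sarr)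
 have r: "F oo word_act [X, V, H_ldual X] = sact V oo ($[H] ** F) \<longleftrightarrow> HM.wt (Str [X, V, H_ldual X] (sarr F) [V])"
  using HM_wt_iff[OF m, of "sarr F"] hF sF by (simp del: word_act.simps(3))
 show ?thesis unfolding L r
 proof
  assume wL: "HM.wt ?L"
  then have "forget ?F = F" using V X H_ldual_module[OF X] w unfolding F_def by (simp add: forget_stens lsh_def)
  then have "Str [X, V, H_ldual X] (sarr F) [V] = ?F"
   using sarr_forget[of ?F] by (simp add: Str_sarr[of ?F] HM.Str_sarr)
  moreover have "HM.wt ?F" using wL V X H_ldual_module[OF X] w by simp
  ultimately show "HM.wt (Str [X, V, H_ldual X] (sarr F) [V])" by simp
 next
  assume wF: "HM.wt (Str [X, V, H_ldual X] (sarr F) [V])"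
  let ?K = "HM.scomp (HM.stens (Str [X, V, H_ldual X] (sarr F) [V]) (HM.strand [HM.lsh X]))
    (HM.stens (HM.strand [X, V]) (Str [] (coevl B (LD (fst X))) [H_ldual X, HM.lsh X]))"
  have wK: "HM.wt ?K" using wF w V X HM_lsh_module[OF X] by simp
  have "forget ?K = (F ** $[lsh (fst X)]) oo ($[fst X, fst V] ** scoevl (LD (fst X)))"
   using wF w V X HM_lsh_module[OF X] sF by (simp add: forget_stens lsh_def)
  also have "... = ($[fst V] ** ((sevl (LD (fst X)) ** $[lsh (fst X)]) oo ($[lsh (fst X)] ** scoevl (LD (fst X))))) oo forget ?L"
   unfolding F_def by (simp add: diag lsh_def)
  also have "... = forget ?L"
   using ldual_zigzag'[of "LD (fst X)"] by (simp add: lsh_def diag)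
  finally have "?K = ?L" by (rule forget_eqD) simp_all
  then show "HM.wt ?L" using wK by simp
 qed
qed

lemma HM_left_half_braiding_iff:
 assumes V: "H_module M a"
 defines "L \<equiv> \<lambda>l X. Str [fst X, M] (l X) [M, lsh (fst X)]"
 shows "HM_left_half_braiding (M, a) l \<longleftrightarrow>
  (\<forall>X. H_module (fst X) (snd X) --> is_iso B (fst X \<otimes> M) (M \<otimes> lsh (fst X)) (l X) \<and> l X \<in> H_hom (H_tens X (M, a)) (H_tens (M, a) (HM.lsh X))) \<and>
  (\<forall>X Y f. H_module (fst X) (snd X) \<and> H_module (fst Y) (snd Y) \<and> f \<in> H_hom X Y -->
   L l Y oo (Str [fst X] f [fst Y] ** $[M]) =
    ($[M] ** Str [lsh (fst X)] (lshmap (fst X) (fst Y) f) [lsh (fst Y)]) oo L l X) \<and>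
  ($[M] ** lsh_unit) oo L l (H_triv \<I>) = unpack [] ** $[M] \<and>
  (\<forall>X Y. H_module (fst X) (snd X) \<and> H_module (fst Y) (snd Y) -->
   ($[M] ** lsh_tens (fst X) (fst Y)) oo L l (H_tens X Y) =
    (L l X ** $[lsh (fst Y)]) oo ($[fst X] ** L l Y) oo (unpack [fst X, fst Y] ** $[M]))"
  (is "_ \<longleftrightarrow> ?P1 \<and> ?P2 \<and> ?P3 \<and> ?P4")
proof -
 let ?V = "(M, a)"
 let ?L = "\<lambda>X. Str [X, ?V] (l X) [?V, HM.lsh X]"
 have mI: "H_module \<I> (snd (H_triv \<I>))" using H_module_triv[of \<I>] by simp
 define Q1 where "Q1 \<longleftrightarrow> (\<forall>X \<in> Obj H_mod. is_iso H_mod (H_tens X ?V) (H_tens ?V (HM.lsh X)) (l X))"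
 have 1: "Q1 \<longleftrightarrow> ?P1"
 proof -
  have "is_iso H_mod (H_tens X ?V) (H_tens ?V (HM.lsh X)) (l X) \<longleftrightarrow> is_iso B (fst X \<otimes> M) (M \<otimes> lsh (fst X)) (l X) \<and> l X \<in> H_hom (H_tens X ?V) (H_tens ?V (HM.lsh X))"
   if X: "H_module (fst X) (snd X)" for X
   using H_mod_is_iso[of "H_tens X ?V" "H_tens ?V (HM.lsh X)" "l X"] H_tens_obj[OF X, of ?V] H_tens_obj[of ?V "HM.lsh X"] HM_lsh_module[OF X] V
   by (auto simp: is_iso_def[of H_mod])
  then show ?thesis unfolding Q1_def Ball_def H_mod_simps(1) by (simp del: split_paired_All)
 qed
 show ?thesis
 proof (cases ?P1)
  case False
  moreover have "HM_left_half_braiding ?V l ==> Q1" by (simp add: HM.left_half_braiding_def Q1_def)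
  ultimately show ?thesis using 1 by blast
 next
  case True
  have w: "HM.wt (?L X)" if "H_module (fst X) (snd X)" for X
  proof -
   have "l X \<in> H_hom (H_tens X ?V) (H_tens ?V (HM.lsh X))" using True that by blast
   then show ?thesis using that HM_lsh_module[OF that] V by (simp add: HM.wt_Str)
  qed
  have n: "HM.scomp (?L Y) (HM.stens (Str [X] f [Y]) (HM.strand [?V])) = HM.scomp (HM.stens (HM.strand [?V]) (Str [HM.lsh X] (HM.lshmap X Y f) [HM.lsh Y])) (?L X) \<longleftrightarrow>
   L l Y oo (Str [fst X] f [fst Y] ** $[M]) =
    ($[M] ** Str [lsh (fst X)] (lshmap (fst X) (fst Y) f) [lsh (fst Y)]) oo L l X"
   if m: "H_module (fst X) (snd X)" "H_module (fst Y) (snd Y)" "f \<in> H_hom X Y" for X Y f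
  proof -
   have "HM.wt (Str [X] f [Y])" "HM.wt (Str [HM.lsh X] (HM.lshmap X Y f) [HM.lsh Y])" "HM.wt (HM.strand [?V])"
    using m V HM_lsh_module[of X] HM_lsh_module[of Y] HM.lmap_hom'(3)[of X Y f] by (simp_all add: HM.wt_Str)
   then show ?thesis unfolding L_def using HM_lshmap[OF m] by (subst forget_eq_iff) (simp_all add: forget_stens)
  qed
  have u: "HM.scomp (HM.stens (HM.strand [?V]) HM.lsh_unit) (?L (H_triv \<I>)) = HM.stens (HM.unpack []) (HM.strand [?V]) \<longleftrightarrow> ?P3"
  proof -
   have "HM.wt HM.lsh_unit" unfolding HM.unit_Str using HM.sh_unit_hom(1) HM_lsh_module[of "H_triv \<I>"] mI by (simp add: HM.wt_Str)
   then show ?thesis unfolding L_def using V forget_lsh_unit HM.unit_Str(1) by (subst forget_eq_iff) (simp_all add: forget_stens)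
  qed
  have t: "HM.scomp (HM.stens (HM.strand [?V]) (HM.lsh_tens X Y)) (?L (H_tens X Y)) =
    HM.scomp (HM.stens (?L X) (HM.strand [HM.lsh Y])) (HM.scomp (HM.stens (HM.strand [X]) (?L Y)) (HM.stens (HM.unpack [X, Y]) (HM.strand [?V]))) \<longleftrightarrow>
   ($[M] ** lsh_tens (fst X) (fst Y)) oo L l (H_tens X Y) =
    (L l X ** $[lsh (fst Y)]) oo ($[fst X] ** L l Y) oo (unpack [fst X, fst Y] ** $[M])"
   if m: "H_module (fst X) (snd X)" "H_module (fst Y) (snd Y)" for X Y
  proof -
   have "HM.wt (HM.lsh_tens X Y)" "HM.wt (HM.strand [?V])" "HM.wt (HM.strand [X])" "HM.wt (HM.strand [HM.lsh Y])" "HM.wt (HM.unpack [X, Y])"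
    using m V HM_lsh_module[of Y] HM.wt_lsh_tens[of X Y] by simp_all
   then show ?thesis unfolding L_def using w m V forget_lsh_tens[OF m] by (subst forget_eq_iff) (simp_all add: forget_stens)
  qed
  have "HM_left_half_braiding ?V l \<longleftrightarrow> Q1 \<and> ?P2 \<and> ?P3 \<and> ?P4"
   unfolding HM.left_half_braiding_def Q1_def Ball_def H_mod_simps u
   by (simp add: n t imp_conjL u[simplified] del: split_paired_All cong: imp_cong)
  then show ?thesis using 1 by blast
 qed
qed

end

section \<open>Half braidings from coactions\<close>

locale pivotal_hopf_algebra = pivotal_braided_category B \<rho> + braided_hopf_algebra B Ha
 for B :: "('k::field, 'o, 'a, 'z) brcat_scheme" (structure) and \<rho> :: "'o => 'a" and Ha :: "('o, 'a) hopf"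
begin

abbreviation R :: "'o" where "R \<equiv> RD H"

definition coaction :: "'o => 'a => bool" where
 "coaction M c \<longleftrightarrow> M \<in> Obj B \<and> c \<in> Hom B M (M \<otimes> H) \<and>
   (Str [M] c [M, H] ** $[H]) oo Str [M] c [M, H] = ($[M] ** scom) oo Str [M] c [M, H] \<and>
   ($[M] ** scou) oo Str [M] c [M, H] = $[M]"

definition pass :: "'o => 'a => 'o \<times> 'a => ('o, 'a) strarr" where
 "pass M c X = ($[M] ** sact X) oo (Str [M] c [M, H] ** $[fst X]) oo ibr [fst X] [M]"

definition pass_left :: "'o => 'a => 'o \<times> 'a => 'a" where
 "pass_left M c X = sarr (($[M] ** spivot \<rho> (fst X)) oo pass M c X)"

lemma sdom_pass [simp]: "sdom (pass M c X) = [fst X, M]" and scod_pass [simp]: "scod (pass M c X) = [M, fst X]"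
 by (simp_all add: pass_def)

definition "pass_arr M c X = sarr (pass M c X)"

lemma pass_Str: "pass M c X = Str [fst X, M] (pass_arr M c X) [M, fst X]"
 by (simp add: pass_arr_def Str_sarr)

lemma pass_left_Str:
 "Str [fst X, M] (pass_left M c X) [M, lsh (fst X)] = ($[M] ** spivot \<rho> (fst X)) oo pass M c X"
 unfolding pass_left_def by (rule Str_sarr) simp_all

context
 fixes M :: 'o and c :: 'a
 assumes c: "coaction M c"
begin

private lemma co_hom [simp]: "M \<in> Obj B" "c \<in> Hom B M (M \<otimes> H)"
 using c by (auto simp: coaction_def)

private lemma co_assoc: "(Str [M] c [M, H] ** $[H]) oo Str [M] c [M, H] = ($[M] ** scom) oo Str [M] c [M, H]"
 and co_unit: "($[M] ** scou) oo Str [M] c [M, H] = $[M]"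
 using c by (auto simp: coaction_def)

private abbreviation "C \<equiv> Str [M] c [M, H]"

lemma pass_hom [simp]:
 assumes "H_module (fst X) (snd X)"
 shows "pass_arr M c X \<in> Hom B (fst X \<otimes> M) (M \<otimes> fst X)"
proof -
 note [simp] = H_mod_obj[OF assms] H_mod_act[OF assms]
 have "wt (pass M c X)" by (simp add: pass_def wt_Str)
 then show ?thesis by (simp add: pass_Str wt_Str)
qed

lemma pass_left_iso:
 assumes m: "H_module (fst X) (snd X)"
 shows "is_iso B (fst X \<otimes> M) (M \<otimes> lsh (fst X)) (pass_left M c X)"
proof -
 note [simp] = H_mod_obj[OF m] H_mod_act[OF m]
 let ?X = "fst X" and ?x = "sact X"
 note mul = H_moduleD(3)[OF m] and unit = H_moduleD(4)[OF m]
 let ?q = "($[M] ** (?x oo (sant ** $[?X]))) oo (C ** $[?X])"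
 let ?p = "($[M] ** ?x) oo (C ** $[?X])"
 have pq: "?p oo ?q = $[M, ?X]"
 proof -
  have "?p oo ?q = ($[M] ** (?x oo ($[H] ** ?x) oo ($[H] ** sant ** $[?X]))) oo (((C ** $[H]) oo C) ** $[?X])"
   by (simp add: bdiag)
  also have "... = ($[M] ** (?x oo ($[H] ** ?x)) ) oo ($[M] ** ((($[H] ** sant) oo scom) ** $[?X])) oo (C ** $[?X])"
   unfolding co_assoc by (simp add: bdiag)
  also have "... = ($[M] ** ?x) oo ($[M] ** (smul oo ($[H] ** sant) oo scom) ** $[?X]) oo (C ** $[?X])"
   unfolding mul[symmetric] by (simp add: bdiag)
  also have "... = ($[M] ** (?x oo (sunt ** $[?X]))) oo ((($[M] ** scou) oo C) ** $[?X])"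
   unfolding ant_right by (simp add: bdiag)
  also have "... = $[M, ?X]"
   unfolding unit co_unit by (simp add: strand_stens strand_scomp)
  finally show ?thesis .
 qed
 have qp: "?q oo ?p = $[M, ?X]"
 proof -
  have "?q oo ?p = ($[M] ** (?x oo ($[H] ** ?x) oo (sant ** $[H, ?X]))) oo (((C ** $[H]) oo C) ** $[?X])"
   by (simp add: bdiag)
  also have "... = ($[M] ** (?x oo ($[H] ** ?x)) ) oo ($[M] ** (((sant ** $[H]) oo scom) ** $[?X])) oo (C ** $[?X])"
   unfolding co_assoc by (simp add: bdiag)
  also have "... = ($[M] ** ?x) oo ($[M] ** (smul oo (sant ** $[H]) oo scom) ** $[?X]) oo (C ** $[?X])"
   unfolding mul[symmetric] by (simp add: bdiag)
  also have "... = ($[M] ** (?x oo (sunt ** $[?X]))) oo ((($[M] ** scou) oo C) ** $[?X])"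
   unfolding ant_left by (simp add: bdiag)
  also have "... = $[M, ?X]"
   unfolding unit co_unit by (simp add: strand_stens strand_scomp)
  finally show ?thesis .
 qed
 have 1: "inverses ?p ?q" unfolding inverses_def pq qp by (simp add: wt_Str)
 have 2: "inverses (ibr [?X] [M]) (br [M] [?X])"
  using inverses_sym[OF inverses_br[of "[?X]" "[M]"]] by simp
 have "inverses (($[M] ** spivot \<rho> ?X) oo ?p oo ibr [?X] [M]) ((br [M] [?X] oo ?q) oo ($[M] ** Str [lsh ?X] (pivot_inv ?X) [?X]))"
  by (intro inverses_scomp[OF inverses_stens[OF inverses_strand inverses_pivot] inverses_scomp[OF 1 2]]) auto
 moreover have "($[M] ** spivot \<rho> ?X) oo ?p oo ibr [?X] [M] = ($[M] ** spivot \<rho> ?X) oo pass M c X"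
  unfolding pass_def by (simp add: scomp_assoc wt_Str)
 ultimately show ?thesis
  unfolding pass_left_Str[symmetric] by (drule_tac inverses_is_iso) simp
qed

lemma pass_left_natural:
 assumes m: "H_module (fst X) (snd X)" "H_module (fst Y) (snd Y)" and f: "f \<in> H_hom X Y"
 shows "Str [fst Y, M] (pass_left M c Y) [M, lsh (fst Y)] oo (Str [fst X] f [fst Y] ** $[M]) =
  ($[M] ** Str [lsh (fst X)] (lshmap (fst X) (fst Y) f) [lsh (fst Y)]) oo Str [fst X, M] (pass_left M c X) [M, lsh (fst X)]"
proof -
 note [simp] = m[THEN H_mod_obj] m[THEN H_mod_act] H_homD[OF f]
 let ?f = "Str [fst X] f [fst Y]" and ?lf = "Str [lsh (fst X)] (lshmap (fst X) (fst Y) f) [lsh (fst Y)]"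
 have lin: "?f oo sact X = sact Y oo ($[H] ** ?f)"
  using f H_hom_iff[OF m, of f] by simp
 have n: "ibr [fst Y] [M] oo (?f ** $[M]) = ($[M] ** ?f) oo ibr [fst X] [M]"
  by (rule ibr_natural) (auto simp: wt_Str)
 have r: "spivot \<rho> (fst Y) oo ?f = ?lf oo spivot \<rho> (fst X)"
  using pivot unfolding pivot_def by (simp add: scomp_def)
 have [simp]: "lshmap (fst X) (fst Y) f \<in> Hom B (lsh (fst X)) (lsh (fst Y))" by simp
 have "pass M c Y oo (?f ** $[M]) = ($[M] ** sact Y) oo (C ** $[fst Y]) oo (ibr [fst Y] [M] oo (?f ** $[M]))"
  unfolding pass_def by (simp add: bdiag)
 also have "... = ($[M] ** (sact Y oo ($[H] ** ?f))) oo (C ** $[fst X]) oo ibr [fst X] [M]"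
  unfolding n by (simp add: bdiag)
 also have "... = ($[M] ** ?f) oo pass M c X"
  unfolding lin[symmetric] pass_def by (simp add: bdiag)
 finally have p: "pass M c Y oo (?f ** $[M]) = ($[M] ** ?f) oo pass M c X" .
 have [simp]: "pass_arr M c X \<in> Hom B (fst X \<otimes> M) (M \<otimes> fst X)" "pass_arr M c Y \<in> Hom B (fst Y \<otimes> M) (M \<otimes> fst Y)"
  using m by simp_all
 have "(($[M] ** spivot \<rho> (fst Y)) oo pass M c Y) oo (?f ** $[M]) = ($[M] ** spivot \<rho> (fst Y)) oo (pass M c Y oo (?f ** $[M]))"
  by (simp add: scomp_assoc wt_Str pass_Str)
 also have "... = ($[M] ** (spivot \<rho> (fst Y) oo ?f)) oo pass M c X"
  unfolding p unfolding pass_Str by (simp add: bdiag)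
 also have "... = ($[M] ** ?lf) oo ($[M] ** spivot \<rho> (fst X)) oo pass M c X"
  unfolding r unfolding pass_Str by (simp add: bdiag)
 finally show ?thesis unfolding pass_left_Str .
qed

lemma pass_triv:
 assumes [simp]: "X \<in> Obj B"
 shows "pass M c (H_triv X) = ibr [X] [M]"
proof -
 have "pass M c (H_triv X) = ((($[M] ** scou) oo C) ** $[X]) oo ibr [X] [M]"
  unfolding pass_def sact_H_triv[OF assms] by (simp add: bdiag)
 then show ?thesis unfolding co_unit by (simp add: strand_stens strand_scomp)
qed

lemma pass_left_unit:
 "($[M] ** lsh_unit) oo Str [fst (H_triv \<I>), M] (pass_left M c (H_triv \<I>)) [M, lsh (fst (H_triv \<I>))] = unpack [] ** $[M]"
proof -
 have r: "lsh_unit oo spivot \<rho> \<I> = unpack []" using pivot unfolding pivot_def by simp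
 have n: "ibr [] [M] oo (unpack [] ** $[M]) = ($[M] ** unpack []) oo ibr [\<I>] [M]"
  by (rule ibr_natural) auto
 have "($[M] ** lsh_unit) oo ($[M] ** spivot \<rho> \<I>) oo ibr [\<I>] [M] = ($[M] ** (lsh_unit oo spivot \<rho> \<I>)) oo ibr [\<I>] [M]"
  unfolding unit_Str by (simp add: bdiag)
 also have "... = unpack [] ** $[M]" unfolding r n[symmetric] by (simp add: br_Nil strand_scomp)
 finally show ?thesis unfolding pass_left_Str pass_triv[OF munit_obj] by simp
qed

lemma pass_tens:
 assumes m: "H_module (fst X) (snd X)" "H_module (fst Y) (snd Y)"
 shows "($[M] ** unpack [fst X, fst Y]) oo pass M c (H_tens X Y) =
  (pass M c X ** $[fst Y]) oo ($[fst X] ** pass M c Y) oo (unpack [fst X, fst Y] ** $[M])"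
proof -
 let ?X = "fst X" and ?Y = "fst Y" let ?u = "unpack [?X, ?Y]" and ?t = "tens_act ?X (snd X) ?Y (snd Y)"
 note [simp] = m[THEN H_mod_obj] m[THEN H_mod_act]
 note s = sact_H_tens[OF m, unfolded prod.collapse fst_H_tens]
 note up = unpack_pack[of "[?X, ?Y]", simplified]
 have n: "ibr [?X, ?Y] [M] oo (?u ** $[M]) = ($[M] ** ?u) oo ibr [?X \<otimes> ?Y] [M]"
  by (rule ibr_natural) (auto simp: wt_Str)
 have n2: "ibr [?X] [M, H] oo ($[?X] ** C) = (C ** $[?X]) oo ibr [?X] [M]"
  by (rule ibr_natural) (auto simp: wt_Str)
 have "($[M] ** ?u) oo pass M c (H_tens X Y) = ($[M] ** (?u oo pack [?X, ?Y])) oo ($[M] ** ?t) oo (C ** ?u) oo ibr [?X \<otimes> ?Y] [M]"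
  unfolding pass_def fst_H_tens s tens_act_def by (simp add: bdiag)
 also have "... = ($[M] ** ?t) oo (C ** $[?X, ?Y]) oo (($[M] ** ?u) oo ibr [?X \<otimes> ?Y] [M])"
  unfolding up tens_act_def by (simp add: bdiag)
 also have "... = ($[M] ** sact X ** sact Y) oo ($[M, H] ** br [H] [?X] ** $[?Y]) oo
   ((($[M] ** scom) oo C) ** $[?X, ?Y]) oo ibr [?X, ?Y] [M] oo (?u ** $[M])"
  unfolding n[symmetric] tens_act_def by (simp add: bdiag)
 also have "... = ($[M] ** sact X ** sact Y) oo (C ** br [H] [?X] ** $[?Y]) oo (((C ** $[?X]) oo ibr [?X] [M]) ** $[?Y]) oo
   ($[?X] ** ibr [?Y] [M]) oo (?u ** $[M])"
  unfolding co_assoc[symmetric] by (simp add: bdiag)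
 also have "... = ($[M] ** sact X ** sact Y) oo (C ** (br [H] [?X] oo ibr [?X] [H]) ** $[?Y]) oo
   (ibr [?X] [M] ** $[H, ?Y]) oo ($[?X] ** C ** $[?Y]) oo ($[?X] ** ibr [?Y] [M]) oo (?u ** $[M])"
  unfolding n2[symmetric] by (simp add: bdiag)
 also have "... = (pass M c X ** $[?Y]) oo ($[?X] ** pass M c Y) oo (?u ** $[M])"
  unfolding br_ibr[of "[?X]" "[H]", simplified] pass_def by (simp add: bdiag)
 finally show ?thesis .
qed

lemma pass_left_tens:
 assumes m: "H_module (fst X) (snd X)" "H_module (fst Y) (snd Y)"
 shows "($[M] ** lsh_tens (fst X) (fst Y)) oo Str [fst (H_tens X Y), M] (pass_left M c (H_tens X Y)) [M, lsh (fst (H_tens X Y))] =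
  (Str [fst X, M] (pass_left M c X) [M, lsh (fst X)] ** $[lsh (fst Y)]) oo
  ($[fst X] ** Str [fst Y, M] (pass_left M c Y) [M, lsh (fst Y)]) oo (unpack [fst X, fst Y] ** $[M])"
proof -
 let ?X = "fst X" and ?Y = "fst Y" let ?u = "unpack [?X, ?Y]"
 note [simp] = m[THEN H_mod_obj] m[THEN H_mod_act]
 have r: "lsh_tens ?X ?Y oo spivot \<rho> (?X \<otimes> ?Y) = (spivot \<rho> ?X ** spivot \<rho> ?Y) oo ?u" using pivot unfolding pivot_def by simp
 have h [simp]: "pass_arr M c X \<in> Hom B (?X \<otimes> M) (M \<otimes> ?X)" "pass_arr M c Y \<in> Hom B (?Y \<otimes> M) (M \<otimes> ?Y)"
  "pass_arr M c (H_tens X Y) \<in> Hom B ((?X \<otimes> ?Y) \<otimes> M) (M \<otimes> ?X \<otimes> ?Y)"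
  using m H_tens_obj[OF m] pass_hom[of "H_tens X Y"] by simp_all
 have "($[M] ** lsh_tens ?X ?Y) oo ($[M] ** spivot \<rho> (?X \<otimes> ?Y)) oo pass M c (H_tens X Y) =
   ($[M] ** (lsh_tens ?X ?Y oo spivot \<rho> (?X \<otimes> ?Y))) oo pass M c (H_tens X Y)"
  unfolding sh_tens_Str pass_Str by (simp add: bdiag)
 also have "... = ($[M] ** spivot \<rho> ?X ** spivot \<rho> ?Y) oo (($[M] ** ?u) oo pass M c (H_tens X Y))"
  unfolding r unfolding pass_Str by (simp add: bdiag)
 also have "... = ((($[M] ** spivot \<rho> ?X) oo pass M c X) ** $[lsh ?Y]) oo ($[?X] ** (($[M] ** spivot \<rho> ?Y) oo pass M c Y)) oo (?u ** $[M])"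
  unfolding pass_tens[OF m] unfolding pass_Str by (simp add: bdiag)
 finally show ?thesis unfolding pass_left_Str by simp
qed

lemma HM_left_half_braiding_pass_left:
 assumes "H_module M a" and "\<And>X. H_module (fst X) (snd X) ==>
  pass_left M c X \<in> H_hom (H_tens X (M, a)) (H_tens (M, a) (rigid_data.lsh H_mod X))"
 shows "HM_left_half_braiding (M, a) (pass_left M c)"
 unfolding HM_left_half_braiding_iff[OF assms(1)]
 using assms(2) pass_left_iso pass_left_natural pass_left_unit pass_left_tens by blast

end

end

context monoidal_category
begin

lemma dual_pair_cancel_inner:
 assumes d: "dual_pair Ls Xs e c" and eq: "($Ws ** e) oo (f ** $Xs) = ($Ws ** e) oo (g ** $Xs)"
  and "wt f" "wt g" "sdom f = sdom g" "scod f = Ws @ Ls" "scod g = Ws @ Ls"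
 shows "f = g"
proof -
 have *: "h = ((($Ws ** e) oo (h ** $Xs)) ** $Ls) oo ($(sdom h) ** c)"
  if w: "wt h" "scod h = Ws @ Ls" for h
 proof -
  obtain Vs d where h: "h = Str Vs d (Ws @ Ls)" "d \<in> Hom C (word Vs) (word (Ws @ Ls))" "set Vs <= Obj C" "set Ws <= Obj C"
   using w by (cases h) (auto simp: wt_Str)
  obtain e' where e: "e = Str (Ls @ Xs) e' []" "e' \<in> Hom C (word (Ls @ Xs)) (word [])"
   using assms(1) by (cases e) (auto simp: dual_pair_def wt_Str simp del: word.simps)
  obtain c' where c: "c = Str [] c' (Xs @ Ls)" "c' \<in> Hom C (word []) (word (Xs @ Ls))"
   using assms(1) by (cases c) (auto simp: dual_pair_def wt_Str simp del: word.simps)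
  have o: "set Ls <= Obj C" "set Xs <= Obj C"
   using assms(1) by (auto simp: dual_pair_def)
  have "h = ($Ws ** ((e ** $Ls) oo ($Ls ** c))) oo h"
   using assms(1) w h by (simp add: dual_pair_def strand_scomp strand_stens)
  also have "... = ((($Ws ** e) oo (h ** $Xs)) ** $Ls) oo ($(sdom h) ** c)"
   using h(2-) e(2) c(2) o unfolding h(1) e(1) c(1) by (simp del: word.simps add: layer_simps)
  finally show ?thesis .
 qed
 show ?thesis using *[of f] *[of g] assms by metis
qed

end

context pivotal_hopf_algebra
begin

subsection \<open>Half braidings that extend the braiding come from coactions\<close>

definition reg :: "'o \<times> 'a" where "reg = (H, mul Ha)"

lemma reg_module: "H_module (fst reg) (snd reg)"
 using mul_assoc mul_unit_left by (simp add: reg_def is_module_def)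

lemma fst_reg [simp]: "fst reg = H" and snd_reg [simp]: "snd reg = mul Ha"
 by (simp_all add: reg_def)

lemma tens_act_reg_triv:
 assumes [simp]: "X \<in> Obj B"
 shows "tens_act H (mul Ha) X (snd (H_triv X)) = smul ** $[X]"
proof -
 have n: "($[H] ** scou) oo br [H] [H] = br [] [H] oo (scou ** $[H])"
  by (rule br_natural[symmetric]) (auto simp: wt_Str)
 have s: "Str [H, X] (snd (H_triv X)) [X] = scou ** $[X]" using sact_H_triv[OF assms] by simp
 have "tens_act H (mul Ha) X (snd (H_triv X)) = (smul ** $[X]) oo ($[H] ** (($[H] ** scou) oo br [H] [H]) ** $[X]) oo (scom ** $[H, X])"
  unfolding tens_act_def s by (simp add: bdiag)
 also have "... = (smul ** $[X]) oo ((($[H] ** scou) oo scom) ** $[H, X])"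
  unfolding n by (simp add: bdiag)
 also have "... = smul ** $[X]" unfolding com_cou_right by (simp add: bdiag)
 finally show ?thesis .
qed

lemma act_linear:
 assumes m: "H_module (fst X) (snd X)"
 shows "snd X \<in> H_hom (H_tens reg (H_triv (fst X))) X"
 using H_hom_Hword_iff[of "[reg, H_triv (fst X)]" "[X]" "snd X"] m reg_module H_module_triv[of "fst X"] H_mod_obj[OF m] H_mod_act[OF m]
  H_moduleD(3)[OF m] tens_act_reg_triv[of "fst X"]
 by (simp add: Hword_simps word_act_pair del: word_act.simps(3))

lemma com_linear: "com Ha \<in> H_hom reg (H_tens reg reg)"
 using H_hom_Hword_iff[of "[reg]" "[reg, reg]" "com Ha"] reg_module
 by (simp add: Hword_simps word_act_pair com_mul tens_act_def del: word_act.simps(3)) (simp add: bdiag)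

lemma cou_linear: "cou Ha \<in> H_hom reg (H_triv \<I>)"
 using H_hom_Hword_iff[of "[reg]" "[]" "cou Ha"] reg_module
 by (simp add: Hword_simps cou_mul) (simp add: bdiag)

lemma coaction_of_half_braiding:
 assumes m: "H_module M a" and l: "HM_left_half_braiding (M, a) l"
  and triv: "\<And>X. X \<in> Obj B ==> l (H_triv X) = (idm B M \<star> \<rho> X) \<cdot> ibraid X M"
 obtains c where "coaction M c" "\<And>X. H_module (fst X) (snd X) ==> l X = pass_left M c X"
proof -
 define L where "L X = Str [fst X, M] (l X) [M, lsh (fst X)]" for X
 note [simp] = H_moduleD(1)[OF m]
 note L = l[unfolded HM_left_half_braiding_iff[OF m] L_def[symmetric]]
 have hom [simp]: "l X \<in> Hom B (fst X \<otimes> M) (M \<otimes> lsh (fst X))" if "H_module (fst X) (snd X)" for X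
  using L that unfolding is_iso_def by blast
 define p where "p X = ($[M] ** Str [lsh (fst X)] (pivot_inv (fst X)) [fst X]) oo L X" for X
 define q where "q X = sarr (p X)" for X
 have p_Str: "p X = Str [fst X, M] (q X) [M, fst X]" for X
  by (simp add: q_def p_def L_def Str_sarr)
 have wp: "wt (p X)" if "H_module (fst X) (snd X)" for X
  using H_mod_obj[OF that] hom[OF that] by (simp add: p_def L_def wt_Str)
 have p_hom [simp]: "q X \<in> Hom B (fst X \<otimes> M) (M \<otimes> fst X)" if "H_module (fst X) (snd X)" for X
  using wp[OF that] unfolding p_Str by (simp add: wt_Str)
 have ri: "spivot \<rho> X oo Str [lsh X] (pivot_inv X) [X] = $[lsh X]" "Str [lsh X] (pivot_inv X) [X] oo spivot \<rho> X = $[X]" if "X \<in> Obj B" for X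
  using inverses_pivot[OF that] by (auto simp: inverses_def)
 have Lp: "L X = ($[M] ** spivot \<rho> (fst X)) oo p X" if X: "H_module (fst X) (snd X)" for X
 proof -
  have "($[M] ** spivot \<rho> (fst X)) oo p X = ($[M] ** (spivot \<rho> (fst X) oo Str [lsh (fst X)] (pivot_inv (fst X)) [fst X])) oo L X"
   using H_mod_obj[OF X] hom[OF X] unfolding p_def L_def by (simp add: bdiag)
  then show ?thesis
   using H_mod_obj[OF X] hom[OF X] unfolding ri(1)[OF H_mod_obj[OF X]] L_def by (simp add: bdiag)
 qed
 have cancel: "f = g" if "($[M] ** spivot \<rho> X) oo f = ($[M] ** spivot \<rho> X) oo g" "X \<in> Obj B" "wt f" "wt g" "scod f = [M, X]" "scod g = [M, X]" for f g X
  using inverses_cancel_left[OF inverses_stens[OF inverses_strand[of "[M]"] inverses_pivot[of X]], of f g] that by simp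
 have p_triv: "p (H_triv X) = ibr [X] [M]" if [simp]: "X \<in> Obj B" for X
 proof (rule cancel)
  have "L (H_triv X) = ($[M] ** spivot \<rho> X) oo ibr [X] [M]"
   using triv[OF that] by (simp add: L_def stens_strand1 br_single scomp_def)
  then show "($[M] ** spivot \<rho> X) oo p (H_triv X) = ($[M] ** spivot \<rho> X) oo ibr [X] [M]"
   using Lp[of "H_triv X"] H_module_triv[OF that] by simp
 qed (use wp[of "H_triv X"] H_module_triv[OF that] p_Str[of "H_triv X"] in \<open>auto simp: p_def L_def\<close>)
 have p_natural: "p Y oo (Str [fst X] f [fst Y] ** $[M]) = ($[M] ** Str [fst X] f [fst Y]) oo p X"
  if X: "H_module (fst X) (snd X)" and Y: "H_module (fst Y) (snd Y)" and f: "f \<in> H_hom X Y" for X Y f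
 proof (rule cancel)
  note [simp] = H_mod_obj[OF X] H_mod_obj[OF Y] H_homD[OF f] p_hom[OF X] p_hom[OF Y]
  let ?f = "Str [fst X] f [fst Y]" and ?lf = "Str [lsh (fst X)] (lshmap (fst X) (fst Y) f) [lsh (fst Y)]"
  have r: "spivot \<rho> (fst Y) oo ?f = ?lf oo spivot \<rho> (fst X)"
   using pivot unfolding pivot_def by (simp add: scomp_def)
  have "($[M] ** spivot \<rho> (fst Y)) oo p Y oo (?f ** $[M]) = L Y oo (?f ** $[M])"
   unfolding Lp[OF Y] using wp[OF Y] by (simp add: scomp_assoc wt_Str p_def L_def)
  also have "... = ($[M] ** ?lf) oo L X" using L X Y f by blast
  also have "... = ($[M] ** (?lf oo spivot \<rho> (fst X))) oo p X"
   unfolding Lp[OF X] unfolding p_Str by (simp add: bdiag)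
  also have "... = ($[M] ** spivot \<rho> (fst Y)) oo ($[M] ** ?f) oo p X"
   unfolding r[symmetric] unfolding p_Str by (simp add: bdiag)
  finally show "($[M] ** spivot \<rho> (fst Y)) oo p Y oo (?f ** $[M]) = ..." .
 qed (use wp[OF X] wp[OF Y] H_mod_obj[OF X] H_mod_obj[OF Y] H_homD[OF f] in \<open>auto simp: p_def L_def wt_Str\<close>)
 have p_tens: "($[M] ** unpack [fst X, fst Y]) oo p (H_tens X Y) = (p X ** $[fst Y]) oo ($[fst X] ** p Y) oo (unpack [fst X, fst Y] ** $[M])"
  if X: "H_module (fst X) (snd X)" and Y: "H_module (fst Y) (snd Y)" for X Y
 proof -
  let ?X = "fst X" and ?Y = "fst Y" let ?u = "unpack [?X, ?Y]"
  note [simp] = H_mod_obj[OF X] H_mod_obj[OF Y] p_hom[OF X] p_hom[OF Y]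
  have T: "H_module (fst (H_tens X Y)) (snd (H_tens X Y))" using H_tens_obj[OF X Y] by simp
  have [simp]: "q (H_tens X Y) \<in> Hom B ((?X \<otimes> ?Y) \<otimes> M) (M \<otimes> ?X \<otimes> ?Y)" using p_hom[OF T] by simp
  have r: "lsh_tens ?X ?Y oo spivot \<rho> (?X \<otimes> ?Y) = (spivot \<rho> ?X ** spivot \<rho> ?Y) oo ?u" using pivot unfolding pivot_def by simp
  have "($[M] ** spivot \<rho> ?X ** spivot \<rho> ?Y) oo ($[M] ** ?u) oo p (H_tens X Y) = ($[M] ** (lsh_tens ?X ?Y oo spivot \<rho> (?X \<otimes> ?Y))) oo p (H_tens X Y)"
   unfolding r unfolding p_Str by (simp add: bdiag)
  also have "... = ($[M] ** lsh_tens ?X ?Y) oo L (H_tens X Y)"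
   unfolding Lp[OF T] sh_tens_Str unfolding p_Str by (simp add: bdiag)
  also have "... = (L X ** $[lsh ?Y]) oo ($[?X] ** L Y) oo (?u ** $[M])"
   using L X Y by blast
  also have "... = ($[M] ** spivot \<rho> ?X ** spivot \<rho> ?Y) oo (p X ** $[?Y]) oo ($[?X] ** p Y) oo (?u ** $[M])"
   unfolding Lp[OF X] Lp[OF Y] unfolding p_Str by (simp add: bdiag)
  finally have "($[M] ** spivot \<rho> ?X ** spivot \<rho> ?Y) oo (($[M] ** ?u) oo p (H_tens X Y)) = ($[M] ** spivot \<rho> ?X ** spivot \<rho> ?Y) oo ((p X ** $[?Y]) oo ($[?X] ** p Y) oo (?u ** $[M]))" .
  moreover have "inverses ($[M] ** spivot \<rho> ?X ** spivot \<rho> ?Y) ($[M] ** Str [lsh ?X] (pivot_inv ?X) [?X] ** Str [lsh ?Y] (pivot_inv ?Y) [?Y])"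
   by (intro inverses_stens inverses_strand inverses_pivot) auto
  ultimately show ?thesis
   by (elim inverses_cancel_left[rotated]) (use wp[OF X] wp[OF Y] wp[OF T] in \<open>auto simp: p_def L_def\<close>)
 qed
 define c where "c = sarr (p reg oo (sunt ** $[M]))"
 have pr [simp]: "q reg \<in> Hom B (H \<otimes> M) (M \<otimes> H)" using p_hom[OF reg_module] by simp
 have C: "Str [M] c [M, H] = p reg oo (sunt ** $[M])"
  unfolding c_def by (rule Str_sarr) (simp_all add: p_def L_def)
 have "wt (p reg oo (sunt ** $[M]))" unfolding p_Str by (simp add: wt_Str)
 then have c_hom [simp]: "c \<in> Hom B M (M \<otimes> H)" unfolding C[symmetric] by (simp add: wt_Str)
 have "($[M] ** scom) oo Str [M] c [M, H] = (Str [M] c [M, H] ** $[H]) oo Str [M] c [M, H]"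
 proof -
  have s: "unpack [H, H] oo Str [H] (com Ha) [H \<otimes> H] = scom" by (simp add: unpack_def scomp_def comp_idl[of H "H \<otimes> H"])
  have t: "H_module (fst (H_tens reg reg)) (snd (H_tens reg reg))" using H_tens_obj[OF reg_module reg_module] by simp
  have n: "p (H_tens reg reg) oo (Str [H] (com Ha) [H \<otimes> H] ** $[M]) = ($[M] ** Str [H] (com Ha) [H \<otimes> H]) oo p reg"
   using p_natural[OF reg_module t com_linear] by simp
  have [simp]: "q (H_tens reg reg) \<in> Hom B ((H \<otimes> H) \<otimes> M) (M \<otimes> H \<otimes> H)" using p_hom[OF t] by simp
  have "($[M] ** scom) oo p reg = ($[M] ** unpack [H, H]) oo (($[M] ** Str [H] (com Ha) [H \<otimes> H]) oo p reg)"
   unfolding s[symmetric] unfolding p_Str by (simp add: bdiag)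
  also have "... = (($[M] ** unpack [H, H]) oo p (H_tens reg reg)) oo (Str [H] (com Ha) [H \<otimes> H] ** $[M])"
   unfolding n[symmetric] unfolding p_Str by (simp add: bdiag)
  also have "... = (p reg ** $[H]) oo ($[H] ** p reg) oo ((unpack [H, H] oo Str [H] (com Ha) [H \<otimes> H]) ** $[M])"
   unfolding p_tens[OF reg_module reg_module, simplified] unfolding p_Str by (simp add: bdiag)
  finally have e: "($[M] ** scom) oo p reg = (p reg ** $[H]) oo ($[H] ** p reg) oo (scom ** $[M])" unfolding s .
  have "($[M] ** scom) oo Str [M] c [M, H] = (($[M] ** scom) oo p reg) oo (sunt ** $[M])"
   unfolding C unfolding p_Str by (simp add: bdiag)
  also have "... = (p reg ** $[H]) oo ($[H] ** p reg) oo ((scom oo sunt) ** $[M])"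
   unfolding e unfolding p_Str by (simp add: bdiag)
  also have "... = (Str [M] c [M, H] ** $[H]) oo Str [M] c [M, H]"
   unfolding com_unt C unfolding p_Str by (simp add: bdiag)
  finally show ?thesis .
 qed
 moreover have "($[M] ** scou) oo Str [M] c [M, H] = $[M]"
 proof -
  have s: "unpack [] oo Str [H] (cou Ha) [\<I>] = scou" by (simp add: unpack_def scomp_def comp_idl[of H \<I>])
  have t: "H_module (fst (H_triv \<I>)) (snd (H_triv \<I>))" using H_module_triv[of \<I>] by simp
  have n: "ibr [\<I>] [M] oo (Str [H] (cou Ha) [\<I>] ** $[M]) = ($[M] ** Str [H] (cou Ha) [\<I>]) oo p reg"
   using p_natural[OF reg_module t cou_linear] p_triv[of \<I>] by simp
  have n2: "ibr [] [M] oo (unpack [] ** $[M]) = ($[M] ** unpack []) oo ibr [\<I>] [M]"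
   by (rule ibr_natural) auto
  have "($[M] ** scou) oo p reg = ($[M] ** unpack []) oo (($[M] ** Str [H] (cou Ha) [\<I>]) oo p reg)"
   unfolding s[symmetric] unfolding p_Str by (simp add: bdiag)
  also have "... = (($[M] ** unpack []) oo ibr [\<I>] [M]) oo (Str [H] (cou Ha) [\<I>] ** $[M])"
   unfolding n[symmetric] by (simp add: bdiag)
  also have "... = (unpack [] oo Str [H] (cou Ha) [\<I>]) ** $[M]"
   unfolding n2[symmetric] by (simp add: bdiag)
  finally have e: "($[M] ** scou) oo p reg = scou ** $[M]" unfolding s .
  have "($[M] ** scou) oo Str [M] c [M, H] = (($[M] ** scou) oo p reg) oo (sunt ** $[M])"
   unfolding C unfolding p_Str by (simp add: bdiag)
  also have "... = (scou oo sunt) ** $[M]" unfolding e by (simp add: bdiag)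
  finally show ?thesis unfolding cou_unt by (simp add: strand_stens)
 qed
 ultimately have co: "coaction M c" unfolding coaction_def by simp
 have "l X = pass_left M c X" if X: "H_module (fst X) (snd X)" for X
 proof -
  let ?x = "fst X" and ?S = "Str [H \<otimes> fst X] (snd X) [fst X]"
  note [simp] = H_mod_obj[OF X] H_mod_act[OF X] p_hom[OF X]
  have t: "H_module (fst (H_triv ?x)) (snd (H_triv ?x))" using H_module_triv[of ?x] by simp
  have t2: "H_module (fst (H_tens reg (H_triv ?x))) (snd (H_tens reg (H_triv ?x)))" using H_tens_obj[OF reg_module t] by simp
  have S: "?S oo pack [H, ?x] = sact X" using Str_pack[of "snd X" "[H, ?x]" "[?x]"] by simp
  have S': "?S = sact X oo unpack [H, ?x]" by (simp add: unpack_def scomp_def comp_idr[of "H \<otimes> ?x" ?x])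
  have n: "p X oo (?S ** $[M]) = ($[M] ** ?S) oo p (H_tens reg (H_triv ?x))"
   using p_natural[OF t2 X act_linear[OF X]] by simp
  let ?T = "p (H_tens reg (H_triv ?x))"
  have [simp]: "q (H_tens reg (H_triv ?x)) \<in> Hom B ((H \<otimes> ?x) \<otimes> M) (M \<otimes> H \<otimes> ?x)" using p_hom[OF t2] by simp
  have "p X oo (sact X ** $[M]) = (p X oo (?S ** $[M])) oo (pack [H, ?x] ** $[M])"
   unfolding S[symmetric] unfolding p_Str by (simp add: bdiag)
  also have "... = ($[M] ** sact X) oo (($[M] ** unpack [H, ?x]) oo ?T) oo (pack [H, ?x] ** $[M])"
   unfolding n unfolding S' unfolding p_Str by (simp add: bdiag)
  also have "($[M] ** unpack [H, ?x]) oo ?T = (p reg ** $[?x]) oo ($[H] ** ibr [?x] [M]) oo (unpack [H, ?x] ** $[M])"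
   using p_tens[OF reg_module t] p_triv[of ?x] by simp
  also have "($[M] ** sact X) oo ... oo (pack [H, ?x] ** $[M]) = ($[M] ** sact X) oo (p reg ** $[?x]) oo ($[H] ** ibr [?x] [M]) oo ((unpack [H, ?x] oo pack [H, ?x]) ** $[M])"
   unfolding p_Str by (simp add: bdiag)
  also have "unpack [H, ?x] oo pack [H, ?x] = $[H, ?x]" by (rule unpack_pack) simp
  finally have e: "p X oo (sact X ** $[M]) = ($[M] ** sact X) oo (p reg ** $[?x]) oo ($[H] ** ibr [?x] [M])"
   unfolding p_Str by (simp add: bdiag)
  have "p X oo ((sact X oo (sunt ** $[?x])) ** $[M]) = (p X oo (sact X ** $[M])) oo (sunt ** $[?x, M])"
   unfolding p_Str by (simp add: bdiag)
  also have "... = pass M c X"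
   unfolding e pass_def C unfolding p_Str by (simp add: bdiag)
  finally have "p X = pass M c X"
   unfolding H_moduleD(4)[OF X] using wp[OF X] by (simp add: strand_stens scomp_strand p_def L_def)
  then have "L X = Str [fst X, M] (pass_left M c X) [M, lsh (fst X)]"
   unfolding pass_left_Str Lp[OF X] by simp
  then show ?thesis by (simp add: L_def)
 qed
 with co show ?thesis by (rule that)
qed

lemma pass_left_morphism_iff:
 assumes c: "coaction M c" and d: "coaction N d" and f: "f \<in> Hom B M N"
 shows "(\<forall>X. H_module (fst X) (snd X) -->
   (Str [M] f [N] ** $[lsh (fst X)]) oo Str [fst X, M] (pass_left M c X) [M, lsh (fst X)] =
   Str [fst X, N] (pass_left N d X) [N, lsh (fst X)] oo ($[fst X] ** Str [M] f [N])) \<longleftrightarrow>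
  (Str [M] f [N] ** $[H]) oo Str [M] c [M, H] = Str [N] d [N, H] oo Str [M] f [N]" (is "?l \<longleftrightarrow> ?r")
proof -
 let ?f = "Str [M] f [N]" and ?C = "Str [M] c [M, H]" and ?D = "Str [N] d [N, H]"
 have [simp]: "M \<in> Obj B" "N \<in> Obj B" "c \<in> Hom B M (M \<otimes> H)" "d \<in> Hom B N (N \<otimes> H)" "f \<in> Hom B M N"
  using c d f unfolding coaction_def by blast+
 have 1: "(?f ** $[lsh (fst X)]) oo Str [fst X, M] (pass_left M c X) [M, lsh (fst X)] = ($[N] ** spivot \<rho> (fst X)) oo (?f ** $[fst X]) oo pass M c X"
  and 2: "Str [fst X, N] (pass_left N d X) [N, lsh (fst X)] oo ($[fst X] ** ?f) = ($[N] ** spivot \<rho> (fst X)) oo pass N d X oo ($[fst X] ** ?f)"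
  if X: "H_module (fst X) (snd X)" for X
 proof -
  note [simp] = H_mod_obj[OF X] pass_hom[OF c X] pass_hom[OF d X]
  show "(?f ** $[lsh (fst X)]) oo Str [fst X, M] (pass_left M c X) [M, lsh (fst X)] = ($[N] ** spivot \<rho> (fst X)) oo (?f ** $[fst X]) oo pass M c X"
   "Str [fst X, N] (pass_left N d X) [N, lsh (fst X)] oo ($[fst X] ** ?f) = ($[N] ** spivot \<rho> (fst X)) oo pass N d X oo ($[fst X] ** ?f)"
   unfolding pass_left_Str unfolding pass_Str by (simp_all add: bdiag)
 qed
 show ?thesis
 proof
  assume r: ?r
  have "(?f ** $[fst X]) oo pass M c X = pass N d X oo ($[fst X] ** ?f)" if X: "H_module (fst X) (snd X)" for X
  proof -
   note [simp] = H_mod_obj[OF X] H_mod_act[OF X]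
   have n: "ibr [fst X] [N] oo ($[fst X] ** ?f) = (?f ** $[fst X]) oo ibr [fst X] [M]"
    by (rule ibr_natural) (auto simp: wt_Str)
   have "pass N d X oo ($[fst X] ** ?f) = ($[N] ** sact X) oo (?D ** $[fst X]) oo (ibr [fst X] [N] oo ($[fst X] ** ?f))"
    unfolding pass_def by (simp add: bdiag)
   also have "... = ($[N] ** sact X) oo ((?D oo ?f) ** $[fst X]) oo ibr [fst X] [M]"
    unfolding n by (simp add: bdiag)
   also have "... = (?f ** $[fst X]) oo pass M c X"
    unfolding r[symmetric] pass_def by (simp add: bdiag)
   finally show ?thesis ..
  qed
  then show ?l using 1 2 by simp
 next
  assume l: ?l
  note [simp] = pass_hom[OF c reg_module, simplified] pass_hom[OF d reg_module, simplified]
  have "($[N] ** spivot \<rho> H) oo ((?f ** $[H]) oo pass M c reg) = ($[N] ** spivot \<rho> H) oo (pass N d reg oo ($[H] ** ?f))"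
   using l[rule_format, OF reg_module] 1[OF reg_module] 2[OF reg_module] by simp
  then have e: "(?f ** $[H]) oo pass M c reg = pass N d reg oo ($[H] ** ?f)"
   using inverses_stens[OF inverses_strand[of "[N]"] inverses_pivot[of H]]
   by (elim inverses_cancel_left[rotated]) (auto simp: wt_Str pass_Str)
  have p: "pass K k reg oo (sunt ** $[K]) = Str [K] k [K, H]" if "coaction K k" for K k
  proof -
   have [simp]: "K \<in> Obj B" "k \<in> Hom B K (K \<otimes> H)" using that unfolding coaction_def by blast+
   have n: "ibr [H] [K] oo (sunt ** $[K]) = ($[K] ** sunt) oo ibr [] [K]"
    by (rule ibr_natural) (auto simp: wt_Str)
   have "pass K k reg oo (sunt ** $[K]) = ($[K] ** smul) oo (Str [K] k [K, H] ** $[H]) oo (ibr [H] [K] oo (sunt ** $[K]))"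
    unfolding pass_def by (simp add: bdiag)
   also have "... = ($[K] ** (smul oo ($[H] ** sunt))) oo Str [K] k [K, H]"
    unfolding n by (simp add: bdiag)
   finally show ?thesis unfolding mul_unit_right by (simp add: strand_stens strand_scomp wt_Str)
  qed
  have "(?f ** $[H]) oo ?C = ((?f ** $[H]) oo pass M c reg) oo (sunt ** $[M])"
   unfolding p[OF c, symmetric] unfolding pass_Str by (simp add: bdiag)
  also have "... = (pass N d reg oo (sunt ** $[N])) oo ?f"
   unfolding e unfolding pass_Str by (simp add: bdiag)
  finally show ?r unfolding p[OF d] .
 qed
qed

subsection \<open>Coactions are modules over the dual algebra\<close>

abbreviation shmul :: "('o, 'a) strarr" where "shmul \<equiv> Str [R, R] Hd_mul [R]"
abbreviation shunt :: "('o, 'a) strarr" where "shunt \<equiv> Str [] Hd_unt [R]"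

lemma evr_adj:
 assumes f: "f \<in> Hom B (word (H # Ys)) (word Zs)" and o: "set Ys <= Obj B" "set Zs <= Obj B"
 shows "(sevr H ** $Zs) oo ($[H] ** adj (Str (H # Ys) f Zs)) = Str (H # Ys) f Zs"
proof -
 have "(sevr H ** $Zs) oo ($[H] ** adj (Str (H # Ys) f Zs)) = Str (H # Ys) f Zs oo (((sevr H ** $[H]) oo ($[H] ** scoevr H)) ** $Ys)"
  using assms unfolding adj_def by (simp add: layer_simps del: word.simps) (simp add: layer_simps)
 then show ?thesis
  unfolding rdual_zigzag[OF H_obj] using assms by (simp add: strand_stens scomp_strand wt_Str del: word.simps)
qed

lemma evr_Hd_mul: "sevr H oo ($[H] ** shmul) = nestr H H oo ((ibr [H] [H] oo scom) ** $[R, R])"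
 and Hd_mul_hom [simp]: "Hd_mul \<in> Hom B (R \<otimes> R) R"
proof -
 let ?F = "sevr H oo ($[H] ** sevr H ** $[R]) oo ((sibraid H H oo scom) ** $[R, R])"
 have "wt ?F" "sdom ?F = [H, R, R]" "scod ?F = []" by (simp_all add: wt_Str)
 from wt_StrE[OF this] obtain k where k: "?F = Str [H, R, R] k []" "k \<in> Hom B (H \<otimes> R \<otimes> R) \<I>" by auto
 have s: "shmul = adj (Str [H, R, R] k [])" unfolding Hd_mul_def k(1) by (rule Str_sarr) (simp_all add: adj_def)
 have "wt (adj (Str [H, R, R] k []))" using k(2) by (simp add: adj_def wt_Str)
 then show "Hd_mul \<in> Hom B (R \<otimes> R) R" unfolding s[symmetric] by (simp add: wt_Str)
 have "sevr H oo ($[H] ** shmul) = ?F"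
  using evr_adj[of k "[R, R]" "[]"] k by (simp add: s stens_unit_right wt_Str)
 then show "sevr H oo ($[H] ** shmul) = nestr H H oo ((ibr [H] [H] oo scom) ** $[R, R])"
  unfolding nestr_def by (simp add: bdiag)
qed

lemma evr_Hd_unt: "sevr H oo ($[H] ** shunt) = scou"
 and Hd_unt_hom [simp]: "Hd_unt \<in> Hom B \<I> R"
proof -
 let ?r = "Str [RD \<I>] (rmap H \<I> (cou Ha)) [R]" and ?e = "Str [H] (cou Ha) [\<I>]"
 have s: "shunt = ?r oo rdual_unit" unfolding Hd_unt_def by (rule Str_sarr) (simp_all add: unit_Str)
 have "wt (?r oo rdual_unit)" by (simp add: unit_Str wt_Str)
 then show "Hd_unt \<in> Hom B \<I> R" unfolding s[symmetric] by (simp add: wt_Str)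
 have "sevr H oo ($[H] ** shunt) = (sevr H oo ($[H] ** ?r)) oo ($[H] ** rdual_unit)"
  unfolding s unfolding unit_Str by (simp add: bdiag)
 also have "sevr H oo ($[H] ** ?r) = sevr \<I> oo (?e ** $[RD \<I>])"
  by (rule evr_rmap) auto
 also have "(sevr \<I> oo (?e ** $[RD \<I>])) oo ($[H] ** rdual_unit) = (sevr \<I> oo ($[\<I>] ** rdual_unit)) oo ?e"
  unfolding unit_Str by (simp add: bdiag)
 also have "... = scou" unfolding evr_rdual_unit by (simp add: unpack_def scomp_def comp_idl[of H \<I>])
 finally show "sevr H oo ($[H] ** shunt) = scou" .
qed

abbreviation stw' :: "'o => ('o, 'a) strarr" where
 "stw' M \<equiv> Str [M] (arr_inv B M M (anti_twist \<rho> M)) [M]"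

lemma stw_stw': "M \<in> Obj B ==> stw M oo stw' M = $[M]" "M \<in> Obj B ==> stw' M oo stw M = $[M]"
 using inverses_stw1 by (auto simp: inverses_def)

definition twisted :: "'o => 'a => 'a" where
 "twisted M b = sarr (stw M oo Str [R, M] b [M] oo ($[R] ** stw' M))"

lemma twisted_Str: "Str [R, M] (twisted M b) [M] = stw M oo Str [R, M] b [M] oo ($[R] ** stw' M)"
 unfolding twisted_def by (rule Str_sarr) simp_all

lemma twisted_hom [simp]:
 assumes "M \<in> Obj B" "b \<in> Hom B (R \<otimes> M) M"
 shows "twisted M b \<in> Hom B (R \<otimes> M) M"
proof -
 have "wt (stw M oo Str [R, M] b [M] oo ($[R] ** stw' M))" using assms by (simp add: wt_Str)
 then show ?thesis unfolding twisted_Str[symmetric] by (simp add: wt_Str)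
qed

definition coact :: "'o => 'a => 'a" where
 "coact M b = sarr (((Str [R, M] (twisted M b) [M] oo br [M] [R]) ** $[H]) oo ($[M] ** scoevr H))"

definition act :: "'o => 'a => 'a" where
 "act M c = sarr (stw' M oo (($[M] ** sevr H) oo (Str [M] c [M, H] ** $[R]) oo ibr [R] [M]) oo ($[R] ** stw M))"

context
 fixes M :: 'o and b :: 'a
 assumes b [simp]: "M \<in> Obj B" "b \<in> Hom B (R \<otimes> M) M"
begin

private abbreviation "BT \<equiv> Str [R, M] (twisted M b) [M]"
private abbreviation "CT \<equiv> Str [M] (coact M b) [M, H]"

lemma coact_Str: "CT = ((BT oo br [M] [R]) ** $[H]) oo ($[M] ** scoevr H)"
 unfolding coact_def by (rule Str_sarr) simp_all

lemma coact_hom [simp]: "coact M b \<in> Hom B M (M \<otimes> H)"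
proof -
 have "wt (((BT oo br [M] [R]) ** $[H]) oo ($[M] ** scoevr H))" by (simp add: wt_Str)
 then show ?thesis unfolding coact_Str[symmetric] by (simp add: wt_Str)
qed

lemma coact_eq: "($[M] ** sevr H) oo (CT ** $[R]) = BT oo br [M] [R]"
proof -
 have "($[M] ** sevr H) oo (CT ** $[R]) = BT oo br [M] [R] oo ($[M] ** (($[R] ** sevr H) oo (scoevr H ** $[R])))"
  unfolding coact_Str by (simp add: bdiag)
 then show ?thesis unfolding rdual_zigzag'[OF H_obj] by (simp add: strand_stens scomp_strand wt_Str)
qed

lemma Hd_module_iff_twisted:
 "Hd_module M b \<longleftrightarrow> BT oo (shmul ** $[M]) = BT oo ($[R] ** BT) \<and> BT oo (shunt ** $[M]) = $[M]"
proof -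
 let ?b = "Str [R, M] b [M]"
 note i = inverses_stw1[OF b(1)]
 note i2 = inverses_stens[OF inverses_strand[of "[R, R]"] inverses_sym[OF i]]
 have 1: "BT oo (shmul ** $[M]) = stw M oo (?b oo (shmul ** $[M])) oo ($[R, R] ** stw' M)"
  unfolding twisted_Str by (simp add: bdiag)
 have "BT oo ($[R] ** BT) = stw M oo ?b oo ($[R] ** (stw' M oo stw M)) oo ($[R] ** ?b) oo ($[R, R] ** stw' M)"
  unfolding twisted_Str by (simp add: bdiag)
 then have 2: "BT oo ($[R] ** BT) = stw M oo (?b oo ($[R] ** ?b)) oo ($[R, R] ** stw' M)"
  unfolding stw_stw'[OF b(1)] by (simp add: bdiag)
 have 3: "BT oo (shunt ** $[M]) = stw M oo (?b oo (shunt ** $[M])) oo stw' M"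
  unfolding twisted_Str by (simp add: bdiag)
 have c: "stw M oo x oo ($[R, R] ** stw' M) = stw M oo y oo ($[R, R] ** stw' M) \<longleftrightarrow> x = y"
  if w: "wt x" "wt y" "sdom x = [R, R, M]" "sdom y = [R, R, M]" "scod x = [M]" "scod y = [M]" for x y
 proof
  assume "stw M oo x oo ($[R, R] ** stw' M) = stw M oo y oo ($[R, R] ** stw' M)"
  then have "x oo ($[R, R] ** stw' M) = y oo ($[R, R] ** stw' M)"
   using i by (elim inverses_cancel_left[rotated]) (use w in \<open>auto simp: wt_Str\<close>)
  then show "x = y" using i2 by (elim inverses_cancel_right[rotated]) (use w in \<open>auto simp: wt_Str\<close>)
 qed simp
 have d: "stw M oo x oo stw' M = $[M] \<longleftrightarrow> x = $[M]"
  if w: "wt x" "sdom x = [M]" "scod x = [M]" for x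
 proof
  assume "stw M oo x oo stw' M = $[M]"
  then have "stw M oo x oo stw' M = stw M oo stw' M" by (simp add: stw_stw')
  then have "x oo stw' M = stw' M" using i by (elim inverses_cancel_left[rotated]) (use w in \<open>auto simp: wt_Str\<close>)
  then have "x oo stw' M = $[M] oo stw' M" by (simp add: strand_scomp wt_Str)
  then show "x = $[M]" using inverses_sym[OF i] by (elim inverses_cancel_right[rotated]) (use w in \<open>auto simp: wt_Str\<close>)
 qed (simp add: strand_scomp wt_Str stw_stw')
 show ?thesis
  unfolding 1 2 3 is_module_def by (subst c, simp_all add: wt_Str, subst d, simp_all add: wt_Str)
qed

lemma Hd_module_iff: "Hd_module M b \<longleftrightarrow> coaction M (coact M b)"
proof -
 have n1: "br [M] [R] oo ($[M] ** shmul) = (shmul ** $[M]) oo br [M] [R, R]"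
  and n2: "br [M] [R] oo ($[M] ** shunt) = (shunt ** $[M]) oo br [M] []"
  and n3: "br [M, H] [R] oo (CT ** $[R]) = ($[R] ** CT) oo br [M] [R]"
  and n4: "br [H] [] oo ($[H] ** sevr H) = (sevr H ** $[H]) oo br [H] [H, R]"
  by (rule br_natural; simp add: wt_Str)+
 have N: "sevr H oo ($[H, R] ** sevr H) oo ($[H] ** br [H] [R] ** $[R]) = nestr H H oo (ibr [H] [H] ** $[R, R])"
 proof -
  have "nestr H H oo (ibr [H] [H] ** $[R, R]) = sevr H oo ((br [H] [] oo ($[H] ** sevr H)) ** $[R]) oo (ibr [H] [H] ** $[R, R])"
   unfolding nestr_def by (simp add: bdiag)
  also have "... = sevr H oo (sevr H ** $[H, R]) oo ($[H] ** br [H] [R] ** $[R]) oo ((br [H] [H] oo ibr [H] [H]) ** $[R, R])"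
   unfolding n4 by (simp add: bdiag)
  finally show ?thesis unfolding br_ibr[of "[H]" "[H]", simplified] by (simp add: bdiag)
 qed
 let ?Q = "($[M] ** nestr H H)"
 have 1: "BT oo (shmul ** $[M]) oo br [M] [R, R] = ?Q oo ((($[M] ** ibr [H] [H]) oo ($[M] ** scom) oo CT) ** $[R, R])"
 proof -
  have "BT oo (shmul ** $[M]) oo br [M] [R, R] = (BT oo br [M] [R]) oo ($[M] ** shmul)"
   unfolding n1[symmetric] by (simp add: scomp_assoc wt_Str)
  also have "... = ($[M] ** (sevr H oo ($[H] ** shmul))) oo (CT ** $[R, R])"
   unfolding coact_eq[symmetric] by (simp add: bdiag)
  also have "... = ?Q oo ((($[M] ** ibr [H] [H]) oo ($[M] ** scom) oo CT) ** $[R, R])"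
   unfolding evr_Hd_mul nestr_def by (simp add: bdiag)
  finally show ?thesis .
 qed
 have 2: "BT oo ($[R] ** BT) oo br [M] [R, R] = ?Q oo ((($[M] ** ibr [H] [H]) oo (CT ** $[H]) oo CT) ** $[R, R])"
 proof -
  have "BT oo ($[R] ** BT) oo br [M] [R, R] = BT oo ($[R] ** (BT oo br [M] [R])) oo (br [M] [R] ** $[R])"
   by (simp add: bdiag)
  also have "... = BT oo ($[R, M] ** sevr H) oo ((($[R] ** CT) oo br [M] [R]) ** $[R])"
   unfolding coact_eq[symmetric] by (simp add: bdiag)
  also have "... = (BT oo br [M] [R]) oo ($[M, R] ** sevr H) oo ($[M] ** br [H] [R] ** $[R]) oo (CT ** $[R, R])"
   unfolding n3[symmetric] by (simp add: bdiag)
  also have "... = ($[M] ** (sevr H oo ($[H, R] ** sevr H) oo ($[H] ** br [H] [R] ** $[R]))) oo (((CT ** $[H]) oo CT) ** $[R, R])"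
   unfolding coact_eq[symmetric] by (simp add: bdiag)
  also have "... = ?Q oo ((($[M] ** ibr [H] [H]) oo (CT ** $[H]) oo CT) ** $[R, R])"
   unfolding N nestr_def by (simp add: bdiag)
  finally show ?thesis .
 qed
 have 3: "(BT oo (shunt ** $[M])) = ($[M] ** scou) oo CT"
 proof -
  have "BT oo (shunt ** $[M]) = (BT oo br [M] [R]) oo ($[M] ** shunt)"
   using n2 by (simp add: scomp_assoc wt_Str br_Nil scomp_strand)
  also have "... = ($[M] ** (sevr H oo ($[H] ** shunt))) oo CT"
   unfolding coact_eq[symmetric] by (simp add: bdiag)
  finally show ?thesis unfolding evr_Hd_unt .
 qed
 have i: "inverses (br [M] [R, R]) (ibr [R, R] [M])" by (rule inverses_br) auto
 have j: "inverses ($[M] ** ibr [H] [H]) ($[M] ** br [H] [H])"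
  using inverses_stens[OF inverses_strand[of "[M]"] inverses_sym[OF inverses_br[of "[H]" "[H]"]]] by simp
 have wtn [simp]: "wt (nestr H H)" "sdom (nestr H H) = [H, H, R, R]" "scod (nestr H H) = []" by (simp_all add: nestr_def wt_Str)
 have "BT oo (shmul ** $[M]) = BT oo ($[R] ** BT) \<longleftrightarrow> (CT ** $[H]) oo CT = ($[M] ** scom) oo CT"
 proof
  assume "BT oo (shmul ** $[M]) = BT oo ($[R] ** BT)"
  then have "(BT oo ($[R] ** BT)) oo br [M] [R, R] = (BT oo (shmul ** $[M])) oo br [M] [R, R]" by simp
  then have "BT oo ($[R] ** BT) oo br [M] [R, R] = BT oo (shmul ** $[M]) oo br [M] [R, R]"
   by (simp add: scomp_assoc wt_Str)
  then have "($[M] ** ibr [H] [H]) oo (CT ** $[H]) oo CT = ($[M] ** ibr [H] [H]) oo ($[M] ** scom) oo CT"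
   unfolding 1 2 using dual_pair_nestr[OF H_obj H_obj] by (elim dual_pair_cancel_inner[rotated]) (auto simp: wt_Str)
  then show "(CT ** $[H]) oo CT = ($[M] ** scom) oo CT"
   using j by (elim inverses_cancel_left[rotated]) (auto simp: wt_Str)
 next
  assume "(CT ** $[H]) oo CT = ($[M] ** scom) oo CT"
  then have "(BT oo (shmul ** $[M])) oo br [M] [R, R] = (BT oo ($[R] ** BT)) oo br [M] [R, R]"
   using 1 2 by (simp add: scomp_assoc wt_Str)
  then show "BT oo (shmul ** $[M]) = BT oo ($[R] ** BT)"
   using i by (elim inverses_cancel_right[rotated]) (auto simp: wt_Str)
 qed
 then show ?thesis
  unfolding Hd_module_iff_twisted 3 coaction_def by simp
qed

end

lemma
 assumes [simp]: "M \<in> Obj B" "c \<in> Hom B M (M \<otimes> H)"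
 shows act_hom: "act M c \<in> Hom B (R \<otimes> M) M"
  and coact_act: "coact M (act M c) = c"
proof -
 let ?C = "Str [M] c [M, H]"
 let ?D = "($[M] ** sevr H) oo (?C ** $[R]) oo ibr [R] [M]"
 have A: "Str [R, M] (act M c) [M] = stw' M oo ?D oo ($[R] ** stw M)"
  unfolding act_def by (rule Str_sarr) simp_all
 have "wt (stw' M oo ?D oo ($[R] ** stw M))" by (simp add: wt_Str)
 then show h: "act M c \<in> Hom B (R \<otimes> M) M" unfolding A[symmetric] by (simp add: wt_Str)
 have "Str [R, M] (twisted M (act M c)) [M] = (stw M oo stw' M) oo ?D oo ($[R] ** (stw M oo stw' M))"
  unfolding twisted_Str A by (simp add: bdiag)
 then have T: "Str [R, M] (twisted M (act M c)) [M] = ?D"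
  unfolding stw_stw'[OF assms(1)] by (simp add: bdiag)
 have "($[M] ** sevr H) oo (Str [M] (coact M (act M c)) [M, H] ** $[R]) = ?D oo br [M] [R]"
  using coact_eq[OF assms(1) h] T by simp
 also have "... = ($[M] ** sevr H) oo (?C ** $[R]) oo (ibr [R] [M] oo br [M] [R])"
  by (simp add: bdiag)
 also have "... = ($[M] ** sevr H) oo (?C ** $[R])"
  unfolding ibr_br[of "[R]" "[M]", simplified] by (simp add: bdiag)
 finally have "Str [M] (coact M (act M c)) [M, H] = ?C"
  using dual_pair_evr[OF H_obj] h by (elim dual_pair_cancel_inner[rotated]) (auto simp: wt_Str)
 then show "coact M (act M c) = c" by simp
qed

lemma coact_morphism_iff:
 assumes [simp]: "M \<in> Obj B" "N \<in> Obj B" "b \<in> Hom B (R \<otimes> M) M" "d \<in> Hom B (R \<otimes> N) N" "f \<in> Hom B M N"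
 shows "Str [M] f [N] oo Str [R, M] b [M] = Str [R, N] d [N] oo ($[R] ** Str [M] f [N]) \<longleftrightarrow>
  (Str [M] f [N] ** $[H]) oo Str [M] (coact M b) [M, H] = Str [N] (coact N d) [N, H] oo Str [M] f [N]"
  (is "?l \<longleftrightarrow> ?r")
proof -
 let ?f = "Str [M] f [N]" and ?b = "Str [R, M] b [M]" and ?d = "Str [R, N] d [N]"
 let ?B = "Str [R, M] (twisted M b) [M]" and ?D = "Str [R, N] (twisted N d) [N]"
 have s: "stw N oo ?f = ?f oo stw M" by (rule stw_natural1) auto
 have s': "stw' N oo ?f = ?f oo stw' M"
  by (rule inverses_move[OF inverses_stw1 inverses_stw1]) (use s in \<open>auto simp: wt_Str\<close>)
 have n: "br [N] [R] oo (?f ** $[R]) = ($[R] ** ?f) oo br [M] [R]"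
  by (rule br_natural) (auto simp: wt_Str)
 have 1: "stw N oo (?f oo ?b) oo ($[R] ** stw' M) = ?f oo ?B"
 proof -
  have "stw N oo (?f oo ?b) oo ($[R] ** stw' M) = (stw N oo ?f) oo ?b oo ($[R] ** stw' M)" by (simp add: scomp_assoc wt_Str)
  also have "... = ?f oo ?B" unfolding s twisted_Str by (simp add: scomp_assoc wt_Str)
  finally show ?thesis .
 qed
 have 2: "stw N oo (?d oo ($[R] ** ?f)) oo ($[R] ** stw' M) = ?D oo ($[R] ** ?f)"
 proof -
  have "stw N oo (?d oo ($[R] ** ?f)) oo ($[R] ** stw' M) = stw N oo ?d oo ($[R] ** (?f oo stw' M))" by (simp add: bdiag)
  also have "... = ?D oo ($[R] ** ?f)" unfolding s'[symmetric] twisted_Str by (simp add: bdiag)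
  finally show ?thesis .
 qed
 have 3: "(?f oo ?B) oo br [M] [R] = ($[N] ** sevr H) oo (((?f ** $[H]) oo Str [M] (coact M b) [M, H]) ** $[R])"
 proof -
  have "(?f oo ?B) oo br [M] [R] = ?f oo (?B oo br [M] [R])" by (simp add: scomp_assoc wt_Str)
  then show ?thesis unfolding coact_eq[OF assms(1,3), symmetric] by (simp add: bdiag)
 qed
 have 4: "(?D oo ($[R] ** ?f)) oo br [M] [R] = ($[N] ** sevr H) oo ((Str [N] (coact N d) [N, H] oo ?f) ** $[R])"
 proof -
  have "(?D oo ($[R] ** ?f)) oo br [M] [R] = (?D oo br [N] [R]) oo (?f ** $[R])" using n by (simp add: scomp_assoc wt_Str)
  then show ?thesis unfolding coact_eq[OF assms(2,4), symmetric] by (simp add: bdiag)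
 qed
 have i: "inverses (br [M] [R]) (ibr [R] [M])" by (rule inverses_br) auto
 have j: "inverses ($[R] ** stw' M) ($[R] ** stw M)"
  by (intro inverses_stens inverses_strand inverses_sym[OF inverses_stw1]) auto
 show ?thesis
 proof
  assume ?l
  then have "(?f oo ?B) oo br [M] [R] = (?D oo ($[R] ** ?f)) oo br [M] [R]" unfolding 1[symmetric] 2[symmetric] by simp
  then show ?r unfolding 3 4 using dual_pair_evr[OF H_obj] by (elim dual_pair_cancel_inner[rotated]) (auto simp: wt_Str)
 next
  assume ?r
  then have "(?f oo ?B) oo br [M] [R] = (?D oo ($[R] ** ?f)) oo br [M] [R]" unfolding 3 4 by simp
  then have "?f oo ?B = ?D oo ($[R] ** ?f)" using i by (elim inverses_cancel_right[rotated]) (auto simp: wt_Str)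
  then have "stw N oo (?f oo ?b) oo ($[R] ** stw' M) = stw N oo (?d oo ($[R] ** ?f)) oo ($[R] ** stw' M)" unfolding 1 2 .
  then have "(?f oo ?b) oo ($[R] ** stw' M) = (?d oo ($[R] ** ?f)) oo ($[R] ** stw' M)"
   using inverses_stw1[OF assms(2)] by (elim inverses_cancel_left[rotated]) (auto simp: wt_Str)
  then show ?l using j by (elim inverses_cancel_right[rotated]) (auto simp: wt_Str)
 qed
qed

end

section \<open>The anti-Yetter-Drinfeld condition\<close>

context pivotal_hopf_algebra
begin

subsection \<open>The module structure of the twisted module category\<close>

definition tE :: "'o list => ('o, 'a) strarr" where
 "tE Ys = swd (H # Ys) oo ($[H] ** swd' Ys)"

definition tE' :: "'o list => ('o, 'a) strarr" where
 "tE' Ys = ($[H] ** swd Ys) oo swd' (H # Ys)"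

lemma sdom_tE [simp]: "sdom (tE Ys) = H # Ys" "sdom (tE' Ys) = H # Ys"
 and scod_tE [simp]: "scod (tE Ys) = H # Ys" "scod (tE' Ys) = H # Ys"
 by (simp_all add: tE_def tE'_def)

lemma wt_tE [simp]: "set Ys <= Obj B ==> wt (tE Ys)" "set Ys <= Obj B ==> wt (tE' Ys)"
 by (simp_all add: tE_def tE'_def)

lemma inverses_tE:
 assumes "set Ys <= Obj B"
 shows "inverses (tE Ys) (tE' Ys)"
 unfolding tE_def tE'_def using assms
 by (intro inverses_scomp inverses_swd inverses_stens inverses_strand inverses_sym[OF inverses_swd]) auto

definition "tE_arr Ys = sarr (tE Ys)"
definition "tE_arr' Ys = sarr (tE' Ys)"

lemma tE_Str: "tE Ys = Str (H # Ys) (tE_arr Ys) (H # Ys)" "tE' Ys = Str (H # Ys) (tE_arr' Ys) (H # Ys)"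
 by (simp_all add: tE_arr_def tE_arr'_def Str_sarr)

lemma tE_arr_hom [simp]:
 assumes "set Ys <= Obj B" "W = word (H # Ys)" "W' = word (H # Ys)"
 shows "tE_arr Ys \<in> Hom B W W'" "tE_arr' Ys \<in> Hom B W W'"
 using wt_tE[OF assms(1)] assms by (simp_all add: tE_Str wt_Str)

lemma tE_natural:
 assumes f: "wt f" "sdom f = Xs" "scod f = Ys"
 shows "tE Ys oo ($[H] ** f) = ($[H] ** f) oo tE Xs"
  and "tE' Ys oo ($[H] ** f) = ($[H] ** f) oo tE' Xs"
proof -
 note [simp] = f wt_dom[OF f(1), unfolded f(2)] wt_cod[OF f(1), unfolded f(3)]
 have s: "($[H] ** swd' Ys) oo ($[H] ** f) = ($[H] ** f) oo ($[H] ** swd' Xs)"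
  using swd'_natural[OF f] stens_scomp[of "$[H]" "$[H]" "swd' Ys" f] stens_scomp[of "$[H]" "$[H]" f "swd' Xs"]
  by (simp add: strand_scomp)
 have t: "swd (H # Ys) oo ($[H] ** f) = ($[H] ** f) oo swd (H # Xs)"
  by (rule swd_natural) auto
 have "tE Ys oo ($[H] ** f) = (swd (H # Ys) oo ($[H] ** f)) oo ($[H] ** swd' Xs)"
  unfolding tE_def using s by (simp add: scomp_assoc)
 also have "... = ($[H] ** f) oo tE Xs"
  unfolding t tE_def by (simp add: scomp_assoc)
 finally show e: "tE Ys oo ($[H] ** f) = ($[H] ** f) oo tE Xs" .
 show "tE' Ys oo ($[H] ** f) = ($[H] ** f) oo tE' Xs"
  by (rule inverses_move[OF inverses_tE inverses_tE]) (use e in auto)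
qed

lemma tE_com:
 assumes [simp]: "set Ys <= Obj B"
 shows "tE (H # Ys) oo ($[H] ** tE Ys) oo (scom ** $Ys) = (scom ** $Ys) oo tE Ys"
proof -
 have n: "swd (H # H # Ys) oo (scom ** $Ys) = (scom ** $Ys) oo swd (H # Ys)"
  by (rule swd_natural) (auto simp: wt_Str)
 have 1: "($[H] ** swd' (H # Ys)) oo ($[H] ** tE Ys) = $[H] ** ($[H] ** swd' Ys)"
 proof -
  have "swd' (H # Ys) oo tE Ys = (swd' (H # Ys) oo swd (H # Ys)) oo ($[H] ** swd' Ys)"
   unfolding tE_def by (simp add: scomp_assoc)
  then have "swd' (H # Ys) oo tE Ys = $[H] ** swd' Ys" by (simp add: swd_inv strand_scomp)
  then show ?thesis using stens_scomp[of "$[H]" "$[H]" "swd' (H # Ys)" "tE Ys"] by (simp add: strand_scomp)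
 qed
 have 2: "($[H] ** ($[H] ** swd' Ys)) oo (scom ** $Ys) = (scom ** $Ys) oo ($[H] ** swd' Ys)"
  using stens_scomp[of "$[H, H]" scom "swd' Ys" "$Ys"] stens_scomp[of scom "$[H]" "$Ys" "swd' Ys"]
  by (simp add: stens_assoc[symmetric] strand_stens strand_scomp scomp_strand wt_Str)
 have "tE (H # Ys) oo ($[H] ** tE Ys) oo (scom ** $Ys) =
   swd (H # H # Ys) oo (($[H] ** swd' (H # Ys)) oo ($[H] ** tE Ys)) oo (scom ** $Ys)"
  unfolding tE_def[of "H # Ys"] by (simp add: scomp_assoc wt_Str)
 also have "... = (swd (H # H # Ys) oo (scom ** $Ys)) oo ($[H] ** swd' Ys)"
  unfolding 1 2 by (simp add: scomp_assoc wt_Str)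
 also have "... = (scom ** $Ys) oo tE Ys"
  unfolding n tE_def by (simp add: scomp_assoc wt_Str)
 finally show ?thesis .
qed

lemma tE_com':
 assumes [simp]: "set Ys <= Obj B"
 shows "tE (H # Ys) oo (scom ** $Ys) = ($[H] ** tE' Ys) oo (scom ** $Ys) oo tE Ys"
proof -
 have n: "tE (H # Ys) oo ($[H] ** tE Ys) = ($[H] ** tE Ys) oo tE (H # Ys)"
  by (rule tE_natural) auto
 have i: "($[H] ** tE' Ys) oo ($[H] ** tE Ys) = $(H # H # Ys)"
  using inverses_tE[OF assms] stens_scomp[of "$[H]" "$[H]" "tE' Ys" "tE Ys"]
  by (simp add: inverses_def strand_scomp strand_stens)
 have "($[H] ** tE' Ys) oo (scom ** $Ys) oo tE Ys = ($[H] ** tE' Ys) oo (tE (H # Ys) oo ($[H] ** tE Ys)) oo (scom ** $Ys)"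
  using tE_com[OF assms] by (simp add: scomp_assoc wt_Str)
 also have "... = (($[H] ** tE' Ys) oo ($[H] ** tE Ys)) oo tE (H # Ys) oo (scom ** $Ys)"
  unfolding n by (simp add: scomp_assoc wt_Str)
 finally show ?thesis unfolding i by (simp add: strand_scomp wt_Str)
qed

lemma swd_single: "swd [X] = stw X" "swd' [X] = stw' X"
 by (simp_all add: swd_def swd'_def)

lemma tE_eq:
 assumes [simp]: "set Ys <= Obj B"
 shows "tE Ys = ibr Ys [H] oo ibr [H] Ys oo (stw H ** $Ys)"
  and "tE' Ys = (stw' H ** $Ys) oo br Ys [H] oo br [H] Ys"
proof -
 have "(swd [H] ** swd Ys) oo ($[H] ** swd' Ys) = stw H ** $Ys"
  using stens_scomp[of "swd [H]" "$[H]" "swd Ys" "swd' Ys"] by (simp add: swd_inv scomp_strand swd_single wt_Str)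
 then show e: "tE Ys = ibr Ys [H] oo ibr [H] Ys oo (stw H ** $Ys)"
  unfolding tE_def using swd_append[of "[H]" Ys] by (simp add: scomp_assoc)
 have "inverses (ibr Ys [H] oo ibr [H] Ys oo (stw H ** $Ys)) (((stw' H ** $Ys) oo br Ys [H]) oo br [H] Ys)"
  by (intro inverses_scomp inverses_stens inverses_strand inverses_stw1 inverses_sym[OF inverses_br]) auto
 then have "tE' Ys = ((stw' H ** $Ys) oo br Ys [H]) oo br [H] Ys"
  using inverses_unique[OF inverses_tE[OF assms]] e by simp
 then show "tE' Ys = (stw' H ** $Ys) oo br Ys [H] oo br [H] Ys" by (simp add: scomp_assoc wt_Str)
qed

lemma tE_br:
 assumes [simp]: "X \<in> Obj B" "Y \<in> Obj B"
 shows "tE [H, X, Y] oo (br [H] [H] ** $[X, Y]) = (ibr [H] [H] ** $[X, Y]) oo ($[H] ** tE [X, Y])"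
proof -
 have n: "(stw H ** $[H]) oo br [H] [H] = br [H] [H] oo ($[H] ** stw H)"
  by (rule br_natural[symmetric]) (auto simp: wt_Str)
 have "tE [H, X, Y] oo (br [H] [H] ** $[X, Y]) = ibr [H, X, Y] [H] oo ibr [H] [H, X, Y] oo (((stw H ** $[H]) oo br [H] [H]) ** $[X, Y])"
  using tE_eq(1)[of "[H, X, Y]"] by (simp add: bdiag)
 also have "... = ibr [H, X, Y] [H] oo ($[H] ** ibr [H] [X, Y]) oo ((ibr [H] [H] oo br [H] [H]) ** $[X, Y]) oo ($[H] ** stw H ** $[X, Y])"
  unfolding n by (simp add: bdiag)
 also have "... = (ibr [H] [H] ** $[X, Y]) oo ($[H] ** tE [X, Y])"
  unfolding ibr_br[of "[H]" "[H]", simplified] using tE_eq(1)[of "[X, Y]"] by (simp add: bdiag)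
 finally show ?thesis .
qed

lemma twist_E_tE:
 assumes [simp]: "X \<in> Obj B" "Y \<in> Obj B"
 shows "Str [H, X, Y] (twist_E (anti_twist \<rho>) H (X \<otimes> Y)) [H, X, Y] = tE [X, Y]"
proof -
 have s: "$[H] ** swd [X, Y] = Str [H, X, Y] (idm B H \<star> anti_twist \<rho> (X \<otimes> Y)) [H, X, Y]"
  "$[H] ** swd' [X, Y] = Str [H, X, Y] (idm B H \<star> arr_inv B (X \<otimes> Y) (X \<otimes> Y) (anti_twist \<rho> (X \<otimes> Y))) [H, X, Y]"
  unfolding strand_def swd_def swd'_def by (simp_all add: single_stens_Cons)
 have "inverses ($[H] ** swd [X, Y]) ($[H] ** swd' [X, Y])"
  by (intro inverses_stens inverses_strand inverses_swd) auto
 from inverses_arr_inv_eq[OF this[unfolded s]] show ?thesis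
  unfolding tE_def s twist_E_def by (simp add: swd_def scomp_def)
qed

lemma evr_cancel_outer:
 assumes e: "(sevr H ** $Zs) oo ($[H] ** f) = (sevr H ** $Zs) oo ($[H] ** g)"
  and w: "wt f" "wt g" "sdom f = Ys" "sdom g = Ys" "scod f = R # Zs" "scod g = R # Zs"
 shows "f = g"
proof -
 have *: "h = ($[R] ** ((sevr H ** $Zs) oo ($[H] ** h))) oo (scoevr H ** $Ys)"
  if h: "wt h" "sdom h = Ys" "scod h = R # Zs" for h
 proof -
  obtain k where k: "h = Str Ys k (R # Zs)" "k \<in> Hom B (word Ys) (word (R # Zs))" using wt_StrE[OF h] .
  have [simp]: "set Ys <= Obj B" "set Zs <= Obj B" using h wt_dom[OF h(1)] wt_cod[OF h(1)] by auto
  have "($[R] ** ((sevr H ** $Zs) oo ($[H] ** h))) oo (scoevr H ** $Ys) =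
    ((($[R] ** sevr H) oo (scoevr H ** $[R])) ** $Zs) oo h"
   using k(2) unfolding k(1) by (simp add: layer_simps del: word.simps) (simp add: layer_simps)
  then show ?thesis
   unfolding rdual_zigzag'[OF H_obj] using h by (simp add: strand_stens strand_scomp)
 qed
 show ?thesis using *[of f] *[of g] assms by metis
qed

subsection \<open>Conjugating the action by the anti-twist\<close>

context
 fixes M :: 'o and a :: 'a
 assumes m: "H_module M a"
begin

private lemma act_hom' [simp]: "M \<in> Obj B" "a \<in> Hom B (H \<otimes> M) M"
 using H_moduleD[OF m] by auto

private abbreviation "AM \<equiv> Str [H, M] a [M]"

private definition "eq0 = sevr H oo (smul ** $[R]) oo (sant ** $[H, R])"

private lemma eq0_props: "wt eq0" "sdom eq0 = [H, H, R]" "scod eq0 = []"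
 by (simp_all add: eq0_def wt_Str)

private definition "Z1 = AM oo ($[H] ** eq0 ** $[M]) oo (scom ** $[H, R, M]) oo (br [H] [H] ** $[R, M])"
private definition "Z2 = AM oo ($[H] ** eq0 ** $[M]) oo ($[H] ** tE' [H, R, M]) oo (scom ** $[H, R, M]) oo (ibr [H] [H] ** $[R, M])"
definition "pairing2 = Z2 oo (smul ** $[H, R, M]) oo ($[H] ** scom ** $[R, M])"

definition "act2 = adj pairing2"

private lemma Z_props: "wt Z1" "sdom Z1 = [H, H, R, M]" "scod Z1 = [M]" "wt Z2" "sdom Z2 = [H, H, R, M]" "scod Z2 = [M]"
 by (simp_all add: Z1_def Z2_def eq0_props wt_Str)

lemma pairing2_props: "wt pairing2" "sdom pairing2 = [H, H, R, M]" "scod pairing2 = [M]"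
 by (simp_all add: pairing2_def Z_props wt_Str)

private lemma stw_Z1: "stw M oo Z1 oo ($[H, H, R] ** stw' M) = Z2 oo ($[H] ** tE [R, M])"
proof -
 obtain e where e: "eq0 = Str [H, H, R] e []" and [simp]: "e \<in> Hom B (H \<otimes> H \<otimes> R) \<I>"
  using wt_StrE[OF eq0_props] by auto
 have tA: "AM oo tE [M] = stw M oo AM oo ($[H] ** stw' M)"
 proof -
  have "swd [M] oo AM = AM oo swd [H, M]" by (rule swd_natural) (auto simp: wt_Str)
  then show ?thesis unfolding tE_def swd_single using scomp_assoc[of "stw M" AM "$[H] ** stw' M"] scomp_assoc[of AM "swd [H, M]" "$[H] ** stw' M"]
   by (simp add: wt_Str)
 qed
 have n: "tE [M] oo ($[H] ** (eq0 ** $[M])) = ($[H] ** (eq0 ** $[M])) oo tE [H, H, R, M]"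
  by (rule tE_natural) (auto simp: eq0_props)
 have "stw M oo Z1 oo ($[H, H, R] ** stw' M) = (stw M oo AM oo ($[H] ** stw' M)) oo ($[H] ** eq0 ** $[M]) oo (scom ** $[H, R, M]) oo (br [H] [H] ** $[R, M])"
  unfolding Z1_def e by (simp add: bdiag)
 also have "... = AM oo (tE [M] oo ($[H] ** (eq0 ** $[M]))) oo (scom ** $[H, R, M]) oo (br [H] [H] ** $[R, M])"
  unfolding tA[symmetric] by (simp add: scomp_assoc wt_Str eq0_props)
 also have "... = AM oo ($[H] ** eq0 ** $[M]) oo (tE [H, H, R, M] oo (scom ** $[H, R, M])) oo (br [H] [H] ** $[R, M])"
  unfolding n by (simp add: scomp_assoc wt_Str eq0_props)
 also have "tE [H, H, R, M] oo (scom ** $[H, R, M]) = ($[H] ** tE' [H, R, M]) oo (scom ** $[H, R, M]) oo tE [H, R, M]"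
  by (rule tE_com') auto
 also have "AM oo ($[H] ** eq0 ** $[M]) oo ... oo (br [H] [H] ** $[R, M]) =
   AM oo ($[H] ** eq0 ** $[M]) oo ($[H] ** tE' [H, R, M]) oo (scom ** $[H, R, M]) oo (tE [H, R, M] oo (br [H] [H] ** $[R, M]))"
  by (simp add: scomp_assoc wt_Str eq0_props)
 also have "tE [H, R, M] oo (br [H] [H] ** $[R, M]) = (ibr [H] [H] ** $[R, M]) oo ($[H] ** tE [R, M])"
  by (rule tE_br) auto
 finally show ?thesis unfolding Z2_def by (simp add: scomp_assoc wt_Str eq0_props)
qed

private lemma evr_yd_act: "(sevr H ** $[M]) oo ($[H] ** yd_act (twist_E (anti_twist \<rho>)) M a) =
  Z1 oo (smul ** $[H, R, M]) oo ($[H] ** tE [H, R, M]) oo ($[H] ** scom ** $[R, M])"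
 and wt_yd_act: "wt (yd_act (twist_E (anti_twist \<rho>)) M a)"
proof -
 let ?F = "AM oo ($[H] ** sevr H ** $[M]) oo ($[H] ** smul ** $[R, M]) oo ($[H] ** sant ** $[H, R, M]) oo
   (scom ** $[H, R, M]) oo (sbraid H H ** $[R, M])"
 have F: "?F = Z1" unfolding Z1_def eq0_def by (simp add: bdiag)
 obtain z where z: "Z1 = Str [H, H, R, M] z [M]" and z_hom: "z \<in> Hom B (word (H # [H, R, M])) (word [M])"
  using wt_StrE[OF Z_props(1-3)] by auto
 have r0: "r_zero M a = adj Z1" unfolding r_zero_def F ..
 have w0: "wt (r_zero M a)" "sdom (r_zero M a) = [H, R, M]" "scod (r_zero M a) = [R, M]"
  unfolding r0 adj_def by (simp_all add: Z_props wt_Str)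
 obtain r where r: "r_zero M a = Str [H, R, M] r [R, M]" and r_hom [simp]: "r \<in> Hom B (H \<otimes> R \<otimes> M) (R \<otimes> M)"
  using wt_StrE[OF w0] by auto
 have e0: "(sevr H ** $[M]) oo ($[H] ** r_zero M a) = Z1"
  unfolding r0 z by (rule evr_adj) (use z_hom in auto)
 let ?G = "(sevr H ** $[M]) oo (smul ** $[R, M])"
 have G: "wt ?G" "sdom ?G = H # [H, R, M]" "scod ?G = [M]" by (simp_all add: wt_Str)
 obtain g where g: "?G = Str (H # [H, R, M]) g [M]" and g_hom: "g \<in> Hom B (word (H # [H, R, M])) (word [M])"
  using wt_StrE[OF G] by auto
 have w1: "wt (r_one M)" "sdom (r_one M) = [H, R, M]" "scod (r_one M) = [R, M]"
  unfolding r_one_def adj_def by (simp_all add: wt_Str)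
 obtain t where t: "r_one M = Str [H, R, M] t [R, M]" and t_hom [simp]: "t \<in> Hom B (H \<otimes> R \<otimes> M) (R \<otimes> M)"
  using wt_StrE[OF w1] by auto
 have e1: "(sevr H ** $[M]) oo ($[H] ** r_one M) = ?G"
  unfolding r_one_def g by (rule evr_adj) (use g_hom in auto)
 have yd: "yd_act (twist_E (anti_twist \<rho>)) M a = r_one M oo tE [R, M] oo ($[H] ** r_zero M a) oo (scom ** $[R, M])"
  unfolding yd_act_def using twist_E_tE[of R M] by simp
 then show "wt (yd_act (twist_E (anti_twist \<rho>)) M a)" by (simp add: w0 w1 wt_Str)
 have n: "tE [R, M] oo ($[H] ** r_zero M a) = ($[H] ** r_zero M a) oo tE [H, R, M]"
  by (rule tE_natural) (auto simp: w0)
 have "(sevr H ** $[M]) oo ($[H] ** yd_act (twist_E (anti_twist \<rho>)) M a) =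
   ((sevr H ** $[M]) oo ($[H] ** r_one M)) oo ($[H] ** (tE [R, M] oo ($[H] ** r_zero M a))) oo ($[H] ** scom ** $[R, M])"
  unfolding yd unfolding t r tE_Str by (simp add: bdiag)
 also have "... = ((sevr H ** $[M]) oo ($[H] ** r_zero M a)) oo (smul ** $[H, R, M]) oo ($[H] ** tE [H, R, M]) oo ($[H] ** scom ** $[R, M])"
  unfolding n e1 unfolding r tE_Str by (simp add: bdiag)
 finally show "(sevr H ** $[M]) oo ($[H] ** yd_act (twist_E (anti_twist \<rho>)) M a) =
   Z1 oo (smul ** $[H, R, M]) oo ($[H] ** tE [H, R, M]) oo ($[H] ** scom ** $[R, M])"
  unfolding e0 .
qed

lemma evr_act2: "(sevr H ** $[M]) oo ($[H] ** act2) = pairing2"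
 and act2_props: "wt act2" "sdom act2 = [H, R, M]" "scod act2 = [R, M]"
proof -
 obtain p where p: "pairing2 = Str (H # [H, R, M]) p [M]" and p_hom: "p \<in> Hom B (word (H # [H, R, M])) (word [M])"
  using wt_StrE[OF pairing2_props] by auto
 show "(sevr H ** $[M]) oo ($[H] ** act2) = pairing2"
  unfolding act2_def p by (rule evr_adj) (use p_hom in auto)
 show "wt act2" "sdom act2 = [H, R, M]" "scod act2 = [R, M]"
  unfolding act2_def adj_def by (simp_all add: pairing2_props wt_Str)
qed

lemma yd_act_conj: "($[R] ** stw M) oo yd_act (twist_E (anti_twist \<rho>)) M a oo ($[H, R] ** stw' M) = act2 oo tE [R, M]"
proof (rule evr_cancel_outer)
 let ?y = "yd_act (twist_E (anti_twist \<rho>)) M a"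
 have y: "sdom ?y = [H, R, M]" "scod ?y = [R, M]"
  by (simp_all add: yd_act_def r_one_def adj_def)
 obtain k where k: "?y = Str [H, R, M] k [R, M]" and [simp]: "k \<in> Hom B (H \<otimes> R \<otimes> M) (R \<otimes> M)"
  using wt_StrE[OF wt_yd_act y] by auto
 obtain z where z: "Z1 = Str [H, H, R, M] z [M]" and [simp]: "z \<in> Hom B (H \<otimes> H \<otimes> R \<otimes> M) M"
  using wt_StrE[OF Z_props(1-3)] by auto
 obtain z' where z': "Z2 = Str [H, H, R, M] z' [M]" and [simp]: "z' \<in> Hom B (H \<otimes> H \<otimes> R \<otimes> M) M"
  using wt_StrE[OF Z_props(4-6)] by auto
 obtain l where l: "act2 = Str [H, R, M] l [R, M]" and [simp]: "l \<in> Hom B (H \<otimes> R \<otimes> M) (R \<otimes> M)"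
  using wt_StrE[OF act2_props] by auto
 have n: "tE [H, R, M] oo ($[H] ** ($[H, R] ** stw' M)) = ($[H] ** ($[H, R] ** stw' M)) oo tE [H, R, M]"
  by (rule tE_natural) (auto simp: wt_Str)
 have n2: "($[H] ** tE [R, M]) oo tE [H, R, M] = tE [H, R, M] oo ($[H] ** tE [R, M])"
  by (rule tE_natural[symmetric]) auto
 have "(sevr H ** $[M]) oo ($[H] ** (($[R] ** stw M) oo ?y oo ($[H, R] ** stw' M))) =
   stw M oo ((sevr H ** $[M]) oo ($[H] ** ?y)) oo ($[H, H, R] ** stw' M)"
  unfolding k by (simp add: bdiag)
 also have "... = stw M oo Z1 oo (smul ** $[H, R, M]) oo ($[H] ** (tE [H, R, M] oo ($[H] ** ($[H, R] ** stw' M)))) oo ($[H] ** scom ** $[R, M])"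
  unfolding evr_yd_act z tE_Str by (simp add: bdiag)
 also have "... = (stw M oo Z1 oo ($[H, H, R] ** stw' M)) oo (smul ** $[H, R, M]) oo ($[H] ** tE [H, R, M]) oo ($[H] ** scom ** $[R, M])"
  unfolding n unfolding z tE_Str by (simp add: bdiag)
 also have "... = Z2 oo (smul ** $[H, R, M]) oo ($[H] ** (($[H] ** tE [R, M]) oo tE [H, R, M])) oo ($[H] ** scom ** $[R, M])"
  unfolding stw_Z1 unfolding z' tE_Str by (simp add: bdiag)
 also have "... = Z2 oo (smul ** $[H, R, M]) oo ($[H] ** (tE [H, R, M] oo ($[H] ** tE [R, M]) oo (scom ** $[R, M])))"
  unfolding n2 unfolding z' tE_Str by (simp add: bdiag)
 also have "... = pairing2 oo ($[H] ** tE [R, M])"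
  unfolding tE_com[of "[R, M]", simplified] pairing2_def unfolding z' tE_Str by (simp add: bdiag)
 also have "... = (sevr H ** $[M]) oo ($[H] ** (act2 oo tE [R, M]))"
  unfolding evr_act2[symmetric] unfolding l tE_Str by (simp add: bdiag)
 finally show "(sevr H ** $[M]) oo ($[H] ** (($[R] ** stw M) oo ?y oo ($[H, R] ** stw' M))) = ..." .
qed (use wt_yd_act act2_props in \<open>auto simp: wt_Str yd_act_def r_one_def adj_def\<close>)

lemma aYD_iff_twisted:
 assumes [simp]: "b \<in> Hom B (R \<otimes> M) M"
 defines "BT \<equiv> Str [R, M] (twisted M b) [M]"
 shows "AM oo ($[H] ** Str [R, M] b [M]) = Str [R, M] b [M] oo yd_act (twist_E (anti_twist \<rho>)) M a \<longleftrightarrow>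
  AM oo ($[H] ** BT) = BT oo act2"
proof -
 let ?y = "yd_act (twist_E (anti_twist \<rho>)) M a" and ?b = "Str [R, M] b [M]"
 have y: "sdom ?y = [H, R, M]" "scod ?y = [R, M]"
  by (simp_all add: yd_act_def r_one_def adj_def)
 obtain k where k: "?y = Str [H, R, M] k [R, M]" and [simp]: "k \<in> Hom B (H \<otimes> R \<otimes> M) (R \<otimes> M)"
  using wt_StrE[OF wt_yd_act y] by auto
 obtain l where l: "act2 = Str [H, R, M] l [R, M]" and [simp]: "l \<in> Hom B (H \<otimes> R \<otimes> M) (R \<otimes> M)"
  using wt_StrE[OF act2_props] by auto
 have wB [simp]: "wt BT" "sdom BT = [R, M]" "scod BT = [M]" unfolding BT_def by (simp_all add: wt_Str)
 have ss: "stw' M oo stw M = $[M]" by (simp add: stw_stw')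
 have tA: "AM oo tE [M] = stw M oo AM oo ($[H] ** stw' M)"
 proof -
  have "swd [M] oo AM = AM oo swd [H, M]" by (rule swd_natural) (auto simp: wt_Str)
  then show ?thesis unfolding tE_def swd_single using scomp_assoc[of "stw M" AM "$[H] ** stw' M"] scomp_assoc[of AM "swd [H, M]" "$[H] ** stw' M"]
   by (simp add: wt_Str)
 qed
 have bs: "stw' M oo BT = ?b oo ($[R] ** stw' M)"
 proof -
  have "stw' M oo BT = (stw' M oo stw M) oo ?b oo ($[R] ** stw' M)"
   unfolding BT_def twisted_Str by (simp add: scomp_assoc wt_Str)
  then show ?thesis unfolding ss by (simp add: strand_scomp wt_Str)
 qed
 have sb: "BT oo ($[R] ** stw M) = stw M oo ?b"
 proof -
  have "BT oo ($[R] ** stw M) = stw M oo ?b oo ($[R] ** (stw' M oo stw M))"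
   unfolding BT_def twisted_Str by (simp add: bdiag)
  then show ?thesis unfolding ss by (simp add: strand_stens scomp_strand wt_Str)
 qed
 have n: "tE [M] oo ($[H] ** BT) = ($[H] ** BT) oo tE [R, M]" by (rule tE_natural) auto
 have 1: "stw M oo (AM oo ($[H] ** ?b)) oo ($[H, R] ** stw' M) = (AM oo ($[H] ** BT)) oo tE [R, M]"
 proof -
  have "stw M oo (AM oo ($[H] ** ?b)) oo ($[H, R] ** stw' M) = stw M oo AM oo ($[H] ** (?b oo ($[R] ** stw' M)))"
   by (simp add: bdiag)
  also have "... = (stw M oo AM oo ($[H] ** stw' M)) oo ($[H] ** BT)"
   unfolding bs[symmetric] unfolding BT_def by (simp add: bdiag)
  also have "... = AM oo (tE [M] oo ($[H] ** BT))" unfolding tA[symmetric] by (simp add: scomp_assoc wt_Str)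
  finally show ?thesis unfolding n by (simp add: scomp_assoc wt_Str)
 qed
 have 2: "stw M oo (?b oo ?y) oo ($[H, R] ** stw' M) = (BT oo act2) oo tE [R, M]"
 proof -
  have "stw M oo (?b oo ?y) oo ($[H, R] ** stw' M) = (stw M oo ?b) oo ?y oo ($[H, R] ** stw' M)"
   unfolding k by (simp add: scomp_assoc wt_Str)
  also have "... = BT oo (($[R] ** stw M) oo ?y oo ($[H, R] ** stw' M))"
   unfolding sb[symmetric] k by (simp add: scomp_assoc wt_Str)
  finally show ?thesis unfolding yd_act_conj by (simp add: scomp_assoc act2_props)
 qed
 note i = inverses_stw1[OF act_hom'(1)]
 have j: "inverses ($[H, R] ** stw' M) ($[H, R] ** stw M)"
  by (intro inverses_stens inverses_strand inverses_sym[OF i]) auto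
 have t: "inverses (tE [R, M]) (tE' [R, M])" by (rule inverses_tE) auto
 show ?thesis
 proof
  assume "AM oo ($[H] ** ?b) = ?b oo ?y"
  then have "(AM oo ($[H] ** BT)) oo tE [R, M] = (BT oo act2) oo tE [R, M]" unfolding 1[symmetric] 2[symmetric] by simp
  then show "AM oo ($[H] ** BT) = BT oo act2"
   using t by (elim inverses_cancel_right[rotated]) (auto simp: wt_Str act2_props)
 next
  assume "AM oo ($[H] ** BT) = BT oo act2"
  then have "stw M oo (AM oo ($[H] ** ?b)) oo ($[H, R] ** stw' M) = stw M oo (?b oo ?y) oo ($[H, R] ** stw' M)" unfolding 1 2 by simp
  then have "(AM oo ($[H] ** ?b)) oo ($[H, R] ** stw' M) = (?b oo ?y) oo ($[H, R] ** stw' M)"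
   using i by (elim inverses_cancel_left[rotated]) (auto simp: wt_Str k)
  then show "AM oo ($[H] ** ?b) = ?b oo ?y"
   using j by (elim inverses_cancel_right[rotated]) (auto simp: wt_Str k)
 qed
qed

lemma pairing2_eq: "pairing2 = AM oo ($[H] ** (sevr H oo (smul ** $[R]) oo (sant ** $[H, R])) ** $[M]) oo
  ($[H] ** tE' [H, R, M]) oo (scom ** $[H, R, M]) oo (ibr [H] [H] ** $[R, M]) oo
  (smul ** $[H, R, M]) oo ($[H] ** scom ** $[R, M])"
 unfolding pairing2_def Z2_def eq0_def by (simp add: scomp_assoc wt_Str)

end

subsection \<open>Linearity of the half braiding\<close>

definition cmap :: "'o \<times> 'a => ('o, 'a) strarr" where
 "cmap X = adj (evp (fst X) oo (sact X ** $[LD (fst X)]))"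

definition bend :: "'o => 'o \<times> 'a => ('o, 'a) strarr" where
 "bend M X = (cmap X ** $[M]) oo ($[fst X] ** br [M] [LD (fst X)])"

lemma sdom_cmap [simp]: "sdom (cmap X) = [fst X, LD (fst X)]" and scod_cmap [simp]: "scod (cmap X) = [R]"
 by (simp_all add: cmap_def adj_def evp_Str)

lemma sdom_bend [simp]: "sdom (bend M X) = [fst X, M, LD (fst X)]" and scod_bend [simp]: "scod (bend M X) = [R, M]"
 by (simp_all add: bend_def)

context
 fixes X :: "'o \<times> 'a"
 assumes X: "H_module (fst X) (snd X)"
begin

private abbreviation "x \<equiv> fst X"
private abbreviation "L \<equiv> LD x"
private abbreviation "SX \<equiv> sact X"

private lemma X_hom [simp]: "x \<in> Obj B" "snd X \<in> Hom B (H \<otimes> x) x"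
 using H_mod_obj[OF X] H_mod_act[OF X] by auto

private lemma X_mul: "SX oo (smul ** $[x]) = SX oo ($[H] ** SX)" and X_unit: "SX oo (sunt ** $[x]) = $[x]"
 using H_moduleD[OF X] by auto

lemma wt_cmap [simp]: "wt (cmap X)"
 by (simp add: cmap_def adj_def evp_Str wt_Str)

lemma wt_bend [simp]: "M \<in> Obj B ==> wt (bend M X)"
 by (simp add: bend_def)

lemma evr_cmap: "sevr H oo ($[H] ** cmap X) = evp x oo (SX ** $[L])"
proof -
 have w: "wt (evp x oo (SX ** $[L]))" "sdom (evp x oo (SX ** $[L])) = H # [x, L]" "scod (evp x oo (SX ** $[L])) = []"
  by (simp_all add: evp_Str wt_Str)
 obtain k where k: "evp x oo (SX ** $[L]) = Str (H # [x, L]) k []" "k \<in> Hom B (word (H # [x, L])) (word [])"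
  using wt_StrE[OF w] by auto
 have "(sevr H ** $[]) oo ($[H] ** cmap X) = evp x oo (SX ** $[L])"
  unfolding cmap_def k by (rule evr_adj) (use k in auto)
 then show ?thesis by (simp add: stens_unit_right wt_Str)
qed

private abbreviation "w \<equiv> evp x oo ((SX oo (sant ** $[x])) ** $[L])"

private lemma evp_ldual_act:
 "evp x oo ($[x] ** ldual_act x (snd X)) = w oo (stw' H ** $[x, L]) oo br [x, L] [H] oo ($[x] ** br [H] [L])"
proof -
 let ?v = "evp x oo ($[x] ** (((sevl x oo ($[L] ** SX)) ** $[L]) oo ($[L, H] ** scoevl x)))"
 have wv: "wt ?v" "sdom ?v = [x, L, H]" "scod ?v = []" by (simp_all add: evp_Str wt_Str)
 obtain v where v: "?v = Str [x, L, H] v []" and [simp]: "v \<in> Hom B (x \<otimes> L \<otimes> H) \<I>" using wt_StrE[OF wv] by auto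
 have F1: "?v oo ibr [H] [x, L] oo (stw H ** $[x, L]) = evp x oo (SX ** $[L])"
  by (rule stw_rotate_action) auto
 have n: "br [x, L] [H] oo ($[x, L] ** sant) = (sant ** $[x, L]) oo br [x, L] [H]"
  by (rule br_natural) (auto simp: wt_Str)
 have ns: "stw' H oo sant = sant oo stw' H"
  by (rule inverses_move[OF inverses_stw1 inverses_stw1]) (use stw_natural1[of H H "ant Ha"] in \<open>auto simp: wt_Str\<close>)
 have v': "?v = evp x oo (SX ** $[L]) oo (stw' H ** $[x, L]) oo br [x, L] [H]"
 proof -
  have "(?v oo ibr [H] [x, L] oo (stw H ** $[x, L])) oo (stw' H ** $[x, L]) oo br [x, L] [H] =
    ?v oo ibr [H] [x, L] oo ((stw H oo stw' H) ** $[x, L]) oo br [x, L] [H]"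
   unfolding v by (simp add: bdiag)
  also have "... = ?v oo (ibr [H] [x, L] oo br [x, L] [H])"
   unfolding stw_stw'[OF H_obj] by (simp add: strand_stens strand_scomp)
  also have "... = ?v" unfolding v using ibr_br[of "[H]" "[x, L]"] by (simp add: scomp_strand wt_Str)
  finally show ?thesis unfolding F1 by (simp add: scomp_assoc evp_Str wt_Str)
 qed
 have "evp x oo ($[x] ** ldual_act x (snd X)) = ?v oo ($[x, L] ** sant) oo ($[x] ** br [H] [L])"
  unfolding ldual_act_def evp_Str by (simp add: bdiag)
 also have "... = evp x oo (SX ** $[L]) oo (stw' H ** $[x, L]) oo (br [x, L] [H] oo ($[x, L] ** sant)) oo ($[x] ** br [H] [L])"
  unfolding v' by (simp add: scomp_assoc evp_Str wt_Str)
 also have "... = evp x oo (SX ** $[L]) oo ((stw' H oo sant) ** $[x, L]) oo br [x, L] [H] oo ($[x] ** br [H] [L])"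
  unfolding n evp_Str by (simp add: bdiag)
 also have "... = w oo (stw' H ** $[x, L]) oo br [x, L] [H] oo ($[x] ** br [H] [L])"
  unfolding ns evp_Str by (simp add: bdiag)
 finally show ?thesis .
qed

context
 fixes M :: 'o and a :: 'a
 assumes M: "H_module M a"
begin

private lemma M_hom [simp]: "M \<in> Obj B" "a \<in> Hom B (H \<otimes> M) M"
 using H_moduleD[OF M] by auto

private abbreviation "AY \<equiv> Str [H, M] a [M]"

private lemma bend_tens_act:
 "(evp x ** $[M]) oo ($[x] ** br [M] [L]) oo ($[x] ** tens_act M a L (ldual_act_arr x (snd X))) oo (br [H] [x] ** $[M, L]) =
  AY oo ($[H] ** ((w ** $[M]) oo tE' [x, L, M])) oo (scom ** $[x, L, M]) oo ($[H, x] ** br [M] [L])"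
proof -
 let ?l = "Str [H, L] (ldual_act_arr x (snd X)) [L]"
 note [simp] = dual_act_hom[OF X]
 define D where "D = br [M] [H] oo br [H] [M]"
 have wD: "wt D" "sdom D = [H, M]" "scod D = [H, M]" by (simp_all add: D_def)
 obtain d where d: "D = Str [H, M] d [H, M]" and [simp]: "d \<in> Hom B (H \<otimes> M) (H \<otimes> M)" using wt_StrE[OF wD] by auto
 let ?T = "(evp x ** $[M]) oo ($[x] ** br [M] [L]) oo ($[x, M] ** ?l) oo ($[x] ** br [H] [M] ** $[L]) oo (br [H] [x] ** $[M, L])"
 have n1: "br [M] [L] oo ($[M] ** ?l) = (?l ** $[M]) oo br [M] [H, L]"
  and n2: "br [H, M] [L] oo (D ** $[L]) = ($[L] ** D) oo br [H, M] [L]"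
  and n3: "br [M] [L] oo (AY ** $[L]) = ($[L] ** AY) oo br [H, M] [L]"
  and n4: "br [H] [] oo ($[H] ** evp x) = (evp x ** $[H]) oo br [H] [x, L]"
  and n5: "br [H, H] [x] oo (scom ** $[x]) = ($[x] ** scom) oo br [H] [x]"
  by (rule br_natural; simp add: wt_Str wD evp_Str)+
 have e: "evp x oo ($[x] ** ?l) = w oo (stw' H ** $[x, L]) oo br [x, L] [H] oo ($[x] ** br [H] [L])"
  using evp_ldual_act unfolding dual_act_Str .
 have T: "?T = (w ** $[M]) oo tE' [x, L, M] oo ($[H, x] ** br [M] [L])"
 proof -
  have "?T = (evp x ** $[M]) oo ($[x] ** (br [M] [L] oo ($[M] ** ?l))) oo ($[x] ** br [H] [M] ** $[L]) oo (br [H] [x] ** $[M, L])"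
   unfolding evp_Str by (simp add: bdiag)
  also have "... = ((evp x oo ($[x] ** ?l)) ** $[M]) oo ($[x, H] ** br [M] [L]) oo ($[x] ** D ** $[L]) oo (br [H] [x] ** $[M, L])"
   unfolding n1 D_def evp_Str by (simp add: bdiag)
  also have "... = (w ** $[M]) oo (stw' H ** $[x, L, M]) oo (br [x, L] [H] ** $[M]) oo
    ($[x] ** (br [H, M] [L] oo (D ** $[L]))) oo (br [H] [x] ** $[M, L])"
   unfolding e unfolding d evp_Str by (simp add: bdiag)
  also have "... = (w ** $[M]) oo ((stw' H ** $[x, L, M]) oo br [x, L, M] [H] oo br [H] [x, L, M]) oo ($[H, x] ** br [M] [L])"
   unfolding n2 unfolding D_def evp_Str by (simp add: bdiag)
  finally show ?thesis using tE_eq(2)[of "[x, L, M]"] by simp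
 qed
 have wT: "wt ?T" "sdom ?T = [H, x, M, L]" "scod ?T = [M]" by (simp_all add: wt_Str evp_Str)
 obtain t where t: "?T = Str [H, x, M, L] t [M]" and [simp]: "t \<in> Hom B (H \<otimes> x \<otimes> M \<otimes> L) M" using wt_StrE[OF wT] by auto
 have "(evp x ** $[M]) oo ($[x] ** br [M] [L]) oo ($[x] ** tens_act M a L (ldual_act_arr x (snd X))) oo (br [H] [x] ** $[M, L]) =
   (evp x ** $[M]) oo ($[x] ** br [M] [L]) oo ($[x] ** AY ** ?l) oo ($[x, H] ** br [H] [M] ** $[L]) oo
   ((($[x] ** scom) oo br [H] [x]) ** $[M, L])"
  unfolding tens_act_def evp_Str by (simp add: bdiag)
 also have "... = (evp x ** $[M]) oo ($[x] ** (br [M] [L] oo (AY ** $[L]))) oo (br [H] [x] ** $[M, L]) oo ($[H, x, M] ** ?l) oo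
   ($[H, x] ** br [H] [M] ** $[L]) oo ($[H] ** br [H] [x] ** $[M, L]) oo (scom ** $[x, M, L])"
  unfolding n5[symmetric] evp_Str by (simp add: bdiag)
 also have "... = AY oo (((evp x ** $[H]) oo br [H] [x, L]) ** $[M]) oo ($[H, x] ** br [M] [L]) oo ($[H, x, M] ** ?l) oo
   ($[H, x] ** br [H] [M] ** $[L]) oo ($[H] ** br [H] [x] ** $[M, L]) oo (scom ** $[x, M, L])"
  unfolding n3 evp_Str by (simp add: bdiag)
 also have "... = AY oo ($[H] ** ?T) oo (scom ** $[x, M, L])"
  unfolding n4[symmetric] unfolding evp_Str by (simp add: bdiag)
 also have "... = AY oo ($[H] ** ((w ** $[M]) oo tE' [x, L, M])) oo (scom ** $[x, L, M]) oo ($[H, x] ** br [M] [L])"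
  unfolding T unfolding evp_Str tE_Str by (simp add: bdiag)
 finally show ?thesis .
qed

lemma bend_act: "bend M X oo word_act [X, (M, a), H_ldual X] = act2 M a oo ($[H] ** bend M X)"
proof (rule evr_cancel_outer)
 let ?t = "tens_act M a L (ldual_act_arr x (snd X))"
 note Lm = H_module_ldual[OF X]
 obtain t where t: "?t = Str [H, M, L] t [M, L]" and [simp]: "t \<in> Hom B (H \<otimes> M \<otimes> L) (M \<otimes> L)"
  using tens_act_Str[OF M Lm] .
 have wa: "word_act [X, (M, a), H_ldual X] = (SX ** ?t) oo ($[H] ** br [H] [x] ** $[M, L]) oo (scom ** $[x, M, L])"
  unfolding word_act.simps(3)[of X] word_act_pair by (simp add: H_ldual_eq[OF X])
 obtain c where c: "cmap X = Str [x, L] c [R]" and [simp]: "c \<in> Hom B (x \<otimes> L) R"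
  using wt_StrE[OF wt_cmap sdom_cmap scod_cmap] by auto
 obtain r where r: "act2 M a = Str [H, R, M] r [R, M]" and [simp]: "r \<in> Hom B (H \<otimes> R \<otimes> M) (R \<otimes> M)"
  using wt_StrE[OF act2_props[OF M]] by auto
 let ?D = "(evp x ** $[M]) oo ($[x] ** br [M] [L])"
 have n: "br [H] [x] oo ($[H] ** SX) = (SX ** $[H]) oo br [H] [H, x]"
  by (rule br_natural) (auto simp: wt_Str)
 have n': "(SX ** $[H]) oo ($[H] ** br [H] [x]) = br [H] [x] oo ($[H] ** SX) oo (ibr [H] [H] ** $[x])"
 proof -
  have "br [H] [x] oo ($[H] ** SX) oo (ibr [H] [H] ** $[x]) = (br [H] [x] oo ($[H] ** SX)) oo (ibr [H] [H] ** $[x])"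
   by (simp add: bdiag)
  also have "... = (SX ** $[H]) oo ($[H] ** br [H] [x]) oo ((br [H] [H] oo ibr [H] [H]) ** $[x])"
   unfolding n by (simp add: bdiag)
  finally show ?thesis unfolding br_ibr[of "[H]" "[H]", simplified] by (simp add: bdiag)
 qed
 have l: "(sevr H ** $[M]) oo ($[H] ** (bend M X oo word_act [X, (M, a), H_ldual X])) =
  AY oo ($[H] ** ((w ** $[M]) oo tE' [x, L, M])) oo (scom ** $[x, L, M]) oo ($[H, x] ** br [M] [L]) oo
  ($[H] ** SX ** $[M, L]) oo (ibr [H] [H] ** $[x, M, L]) oo (smul ** $[H, x, M, L]) oo ($[H] ** scom ** $[x, M, L])"
 proof -
  have "(sevr H ** $[M]) oo ($[H] ** (bend M X oo word_act [X, (M, a), H_ldual X])) =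
    ((sevr H oo ($[H] ** cmap X)) ** $[M]) oo ($[H, x] ** br [M] [L]) oo
    ($[H] ** ((SX ** ?t) oo ($[H] ** br [H] [x] ** $[M, L]) oo (scom ** $[x, M, L])))"
   unfolding wa bend_def c t by (simp add: bdiag)
  also have "... = ?D oo ($[x] ** ?t) oo ((SX oo ($[H] ** SX)) ** $[H, M, L]) oo
    ($[H, H] ** br [H] [x] ** $[M, L]) oo ($[H] ** scom ** $[x, M, L])"
   unfolding evr_cmap evp_Str t by (simp add: bdiag)
  also have "... = ?D oo ($[x] ** ?t) oo (((SX ** $[H]) oo ($[H] ** br [H] [x])) ** $[M, L]) oo
    (smul ** $[H, x, M, L]) oo ($[H] ** scom ** $[x, M, L])"
   unfolding X_mul[symmetric] evp_Str t by (simp add: bdiag)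
  also have "... = ((evp x ** $[M]) oo ($[x] ** br [M] [L]) oo ($[x] ** ?t) oo (br [H] [x] ** $[M, L])) oo
    ($[H] ** SX ** $[M, L]) oo (ibr [H] [H] ** $[x, M, L]) oo
    (smul ** $[H, x, M, L]) oo ($[H] ** scom ** $[x, M, L])"
   unfolding n' evp_Str t by (simp add: bdiag)
  finally show ?thesis unfolding bend_tens_act by (simp add: scomp_assoc wt_Str evp_Str)
 qed
 have nE: "tE' [x, L, M] oo ($[H] ** (SX ** $[L, M])) = ($[H] ** (SX ** $[L, M])) oo tE' [H, x, L, M]"
  and nE': "tE' [H, R, M] oo ($[H] ** ($[H] ** cmap X ** $[M])) = ($[H] ** ($[H] ** cmap X ** $[M])) oo tE' [H, x, L, M]"
  by (rule tE_natural(2); simp add: wt_Str)+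
 have "(sevr H ** $[M]) oo ($[H] ** (act2 M a oo ($[H] ** bend M X))) = ((sevr H ** $[M]) oo ($[H] ** act2 M a)) oo ($[H, H] ** bend M X)"
  unfolding bend_def c r by (simp add: bdiag)
 also have "... = AY oo ($[H] ** (sevr H oo (smul ** $[R]) oo (sant ** $[H, R])) ** $[M]) oo
  ($[H] ** (tE' [H, R, M] oo ($[H] ** ($[H] ** cmap X ** $[M])))) oo (scom ** $[H, x, L, M]) oo (ibr [H] [H] ** $[x, L, M]) oo
  (smul ** $[H, x, L, M]) oo ($[H] ** scom ** $[x, L, M]) oo ($[H, H, x] ** br [M] [L])"
  unfolding evr_act2[OF M] pairing2_eq[OF M] bend_def c tE_Str by (simp add: bdiag)
 also have "... = AY oo ($[H] ** (sevr H oo ($[H] ** cmap X)) ** $[M]) oo ($[H] ** ((smul oo (sant ** $[H])) ** $[x, L, M])) oo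
  ($[H] ** tE' [H, x, L, M]) oo (scom ** $[H, x, L, M]) oo (ibr [H] [H] ** $[x, L, M]) oo
  (smul ** $[H, x, L, M]) oo ($[H] ** scom ** $[x, L, M]) oo ($[H, H, x] ** br [M] [L])"
  unfolding nE' unfolding c tE_Str by (simp add: bdiag)
 also have "... = AY oo ($[H] ** evp x ** $[M]) oo ($[H] ** ((SX oo (smul ** $[x])) oo (sant ** $[H, x])) ** $[L, M]) oo
  ($[H] ** tE' [H, x, L, M]) oo (scom ** $[H, x, L, M]) oo (ibr [H] [H] ** $[x, L, M]) oo
  (smul ** $[H, x, L, M]) oo ($[H] ** scom ** $[x, L, M]) oo ($[H, H, x] ** br [M] [L])"
  unfolding evr_cmap evp_Str tE_Str by (simp add: bdiag)
 also have "... = AY oo ($[H] ** (w ** $[M])) oo ($[H] ** (($[H] ** (SX ** $[L, M])) oo tE' [H, x, L, M])) oo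
  (scom ** $[H, x, L, M]) oo (ibr [H] [H] ** $[x, L, M]) oo
  (smul ** $[H, x, L, M]) oo ($[H] ** scom ** $[x, L, M]) oo ($[H, H, x] ** br [M] [L])"
  unfolding X_mul evp_Str tE_Str by (simp add: bdiag)
 also have "... = AY oo ($[H] ** ((w ** $[M]) oo tE' [x, L, M])) oo (scom ** $[x, L, M]) oo ($[H, x] ** br [M] [L]) oo
  ($[H] ** SX ** $[M, L]) oo (ibr [H] [H] ** $[x, M, L]) oo (smul ** $[H, x, M, L]) oo ($[H] ** scom ** $[x, M, L])"
  unfolding nE[symmetric] unfolding evp_Str tE_Str by (simp add: bdiag)
 finally show "(sevr H ** $[M]) oo ($[H] ** (bend M X oo word_act [X, (M, a), H_ldual X])) =
   (sevr H ** $[M]) oo ($[H] ** (act2 M a oo ($[H] ** bend M X)))"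
  unfolding l ..
 show "wt (bend M X oo word_act [X, (M, a), H_ldual X])"
  using X M H_ldual_module[OF X] by (intro wt_scomp wt_word_act) auto
qed (use act2_props[OF M] X in \<open>auto simp: bend_def\<close>)

lemma pass_left_bend:
 assumes [simp]: "b \<in> Hom B (R \<otimes> M) M"
 shows "($[M] ** sevl (LD x)) oo (Str [x, M] (pass_left M (coact M b) X) [M, lsh x] ** $[L]) = Str [R, M] (twisted M b) [M] oo bend M X"
proof -
 let ?C = "Str [M] (coact M b) [M, H]" and ?B = "Str [R, M] (twisted M b) [M]"
 obtain c where c: "cmap X = Str [x, L] c [R]" and [simp]: "c \<in> Hom B (x \<otimes> L) R"
  using wt_StrE[OF wt_cmap sdom_cmap scod_cmap] by auto
 have n: "br [M] [R] oo ($[M] ** cmap X) = (cmap X ** $[M]) oo br [M] [x, L]"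
  by (rule br_natural) auto
 have "?B oo bend M X = ?B oo (cmap X ** $[M]) oo ($[x] ** br [M] [L]) oo ((br [M] [x] oo ibr [x] [M]) ** $[L])"
  unfolding bend_def br_ibr[of "[x]" "[M]", simplified] c by (simp add: bdiag)
 also have "... = ?B oo ((cmap X ** $[M]) oo br [M] [x, L]) oo (ibr [x] [M] ** $[L])"
  unfolding c by (simp add: bdiag)
 also have "... = (?B oo br [M] [R]) oo ($[M] ** cmap X) oo (ibr [x] [M] ** $[L])"
  unfolding n[symmetric] unfolding c by (simp add: bdiag)
 also have "... = ($[M] ** (sevr H oo ($[H] ** cmap X))) oo (?C ** $[x, L]) oo (ibr [x] [M] ** $[L])"
  unfolding coact_eq[OF M_hom(1) assms, symmetric] c by (simp add: bdiag)
 also have "... = ($[M] ** evp x) oo (pass M (coact M b) X ** $[L])"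
  unfolding evr_cmap pass_def evp_Str by (simp add: bdiag)
 also have "... = ($[M] ** sevl (LD x)) oo ((($[M] ** spivot \<rho> x) oo pass M (coact M b) X) ** $[L])"
  unfolding pass_def evp_def by (simp add: bdiag lsh_def)
 finally show ?thesis unfolding pass_left_Str ..
qed

end

end

lemma bend_reg_split:
 assumes [simp]: "M \<in> Obj B"
 obtains s where "wt s" "sdom s = [R, M]" "scod s = [H, M, LD H]" "bend M reg oo s = $[R, M]"
proof
 let ?j = "($[LD H] ** sevr H) oo (coevp H ** $[R])"
 have wc [simp]: "wt (coevp H)" "sdom (coevp H) = []" "scod (coevp H) = [LD H, H]"
  using dual_pair_evp[OF H_obj] by (auto simp: dual_pair_def)
 obtain k where k: "coevp H = Str [] k [LD H, H]" and [simp]: "k \<in> Hom B \<I> (LD H \<otimes> H)" using wt_StrE[OF wc] by auto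
 let ?s = "(sunt ** ibr [LD H] [M]) oo (?j ** $[M])"
 show "wt ?s" "sdom ?s = [R, M]" "scod ?s = [H, M, LD H]" by (simp_all add: wt_Str)
 obtain c where c: "cmap reg = Str [H, LD H] c [R]" and [simp]: "c \<in> Hom B (H \<otimes> LD H) R"
  using wt_StrE[OF wt_cmap[OF reg_module] sdom_cmap scod_cmap] by auto
 have z: "(evp H ** $[H]) oo ($[H] ** coevp H) = $[H]"
  using dual_pair_evp[OF H_obj] by (simp add: dual_pair_def)
 have "cmap reg oo (sunt ** ?j) = $[R]"
 proof (rule evr_cancel_right)
  have "sevr H oo ($[H] ** (cmap reg oo (sunt ** ?j))) = (sevr H oo ($[H] ** cmap reg)) oo ($[H] ** sunt ** ?j)"
   unfolding c k by (simp add: bdiag)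
  also have "... = evp H oo ((smul oo ($[H] ** sunt)) ** ?j)"
   unfolding evr_cmap[OF reg_module] k evp_Str by (simp add: bdiag)
  also have "... = sevr H oo (((evp H ** $[H]) oo ($[H] ** coevp H)) ** $[R])"
   unfolding mul_unit_right k evp_Str by (simp add: bdiag)
  finally show "sevr H oo ($[H] ** (cmap reg oo (sunt ** ?j))) = sevr H oo ($[H] ** $[R])"
   unfolding z .
 qed (auto simp: wt_Str wt_cmap[OF reg_module])
 then have e: "cmap reg oo (sunt ** ?j) = $[R]" .
 have "bend M reg oo ?s = (cmap reg ** $[M]) oo (sunt ** (br [M] [LD H] oo ibr [LD H] [M])) oo (?j ** $[M])"
  unfolding bend_def c k by (simp add: bdiag)
 also have "... = (cmap reg oo (sunt ** ?j)) ** $[M]"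
  unfolding br_ibr[of "[LD H]" "[M]", simplified] unfolding c k by (simp add: bdiag)
 finally show "bend M reg oo ?s = $[R, M]" unfolding e by (simp add: strand_stens)
qed

lemma aYD_iff_linear:
 assumes M: "H_module M a" and b: "b \<in> Hom B (R \<otimes> M) M"
 shows "Str [H, M] a [M] oo ($[H] ** Str [R, M] b [M]) = Str [R, M] b [M] oo yd_act (twist_E (anti_twist \<rho>)) M a \<longleftrightarrow>
  (\<forall>X. H_module (fst X) (snd X) -->
   pass_left M (coact M b) X \<in> H_hom (H_tens X (M, a)) (H_tens (M, a) (rigid_data.lsh H_mod X)))" (is "?aYD \<longleftrightarrow> ?lin")
proof -
 note [simp] = H_moduleD(1,2)[OF M] b
 let ?A = "Str [H, M] a [M]" and ?B = "Str [R, M] (twisted M b) [M]"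
 have wB [simp]: "wt ?B" by (simp add: wt_Str)
 have lin: "pass_left M (coact M b) X \<in> H_hom (H_tens X (M, a)) (H_tens (M, a) (rigid_data.lsh H_mod X)) \<longleftrightarrow>
   (?B oo act2 M a) oo ($[H] ** bend M X) = (?A oo ($[H] ** ?B)) oo ($[H] ** bend M X)"
  if X: "H_module (fst X) (snd X)" for X
 proof -
  note wb [simp] = wt_bend[OF X, of M]
  have "wt ($[M] ** spivot \<rho> (fst X) )" using H_mod_obj[OF X] by (simp add: wt_Str)
  moreover have "wt (pass M (coact M b) X)"
   using H_mod_obj[OF X] H_mod_act[OF X] by (simp add: pass_def wt_Str)
  ultimately have "wt (Str [fst X, M] (pass_left M (coact M b) X) [M, lsh (fst X)])"
   unfolding pass_left_Str by simp
  then have h: "pass_left M (coact M b) X \<in> Hom B (fst X \<otimes> fst (M, a)) (fst (M, a) \<otimes> lsh (fst X))" by (simp add: wt_Str)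
  have s: "($[H] ** ?B) oo ($[H] ** bend M X) = $[H] ** (?B oo bend M X)"
   using stens_scomp[of "$[H]" "$[H]" ?B "bend M X"] by (simp add: strand_scomp)
  have w: "wt (word_act [X, (M, a), H_ldual X])" using X M H_ldual_module[OF X] by (intro wt_word_act) auto
  have "pass_left M (coact M b) X \<in> H_hom (H_tens X (M, a)) (H_tens (M, a) (rigid_data.lsh H_mod X)) \<longleftrightarrow>
    (?B oo bend M X) oo word_act [X, (M, a), H_ldual X] = ?A oo ($[H] ** (?B oo bend M X))"
   using H_hom_bend_iff[OF X _ h] M pass_left_bend[OF X M b] by simp
  also have "(?B oo bend M X) oo word_act [X, (M, a), H_ldual X] = ?B oo (bend M X oo word_act [X, (M, a), H_ldual X])"
   using w by (simp add: scomp_assoc)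
  also have "... = (?B oo act2 M a) oo ($[H] ** bend M X)"
   unfolding bend_act[OF X M] by (simp add: scomp_assoc act2_props[OF M])
  also have "?A oo ($[H] ** (?B oo bend M X)) = (?A oo ($[H] ** ?B)) oo ($[H] ** bend M X)"
   unfolding s[symmetric] by (simp add: scomp_assoc wt_Str)
  finally show ?thesis .
 qed
 show ?thesis unfolding aYD_iff_twisted[OF M b]
 proof
  assume "?A oo ($[H] ** ?B) = ?B oo act2 M a"
  then show ?lin using lin by simp
 next
  assume ?lin
  then have e: "(?B oo act2 M a) oo ($[H] ** bend M reg) = (?A oo ($[H] ** ?B)) oo ($[H] ** bend M reg)"
   using lin[OF reg_module] reg_module by blast
  obtain s where s: "wt s" "sdom s = [R, M]" "scod s = [H, M, LD H]" "bend M reg oo s = $[R, M]"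
   using bend_reg_split[of M] by auto
  note [simp] = s(1-3) wt_bend[OF reg_module]
  have "($[H] ** bend M reg) oo ($[H] ** s) = $[H, R, M]"
   using stens_scomp[of "$[H]" "$[H]" "bend M reg" s] s(4) by (simp add: strand_scomp strand_stens)
  then have c: "(y oo ($[H] ** bend M reg)) oo ($[H] ** s) = y" if "wt y" "sdom y = [H, R, M]" for y
   using that by (simp add: scomp_assoc scomp_strand)
  have "?B oo act2 M a = ((?B oo act2 M a) oo ($[H] ** bend M reg)) oo ($[H] ** s)"
   by (rule c[symmetric]) (use act2_props[OF M] in auto)
  also have "... = ?A oo ($[H] ** ?B)"
   unfolding e by (rule c) (auto simp: wt_Str)
  finally show "?A oo ($[H] ** ?B) = ?B oo act2 M a" ..
 qed
qed

end

section \<open>The equivalence\<close>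

lemma linear_equivalence_of_relation:
 fixes C :: "('k, 'o, 'a, 'y) lincat_scheme" and D :: "('k, 'p, 'a, 'z) lincat_scheme"
 assumes left: "\<And>P. P \<in> Obj C ==> \<exists>Q. Rel P Q" and right: "\<And>Q. Q \<in> Obj D ==> \<exists>P. Rel P Q"
  and obj: "\<And>P Q. Rel P Q ==> P \<in> Obj C \<and> Q \<in> Obj D"
  and hom: "\<And>P Q P' Q'. [|Rel P Q; Rel P' Q'|] ==> Hom C P P' = Hom D Q Q'"
  and idm: "\<And>P Q. Rel P Q ==> idm C P = idm D Q"
  and ops: "comp C = comp D" "adda C = adda D" "scal C = scal D"
  and id_hom: "\<And>P. P \<in> Obj C ==> idm C P \<in> Hom C P P"
  and id_comp: "\<And>P P' f. [|P \<in> Obj C; P' \<in> Obj C; f \<in> Hom C P P'|] ==> comp C (idm C P') f = f \<and> comp C f (idm C P) = f"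
 obtains Fo where "linear_equivalence C D Fo (\<lambda>X Y f. f)" "\<And>P. P \<in> Obj C ==> Rel P (Fo P)"
proof -
 define Fo where "Fo P = (SOME Q. Rel P Q)" for P
 define Go where "Go Q = (SOME P. Rel P Q)" for Q
 have F: "Rel P (Fo P)" if "P \<in> Obj C" for P
  unfolding Fo_def using left[OF that] by (rule someI_ex)
 have G: "Rel (Go Q) Q" if "Q \<in> Obj D" for Q
  unfolding Go_def using right[OF that] by (rule someI_ex)
 have Fobj: "Fo P \<in> Obj D" if "P \<in> Obj C" for P using F[OF that] obj by blast
 have Gobj: "Go Q \<in> Obj C" if "Q \<in> Obj D" for Q using G[OF that] obj by blast
 have FG: "Rel (Go (Fo P)) (Fo P)" if "P \<in> Obj C" for P by (rule G[OF Fobj[OF that]])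
 have GF: "Rel (Go Q) (Fo (Go Q))" if "Q \<in> Obj D" for Q by (rule F[OF Gobj[OF that]])
 have lF: "linear_functor C D Fo (\<lambda>X Y f. f)"
  unfolding linear_functor_def using Fobj hom[OF F F] idm[OF F] by (simp add: ops)
 have lG: "linear_functor D C Go (\<lambda>X Y f. f)"
  unfolding linear_functor_def using Gobj hom[OF G G] idm[OF G] by (simp add: ops)
 have idD: "idm D Q \<in> Hom D Q Q" if "Q \<in> Obj D" for Q
  using id_hom[OF Gobj[OF that]] idm[OF G[OF that]] hom[OF G[OF that] G[OF that]] by simp
 have compD: "comp D (idm D Q') f = f \<and> comp D f (idm D Q) = f" if "Q \<in> Obj D" "Q' \<in> Obj D" "f \<in> Hom D Q Q'" for Q Q' f
  using id_comp[OF Gobj[OF that(1)] Gobj[OF that(2)], of f] that idm[OF G[OF that(1)]] idm[OF G[OF that(2)]]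
   hom[OF G[OF that(1)] G[OF that(2)]] ops by simp
 have "natural_iso C C (\<lambda>X. X) (\<lambda>X Y f. f) (\<lambda>X. Go (Fo X)) (\<lambda>X Y f. f) (idm C)"
  unfolding natural_iso_def
 proof (intro conjI ballI)
  fix P assume P: "P \<in> Obj C"
  have "idm C (Go (Fo P)) = idm C P" using idm[OF FG[OF P]] idm[OF F[OF P]] by simp
  moreover have "Hom C P (Go (Fo P)) = Hom C P P" "Hom C (Go (Fo P)) P = Hom C P P"
   using hom[OF F[OF P] FG[OF P]] hom[OF FG[OF P] F[OF P]] hom[OF F[OF P] F[OF P]] by simp_all
  moreover have "comp C (idm C P) (idm C P) = idm C P" using id_comp[OF P P id_hom[OF P]] by simp
  ultimately show "is_iso C P (Go (Fo P)) (idm C P)"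
   unfolding is_iso_def arr_inverse_def using id_hom[OF P] by auto
 next
  fix X Y f assume "X \<in> Obj C" "Y \<in> Obj C" "f \<in> Hom C X Y"
  then show "comp C (idm C Y) f = comp C f (idm C X)" using id_comp by simp
 qed
 moreover have "natural_iso D D (\<lambda>X. Fo (Go X)) (\<lambda>X Y f. f) (\<lambda>X. X) (\<lambda>X Y f. f) (idm D)"
  unfolding natural_iso_def
 proof (intro conjI ballI)
  fix Q assume Q: "Q \<in> Obj D"
  have "idm D (Fo (Go Q)) = idm D Q" using idm[OF GF[OF Q]] idm[OF G[OF Q]] by simp
  moreover have "Hom D Q (Fo (Go Q)) = Hom D Q Q" "Hom D (Fo (Go Q)) Q = Hom D Q Q"
   using hom[OF G[OF Q] GF[OF Q]] hom[OF GF[OF Q] G[OF Q]] hom[OF G[OF Q] G[OF Q]] by simp_all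
  moreover have "comp D (idm D Q) (idm D Q) = idm D Q" using compD[OF Q Q idD[OF Q]] by simp
  ultimately show "is_iso D (Fo (Go Q)) Q (idm D Q)"
   unfolding is_iso_def arr_inverse_def using idD[OF Q] by auto
 next
  fix X Y f assume "X \<in> Obj D" "Y \<in> Obj D" "f \<in> Hom D X Y"
  then show "comp D (idm D Y) f = comp D f (idm D X)" using compD by simp
 qed
 ultimately have "linear_equivalence C D Fo (\<lambda>X Y f. f)"
  unfolding linear_equivalence_def using lF lG by blast
 then show ?thesis using F by (rule that)
qed

context pivotal_hopf_algebra
begin

interpretation HM: rigid_category H_mod by (rule rigid_category_H_mod)

declare split_paired_All [simp del]

abbreviation "AYD \<equiv> aYD (anti_twist \<rho>)"
abbreviation "HHR \<equiv> HH_rho \<rho>"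

lemma aYD_Obj_iff: "(M, a, b) \<in> Obj AYD \<longleftrightarrow> H_module M a \<and> Hd_module M b \<and>
  Str [H, M] a [M] oo ($[H] ** Str [R, M] b [M]) = Str [R, M] b [M] oo yd_act (twist_E (anti_twist \<rho>)) M a"
 by (simp add: aYD_def)

lemma HH_rho_Obj_iff: "((M, a), t) \<in> Obj HHR \<longleftrightarrow> H_module M a \<and> HM.half_braiding (M, a) t \<and>
  (\<forall>X \<in> Obj B. HM.half_left (M, a) t (H_triv X) = (idm B M \<star> \<rho> X) \<cdot> ibraid X M)"
 by (simp add: HH_rho_def full_subcat_def HM.HH_def)

definition corresponds :: "'o \<times> 'a \<times> 'a => ('o \<times> 'a) \<times> ('o \<times> 'a => 'a) => bool" where
 "corresponds = (\<lambda>(M, a, b) (V, t). V = (M, a) \<and> (M, a, b) \<in> Obj AYD \<and> (V, t) \<in> Obj HHR \<and>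
   (\<forall>X. H_module (fst X) (snd X) --> HM.half_left V t X = pass_left M (coact M b) X))"

lemma corresponds_iff: "corresponds (M, a, b) ((M', a'), t) \<longleftrightarrow> M' = M \<and> a' = a \<and> (M, a, b) \<in> Obj AYD \<and> ((M, a), t) \<in> Obj HHR \<and>
  (\<forall>X. H_module (fst X) (snd X) --> HM.half_left (M, a) t X = pass_left M (coact M b) X)"
 by (auto simp: corresponds_def)

lemma Hd_moduleD: "Hd_module M b ==> M \<in> Obj B" "Hd_module M b ==> b \<in> Hom B (R \<otimes> M) M"
 unfolding is_module_def by blast+

lemma corresponds_left:
 assumes "P \<in> Obj AYD"
 shows "\<exists>Q. corresponds P Q"
proof -
 obtain M a b where P: "P = (M, a, b)" by (cases P) auto
 have m: "H_module M a" and h: "Hd_module M b" and y: "Str [H, M] a [M] oo ($[H] ** Str [R, M] b [M]) = Str [R, M] b [M] oo yd_act (twist_E (anti_twist \<rho>)) M a"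
  using assms unfolding P aYD_Obj_iff by blast+
 note [simp] = Hd_moduleD[OF h]
 have c: "coaction M (coact M b)" using Hd_module_iff[of M b] h by simp
 have "HM_left_half_braiding (M, a) (pass_left M (coact M b))"
  using aYD_iff_linear[OF m Hd_moduleD(2)[OF h], THEN iffD1, OF y] by (intro HM_left_half_braiding_pass_left[OF c m]) blast
 then obtain t where t: "HM.half_braiding (M, a) t" "\<forall>X \<in> Obj H_mod. HM.half_left (M, a) t X = pass_left M (coact M b) X"
  using HM.half_braiding_of_left[of "(M, a)"] m by auto
 have "HM.half_left (M, a) t (H_triv X) = (idm B M \<star> \<rho> X) \<cdot> ibraid X M" if X [simp]: "X \<in> Obj B" for X
 proof -
  have "HM.half_left (M, a) t (H_triv X) = pass_left M (coact M b) (H_triv X)" using t(2) H_module_triv[OF X] by simp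
  also have "... = (idm B M \<star> \<rho> X) \<cdot> ibraid X M"
   unfolding pass_left_def pass_triv[OF c X] by (simp add: br_single stens_strand1 scomp_def)
  finally show ?thesis .
 qed
 then have "((M, a), t) \<in> Obj HHR" unfolding HH_rho_Obj_iff using m t by blast
 then have "corresponds P ((M, a), t)" using assms t(2) unfolding corresponds_def P by simp
 then show ?thesis by blast
qed

lemma corresponds_right:
 assumes "Q \<in> Obj HHR"
 shows "\<exists>P. corresponds P Q"
proof -
 obtain M a t where Q: "Q = ((M, a), t)" by (cases Q) auto
 have m: "H_module M a" and t: "HM.half_braiding (M, a) t"
  and r: "\<And>X. X \<in> Obj B ==> HM.half_left (M, a) t (H_triv X) = (idm B M \<star> \<rho> X) \<cdot> ibraid X M"
  using assms unfolding Q HH_rho_Obj_iff by blast+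
 have l: "HM_left_half_braiding (M, a) (HM.half_left (M, a) t)"
  using HM.left_half_braiding_half_left[OF t] m by simp
 from coaction_of_half_braiding[OF m l r] obtain c where c: "coaction M c"
  and p: "\<And>X. H_module (fst X) (snd X) ==> HM.half_left (M, a) t X = pass_left M c X" by blast
 have [simp]: "M \<in> Obj B" "c \<in> Hom B M (M \<otimes> H)" using c unfolding coaction_def by blast+
 define b where "b = act M c"
 have b: "b \<in> Hom B (R \<otimes> M) M" "coact M b = c" unfolding b_def by (simp_all add: act_hom coact_act)
 have "Hd_module M b" using Hd_module_iff[of M b] b c by simp
 moreover have "Str [H, M] a [M] oo ($[H] ** Str [R, M] b [M]) = Str [R, M] b [M] oo yd_act (twist_E (anti_twist \<rho>)) M a"
  unfolding aYD_iff_linear[OF m b(1)] b(2)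
 proof (intro allI impI)
  fix X assume X: "H_module (fst X) (snd X)"
  then have "HM.half_left (M, a) t X \<in> H_hom (H_tens X (M, a)) (H_tens (M, a) (HM.lsh X))"
   using l[unfolded HM_left_half_braiding_iff[OF m]] by blast
  then show "pass_left M c X \<in> H_hom (H_tens X (M, a)) (H_tens (M, a) (HM.lsh X))" using p[OF X] by simp
 qed
 ultimately have "(M, a, b) \<in> Obj AYD" unfolding aYD_Obj_iff using m by blast
 then have "corresponds (M, a, b) Q" using assms p b(2) unfolding corresponds_def Q by simp
 then show ?thesis by blast
qed

lemma corresponds_Hom:
 assumes P: "corresponds P Q" and P': "corresponds P' Q'"
 shows "Hom AYD P P' = Hom HHR Q Q'"
proof -
 obtain M a b where Pe: "P = (M, a, b)" by (cases P) auto
 obtain N d e where Pe': "P' = (N, d, e)" by (cases P') auto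
 from P Pe obtain t where Qe: "Q = ((M, a), t)" unfolding corresponds_def by (cases Q) auto
 from P' Pe' obtain s where Qe': "Q' = ((N, d), s)" unfolding corresponds_def by (cases Q') auto
 have m: "H_module M a" "H_module N d" and h: "Hd_module M b" "Hd_module N e"
  using P P' unfolding Pe Pe' Qe Qe' corresponds_iff aYD_Obj_iff by blast+
 have t: "HM.half_braiding (M, a) t" "HM.half_braiding (N, d) s"
  using P P' unfolding Pe Pe' Qe Qe' corresponds_iff HH_rho_Obj_iff by blast+
 have p: "HM.half_left (M, a) t X = pass_left M (coact M b) X" "HM.half_left (N, d) s X = pass_left N (coact N e) X" if "H_module (fst X) (snd X)" for X
  using P P' that unfolding Pe Pe' Qe Qe' corresponds_iff by blast+
 note [simp] = Hd_moduleD[OF h(1)] Hd_moduleD[OF h(2)] m[THEN H_moduleD(2)]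
 have c: "coaction M (coact M b)" "coaction N (coact N e)"
  using Hd_module_iff[of M b] Hd_module_iff[of N e] h by simp_all
 have "f \<in> Hom AYD P P' \<longleftrightarrow> f \<in> Hom HHR Q Q'" for f
 proof (cases "f \<in> H_hom (M, a) (N, d)")
  case False
  then show ?thesis unfolding Pe Pe' Qe Qe'
   by (auto simp: aYD_def H_hom_def HH_rho_def full_subcat_def HM.HH_def)
 next
  case f: True
  then have [simp]: "f \<in> Hom B M N" and lin: "f \<cdot> a = d \<cdot> (idm B H \<star> f)" by (auto simp: H_hom_def)
  have "f \<in> Hom AYD P P' \<longleftrightarrow> Str [M] f [N] oo Str [R, M] b [M] = Str [R, N] e [N] oo ($[R] ** Str [M] f [N])"
   unfolding Pe Pe' using lin by (simp add: aYD_def stens_strand1 scomp_def)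
  also have "... \<longleftrightarrow> (\<forall>X. H_module (fst X) (snd X) -->
   (Str [M] f [N] ** $[lsh (fst X)]) oo Str [fst X, M] (pass_left M (coact M b) X) [M, lsh (fst X)] =
   Str [fst X, N] (pass_left N (coact N e) X) [N, lsh (fst X)] oo ($[fst X] ** Str [M] f [N]))"
   using coact_morphism_iff[of M N b e f] pass_left_morphism_iff[OF c, of f] by simp
  also have "... \<longleftrightarrow> (\<forall>X. H_module (fst X) (snd X) -->
   HM.scomp (HM.stens (Str [(M, a)] f [(N, d)]) (HM.strand [HM.lsh X])) (Str [X, (M, a)] (HM.half_left (M, a) t X) [(M, a), HM.lsh X]) =
   HM.scomp (Str [X, (N, d)] (HM.half_left (N, d) s X) [(N, d), HM.lsh X]) (HM.stens (HM.strand [X]) (Str [(M, a)] f [(N, d)])))"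
  proof -
   have "(Str [M] f [N] ** $[lsh (fst X)]) oo Str [fst X, M] (pass_left M (coact M b) X) [M, lsh (fst X)] =
    Str [fst X, N] (pass_left N (coact N e) X) [N, lsh (fst X)] oo ($[fst X] ** Str [M] f [N]) \<longleftrightarrow>
    HM.scomp (HM.stens (Str [(M, a)] f [(N, d)]) (HM.strand [HM.lsh X])) (Str [X, (M, a)] (HM.half_left (M, a) t X) [(M, a), HM.lsh X]) =
    HM.scomp (Str [X, (N, d)] (HM.half_left (N, d) s X) [(N, d), HM.lsh X]) (HM.stens (HM.strand [X]) (Str [(M, a)] f [(N, d)]))"
    if X: "H_module (fst X) (snd X)" for X
   proof -
    have "HM.wt (Str [(M, a)] f [(N, d)])" "HM.wt (HM.strand [HM.lsh X])" "HM.wt (HM.strand [X])"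
     using f m X HM_lsh_module[OF X] by (simp_all add: HM.wt_Str)
    then show ?thesis using p[OF X] by (subst forget_eq_iff) (simp_all add: forget_stens)
   qed
   then show ?thesis by blast
  qed
  also have "... \<longleftrightarrow> f \<in> Hom HHR Q Q'"
   using HM.half_braiding_morphism_iff[OF t, of f] f m unfolding Qe Qe' Ball_def H_mod_simps(1)
   by (simp add: HH_rho_def full_subcat_def HM.HH_def Ball_def del: split_paired_All)
  finally show ?thesis .
 qed
 then show ?thesis by blast
qed

lemma stw_eq_br:
 assumes [simp]: "M \<in> Obj B"
 shows "stw M = (evp M ** $[M]) oo ($[M] ** br [M] [LD M]) oo ($[M] ** scoevl M)"
proof -
 have n: "br [M] [] oo ($[M] ** evp M) = (evp M ** $[M]) oo br [M] [M, LD M]"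
  by (rule br_natural) (auto simp: wt_Str evp_Str)
 have "stw M = (br [M] [] oo ($[M] ** evp M)) oo (ibr [M] [M] ** $[LD M]) oo ($[M] ** scoevl M)"
  unfolding stw_eq[OF assms] evp_Str by (simp add: bdiag)
 also have "... = (evp M ** $[M]) oo ($[M] ** br [M] [LD M]) oo ((br [M] [M] oo ibr [M] [M]) ** $[LD M]) oo ($[M] ** scoevl M)"
  unfolding n unfolding evp_Str by (simp add: bdiag)
 finally show ?thesis unfolding br_ibr[of "[M]" "[M]", simplified] unfolding evp_Str by (simp add: bdiag)
qed

lemma aut_eq:
 assumes M: "H_module M a" and b [simp]: "b \<in> Hom B (R \<otimes> M) M"
 shows "(Str [R, M] (twisted M b) [M] oo bend M (M, a)) oo ($[M] ** scoevl M) =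
  Str [R, M] b [M] oo ($[R] ** Str [H, M] a [M]) oo (scoevr H ** $[M]) oo stw M"
proof -
 note [simp] = H_moduleD(1,2)[OF M]
 let ?A = "Str [H, M] a [M]" and ?b = "Str [R, M] b [M]" and ?B = "Str [R, M] (twisted M b) [M]"
 have M': "H_module (fst (M, a)) (snd (M, a))" using M by simp
 obtain c where c: "cmap (M, a) = Str [M, LD M] c [R]" and [simp]: "c \<in> Hom B (M \<otimes> LD M) R"
  using wt_StrE[OF wt_cmap[OF M'] sdom_cmap scod_cmap] by auto
 have e: "bend M (M, a) oo ($[M] ** scoevl M) = ($[R] ** (stw M oo ?A)) oo (scoevr H ** $[M])"
 proof (rule evr_cancel_outer)
  have "(sevr H ** $[M]) oo ($[H] ** (bend M (M, a) oo ($[M] ** scoevl M))) =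
    ((sevr H oo ($[H] ** cmap (M, a))) ** $[M]) oo ($[H, M] ** br [M] [LD M]) oo ($[H, M] ** scoevl M)"
   unfolding bend_def c by (simp add: bdiag)
  also have "... = ((evp M ** $[M]) oo ($[M] ** br [M] [LD M]) oo ($[M] ** scoevl M)) oo ?A"
   unfolding evr_cmap[OF M'] evp_Str by (simp add: bdiag)
  also have "... = stw M oo ?A" unfolding stw_eq_br[OF H_moduleD(1)[OF M], symmetric] ..
  also have "... = stw M oo ?A oo (((sevr H ** $[H]) oo ($[H] ** scoevr H)) ** $[M])"
   unfolding rdual_zigzag[OF H_obj] by (simp add: bdiag)
  also have "... = (sevr H ** $[M]) oo ($[H] ** (($[R] ** (stw M oo ?A)) oo (scoevr H ** $[M])))"
   by (simp add: bdiag)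
  finally show "(sevr H ** $[M]) oo ($[H] ** (bend M (M, a) oo ($[M] ** scoevl M))) = ..." .
 qed (auto simp: wt_Str wt_bend[OF M', simplified])
 have sb: "?B oo ($[R] ** stw M) = stw M oo ?b"
 proof -
  have "?B oo ($[R] ** stw M) = stw M oo ?b oo ($[R] ** (stw' M oo stw M))"
   unfolding twisted_Str by (simp add: bdiag)
  then show ?thesis unfolding stw_stw'[OF H_moduleD(1)[OF M]] by (simp add: strand_stens scomp_strand wt_Str)
 qed
 let ?f = "?b oo ($[R] ** ?A) oo (scoevr H ** $[M])"
 have "(?B oo bend M (M, a)) oo ($[M] ** scoevl M) = ?B oo (bend M (M, a) oo ($[M] ** scoevl M))"
  by (simp add: scomp_assoc wt_Str wt_bend[OF M', simplified])
 also have "... = (?B oo ($[R] ** stw M)) oo ($[R] ** ?A) oo (scoevr H ** $[M])"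
  unfolding e by (simp add: bdiag)
 also have "... = swd [M] oo ?f" unfolding sb swd_single by (simp add: scomp_assoc wt_Str)
 also have "... = ?f oo swd [M]" by (rule swd_natural) (auto simp: wt_Str)
 finally show ?thesis unfolding swd_single by (simp add: scomp_assoc wt_Str)
qed

lemma corresponds_aut:
 assumes P: "corresponds P Q"
 shows "aYD_aut (anti_twist \<rho>) P = HM.HH_aut Q" "aYD_aut (anti_twist \<rho>) P \<in> Hom AYD P P"
proof -
 obtain M a b where Pe: "P = (M, a, b)" by (cases P) auto
 from P Pe obtain t where Qe: "Q = ((M, a), t)" unfolding corresponds_def by (cases Q) auto
 let ?V = "(M, a)"
 have m: "H_module M a" and h: "Hd_module M b" using P unfolding Pe Qe corresponds_iff aYD_Obj_iff by blast+
 have t: "HM.half_braiding ?V t" using P unfolding Pe Qe corresponds_iff HH_rho_Obj_iff by blast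
 have p: "HM.half_left ?V t ?V = pass_left M (coact M b) ?V" using P m unfolding Pe Qe corresponds_iff by simp
 note [simp] = Hd_moduleD[OF h] H_moduleD(2)[OF m]
 have V: "?V \<in> Obj H_mod" using m by simp
 have l: "HM.left_half_braiding ?V (HM.half_left ?V t)" by (rule HM.left_half_braiding_half_left[OF t V])
 let ?L = "Str [?V, ?V] (HM.half_left ?V t ?V) [?V, HM.lsh ?V]"
 have wL: "HM.wt ?L" using HM.left_half_braiding_hom[OF l V V] V HM_lsh_module[of ?V] by (simp add: HM.wt_Str)
 have we: "HM.wt (Str [HM.lsh ?V, H_ldual ?V] (evl B (LD M)) [])" "HM.wt (Str [] (coevl B M) [?V, H_ldual ?V])"
  using HM_wt_dual(1)[OF H_ldual_module[of ?V]] HM_wt_dual(2)[of ?V] m by (simp_all add: HM.lsh_def)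
 have s: "HM.HH_aut Q = sarr (HM.saut ?V (HM.half_left ?V t))"
  unfolding Qe HM.HH_aut_def HM.saut_def[OF l V] HM.lflat_def using wL we m H_ldual_module[of ?V]
  by (simp add: HM.scomp_assoc HM.lsh_def)
 have "sarr (HM.saut ?V (HM.half_left ?V t)) = sarr ((Str [R, M] (twisted M b) [M] oo bend M (M, a)) oo ($[M] ** scoevl M))"
 proof (rule sarr_eq_forget)
  have "forget (HM.saut ?V (HM.half_left ?V t)) = (($[M] ** sevl (LD M)) oo (Str [M, M] (pass_left M (coact M b) ?V) [M, lsh M] ** $[LD M])) oo ($[M] ** scoevl M)"
   unfolding HM.saut_def[OF l V] HM.lflat_def using wL we m H_ldual_module[of ?V] p by (simp add: forget_stens HM.lsh_def lsh_def)
  then show "forget (HM.saut ?V (HM.half_left ?V t)) = (Str [R, M] (twisted M b) [M] oo bend M (M, a)) oo ($[M] ** scoevl M)"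
   using pass_left_bend[of ?V M a b] m by simp
 qed
 then show e: "aYD_aut (anti_twist \<rho>) P = HM.HH_aut Q"
  unfolding s aut_eq[OF m Hd_moduleD(2)[OF h]] Pe aYD_aut_def by simp
 let ?f = "sarr (HM.saut ?V (HM.half_left ?V t))"
 have S: "Str [?V] ?f [?V] = HM.saut ?V (HM.half_left ?V t)" by (rule Str_sarr) (simp_all add: HM.saut_def[OF l V] HM.lflat_def)
 have f: "?f \<in> Hom H_mod ?V ?V" using HM.sarr_hom[OF HM.wt_saut[OF l V], of "[?V]" "[?V]"] by (simp add: HM.saut_def[OF l V] HM.lflat_def)
 have "\<forall>X \<in> Obj H_mod. HM.scomp (HM.stens (Str [?V] ?f [?V]) (HM.strand [HM.lsh X])) (Str [X, ?V] (HM.half_left ?V t X) [?V, HM.lsh X]) =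
   HM.scomp (Str [X, ?V] (HM.half_left ?V t X) [?V, HM.lsh X]) (HM.stens (HM.strand [X]) (Str [?V] ?f [?V]))"
  unfolding S using HM.saut_left_half_braiding[OF l V] by blast
 then have "\<forall>X \<in> Obj H_mod. tensa H_mod (idm H_mod (HM.rsh X)) ?f \<cdot>\<^bsub>H_mod\<^esub> t X = t X \<cdot>\<^bsub>H_mod\<^esub> tensa H_mod ?f (idm H_mod X)"
  using HM.half_braiding_morphism_iff[OF t t V V f] by blast
 then have "?f \<in> Hom HHR Q Q"
  using f unfolding Qe HH_rho_def full_subcat_def HM.HH_def by simp
 then show "aYD_aut (anti_twist \<rho>) P \<in> Hom AYD P P"
  unfolding e s corresponds_Hom[OF P P] .
qed

theorem aYD_equivalent_HH_rho:
 "\<exists>Fo Fa. linear_equivalence AYD HHR Fo Fa \<and>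
   (\<forall>P \<in> Obj AYD. aYD_aut (anti_twist \<rho>) P \<in> Hom AYD P P \<and> Fa P P (aYD_aut (anti_twist \<rho>) P) = HM.HH_aut (Fo P))"
proof -
 obtain Fo where Fo: "linear_equivalence AYD HHR Fo (\<lambda>X Y f. f)" "\<And>P. P \<in> Obj AYD ==> corresponds P (Fo P)"
 proof (rule linear_equivalence_of_relation[of AYD corresponds HHR])
  have "idm AYD (M, a, b) = idm B M" "idm HHR ((M, a), t) = idm B M" for M a b t
   by (simp_all add: aYD_def HH_rho_def full_subcat_def HM.HH_def)
  then show "P \<in> Obj AYD \<and> Q \<in> Obj HHR" "idm AYD P = idm HHR Q" if "corresponds P Q" for P Q
   using that unfolding corresponds_def by auto
  show "comp AYD = comp HHR" "adda AYD = adda HHR" "scal AYD = scal HHR"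
   by (simp_all add: aYD_def HH_rho_def full_subcat_def HM.HH_def)
  show "idm AYD P \<in> Hom AYD P P" if "P \<in> Obj AYD" for P
  proof -
   obtain M a b where P: "P = (M, a, b)" by (cases P) auto
   have m: "H_module M a" "Hd_module M b" using that unfolding P aYD_Obj_iff by blast+
   note h = H_moduleD(1,2)[OF m(1)] Hd_moduleD[OF m(2)]
   show ?thesis unfolding P using h
    by (simp add: aYD_def tensa_id comp_idl[of "H \<otimes> M" M] comp_idr[of "H \<otimes> M" M] comp_idl[of "R \<otimes> M" M] comp_idr[of "R \<otimes> M" M])
  qed
  show "comp AYD (idm AYD P') f = f \<and> comp AYD f (idm AYD P) = f" if "P \<in> Obj AYD" "P' \<in> Obj AYD" "f \<in> Hom AYD P P'" for P P' f
  proof -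
   obtain M a b N d e where P: "P = (M, a, b)" "P' = (N, d, e)" by (cases P; cases P') auto
   have "M \<in> Obj B" "N \<in> Obj B" using that(1,2) H_moduleD(1) unfolding P aYD_Obj_iff by blast+
   moreover have "f \<in> Hom B M N" using that(3) unfolding P by (simp add: aYD_def)
   ultimately show ?thesis unfolding P using comp_idl comp_idr by (simp add: aYD_def)
  qed
 qed (use corresponds_left corresponds_right corresponds_Hom in blast)+
 show ?thesis
  using Fo(1) corresponds_aut[OF Fo(2)] by (intro exI[of _ Fo] exI[of _ "\<lambda>X Y f. f"] conjI ballI) blast+
qed

end

theorem corollary4p44:
  fixes B :: "('k::{alg_closed_field,field_char_0}, 'o, 'a) brcat"
    and H :: "('o, 'a) hopf"
    and \<rho> :: "'o \<Rightarrow> 'a"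
  assumes "rigid_braided_category B"
    and "hopf_data.hopf_algebra B H"
    and "hopf_data.invertible_antipode B H"
    and "braided_data.pivot B \<rho>"
  shows "let
      \<sigma> = braided_data.anti_twist B \<rho>;
      aYD = hopf_data.aYD B H \<sigma>;
      HH\<^sub>\<rho> = hopf_data.HH_rho B H \<rho>;
      aut_aYD = hopf_data.aYD_aut B H \<sigma>;
      aut_HH = rigid_data.HH_aut (hopf_data.H_mod B H)
    in \<exists>Fo Fa. linear_equivalence aYD HH\<^sub>\<rho> Fo Fa \<and>
         (\<forall>M \<in> Obj aYD. aut_aYD M \<in> Hom aYD M M \<and> Fa M M (aut_aYD M) = aut_HH (Fo M))"
proof -
  interpret rigid_braided_category B by fact
  interpret pivotal_hopf_algebra B \<rho> H
    using assms by (intro pivotal_hopf_algebra.intro pivotal_braided_category.intro pivotal_braided_category_axioms.intro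
        braided_hopf_algebra.intro braided_hopf_algebra_axioms.intro)
  show ?thesis unfolding Let_def by (rule aYD_equivalent_HH_rho)
qed

end
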